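(* For every $\varepsilon>0$, there is an $\tilde{O}(m\sqrt n\,\log^2(M)/\varepsilon^2)$ time randomized algorithm that, for any $n$-node $m$-edge directed graph with edge weights in $\{1,\ldots,M\}$, computes with high probability a $(5+\varepsilon)$-approximate roundtrip spanner on $\tilde{O}(n^{1.5}\log^2(M)/\varepsilon^2)$ edges.
   Context: For a directed weighted graph $G=(V,E)$, $d_G(u,v)$ denotes the shortest-path distance from $u$ to $v$ in $G$. A $c$-approximate roundtrip spanner of $G=(V,E)$ is a subgraph $H=(V,E')$ of $G$ (with inherited edge weights) such that for every $u,v\in V$, $d_H(u,v)+d_H(v,u)\le c\cdot(d_G(u,v)+d_G(v,u))$. Edge weights are integers. The notation $\tilde O(\cdot)$ hides factors polylogarithmic in $n$. "With high probability" (whp) means with probability at least $1-1/n^{c}$ for a constant $c>0$ that can be chosen arbitrarily large. Arithmetic operations and comparisons on edge weights take unit time. *)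

theory Defs
  imports "HOL-Probability.Probability" "Graph_Theory.Graph_Theory"
begin

section \<open>Roundtrip spanners\<close>

text \<open>
  The shortest-path distance is the one of \<^verbatim>\<open>Graph_Theory.Shortest_Path\<close>;
  it is an extended real, with value infinity if there is no path. The subgraph inherits
  the weights because both distances use the same weight function.
\<close>

definition dist_in :: "'a pair_pre_digraph \<Rightarrow> ('a \<times> 'a) weight_fun \<Rightarrow> 'a \<Rightarrow> 'a \<Rightarrow> ereal" where
  "dist_in G w u v = wf_digraph.\<mu> (with_proj G) w u v"

definition approx_roundtrip_spanner ::
  "real \<Rightarrow> 'a pair_pre_digraph \<Rightarrow> ('a \<times> 'a) weight_fun \<Rightarrow> 'a pair_pre_digraph \<Rightarrow> bool" where
  "approx_roundtrip_spanner c G w H \<longleftrightarrow>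
     spanning (with_proj H) (with_proj G) \<and>
     (\<forall>u \<in> pverts G. \<forall>v \<in> pverts G.
        dist_in H w u v + dist_in H w v u \<le> ereal c * (dist_in G w u v + dist_in G w v u))"

section \<open>A randomized word RAM\<close>

text \<open>
  Programs are structured three-address code over natural-number registers and arrays. A program
  mentions finitely many registers and arrays, but every array is an unbounded memory bank that is
  indexed by register contents; interleaving the banks gives a RAM with a single memory.
  Every instruction, every evaluation of a guard and every passage from one component of a
  sequence to the next takes one time unit. Unit-cost arithmetic is only meaningful for words of
  bounded length, see \<^verbatim>\<open>fits_words\<close> below.
\<close>

datatype arith_op = Add | Sub | Mul | Div

fun eval_op :: "arith_op \<Rightarrow> nat \<Rightarrow> nat \<Rightarrow> nat" where
  "eval_op Add a b = a + b"
| "eval_op Sub a b = a - b"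
| "eval_op Mul a b = a * b"
| "eval_op Div a b = a div b"

datatype com =
    Skip
  | SetConst nat nat            \<comment> \<open>\<open>SetConst x k\<close>: \<open>x := k\<close>\<close>
  | Arith arith_op nat nat nat  \<comment> \<open>\<open>Arith f x y z\<close>: \<open>x := f y z\<close>\<close>
  | Load nat nat nat            \<comment> \<open>\<open>Load x a y\<close>: \<open>x := a[y]\<close>\<close>
  | Store nat nat nat           \<comment> \<open>\<open>Store a y x\<close>: \<open>a[y] := x\<close>\<close>
  | Rand nat nat                \<comment> \<open>\<open>Rand x y\<close>: \<open>x\<close> := uniform element of \<open>{..<y}\<close>, or \<open>0\<close> if \<open>y = 0\<close>\<close>
  | Seq com com
  | IfLess nat nat com com      \<comment> \<open>the guard compares two registers\<close>
  | WhileLess nat nat com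

record ram_state =
  reg :: "nat \<Rightarrow> nat"
  mem :: "nat \<Rightarrow> nat \<Rightarrow> nat"

definition set_reg :: "nat \<Rightarrow> nat \<Rightarrow> ram_state \<Rightarrow> ram_state" where
  "set_reg x k s = s\<lparr>reg := (reg s)(x := k)\<rparr>"

definition set_mem :: "nat \<Rightarrow> nat \<Rightarrow> nat \<Rightarrow> ram_state \<Rightarrow> ram_state" where
  "set_mem a i k s = s\<lparr>mem := (mem s)(a := (mem s a)(i := k))\<rparr>"

primrec step :: "com \<Rightarrow> ram_state \<Rightarrow> (com \<times> ram_state) pmf" where
  "step Skip s = return_pmf (Skip, s)"
| "step (SetConst x k) s = return_pmf (Skip, set_reg x k s)"
| "step (Arith f x y z) s = return_pmf (Skip, set_reg x (eval_op f (reg s y) (reg s z)) s)"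
| "step (Load x a y) s = return_pmf (Skip, set_reg x (mem s a (reg s y)) s)"
| "step (Store a y x) s = return_pmf (Skip, set_mem a (reg s y) (reg s x) s)"
| "step (Rand x y) s =
     map_pmf (\<lambda>k. (Skip, set_reg x k s)) (pmf_of_set {..<max 1 (reg s y)})"
| "step (Seq p q) s =
     (if p = Skip then return_pmf (q, s)
      else map_pmf (\<lambda>(p', s'). (Seq p' q, s')) (step p s))"
| "step (IfLess x y p q) s = return_pmf (if reg s x < reg s y then p else q, s)"
| "step (WhileLess x y p) s =
     return_pmf (if reg s x < reg s y then Seq p (WhileLess x y p) else Skip, s)"

primrec run :: "nat \<Rightarrow> com \<Rightarrow> ram_state \<Rightarrow> (com \<times> ram_state) pmf" where
  "run 0 p s = return_pmf (p, s)"
| "run (Suc t) p s = bind_pmf (run t p s) (\<lambda>(p', s'). step p' s')"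

text \<open>A configuration with program \<open>Skip\<close> is halted, and \<open>step\<close> leaves it unchanged.\<close>

definition halts_within :: "nat \<Rightarrow> com \<Rightarrow> ram_state \<Rightarrow> bool" where
  "halts_within T p s \<longleftrightarrow> (\<forall>(p', s') \<in> set_pmf (run T p s). p' = Skip)"

definition fits_words :: "real \<Rightarrow> com \<Rightarrow> ram_state \<Rightarrow> bool" where
  "fits_words W p s \<longleftrightarrow>
     (\<forall>t. \<forall>(p', s') \<in> set_pmf (run t p s).
        (\<forall>x. real (reg s' x) \<le> W) \<and> (\<forall>a i. real (mem s' a i) \<le> W))"

section \<open>Input and output\<close>

text \<open>
  The graph on the nodes \<open>{..<n}\<close> is given as an edge list in arbitrary order: sources, targets
  and weights are in arrays 0, 1 and 2. All other registers and memory cells are 0.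
\<close>

definition input_state :: "nat \<Rightarrow> (nat \<times> nat) list \<Rightarrow> (nat \<times> nat \<Rightarrow> nat) \<Rightarrow> ram_state" where
  "input_state n es w =
     \<lparr>reg = (\<lambda>_. 0)(0 := n, 1 := length es),
      mem = (\<lambda>_ _. 0)
        (0 := (\<lambda>i. if i < length es then fst (es ! i) else 0),
         1 := (\<lambda>i. if i < length es then snd (es ! i) else 0),
         2 := (\<lambda>i. if i < length es then w (es ! i) else 0))\<rparr>"

text \<open>The output is an edge list in arrays 3 and 4 whose length is in register 2.\<close>

definition output_graph :: "nat \<Rightarrow> ram_state \<Rightarrow> nat pair_pre_digraph" where
  "output_graph n s =
     \<lparr>pverts = {..<n}, parcs = (\<lambda>i. (mem s 3 i, mem s 4 i)) ` {..<reg s 2}\<rparr>"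

section \<open>Asymptotic bounds\<close>

text \<open>
  As usual in asymptotic bounds, logarithms are read as at least 1; otherwise a bound with a
  factor \<open>log M\<close> would vanish for \<open>M = 1\<close>. For the same reason \<open>m\<close> and \<open>1 / \<epsilon>\<close> are to be
  replaced by \<open>max 1 m\<close> and \<open>1 / min 1 \<epsilon>\<close> in bounds: for \<open>\<epsilon>\<close> much larger than \<open>sqrt n\<close>, a bound
  \<open>n\<^sup>1\<^sup>.\<^sup>5 / \<epsilon>\<^sup>2\<close> with a constant independent of \<open>\<epsilon>\<close> is below the \<open>n\<close> edges that every spanner of
  a strongly connected graph needs.
\<close>

definition lg :: "nat \<Rightarrow> real" where
  "lg x = max 1 (log 2 (real x))"

end

(*
  If m^2 <= n^3, the whole graph is a spanner of the required size. Otherwise, with r about sqrt n,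
  draw O(r log n) uniform vertices and add the shortest-path trees to and from each of them. A
  vertex v is heavy at scale d if some sample of the first half is within roundtrip distance 2 d of
  v; a path through a heavy vertex is replaced by a detour through that sample, which costs 2 d
  more. The scales d grow by the factor 1 + 1/q with q about 4/epsilon, and a roundtrip of length at
  most d has two legs, so the stretch is 5 + O(1/q).

  Paths that avoid heavy vertices must be preserved exactly, and this is the work of a Dijkstra
  search from every light u at every scale d. A vertex y is only explored at distance nd if
  nd <= d and, for every sample s of a short list R(y), dist(s,u) + nd <= d + dist(s,y). No roundtrip
  of length at most d through u and y is lost by this filter: if D is the distance from y back to u,
  then nd + D <= d and dist(s,u) <= dist(s,y) + D. Conversely, two candidates u and s for y that
  survive each other are within roundtrip distance 2 d. As a light vertex has, with high
  probability, at most r vertices that close, each new sample in R(y) removes a constant fraction of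
  the candidates as long as more than 2 r of them are left. After O(log n) samples each y is reached
  from at most 2 r sources, which bounds both the edges and the time of each scale.
*)
theory Submission
  imports Defs
begin

section \<open>Executions with bounded words\<close>

text \<open>Only the stretch is left to chance; running time, output size and word length are
  bounded on every run. To this end each vertex counts its expansions within the current scale and
  is not expanded again after \<open>2 * rt + 1\<close> of them. If all candidate sets of the scale
  have at most \<open>2 * rt\<close> elements, this gate never closes and the searches are complete.
  Randomness is confined to one loop that fills an array with uniform vertices; all other code is
  deterministic.

  The comparison of n^3 with m^2 also serves the running time: each of the n searches of a scale
  initialises arrays of length O(n), and n^2 is at most m sqrt n once n^3 < m^2.

  The samples come in two independent halves, because the elimination argument needs the light
  vertices to be fixed before the filtering samples are drawn. The union bound must not depend on
  the weights, although the scales go up to about n M. It therefore ranges over the distinct sets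
  that occur as d grows; they form chains of sets of vertices or of pairs of vertices.\<close>

lemma run_Suc_step:
  "run (Suc t) p s = bind_pmf (step p s) (\<lambda>(p', s'). run t p' s')"
proof (induction t arbitrary: p s)
  case 0
  show ?case by (simp add: bind_return_pmf case_prod_beta' bind_return_pmf')
next
  case (Suc t)
  have "run (Suc (Suc t)) p s = bind_pmf (run (Suc t) p s) (\<lambda>(p', s'). step p' s')" by simp
  also have "\<dots> = bind_pmf (step p s)
      (\<lambda>a. bind_pmf (run t (fst a) (snd a)) (\<lambda>(p', s'). step p' s'))"
    unfolding Suc.IH by (simp add: bind_assoc_pmf case_prod_beta')
  finally show ?case by (simp add: case_prod_beta')
qed

lemma run_Skip [simp]: "run t Skip s = return_pmf (Skip, s)"
  by (induction t) (simp_all add: bind_return_pmf)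

lemma run_add:
  "run (t + k) p s = bind_pmf (run t p s) (\<lambda>(p', s'). run k p' s')"
  by (induction t arbitrary: p s)
    (simp_all add: bind_return_pmf bind_assoc_pmf case_prod_beta' run_Suc_step del: run.simps(2))

definition fit :: "nat \<Rightarrow> ram_state \<Rightarrow> bool" where
  "fit N s \<longleftrightarrow> (\<forall>x. reg s x \<le> N) \<and> (\<forall>a i. mem s a i \<le> N)"

text \<open>\<open>D\<close> is the law of the final state: at time \<open>T\<close> every run has
  reached \<open>Skip\<close>. The word bound ranges over all times, as in
  \<open>fits_words\<close>. Since \<open>Skip\<close> is absorbing, \<open>T\<close> may always be
  enlarged, so times need only be estimated from above.\<close>

definition ex :: "nat \<Rightarrow> com \<Rightarrow> ram_state \<Rightarrow> nat \<Rightarrow> ram_state pmf \<Rightarrow> bool" where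
  "ex N c s T D \<longleftrightarrow> run T c s = map_pmf (Pair Skip) D \<and>
     (\<forall>t. \<forall>(p', s') \<in> set_pmf (run t c s). fit N s')"

lemma ex_fit:
  assumes "ex N c s T D" "s' \<in> set_pmf D"
  shows "fit N s'"
proof -
  have "(Skip, s') \<in> set_pmf (run T c s)" using assms by (simp add: ex_def)
  with assms(1) show ?thesis unfolding ex_def by fastforce
qed

lemma ex_mono:
  assumes "ex N c s T D" "T \<le> T'"
  shows "ex N c s T' D"
proof -
  obtain k where "T' = T + k" using assms(2) le_Suc_ex by blast
  with assms(1) show ?thesis
    by (simp add: ex_def run_add bind_map_pmf map_pmf_def[symmetric] bind_return_pmf)
qed

lemma ex_Skip: "fit N s \<Longrightarrow> ex N Skip s 0 (return_pmf s)"
  by (simp add: ex_def)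

lemma ex_step:
  assumes "fit N s" "\<And>p' s'. (p', s') \<in> set_pmf (step c s) \<Longrightarrow> ex N p' s' T (E p' s')"
  shows "ex N c s (Suc T) (bind_pmf (step c s) (\<lambda>(p', s'). E p' s'))"
  unfolding ex_def
proof
  have "run (Suc T) c s = bind_pmf (step c s) (\<lambda>(p', s'). run T p' s')"
    by (rule run_Suc_step)
  also have "\<dots> = bind_pmf (step c s) (\<lambda>a. map_pmf (Pair Skip) (E (fst a) (snd a)))"
    using assms(2) by (intro bind_pmf_cong) (auto simp: ex_def)
  finally show "run (Suc T) c s = map_pmf (Pair Skip) (bind_pmf (step c s) (\<lambda>(p', s'). E p' s'))"
    by (simp add: map_bind_pmf case_prod_beta')
  show "\<forall>t. \<forall>(p', s')\<in>set_pmf (run t c s). fit N s'"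
  proof
    fix t show "\<forall>(p', s')\<in>set_pmf (run t c s). fit N s'"
    proof (cases t)
      case 0 then show ?thesis using assms(1) by simp
    next
      case (Suc k)
      then show ?thesis using assms(2) unfolding Suc run_Suc_step ex_def by fastforce
    qed
  qed
qed

lemma ex_det:
  assumes "fit N s" "step c s = return_pmf (p', s')" "ex N p' s' T D"
  shows "ex N c s (Suc T) D"
  using ex_step[of N s c T "\<lambda>_ _. D"] assms by (simp add: bind_return_pmf)

text \<open>Induction on the time of \<open>p\<close>, not on its syntax, because a step may turn
  \<open>p\<close> into an arbitrary program. The extra unit in \<open>Suc T2\<close> is the passage
  from \<open>Skip\<close> to \<open>q\<close>.\<close>

lemma ex_Seq:
  assumes "ex N p s T1 D" "\<And>s'. s' \<in> set_pmf D \<Longrightarrow> ex N q s' T2 (E s')"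
  shows "ex N (Seq p q) s (T1 + Suc T2) (bind_pmf D E)"
  using assms
proof (induction T1 arbitrary: p s D)
  case (0 p s D)
  then have "map_pmf (Pair Skip) D = return_pmf (p, s)" by (simp add: ex_def)
  then have "Pair Skip ` set_pmf D = {(p, s)}" by (metis set_map_pmf set_return_pmf)
  then have p: "p = Skip" and "set_pmf D \<subseteq> {s}" by auto
  then have D: "D = return_pmf s" by (simp add: set_pmf_subset_singleton)
  have "fit N s" using ex_fit[OF 0(1)] D by simp
  then have "ex N (Seq p q) s (Suc T2) (E s)"
    using 0(2) D p by (intro ex_det) auto
  then show ?case using D by (simp add: bind_return_pmf)
next
  case (Suc T1 p s D)
  have fit: "fit N s" using Suc.prems(1) unfolding ex_def by (metis (no_types, lifting) case_prodD run.simps(1) set_return_pmf singletonI)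
  show ?case
  proof (cases "p = Skip")
    case True
    then have "map_pmf (Pair Skip) D = return_pmf (Skip, s)" using Suc.prems by (simp add: ex_def del: run.simps)
    then have "Pair Skip ` set_pmf D = {(Skip, s)}" by (metis set_map_pmf set_return_pmf)
    then have "set_pmf D \<subseteq> {s}" by auto
    then have D: "D = return_pmf s" by (simp add: set_pmf_subset_singleton)
    have "ex N (Seq p q) s (Suc T2) (E s)"
      using Suc.prems(2) D True fit by (intro ex_det) auto
    then have "ex N (Seq p q) s (Suc T1 + Suc T2) (E s)" by (rule ex_mono) simp
    then show ?thesis using D by (simp add: bind_return_pmf)
  next
    case False
    \<comment> \<open>The law of the outcome after a given first step has to be recovered from
      \<open>run\<close>, since the hypothesis only provides the mixture \<open>D\<close> of these
      laws.\<close>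
    define D' where "D' p' s' = map_pmf snd (run T1 p' s')" for p' s'
    have run: "run (Suc T1) p s = bind_pmf (step p s) (\<lambda>(p', s'). run T1 p' s')"
      by (rule run_Suc_step)
    have D: "D = bind_pmf (step p s) (\<lambda>(p', s'). D' p' s')"
    proof -
      have "D = map_pmf snd (run (Suc T1) p s)"
        using Suc.prems(1) by (simp add: ex_def pmf.map_comp o_def del: run.simps)
      then show ?thesis unfolding run D'_def by (simp add: map_bind_pmf case_prod_beta')
    qed
    have ex': "ex N p' s' T1 (D' p' s')" if "(p', s') \<in> set_pmf (step p s)" for p' s'
    proof -
      have "set_pmf (run T1 p' s') \<subseteq> set_pmf (run (Suc T1) p s)"
        unfolding run using that by auto
      also have "\<dots> \<subseteq> range (Pair Skip)" using Suc.prems(1) by (auto simp: ex_def simp del: run.simps)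
      finally have *: "\<And>a. a \<in> set_pmf (run T1 p' s') \<Longrightarrow> fst a = Skip" by auto
      have "map_pmf (Pair Skip) (D' p' s') = map_pmf (\<lambda>a. a) (run T1 p' s')"
        unfolding D'_def pmf.map_comp by (intro map_pmf_cong) (auto simp: * prod_eq_iff)
      moreover have "fit N s''" if "(p'', s'') \<in> set_pmf (run t p' s')" for t p'' s''
      proof -
        have "(p'', s'') \<in> set_pmf (run (Suc t) p s)"
          unfolding run_Suc_step using that \<open>(p', s') \<in> set_pmf (step p s)\<close> by force
        then show ?thesis using Suc.prems(1) unfolding ex_def by fastforce
      qed
      ultimately show ?thesis unfolding ex_def by (auto simp: map_pmf_ident)
    qed
    have "ex N (Seq p' q) s' (T1 + Suc T2) (bind_pmf (D' p' s') E)"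
      if "(p', s') \<in> set_pmf (step p s)" for p' s'
    proof (rule Suc.IH[OF ex'[OF that]])
      fix s'' assume "s'' \<in> set_pmf (D' p' s')"
      then have "s'' \<in> set_pmf D" unfolding D using that by force
      then show "ex N q s'' T2 (E s'')" by (rule Suc.prems(2))
    qed
    \<comment> \<open>As \<open>p\<close> is not \<open>Skip\<close>, every successor has the form
      \<open>Seq p' q\<close>; the second branch of the \<open>case\<close> is a dummy that is never
      reached.\<close>
    then have "ex N (Seq p q) s (Suc (T1 + Suc T2))
      (bind_pmf (step (Seq p q) s) (\<lambda>(p', s'). case p' of Seq p'' _ \<Rightarrow> bind_pmf (D' p'' s') E | _ \<Rightarrow> return_pmf s'))"
      using fit False by (intro ex_step) auto
    also have "bind_pmf (step (Seq p q) s) (\<lambda>(p', s'). case p' of Seq p'' _ \<Rightarrow> bind_pmf (D' p'' s') E | _ \<Rightarrow> return_pmf s') = bind_pmf D E"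
      using False by (simp add: D bind_assoc_pmf bind_map_pmf case_prod_beta')
    finally show ?thesis by simp
  qed
qed

section \<open>Expressions and structured commands\<close>

datatype exp = Vr nat | Cn nat | Op arith_op exp exp | Ld nat exp

fun vl :: "exp \<Rightarrow> (nat \<Rightarrow> nat) \<Rightarrow> (nat \<Rightarrow> nat \<Rightarrow> nat) \<Rightarrow> nat" where
  "vl (Vr x) r h = r x"
| "vl (Cn k) r h = k"
| "vl (Op f a b) r h = eval_op f (vl a r h) (vl b r h)"
| "vl (Ld a e) r h = h a (vl e r h)"

text \<open>Registers from 60 on hold intermediate results of expressions.\<close>

fun cexp :: "exp \<Rightarrow> nat \<Rightarrow> com" where
  "cexp (Vr x) k = Seq (SetConst k 0) (Arith Add k x k)"
| "cexp (Cn c) k = SetConst k c"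
| "cexp (Op f a b) k = Seq (cexp a k) (Seq (cexp b (Suc k)) (Arith f k k (Suc k)))"
| "cexp (Ld a e) k = Seq (cexp e k) (Load k a k)"

fun tc :: "exp \<Rightarrow> nat" where
  "tc (Vr x) = 3"
| "tc (Cn c) = 1"
| "tc (Op f a b) = tc a + tc b + 3"
| "tc (Ld a e) = tc e + 2"

text \<open>Only \<open>Add\<close> and \<open>Mul\<close> can leave the word range:
  \<open>Sub\<close> and \<open>Div\<close> do not exceed their first operand, and a loaded word is
  bounded already. The bound 60 protects the scratch registers.\<close>

fun eok :: "nat \<Rightarrow> exp \<Rightarrow> (nat \<Rightarrow> nat) \<Rightarrow> (nat \<Rightarrow> nat \<Rightarrow> nat) \<Rightarrow> bool" where
  "eok N (Vr x) r h \<longleftrightarrow> x < 60"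
| "eok N (Cn k) r h \<longleftrightarrow> k \<le> N"
| "eok N (Op f a b) r h \<longleftrightarrow> eok N a r h \<and> eok N b r h \<and>
     (case f of Add \<Rightarrow> vl a r h + vl b r h \<le> N | Mul \<Rightarrow> vl a r h * vl b r h \<le> N | _ \<Rightarrow> True)"
| "eok N (Ld a e) r h \<longleftrightarrow> eok N e r h"

text \<open>Hides the scratch registers, so that assertions about register contents are insensitive
  to the evaluation of expressions.\<close>

definition ab :: "ram_state \<Rightarrow> nat \<Rightarrow> nat" where
  "ab s x = (if x < 60 then reg s x else 0)"

lemma set_reg_simps [simp]:
  "reg (set_reg x k s) = (reg s)(x := k)" "mem (set_reg x k s) = mem s"
  "reg (set_mem a i k s) = reg s" "mem (set_mem a i k s) = (mem s)(a := (mem s a)(i := k))"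
  by (simp_all add: set_reg_def set_mem_def)

lemma fit_set [intro]:
  "fit N s \<Longrightarrow> k \<le> N \<Longrightarrow> fit N (set_reg x k s)"
  "fit N s \<Longrightarrow> k \<le> N \<Longrightarrow> fit N (set_mem a i k s)"
  by (auto simp: fit_def)

lemma ab_set_reg [simp]: "x < 60 \<Longrightarrow> ab (set_reg x k s) = (ab s)(x := k)"
  "x \<ge> 60 \<Longrightarrow> ab (set_reg x k s) = ab s" "ab (set_mem a i v s) = ab s"
  by (auto simp: ab_def)

lemma ex_prim:
  assumes "fit N s" "step c s = return_pmf (Skip, s')" "fit N s'"
  shows "ex N c s 1 (return_pmf s')"
  using ex_det[OF assms(1,2) ex_Skip[OF assms(3)]] by simp

lemma ex_Seq_det:
  assumes "ex N p s T1 (return_pmf s')" "ex N q s' T2 (return_pmf s'')"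
  shows "ex N (Seq p q) s (T1 + Suc T2) (return_pmf s'')"
  using ex_Seq[OF assms(1), of q T2 "\<lambda>_. return_pmf s''"] assms(2) by (simp add: bind_return_pmf)

text \<open>Evaluation at level \<open>k\<close> works like a stack: nothing below \<open>k\<close>
  changes, so the left operand in \<open>k\<close> survives the evaluation of the right operand at
  \<open>Suc k\<close>.\<close>

lemma comp_correct:
  assumes "fit N s" "60 \<le> k" "eok N e (ab s) (mem s)"
  shows "\<exists>s'. ex N (cexp e k) s (tc e) (return_pmf s') \<and> mem s' = mem s \<and>
    (\<forall>x<k. reg s' x = reg s x) \<and> reg s' k = vl e (ab s) (mem s)"
  using assms
proof (induction e arbitrary: k s)
  case (Vr x)
  let ?s1 = "set_reg k 0 s" and ?s2 = "set_reg k (reg s x) (set_reg k 0 s)"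
  have f: "fit N ?s1" "fit N ?s2" using Vr by (auto simp: fit_def)
  have "x \<noteq> k" using Vr by simp
  then have "ex N (Seq (SetConst k 0) (Arith Add k x k)) s (1 + Suc 1) (return_pmf ?s2)"
    using Vr f by (intro ex_Seq_det[where s' = ?s1] ex_prim) auto
  then show ?case using Vr by (intro exI[of _ ?s2]) (auto simp: ab_def numeral_3_eq_3)
next
  case (Cn c)
  then show ?case by (intro exI[of _ "set_reg k c s"]) (auto intro!: ex_prim[unfolded One_nat_def])
next
  case (Op f a b)
  obtain s1 where s1: "ex N (cexp a k) s (tc a) (return_pmf s1)" "mem s1 = mem s"
    "\<forall>x<k. reg s1 x = reg s x" "reg s1 k = vl a (ab s) (mem s)"
    using Op.IH(1)[of s k] Op.prems by auto
  have ab1: "ab s1 = ab s" using s1(3) Op.prems(2) by (auto simp: ab_def)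
  have fit1: "fit N s1" using ex_fit[OF s1(1)] by simp
  obtain s2 where s2: "ex N (cexp b (Suc k)) s1 (tc b) (return_pmf s2)" "mem s2 = mem s1"
    "\<forall>x<Suc k. reg s2 x = reg s1 x" "reg s2 (Suc k) = vl b (ab s1) (mem s1)"
    using Op.IH(2)[of s1 "Suc k"] Op.prems fit1 ab1 s1 by auto
  have fit2: "fit N s2" using ex_fit[OF s2(1)] by simp
  \<comment> \<open>The value is the content of a register of the fitting state \<open>s2\<close>;
    this settles \<open>Sub\<close> and \<open>Div\<close>.\<close>
  have vb: "vl a (ab s) (mem s) \<le> N" using fit2 s1 s2 unfolding fit_def by (metis lessI)
  let ?s3 = "set_reg k (eval_op f (reg s2 k) (reg s2 (Suc k))) s2"
  have "eval_op f (vl a (ab s) (mem s)) (vl b (ab s) (mem s)) \<le> N"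
    using Op.prems(3) vb by (cases f) (auto intro: le_trans[OF div_le_dividend])
  then have f3: "fit N ?s3" using fit2 s1 s2 ab1 by auto
  have "ex N (cexp (Op f a b) k) s (tc a + Suc (tc b + Suc 1)) (return_pmf ?s3)"
    unfolding cexp.simps using f3 fit2 by (intro ex_Seq_det[OF s1(1)] ex_Seq_det[OF s2(1)] ex_prim) simp_all
  then show ?case using s1 s2 ab1 by (intro exI[of _ ?s3]) (auto simp: numeral_3_eq_3)
next
  case (Ld a e)
  obtain s1 where s1: "ex N (cexp e k) s (tc e) (return_pmf s1)" "mem s1 = mem s"
    "\<forall>x<k. reg s1 x = reg s x" "reg s1 k = vl e (ab s) (mem s)"
    using Ld.IH[of s k] Ld.prems by auto
  have fit1: "fit N s1" using ex_fit[OF s1(1)] by simp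
  let ?s2 = "set_reg k (mem s1 a (reg s1 k)) s1"
  have "fit N ?s2" using fit1 by (auto simp: fit_def)
  then have "ex N (cexp (Ld a e) k) s (tc e + Suc 1) (return_pmf ?s2)"
    unfolding cexp.simps using fit1 by (intro ex_Seq_det[OF s1(1)] ex_prim) simp_all
  then show ?case using s1 by (intro exI[of _ ?s2]) auto
qed

text \<open>Total correctness with a ghost clock: the postcondition sees the elapsed time, so loop
  invariants can carry time bounds, also data-dependent ones. Only deterministic outcomes are
  covered; the sampling loop is treated with \<open>ex\<close> directly.\<close>

definition wp :: "nat \<Rightarrow> com \<Rightarrow> ((nat \<Rightarrow> nat) \<Rightarrow> (nat \<Rightarrow> nat \<Rightarrow> nat) \<Rightarrow> nat \<Rightarrow> bool) \<Rightarrow>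
    (nat \<Rightarrow> nat) \<Rightarrow> (nat \<Rightarrow> nat \<Rightarrow> nat) \<Rightarrow> nat \<Rightarrow> bool" where
  "wp N c Q r h t \<longleftrightarrow> (\<forall>s. fit N s \<longrightarrow> ab s = r \<longrightarrow> mem s = h \<longrightarrow>
     (\<exists>s' T. ex N c s T (return_pmf s') \<and> Q (ab s') (mem s') (t + T)))"

lemma wp_mono:
  assumes "wp N c Q r h t" "\<And>r h t. Q r h t \<Longrightarrow> Q' r h t"
  shows "wp N c Q' r h t"
  using assms unfolding wp_def by blast

lemma wp_skip: "Q r h t \<Longrightarrow> wp N Skip Q r h t"
  unfolding wp_def by (metis add_0_right ex_Skip)

lemma wp_seq:
  assumes "wp N p (\<lambda>r h t. wp N q Q r h (t + 1)) r h t"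
  shows "wp N (Seq p q) Q r h t"
  unfolding wp_def
proof (intro allI impI)
  fix s assume s: "fit N s" "ab s = r" "mem s = h"
  then obtain s1 T1 where 1: "ex N p s T1 (return_pmf s1)" "wp N q Q (ab s1) (mem s1) (t + T1 + 1)"
    using assms unfolding wp_def[of N p] by blast
  have "fit N s1" using ex_fit[OF 1(1)] by simp
  then obtain s2 T2 where 2: "ex N q s1 T2 (return_pmf s2)" "Q (ab s2) (mem s2) (t + T1 + 1 + T2)"
    using 1(2) unfolding wp_def by blast
  then show "\<exists>s' T. ex N (Seq p q) s T (return_pmf s') \<and> Q (ab s') (mem s') (t + T)"
    using ex_Seq_det[OF 1(1) 2(1)] by (intro exI[of _ s2] exI[of _ "T1 + Suc T2"]) (simp add: add.assoc)
qed

section \<open>Structured commands and their proof rules\<close>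

definition asg :: "nat \<Rightarrow> exp \<Rightarrow> com" where
  "asg x e = Seq (cexp e 60) (Seq (SetConst x 0) (Arith Add x x 60))"

definition sto :: "nat \<Rightarrow> exp \<Rightarrow> exp \<Rightarrow> com" where
  "sto a e1 e2 = Seq (cexp e1 60) (Seq (cexp e2 61) (Store a 60 61))"

definition ifl :: "exp \<Rightarrow> exp \<Rightarrow> com \<Rightarrow> com \<Rightarrow> com" where
  "ifl e1 e2 p q = Seq (Seq (cexp e1 60) (cexp e2 61)) (IfLess 60 61 p q)"

text \<open>\<open>WhileLess\<close> compares two registers, so the guard expressions are evaluated
  before the loop and again at the end of each round.\<close>

definition whl :: "exp \<Rightarrow> exp \<Rightarrow> com \<Rightarrow> com" where
  "whl e1 e2 p = Seq (Seq (cexp e1 60) (cexp e2 61))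
     (WhileLess 60 61 (Seq p (Seq (cexp e1 60) (cexp e2 61))))"

definition forl :: "nat \<Rightarrow> exp \<Rightarrow> com \<Rightarrow> com" where
  "forl x e p = Seq (asg x (Cn 0)) (whl (Vr x) e (Seq p (asg x (Op Add (Vr x) (Cn 1)))))"

lemma wp_asg:
  assumes "x < 60" "eok N e r h" "Q (r(x := vl e r h)) h (t + (tc e + 4))"
  shows "wp N (asg x e) Q r h t"
  unfolding wp_def
proof (intro allI impI)
  fix s assume s: "fit N s" "ab s = r" "mem s = h"
  then obtain s1 where s1: "ex N (cexp e 60) s (tc e) (return_pmf s1)" "mem s1 = mem s"
    "\<forall>x<60. reg s1 x = reg s x" "reg s1 60 = vl e (ab s) (mem s)"
    using comp_correct[of N s 60 e] assms by auto
  have f1: "fit N s1" using ex_fit[OF s1(1)] by simp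
  let ?s2 = "set_reg x (reg s1 60) (set_reg x 0 s1)"
  have f2: "fit N (set_reg x 0 s1)" "fit N ?s2" using f1 by (auto simp: fit_def)
  have "ex N (asg x e) s (tc e + Suc (1 + Suc 1)) (return_pmf ?s2)"
    unfolding asg_def using assms(1) f1 f2
    by (intro ex_Seq_det[OF s1(1)] ex_Seq_det[where s' = "set_reg x 0 s1"] ex_prim) auto
  moreover have "ab ?s2 = r(x := vl e r h)" using s s1 assms(1) by (auto simp: ab_def)
  ultimately show "\<exists>s' T. ex N (asg x e) s T (return_pmf s') \<and> Q (ab s') (mem s') (t + T)"
    using assms(3) s s1 by (intro exI[of _ ?s2] exI[of _ "tc e + 4"] conjI) (auto elim: ex_mono)
qed

lemma comp2:
  assumes "fit N s" "eok N e1 (ab s) (mem s)" "eok N e2 (ab s) (mem s)"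
  shows "\<exists>s'. ex N (Seq (cexp e1 60) (cexp e2 61)) s (tc e1 + Suc (tc e2)) (return_pmf s') \<and> mem s' = mem s \<and>
     ab s' = ab s \<and> reg s' 60 = vl e1 (ab s) (mem s) \<and> reg s' 61 = vl e2 (ab s) (mem s)"
proof -
  obtain s1 where s1: "ex N (cexp e1 60) s (tc e1) (return_pmf s1)" "mem s1 = mem s"
    "\<forall>x<60. reg s1 x = reg s x" "reg s1 60 = vl e1 (ab s) (mem s)"
    using comp_correct[of N s 60 e1] assms by auto
  have f1: "fit N s1" using ex_fit[OF s1(1)] by simp
  have a1: "ab s1 = ab s" using s1(3) by (auto simp: ab_def)
  obtain s2 where s2: "ex N (cexp e2 61) s1 (tc e2) (return_pmf s2)" "mem s2 = mem s1"
    "\<forall>x<61. reg s2 x = reg s1 x" "reg s2 61 = vl e2 (ab s1) (mem s1)"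
    using comp_correct[of N s1 61 e2] assms a1 f1 s1(2) by auto
  have "ab s2 = ab s1" using s2(3) by (auto simp: ab_def)
  then show ?thesis using ex_Seq_det[OF s1(1) s2(1)] s1 s2 a1 by (intro exI[of _ s2]) auto
qed

lemma wp_sto:
  assumes "eok N e1 r h" "eok N e2 r h" "Q r (h(a := (h a)(vl e1 r h := vl e2 r h))) (t + (tc e1 + tc e2 + 3))"
  shows "wp N (sto a e1 e2) Q r h t"
  unfolding wp_def
proof (intro allI impI)
  fix s assume s: "fit N s" "ab s = r" "mem s = h"
  then obtain s1 where s1: "ex N (cexp e1 60) s (tc e1) (return_pmf s1)" "mem s1 = mem s"
    "\<forall>x<60. reg s1 x = reg s x" "reg s1 60 = vl e1 (ab s) (mem s)"
    using comp_correct[of N s 60 e1] assms by auto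
  have f1: "fit N s1" using ex_fit[OF s1(1)] by simp
  have a1: "ab s1 = ab s" using s1(3) by (auto simp: ab_def)
  obtain s2 where s2: "ex N (cexp e2 61) s1 (tc e2) (return_pmf s2)" "mem s2 = mem s1"
    "\<forall>x<61. reg s2 x = reg s1 x" "reg s2 61 = vl e2 (ab s1) (mem s1)"
    using comp_correct[of N s1 61 e2] assms a1 f1 s1(2) s by auto
  have f2: "fit N s2" using ex_fit[OF s2(1)] by simp
  have a2: "ab s2 = ab s1" using s2(3) by (auto simp: ab_def)
  let ?s3 = "set_mem a (reg s2 60) (reg s2 61) s2"
  have f3: "fit N ?s3" using f2 by (auto simp: fit_def)
  have "ex N (sto a e1 e2) s (tc e1 + Suc (tc e2 + Suc 1)) (return_pmf ?s3)"
    unfolding sto_def using f2 f3 by (intro ex_Seq_det[OF s1(1)] ex_Seq_det[OF s2(1)] ex_prim) auto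
  then show "\<exists>s' T. ex N (sto a e1 e2) s T (return_pmf s') \<and> Q (ab s') (mem s') (t + T)"
    using assms(3) s s1 s2 a1 a2 by (intro exI[of _ ?s3] exI[of _ "tc e1 + tc e2 + 3"]) (auto elim: ex_mono)
qed

lemma wp_ifl:
  assumes "eok N e1 r h" "eok N e2 r h"
    "vl e1 r h < vl e2 r h \<Longrightarrow> wp N p Q r h (t + (tc e1 + tc e2 + 3))"
    "\<not> vl e1 r h < vl e2 r h \<Longrightarrow> wp N q Q r h (t + (tc e1 + tc e2 + 3))"
  shows "wp N (ifl e1 e2 p q) Q r h t"
  unfolding wp_def
proof (intro allI impI)
  fix s assume s: "fit N s" "ab s = r" "mem s = h"
  then obtain s1 where s1: "ex N (Seq (cexp e1 60) (cexp e2 61)) s (tc e1 + Suc (tc e2)) (return_pmf s1)"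
     "mem s1 = mem s" "ab s1 = ab s" "reg s1 60 = vl e1 (ab s) (mem s)" "reg s1 61 = vl e2 (ab s) (mem s)"
    using comp2[of N s e1 e2] assms by auto
  have f1: "fit N s1" using ex_fit[OF s1(1)] by simp
  let ?c = "if vl e1 r h < vl e2 r h then p else q"
  have "wp N ?c Q r h (t + (tc e1 + tc e2 + 3))" using assms by auto
  then obtain s2 T where s2: "ex N ?c s1 T (return_pmf s2)" "Q (ab s2) (mem s2) (t + (tc e1 + tc e2 + 3) + T)"
    unfolding wp_def using f1 s s1 by metis
  have "ex N (IfLess 60 61 p q) s1 (Suc T) (return_pmf s2)"
    using s1 s s2 f1 by (intro ex_det) auto
  from ex_Seq_det[OF s1(1) this] show "\<exists>s' T. ex N (ifl e1 e2 p q) s T (return_pmf s') \<and> Q (ab s') (mem s') (t + T)"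
    using s2 unfolding ifl_def by (intro exI[of _ s2] exI[of _ "tc e1 + tc e2 + 3 + T"]) (auto elim: ex_mono simp: add.assoc)
qed

lemma wp_whl:
  assumes I: "I r h t"
    and ok: "\<And>r h t. I r h t \<Longrightarrow> eok N e1 r h \<and> eok N e2 r h"
    and body: "\<And>r h t. I r h t \<Longrightarrow> vl e1 r h < vl e2 r h \<Longrightarrow>
      wp N p (\<lambda>r' h' t'. I r' h' t' \<and> v r' h' < (v r h :: nat)) r h (t + (tc e1 + tc e2 + 4))"
    and fin: "\<And>r h t. I r h t \<Longrightarrow> \<not> vl e1 r h < vl e2 r h \<Longrightarrow> Q r h (t + (tc e1 + tc e2 + 4))"
  shows "wp N (whl e1 e2 p) Q r h t"
  unfolding wp_def
proof (intro allI impI)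
  let ?G = "Seq (cexp e1 60) (cexp e2 61)"
  let ?W = "WhileLess 60 61 (Seq p ?G)"
  let ?g = "tc e1 + tc e2 + 4"
  \<comment> \<open>On entry to \<open>?W\<close> the guard values are already in registers 60 and
    61. The clock \<open>t\<close> is read before their evaluation, which \<open>?g - 1\<close> pays
    for; one more unit pays for the final test.\<close>
  have main: "\<exists>s' T. ex N ?W s T (return_pmf s') \<and> Q (ab s') (mem s') (t + (?g - 1) + T)"
    if "fit N s" "I (ab s) (mem s) t" "reg s 60 = vl e1 (ab s) (mem s)" "reg s 61 = vl e2 (ab s) (mem s)" for s t
    using that
  proof (induction "v (ab s) (mem s)" arbitrary: s t rule: less_induct)
    case less
    show ?case
    proof (cases "vl e1 (ab s) (mem s) < vl e2 (ab s) (mem s)")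
      case True
      obtain s2 T2 where s2: "ex N p s T2 (return_pmf s2)"
        "I (ab s2) (mem s2) (t + ?g + T2)" "v (ab s2) (mem s2) < v (ab s) (mem s)"
        using body[OF less.prems(2) True] less.prems(1) unfolding wp_def by metis
      have f2: "fit N s2" using ex_fit[OF s2(1)] by simp
      obtain s3 where s3: "ex N ?G s2 (tc e1 + Suc (tc e2)) (return_pmf s3)"
        "mem s3 = mem s2" "ab s3 = ab s2" "reg s3 60 = vl e1 (ab s2) (mem s2)" "reg s3 61 = vl e2 (ab s2) (mem s2)"
        using comp2[of N s2 e1 e2] f2 s2 ok by blast
      have f3: "fit N s3" using ex_fit[OF s3(1)] by simp
      obtain s4 T3 where s4: "ex N ?W s3 T3 (return_pmf s4)"
        "Q (ab s4) (mem s4) (t + ?g + T2 + (?g - 1) + T3)"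
        using less.hyps[of s3 "t + ?g + T2"] s2 s3 f3 by auto
      have "ex N (Seq (Seq p ?G) ?W) s (T2 + Suc (tc e1 + Suc (tc e2)) + Suc T3) (return_pmf s4)"
        by (intro ex_Seq_det[OF ex_Seq_det[OF s2(1) s3(1)] s4(1)])
      then have "ex N ?W s (Suc (T2 + Suc (tc e1 + Suc (tc e2)) + Suc T3)) (return_pmf s4)"
        using True less.prems by (intro ex_det) auto
      moreover have "t + ?g + T2 + (?g - 1) + T3 = t + (?g - 1) + Suc (T2 + Suc (tc e1 + Suc (tc e2)) + Suc T3)"
        by simp
      ultimately show ?thesis using s4(2) by metis
    next
      case False
      have "ex N ?W s 1 (return_pmf s)" using False less.prems by (intro ex_prim) auto
      moreover have "t + (?g - 1) + 1 = t + ?g" by simp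
      ultimately show ?thesis using fin[OF less.prems(2) False] by metis
    qed
  qed
  fix s assume s: "fit N s" "ab s = r" "mem s = h"
  obtain s1 where s1: "ex N ?G s (tc e1 + Suc (tc e2)) (return_pmf s1)"
     "mem s1 = mem s" "ab s1 = ab s" "reg s1 60 = vl e1 (ab s) (mem s)" "reg s1 61 = vl e2 (ab s) (mem s)"
    using comp2[of N s e1 e2] s I ok by blast
  have f1: "fit N s1" using ex_fit[OF s1(1)] by simp
  obtain s' T where s': "ex N ?W s1 T (return_pmf s')" "Q (ab s') (mem s') (t + (?g - 1) + T)"
    using main[of s1 t] f1 s s1 I by auto
  have "ex N (Seq ?G ?W) s (?g - 1 + T) (return_pmf s')"
    using ex_Seq_det[OF s1(1) s'(1)] by (rule ex_mono) simp
  then show "\<exists>s' T. ex N (whl e1 e2 p) s T (return_pmf s') \<and> Q (ab s') (mem s') (t + T)"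
    using s'(2) unfolding whl_def add.assoc by blast
qed

text \<open>The charges are 6 for the initialisation, \<open>tc e + 7\<close> for one evaluation of
  the guard and 12 for the increment. The bound \<open>e\<close> is evaluated anew in each round,
  hence \<open>ok\<close> asks the invariant to fix its value \<open>b\<close>; \<open>b < N\<close>
  keeps the incremented counter within a word.\<close>

lemma wp_forl:
  assumes x: "x < 60" and I: "I 0 (r(x := 0)) h (t + 6)"
    and ok: "\<And>i r h t. I i r h t \<Longrightarrow> r x = i \<Longrightarrow> i \<le> b \<Longrightarrow> vl e r h = b \<and> eok N e r h"
    and b: "b < N"
    and body: "\<And>i r h t. I i r h t \<Longrightarrow> r x = i \<Longrightarrow> i < b \<Longrightarrow>
      wp N p (\<lambda>r' h' t'. r' x = i \<and> I (Suc i) (r'(x := Suc i)) h' (t' + 12)) r h (t + (tc e + 7))"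
    and fin: "\<And>r h t. I b r h t \<Longrightarrow> r x = b \<Longrightarrow> Q r h (t + (tc e + 7))"
  shows "wp N (forl x e p) Q r h t"
  unfolding forl_def
proof (rule wp_seq, rule wp_asg, goal_cases)
  case 3
  show ?case
  proof (rule wp_whl[where v = "\<lambda>r h. b - r x" and I = "\<lambda>r h t. I (r x) r h t \<and> r x \<le> b"], goal_cases)
    case 1 show ?case using I by (simp add: add.commute)
  next
    case (2 r h t) then show ?case using ok x by auto
  next
    case (3 r h t)
    then have lt: "r x < b" using ok[of "r x" r h t] by auto
    show ?case
    proof (rule wp_seq, rule wp_mono)
      show "wp N p (\<lambda>r' h' t'. r' x = r x \<and> I (Suc (r x)) (r'(x := Suc (r x))) h' (t' + 12)) r h (t + (tc (Vr x) + tc e + 4))"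
        using body[of "r x" r h t] 3 lt by (simp add: algebra_simps)
      fix r' h' t' assume *: "r' x = r x \<and> I (Suc (r x)) (r'(x := Suc (r x))) h' (t' + 12)"
      then show "wp N (asg x (Op Add (Vr x) (Cn 1)))
         (\<lambda>r' h' t'. (I (r' x) r' h' t' \<and> r' x \<le> b) \<and> b - r' x < b - r x) r' h' (t' + 1)"
        using x b lt by (intro wp_asg) (auto simp: numeral_eq_Suc)
    qed
  next
    case (4 r h t)
    then show ?case using ok[of "r x" r h t] fin[of r h t] by (auto simp: algebra_simps)
  qed
qed (use x in auto)

abbreviation seq_com (infixr ";;" 60) where "p ;; q \<equiv> Seq p q"
abbreviation (input) eadd (infixl "[+]" 65) where "a [+] b \<equiv> Op Add a b"
abbreviation (input) esub (infixl "[-]" 65) where "a [-] b \<equiv> Op Sub a b"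
abbreviation (input) emul (infixl "[*]" 70) where "a [*] b \<equiv> Op Mul a b"
abbreviation (input) ediv (infixl "[div]" 70) where "a [div] b \<equiv> Op Div a b"

section \<open>Tournament trees\<close>

text \<open>A tree of minima in heap layout, with vertex \<open>v\<close> at the leaf
  \<open>n + v\<close>. For every \<open>n\<close> the inner nodes 1 to \<open>n - 1\<close> have
  both children in range, so no rounding to a power of two is needed.\<close>

definition tree :: "nat \<Rightarrow> (nat \<Rightarrow> nat) \<Rightarrow> bool" where
  "tree n T \<longleftrightarrow> (\<forall>i. 1 \<le> i \<longrightarrow> i < n \<longrightarrow> T i = min (T (2 * i)) (T (2 * i + 1)))"

lemma tree_root_le:
  assumes "tree n T" "1 \<le> i" "i < 2 * n"
  shows "T 1 \<le> T i"
  using assms(2,3)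
proof (induction i rule: less_induct)
  case (less i)
  show ?case
  proof (cases "i = 1")
    case False
    let ?j = "i div 2"
    have j: "1 \<le> ?j" "?j < n" "?j < i" using less.prems False by auto
    have "T ?j = min (T (2 * ?j)) (T (2 * ?j + 1))" using assms(1) j by (simp add: tree_def)
    moreover have "i = 2 * ?j \<or> i = 2 * ?j + 1" by presburger
    ultimately have "T ?j \<le> T i" by (metis min.cobounded1 min.cobounded2)
    with less.IH[of ?j] j show ?thesis by simp
  qed simp
qed

lemma tree_root_leaf:
  assumes "tree n T" "1 \<le> n"
  shows "\<exists>v<n. T 1 = T (n + v)"
proof -
  have "\<exists>v<n. T i = T (n + v)" if "1 \<le> i" "i < 2 * n" for i
    using that
  proof (induction "2 * n - i" arbitrary: i rule: less_induct)
    case less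
    show ?case
    proof (cases "i < n")
      case True
      have "T i = T (2 * i) \<or> T i = T (2 * i + 1)"
        using assms(1) less.prems True unfolding tree_def by (metis min_def)
      moreover have "\<exists>v<n. T (2 * i) = T (n + v)" "\<exists>v<n. T (2 * i + 1) = T (n + v)"
        using less.prems True by (auto intro!: less.hyps)
      ultimately show ?thesis by metis
    next
      case False
      then show ?thesis using less.prems by (intro exI[of _ "i - n"]) auto
    qed
  qed
  then show ?thesis using assms(2) by simp
qed

definition upd :: com where
  "upd = sto 9 (Vr 0 [+] Vr 40) (Vr 41);; asg 42 (Vr 0 [+] Vr 40);;
    whl (Cn 1) (Vr 42)
     (asg 42 (Vr 42 [div] Cn 2);;
      ifl (Ld 9 (Cn 2 [*] Vr 42 [+] Cn 1)) (Ld 9 (Cn 2 [*] Vr 42))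
        (sto 9 (Vr 42) (Ld 9 (Cn 2 [*] Vr 42 [+] Cn 1)))
        (sto 9 (Vr 42) (Ld 9 (Cn 2 [*] Vr 42))))"

text \<open>The exempt nodes \<open>i div 2 ^ k\<close> are the proper ancestors of
  \<open>i\<close>, those still to be recomputed while the repair climbs from a leaf to the
  root.\<close>

definition tree_except :: "nat \<Rightarrow> nat \<Rightarrow> (nat \<Rightarrow> nat) \<Rightarrow> bool" where
  "tree_except n i T \<longleftrightarrow> (\<forall>j. 1 \<le> j \<longrightarrow> j < n \<longrightarrow> (\<forall>k\<ge>1. j \<noteq> i div 2 ^ k) \<longrightarrow>
     T j = min (T (2 * j)) (T (2 * j + 1)))"

lemma tree_except_leaf:
  assumes "tree n T"
  shows "tree_except n (n + v) (T(n + v := k))"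
  unfolding tree_except_def
proof (intro allI impI)
  fix j assume j: "1 \<le> j" "j < n" "\<forall>k\<ge>1. j \<noteq> (n + v) div 2 ^ k"
  have "2 * j \<noteq> n + v" "2 * j + 1 \<noteq> n + v" using j(3)[rule_format, of 1] by auto
  moreover have "T j = min (T (2 * j)) (T (2 * j + 1))" using assms j by (simp add: tree_def)
  ultimately show "(T(n + v := k)) j = min ((T(n + v := k)) (2 * j)) ((T(n + v := k)) (2 * j + 1))"
    using j by simp
qed

text \<open>Recomputing the parent of \<open>i\<close> repairs it. The only other node whose
  equation reads the changed entry is the parent of that node, which stays exempt.\<close>

lemma tree_except_step:
  fixes T T' :: "nat \<Rightarrow> nat" and i n :: nat
  assumes inv: "tree_except n i T" and i: "1 < i"
    and T': "T' = T(i div 2 := min (T (2 * (i div 2))) (T (2 * (i div 2) + 1)))"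
  shows "tree_except n (i div 2) T'"
  unfolding tree_except_def
proof (intro allI impI)
  fix j assume j: "1 \<le> j" "j < n" "\<forall>k\<ge>1. j \<noteq> i div 2 div 2 ^ k"
  have par: "2 * j \<noteq> i div 2" "2 * j + 1 \<noteq> i div 2"
    using j(3)[rule_format, of 1] by auto
  show "T' j = min (T' (2 * j)) (T' (2 * j + 1))"
  proof (cases "j = i div 2")
    case True
    have "2 * j \<noteq> j" "2 * j + 1 \<noteq> j" using j(1) by auto
    with True show ?thesis by (simp add: T')
  next
    case False
    have "j \<noteq> i div 2 ^ k" if "k \<ge> 1" for k
    proof (cases "k = 1")
      case False
      then obtain k' where "k = Suc k'" "k' \<ge> 1" using \<open>k \<ge> 1\<close> by (cases k) auto
      then show ?thesis using j(3) by (simp add: div_mult2_eq)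
    qed (use \<open>j \<noteq> i div 2\<close> in simp)
    then have "T j = min (T (2 * j)) (T (2 * j + 1))" using inv j by (simp add: tree_except_def)
    then show ?thesis using par False by (simp add: T')
  qed
qed

lemma tree_except_root:
  assumes "tree_except n 1 T"
  shows "tree n T"
  unfolding tree_def
proof (intro allI impI)
  fix j :: nat assume j: "1 \<le> j" "j < n"
  have "j \<noteq> 1 div 2 ^ k" if "k \<ge> 1" for k :: nat
  proof -
    have "(1 :: nat) < 2 ^ k" using that by (intro one_less_power) auto
    then have "1 div 2 ^ k = (0 :: nat)" by (rule div_less)
    then show ?thesis using j by simp
  qed
  then show "T j = min (T (2 * j)) (T (2 * j + 1))"
    using assms j unfolding tree_except_def by blast
qed

lemma upd_wp:
  assumes r: "r 0 = n" "r 40 = v" "v < n" "r 41 = k"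
    and L: "2 * n \<le> 2 ^ L" and N: "4 * n + 4 \<le> N"
    and tr: "tree n (h 9)"
    and Q: "\<And>r' h' t'. \<lbrakk>\<And>x. x \<noteq> 42 \<Longrightarrow> r' x = r x; \<And>a. a \<noteq> 9 \<Longrightarrow> h' a = h a; tree n (h' 9);
      \<And>w. w < n \<Longrightarrow> h' 9 (n + w) = (if w = v then k else h 9 (n + w)); t' \<le> t + 100 * L + 100\<rbrakk> \<Longrightarrow> Q r' h' t'"
  shows "wp N upd Q r h t"
proof -
  \<comment> \<open>After \<open>s\<close> rounds the current node is below
    \<open>2 ^ (L - s)\<close>; this limits the rounds to \<open>L\<close>.\<close>
  define I where "I r' h' t' \<longleftrightarrow> (\<forall>x. x \<noteq> 42 \<longrightarrow> r' x = r x) \<and> (\<forall>a. a \<noteq> 9 \<longrightarrow> h' a = h a) \<and>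
     1 \<le> r' 42 \<and> r' 42 < 2 * n \<and>
     (\<forall>w<n. h' 9 (n + w) = (if w = v then k else h 9 (n + w))) \<and>
     tree_except n (r' 42) (h' 9) \<and>
     (\<exists>s\<le>L. r' 42 < 2 ^ (L - s) \<and> t' \<le> t + 40 + 100 * s)" for r' h' and t' :: nat
  have N': "N \<ge> 4" "\<And>x. x < 2 * n \<Longrightarrow> x \<le> N" "\<And>x. x < n \<Longrightarrow> 2 * x + 1 \<le> N \<and> 2 * x \<le> N"
    using N by auto
  have I0: "I (r(42 := n + v)) (h(9 := (h 9)(n + v := k))) t'" if "t' \<le> t + 40" for t'
    unfolding I_def using tree_except_leaf[OF tr] r L that by (auto intro!: exI[of _ 0])
  show ?thesis
    unfolding upd_def
    apply (rule wp_seq, rule wp_sto)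
    subgoal using r N by simp
    subgoal using r N by simp
    apply (rule wp_seq, rule wp_asg)
    subgoal by simp
    subgoal using r N by simp
    apply (rule wp_whl[where I = I and v = "\<lambda>r h. r 42"])
    subgoal using I0 r by simp
    subgoal using N' by (auto simp: I_def)
    subgoal premises prems for r' h' t'
    proof -
      have i: "1 < r' 42" "r' 42 < 2 * n" using prems by (auto simp: I_def)
      then have d: "r' 42 div 2 < n" "1 \<le> r' 42 div 2" "r' 42 div 2 < r' 42" by auto
      obtain s where s: "s \<le> L" "r' 42 < 2 ^ (L - s)" "t' \<le> t + 40 + 100 * s"
        using prems by (auto simp: I_def)
      have "s \<noteq> L" using s i by auto
      then have s': "Suc s \<le> L" "L - s = Suc (L - Suc s)" using s by auto
      then have s'': "r' 42 div 2 < 2 ^ (L - Suc s)" using s(2) by auto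
      let ?i = "r' 42 div 2"
      let ?T = "(h' 9)(?i := min (h' 9 (2 * ?i)) (h' 9 (2 * ?i + 1)))"
      have tf: "tree_except n ?i ?T"
        using tree_except_step[where n = n and T = "h' 9" and i = "r' 42" and T' = ?T] prems(1) i by (simp add: I_def)
      have fin: "I (r'(42 := ?i)) (h'(9 := ?T)) t'' \<and> (r'(42 := ?i)) 42 < r' 42" if "t'' \<le> t' + 100" for t''
        unfolding I_def using prems(1) d tf s s' s'' that
        by (auto simp: I_def intro!: exI[of _ "Suc s"])
      have m1: "h' 9 (2 * ?i + 1) < h' 9 (2 * ?i) \<Longrightarrow> h' 9 (2 * ?i + 1) = min (h' 9 (2 * ?i)) (h' 9 (2 * ?i + 1))"
        "\<not> h' 9 (2 * ?i + 1) < h' 9 (2 * ?i) \<Longrightarrow> h' 9 (2 * ?i) = min (h' 9 (2 * ?i)) (h' 9 (2 * ?i + 1))"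
        by auto
      show ?thesis
        apply (rule wp_seq, rule wp_asg)
        subgoal by simp
        subgoal using N' by simp
        apply (rule wp_ifl)
        subgoal using d N'(1) N'(3)[of ?i] by simp
        subgoal using d N'(1) N'(3)[of ?i] by simp
        subgoal
          apply (rule wp_sto)
          subgoal by simp
          subgoal using d N'(1) N'(3)[of ?i] by simp
          subgoal using fin m1(1) d(3) by simp
          done
        subgoal
          apply (rule wp_sto)
          subgoal by simp
          subgoal using d N'(1) N'(3)[of ?i] by simp
          subgoal using fin m1(2) d(3) by simp
          done
        done
    qed
    subgoal premises prems for r' h' t'
    proof -
      have i: "r' 42 = 1" using prems by (auto simp: I_def)
      obtain s where s: "s \<le> L" "t' \<le> t + 40 + 100 * s" using prems by (auto simp: I_def)
      have tr': "tree n (h' 9)" using prems(1) i by (intro tree_except_root) (simp add: I_def)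
      show ?thesis
        by (rule Q) (use prems(1) s tr' in \<open>auto simp: I_def\<close>)
    qed
    done
qed

section \<open>Walks and adjacency lists\<close>

inductive walk :: "nat set \<Rightarrow> (nat \<Rightarrow> nat) \<Rightarrow> (nat \<Rightarrow> nat) \<Rightarrow> (nat \<Rightarrow> nat) \<Rightarrow> nat \<Rightarrow> nat \<Rightarrow> nat \<Rightarrow> bool"
  for A sr tg wt u where
  nil: "walk A sr tg wt u u 0"
| snoc: "walk A sr tg wt u v l \<Longrightarrow> e \<in> A \<Longrightarrow> sr e = v \<Longrightarrow> walk A sr tg wt u (tg e) (l + wt e)"

lemma walk_mono: "walk A sr tg wt u v l \<Longrightarrow> A \<subseteq> B \<Longrightarrow> walk B sr tg wt u v l"
  by (induction rule: walk.induct) (auto intro: walk.intros)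

lemma walk_trans: "walk A sr tg wt v z k \<Longrightarrow> walk A sr tg wt u v l \<Longrightarrow> walk A sr tg wt u z (l + k)"
proof (induction rule: walk.induct)
  case (snoc v' l' e)
  then show ?case using walk.snoc[of A sr tg wt u v' "l + l'" e] by (simp add: add.assoc)
qed simp

lemma walk_rev: "walk A sr tg wt u v l \<Longrightarrow> walk A tg sr wt v u l"
proof (induction rule: walk.induct)
  case (snoc v l e)
  have "walk A tg sr wt (tg e) (sr e) (0 + wt e)"
    using snoc.hyps by (intro walk.snoc[OF walk.nil]) auto
  then show ?case using walk_trans[of A tg sr wt v u l "tg e" "wt e"] snoc by (simp add: add.commute)
qed (rule walk.nil)

text \<open>The linked adjacency lists that one pass over the edges builds: 1 plus the largest
  \<open>e < k\<close> with \<open>f e = v\<close>, or 0 if there is none. At \<open>k = m\<close>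
  this is the head of the list of \<open>v\<close>, at \<open>k = e\<close> the link of an edge
  \<open>e\<close> in its list. Hence each list is traversed in descending order.\<close>

fun prv :: "(nat \<Rightarrow> nat) \<Rightarrow> nat \<Rightarrow> nat \<Rightarrow> nat" where
  "prv f v 0 = 0"
| "prv f v (Suc k) = (if f k = v then Suc k else prv f v k)"

lemma prv_le: "prv f v k \<le> k"
  by (induction k) auto

lemma prv_pos: "prv f v k = Suc e \<Longrightarrow> e < k \<and> f e = v"
  by (induction k) (auto split: if_splits)

lemma prv_none: "prv f v k \<le> e \<Longrightarrow> e < k \<Longrightarrow> f e \<noteq> v"
  by (induction k) (auto simp: less_Suc_eq split: if_splits)

section \<open>Dijkstra's algorithm with a filter on the relaxations\<close>

locale wgraph =
  fixes n m :: nat and sr tg wt :: "nat \<Rightarrow> nat" and Wm BIG :: nat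
  assumes edge: "e < m \<Longrightarrow> sr e < n \<and> tg e < n \<and> 1 \<le> wt e \<and> wt e \<le> Wm"
    and BIG: "n * Wm < BIG" "Wm < BIG"
begin

text \<open>\<open>P\<close> holds the popped vertices, \<open>E\<close> those among them that
  passed the gate and were expanded, \<open>Qs\<close> the queue and \<open>X\<close> the relaxed
  edges. With a filter the labels need not be distances, so they are kept below \<open>BIG\<close>
  by the bound \<open>card P * Wm\<close> rather than by comparison with distances. Parents lie in
  \<open>E\<close>, because only expanded vertices have their own parent edge in the output.\<close>

definition dinv :: "(nat \<Rightarrow> nat \<Rightarrow> bool) \<Rightarrow> nat \<Rightarrow> (nat \<Rightarrow> nat) \<Rightarrow> nat \<Rightarrow> (nat \<Rightarrow> nat) \<Rightarrow> (nat \<Rightarrow> nat) \<Rightarrow>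
    nat set \<Rightarrow> nat set \<Rightarrow> nat set \<Rightarrow> nat set \<Rightarrow> bool" where
  "dinv ok u cnt gt D pe Qs P E X \<longleftrightarrow>
    P \<inter> Qs = {} \<and> P \<union> Qs \<subseteq> {..<n} \<and> E \<subseteq> P \<and> u \<in> P \<union> Qs \<and> D u = 0 \<and> pe u = 0 \<and>
    (\<forall>v<n. D v \<le> BIG \<and> (D v < BIG \<longleftrightarrow> v \<in> P \<union> Qs)) \<and>
    (\<forall>p\<in>P. \<forall>y\<in>Qs. D p \<le> D y) \<and>
    (\<forall>y\<in>P \<union> Qs. D y \<le> card P * Wm) \<and>
    (\<forall>y\<in>P \<union> Qs. y \<noteq> u \<longrightarrow>
      (\<exists>e<m. pe y = Suc e \<and> tg e = y \<and> sr e \<in> E \<and> D y = D (sr e) + wt e \<and> ok y (D y))) \<and>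
    (\<forall>x\<in>P - E. gt \<le> cnt x) \<and> (\<forall>x\<in>E. cnt x < gt) \<and>
    (\<forall>e<m. e \<in> X \<longrightarrow> ok (tg e) (D (sr e) + wt e) \<longrightarrow> D (tg e) \<le> D (sr e) + wt e)"

lemma dinv_init:
  assumes "u < n" "D u = 0" "\<And>v. v < n \<Longrightarrow> v \<noteq> u \<Longrightarrow> D v = BIG" "pe u = 0"
  shows "dinv ok u cnt gt D pe {u} {} {} {e. sr e \<in> {}}"
proof -
  have "D v \<le> BIG \<and> (D v < BIG \<longleftrightarrow> v = u)" if "v < n" for v
    using assms(2) assms(3)[OF that] BIG by (cases "v = u") auto
  then show ?thesis unfolding dinv_def using assms by auto
qed

lemma dinv_fin: "dinv ok u cnt gt D pe Qs P E X \<Longrightarrow> finite P \<and> finite Qs \<and> finite E"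
  unfolding dinv_def by (meson finite_Un finite_lessThan finite_subset)

lemma dinv_card: "dinv ok u cnt gt D pe Qs P E X \<Longrightarrow> card P \<le> n"
  unfolding dinv_def by (metis Un_subset_iff card_lessThan card_mono finite_lessThan)

text \<open>A vertex met with exhausted counter counts as popped but not as expanded: it keeps its
  label, and no parent edge will ever start from it.\<close>

lemma dinv_gate:
  assumes inv: "dinv ok u cnt gt D pe Qs P E X" and x: "x \<in> Qs" "\<And>y. y \<in> Qs \<Longrightarrow> D x \<le> D y"
    and "gt \<le> cnt x"
  shows "dinv ok u cnt gt D pe (Qs - {x}) (insert x P) E X"
proof -
  note fin = dinv_fin[OF inv]
  have x': "x \<notin> P" using inv x by (auto simp: dinv_def)
  then have c: "card (insert x P) = Suc (card P)" using fin by simp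
  have eq: "insert x P \<union> (Qs - {x}) = P \<union> Qs" using x by auto
  have b: "D y \<le> card (insert x P) * Wm" if "y \<in> P \<union> Qs" for y
    using inv that unfolding dinv_def c by (auto intro: le_trans)
  show ?thesis unfolding dinv_def eq using inv assms x' b unfolding dinv_def by auto
qed

lemma dinv_expand:
  assumes inv: "dinv ok u cnt gt D pe Qs P E X" and x: "x \<in> Qs" "\<And>y. y \<in> Qs \<Longrightarrow> D x \<le> D y"
  shows "cnt x < gt \<Longrightarrow> dinv ok u cnt gt D pe (Qs - {x}) (insert x P) (insert x E) X"
    "\<forall>p\<in>insert x P. D p \<le> D x" "D x + Wm \<le> card (insert x P) * Wm" "x \<notin> E" "x \<notin> P"
proof -
  note fin = dinv_fin[OF inv]
  show x': "x \<notin> P" using inv x by (auto simp: dinv_def)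
  then have c: "card (insert x P) = Suc (card P)" using fin by simp
  have eq: "insert x P \<union> (Qs - {x}) = P \<union> Qs" using x by auto
  have b: "D y \<le> card (insert x P) * Wm" if "y \<in> P \<union> Qs" for y
    using inv that unfolding dinv_def c by (auto intro: le_trans)
  show "dinv ok u cnt gt D pe (Qs - {x}) (insert x P) (insert x E) X" if "cnt x < gt"
    using that unfolding dinv_def eq using inv assms x' b unfolding dinv_def by auto
  show "\<forall>p\<in>insert x P. D p \<le> D x" using inv x by (auto simp: dinv_def)
  show "D x + Wm \<le> card (insert x P) * Wm" using inv x by (auto simp: dinv_def c)
  show "x \<notin> E" using inv x' by (auto simp: dinv_def)
qed

lemma dinv_skip:
  assumes "dinv ok u cnt gt D pe Qs P E X" "\<not> (D (sr e) + wt e < D (tg e) \<and> ok (tg e) (D (sr e) + wt e))"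
  shows "dinv ok u cnt gt D pe Qs P E (insert e X)"
  using assms unfolding dinv_def by auto

text \<open>A vertex of \<open>P\<close> cannot be improved, since its label is at most that of the
  vertex being expanded. So \<open>y\<close> lies outside \<open>E\<close>, and lowering its label
  breaks no inequality of an edge relaxed earlier.\<close>

lemma dinv_relax:
  assumes inv: "dinv ok u cnt gt D pe Qs P E X" and e: "e < m" "sr e \<in> E" "y = tg e"
    and pm: "\<forall>p\<in>P. D p \<le> D (sr e)" and b: "D (sr e) + Wm \<le> card P * Wm"
    and nd: "nd = D (sr e) + wt e" "nd < D y" "ok y nd" and X: "X \<subseteq> {e. sr e \<in> E}"
  shows "dinv ok u cnt gt (D(y := nd)) (pe(y := Suc e)) (insert y Qs) P E (insert e X)"
    and "y \<notin> P" "nd < BIG"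
proof -
  show yP: "y \<notin> P" using pm nd by fastforce
  have en: "y < n" "1 \<le> wt e" "wt e \<le> Wm" using edge[OF e(1)] e(3) by auto
  have yu: "y \<noteq> u" using inv nd by (auto simp: dinv_def)
  have nb: "nd \<le> card P * Wm" using b en nd by simp
  also have "\<dots> \<le> n * Wm" using dinv_card[OF inv] by simp
  finally show nI: "nd < BIG" using BIG by simp
  have sE: "\<And>x. x \<in> E \<Longrightarrow> x \<noteq> y" using yP inv by (auto simp: dinv_def)
  have par: "\<exists>e'<m. (pe(y := Suc e)) z = Suc e' \<and> tg e' = z \<and> sr e' \<in> E \<and>
      (D(y := nd)) z = (D(y := nd)) (sr e') + wt e' \<and> ok z ((D(y := nd)) z)"
    if z: "z \<in> P \<union> insert y Qs" "z \<noteq> u" for z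
  proof (cases "z = y")
    case True
    then show ?thesis using e nd sE by (intro exI[of _ e]) auto
  next
    case False
    then have "z \<in> P \<union> Qs" using z by auto
    then obtain e' where "e' < m" "pe z = Suc e'" "tg e' = z" "sr e' \<in> E" "D z = D (sr e') + wt e'" "ok z (D z)"
      using inv z(2) unfolding dinv_def by blast
    then show ?thesis using False sE by (intro exI[of _ e']) auto
  qed
  have cl: "(D(y := nd)) (tg e') \<le> (D(y := nd)) (sr e') + wt e'"
    if "e' < m" "e' \<in> insert e X" "ok (tg e') ((D(y := nd)) (sr e') + wt e')" for e'
  proof -
    have s: "sr e' \<in> E" using that e X by auto
    then have s': "sr e' \<noteq> y" using sE by auto
    show ?thesis
    proof (cases "e' = e")
      case True then show ?thesis using s' e nd by auto
    next
      case False
      then have "D (tg e') \<le> D (sr e') + wt e'" using that s' inv by (auto simp: dinv_def)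
      then show ?thesis using s' nd by auto
    qed
  qed
  have cmp: "(D(y := nd)) p \<le> (D(y := nd)) z" if "p \<in> P" "z \<in> insert y Qs" for p z
    using that pm yP nd inv by (auto simp: dinv_def)
  have bnd: "(D(y := nd)) z \<le> card P * Wm" if "z \<in> P \<union> insert y Qs" for z
    using that nb inv by (auto simp: dinv_def)
  have dom: "(D(y := nd)) v \<le> BIG \<and> ((D(y := nd)) v < BIG \<longleftrightarrow> v \<in> P \<union> insert y Qs)" if "v < n" for v
    using that nI inv by (auto simp: dinv_def)
  show "dinv ok u cnt gt (D(y := nd)) (pe(y := Suc e)) (insert y Qs) P E (insert e X)"
    unfolding dinv_def using par cl cmp bnd dom yP yu en inv by (auto simp: dinv_def)
qed

text \<open>Weights are positive, so labels strictly decrease along parent edges, and the induction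
  on the label ends in \<open>u\<close>.\<close>

lemma dinv_walk:
  assumes inv: "dinv ok u cnt gt D pe Qs P E X" and y: "y \<in> P \<union> Qs"
    and A: "\<And>z. z \<in> E \<union> {y} \<Longrightarrow> z \<noteq> u \<Longrightarrow> pe z - 1 \<in> A"
  shows "walk A sr tg wt u y (D y)"
  using y A
proof (induction "D y" arbitrary: y rule: less_induct)
  case less
  show ?case
  proof (cases "y = u")
    case True
    then show ?thesis using inv walk.nil by (auto simp: dinv_def)
  next
    case False
    then obtain e where e: "e < m" "pe y = Suc e" "tg e = y" "sr e \<in> E" "D y = D (sr e) + wt e"
      using inv less.prems unfolding dinv_def by blast
    have "D (sr e) < D y" using e edge[of e] by auto
    moreover have "sr e \<in> P \<union> Qs" using e inv by (auto simp: dinv_def)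
    ultimately have "walk A sr tg wt u (sr e) (D (sr e))" using less.hyps[of "sr e"] less.prems e by auto
    moreover have "e \<in> A" using less.prems(2)[of y] e False by auto
    ultimately show ?thesis using walk.snoc[of A sr tg wt u "sr e" "D (sr e)" e] e by auto
  qed
qed

definition deg :: "nat \<Rightarrow> nat" where "deg x = card {e. e < m \<and> sr e = x}"

lemma sum_deg: "(\<Sum>x<n. deg x) = m"
proof -
  have "(\<Sum>x<n. deg x) = card (\<Union>x<n. {e. e < m \<and> sr e = x})"
    unfolding deg_def by (intro card_UN_disjoint[symmetric]) auto
  also have "(\<Union>x<n. {e. e < m \<and> sr e = x}) = {..<m}" using edge by auto
  finally show ?thesis by simp
qed

end

text \<open>The output stores the ends of edges, and an edge may be written by many searches, as
  \<open>output_graph\<close> forgets repetitions. \<open>outs\<close> translates back into edge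
  numbers, in which \<open>walk\<close> is expressed.\<close>

definition outs :: "nat \<Rightarrow> (nat \<Rightarrow> nat \<Rightarrow> nat) \<Rightarrow> nat \<Rightarrow> nat set" where
  "outs m h c = {e. e < m \<and> (\<exists>i<c. h 3 i = h 0 e \<and> h 4 i = h 1 e)}"

definition outok :: "nat \<Rightarrow> (nat \<Rightarrow> nat \<Rightarrow> nat) \<Rightarrow> nat \<Rightarrow> bool" where
  "outok m h c \<longleftrightarrow> (\<forall>i<c. \<exists>e<m. h 3 i = h 0 e \<and> h 4 i = h 1 e)"

section \<open>Code and invariants of one search\<close>

definition relax :: "nat \<Rightarrow> com \<Rightarrow> com" where
  "relax tb F = asg 35 (Ld tb (Vr 34 [-] Cn 1));; asg 36 (Vr 32 [+] Ld 2 (Vr 34 [-] Cn 1));;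
     ifl (Vr 36) (Ld 10 (Vr 35))
       (F;; ifl (Cn 0) (Vr 37)
          (sto 10 (Vr 35) (Vr 36);; sto 11 (Vr 35) (Vr 34);; asg 40 (Vr 35);;
           asg 41 (Vr 36 [*] Vr 0 [+] Vr 35);; upd)
          Skip)
       Skip"

definition scan :: "nat \<Rightarrow> nat \<Rightarrow> nat \<Rightarrow> com \<Rightarrow> com" where
  "scan hb nb tb F = asg 34 (Ld hb (Vr 33));;
     whl (Cn 0) (Vr 34) (relax tb F;; asg 34 (Ld nb (Vr 34 [-] Cn 1)))"

text \<open>A key is \<open>d * n + v\<close>, so the root of the tree yields the minimal label and
  its vertex by division. A vertex whose counter has reached the gate in register 10 leaves the
  queue without being scanned and without output of its parent edge.\<close>

definition pop :: "nat \<Rightarrow> nat \<Rightarrow> nat \<Rightarrow> com \<Rightarrow> com" where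
  "pop hb nb tb F = asg 31 (Ld 9 (Cn 1));; asg 32 (Vr 31 [div] Vr 0);; asg 33 (Vr 31 [-] Vr 32 [*] Vr 0);;
     asg 40 (Vr 33);; asg 41 (Vr 9);; upd;;
     ifl (Ld 12 (Vr 33)) (Vr 10)
      (sto 12 (Vr 33) (Ld 12 (Vr 33) [+] Cn 1);;
       ifl (Cn 0) (Ld 11 (Vr 33))
         (sto 3 (Vr 2) (Ld 0 (Ld 11 (Vr 33) [-] Cn 1));; sto 4 (Vr 2) (Ld 1 (Ld 11 (Vr 33) [-] Cn 1));;
          asg 2 (Vr 2 [+] Cn 1))
         Skip;;
       scan hb nb tb F)
      Skip"

definition dijk :: "nat \<Rightarrow> nat \<Rightarrow> nat \<Rightarrow> com \<Rightarrow> com" where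
  "dijk hb nb tb F = forl 38 (Cn 2 [*] Vr 0) (sto 9 (Vr 38) (Vr 9);; sto 10 (Vr 38) (Vr 8));;
     sto 10 (Vr 30) (Cn 0);; sto 11 (Vr 30) (Cn 0);; asg 40 (Vr 30);; asg 41 (Vr 30);; upd;;
     whl (Ld 9 (Cn 1)) (Vr 9) (pop hb nb tb F)"

definition DR :: "nat set" where "DR = {2,31,32,33,34,35,36,37,38,39,40,41,42,43}"
definition DB :: "nat set" where "DB = {3,4,9,10,11,12}"

lemma DR_iff [simp]: "x \<in> DR \<longleftrightarrow> x = 2 \<or> x = 31 \<or> x = 32 \<or> x = 33 \<or> x = 34 \<or> x = 35 \<or> x = 36 \<or> x = 37 \<or>
    x = 38 \<or> x = 39 \<or> x = 40 \<or> x = 41 \<or> x = 42 \<or> x = 43"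
  by (auto simp: DR_def)

lemma DB_iff [simp]: "a \<in> DB \<longleftrightarrow> a = 3 \<or> a = 4 \<or> a = 9 \<or> a = 10 \<or> a = 11 \<or> a = 12"
  by (auto simp: DB_def)

definition frame :: "nat set \<Rightarrow> nat set \<Rightarrow> (nat \<Rightarrow> nat) \<Rightarrow> (nat \<Rightarrow> nat \<Rightarrow> nat) \<Rightarrow> (nat \<Rightarrow> nat) \<Rightarrow> (nat \<Rightarrow> nat \<Rightarrow> nat) \<Rightarrow> bool" where
  "frame R B r0 h0 r h \<longleftrightarrow> (\<forall>x. x \<notin> R \<longrightarrow> r x = r0 x) \<and> (\<forall>a. a \<notin> B \<longrightarrow> h a = h0 a)"

lemma frame_r: "frame R B r0 h0 r h \<Longrightarrow> x \<notin> R \<Longrightarrow> r x = r0 x"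
  and frame_h: "frame R B r0 h0 r h \<Longrightarrow> a \<notin> B \<Longrightarrow> h a = h0 a"
  by (auto simp: frame_def)

lemma frame_refl [simp]: "frame R B r h r h" by (simp add: frame_def)

lemma frame_upd: "frame R B r0 h0 r h \<Longrightarrow> x \<in> R \<Longrightarrow> frame R B r0 h0 (r(x := v)) h"
   "frame R B r0 h0 r h \<Longrightarrow> a \<in> B \<Longrightarrow> frame R B r0 h0 r (h(a := f))"
  by (auto simp: frame_def)

lemma frame_trans: "frame R B r0 h0 r h \<Longrightarrow> frame R' B' r h r' h' \<Longrightarrow> R' \<subseteq> R \<Longrightarrow> B' \<subseteq> B \<Longrightarrow> frame R B r0 h0 r' h'"
  by (auto simp: frame_def subset_iff)

text \<open>The counters in \<open>h0 12\<close> are inherited from earlier searches. The code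
  \<open>F\<close> of the filter is a parameter, so that the same search serves the sample trees and
  the local searches and, with \<open>sr\<close> and \<open>tg\<close> exchanged, the reversed
  graph.\<close>

locale dijkstra = wgraph +
  fixes hb nb tb :: nat and F :: com and N L TF gt u :: nat and ok r0 h0
  assumes n1: "1 \<le> n"
    and banks: "hb \<notin> DB" "nb \<notin> DB" "tb \<notin> DB"
    and regs: "r0 0 = n" "r0 8 = BIG" "r0 9 = BIG * n" "r0 10 = gt" "r0 30 = u" and un: "u < n"
    and adj: "\<And>e. e < m \<Longrightarrow> h0 tb e = tg e \<and> h0 2 e = wt e \<and> h0 nb e = prv sr (sr e) e"
      "\<And>v. v < n \<Longrightarrow> h0 hb v = prv sr v m"
    and N: "4 * n + 4 \<le> N" "BIG * n \<le> N" "BIG + Wm \<le> N" "gt < N" "r0 2 + n < N"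
    and L: "2 * n \<le> 2 ^ L"
    and F: "\<And>r h t Q. frame DR DB r0 h0 r h \<Longrightarrow> r 35 < n \<Longrightarrow> r 36 < BIG \<Longrightarrow>
      (\<And>r' t'. frame {37,43} {} r h r' h \<Longrightarrow> (0 < r' 37 \<longleftrightarrow> ok (r 35) (r 36)) \<Longrightarrow> t' \<le> t + TF \<Longrightarrow> Q r' h t') \<Longrightarrow>
      wp N F Q r h t"
    and out0: "outok m h0 (r0 2)"
begin

definition st :: "(nat \<Rightarrow> nat) \<Rightarrow> (nat \<Rightarrow> nat \<Rightarrow> nat) \<Rightarrow> nat set \<Rightarrow> nat set \<Rightarrow> nat set \<Rightarrow> nat set \<Rightarrow> bool" where
  "st r h Qs P E X \<longleftrightarrow> frame DR DB r0 h0 r h \<and> tree n (h 9) \<and>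
     (\<forall>v<n. h 9 (n + v) = (if v \<in> Qs then h 10 v * n + v else BIG * n)) \<and>
     dinv ok u (h0 12) gt (h 10) (h 11) Qs P E X \<and>
     h 12 = (\<lambda>v. if v \<in> E then h0 12 v + 1 else h0 12 v) \<and>
     r0 2 \<le> r 2 \<and> r 2 \<le> r0 2 + card E \<and> outok m h (r 2) \<and>
     outs m h0 (r0 2) \<subseteq> outs m h (r 2) \<and> (\<forall>y\<in>E - {u}. h 11 y - 1 \<in> outs m h (r 2))"

text \<open>\<open>BIG * n\<close> acts as the infinite key: it exceeds the key of every vertex with
  finite label.\<close>

lemma key_less: "v < n \<Longrightarrow> d < BIG \<Longrightarrow> d * n + v < BIG * n"
proof -
  assume "v < n" "d < BIG"
  then have "d * n + v < d * n + n" by simp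
  also have "\<dots> = Suc d * n" by simp
  also have "\<dots> \<le> BIG * n" using \<open>d < BIG\<close> by (intro mult_right_mono) auto
  finally show ?thesis .
qed

text \<open>The situation while the edges of \<open>x\<close> are scanned. The queue is quantified
  existentially because relaxations change it, whereas \<open>P\<close> and \<open>E\<close> stay
  fixed.\<close>

definition rinv :: "nat \<Rightarrow> nat set \<Rightarrow> nat set \<Rightarrow> (nat \<Rightarrow> nat) \<Rightarrow> (nat \<Rightarrow> nat \<Rightarrow> nat) \<Rightarrow> nat set \<Rightarrow> bool" where
  "rinv x P E r h X \<longleftrightarrow> (\<exists>Qs. st r h Qs P E X) \<and> x \<in> E \<and> r 33 = x \<and> r 32 = h 10 x \<and>
     X \<subseteq> {e. sr e \<in> E} \<and> (\<forall>p\<in>P. h 10 p \<le> h 10 x) \<and> h 10 x + Wm \<le> card P * Wm"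

lemma relax_wp:
  assumes R: "rinv x P E r h X" and e: "r 34 = Suc e" "e < m" "sr e = x"
    and Q: "\<And>r' h' t'. rinv x P E r' h' (insert e X) \<Longrightarrow> r' 34 = Suc e \<Longrightarrow> t' \<le> t + (TF + 100 * L + 300) \<Longrightarrow> Q r' h' t'"
  shows "wp N (relax tb F) Q r h t"
proof -
  obtain Qs where st: "st r h Qs P E X" using R by (auto simp: rinv_def)
  have fr: "frame DR DB r0 h0 r h" using st by (simp add: st_def)
  have inv: "dinv ok u (h0 12) gt (h 10) (h 11) Qs P E X" using st by (simp add: st_def)
  have [simp]: "h tb e = tg e" "h 2 e = wt e" "r 0 = n"
    using fr banks adj(1)[OF e(2)] regs by (auto simp: frame_h frame_r)
  have tn: "tg e < n" "wt e \<le> Wm" using edge[OF e(2)] by auto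
  have xP: "x \<in> P" using R inv by (auto simp: rinv_def dinv_def)
  have xn: "h 10 x < BIG" using xP inv by (auto simp: dinv_def)
  have [simp]: "r 32 = h 10 x" "r 33 = x" using R by (auto simp: rinv_def)
  let ?y = "tg e" and ?nd = "h 10 x + wt e"
  have tI: "h 10 ?y \<le> BIG" using inv tn by (simp add: dinv_def)
  have skip: "rinv x P E r' h (insert e X)"
    if "\<not> (?nd < h 10 ?y \<and> ok ?y ?nd)" "frame {35,36,37,43} {} r h r' h" for r'
  proof -
    have "st r' h Qs P E (insert e X)"
      unfolding st_def using st dinv_skip[OF inv, of e] that frame_trans[OF fr that(2)] e
      by (auto simp: st_def frame_r)
    then show ?thesis using R that(2) e unfolding rinv_def by (auto simp: frame_r)
  qed
  have go: "rinv x P E r' h' (insert e X)"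
    if nd: "?nd < h 10 ?y" "ok ?y ?nd" and r': "frame {35,36,37,43,40,41,42} {} r h r' h"
      and h': "\<And>a. a \<noteq> 9 \<Longrightarrow> h' a = (h(10 := (h 10)(?y := ?nd), 11 := (h 11)(?y := Suc e))) a" "tree n (h' 9)"
        "\<And>w. w < n \<Longrightarrow> h' 9 (n + w) = (if w = ?y then ?nd * n + ?y else h 9 (n + w))" for r' h'
  proof -
    have X: "X \<subseteq> {e. sr e \<in> E}" and pm: "\<forall>p\<in>P. h 10 p \<le> h 10 x" and b: "h 10 x + Wm \<le> card P * Wm" and xE: "x \<in> E"
      using R by (auto simp: rinv_def)
    note rel = dinv_relax[OF inv e(2), of ?y ?nd, unfolded e(3), OF xE refl pm b refl nd X]
    have yE: "?y \<notin> E" using rel(2) inv by (auto simp: dinv_def)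
    have yx: "?y \<noteq> x" using rel(2) xP by auto
    have frh: "frame DR DB r0 h0 r' h'"
      using fr r' h'(1) unfolding frame_def by auto
    have hs: "h' 10 = (h 10)(?y := ?nd)" "h' 11 = (h 11)(?y := Suc e)" "h' 12 = h 12" "h' 3 = h 3" "h' 4 = h 4" "h' 0 = h 0" "h' 1 = h 1"
      using h'(1) by auto
    have oo: "outs m h' c = outs m h c" "outok m h' c = outok m h c" for c
      by (simp_all add: outs_def outok_def hs del: One_nat_def)
    have r2: "r' 2 = r 2" using r' by (simp add: frame_r)
    have lv: "\<forall>v<n. h' 9 (n + v) = (if v \<in> insert ?y Qs then h' 10 v * n + v else BIG * n)"
      using st h'(3) by (auto simp: st_def hs)
    have par: "\<forall>y\<in>E - {u}. h' 11 y - 1 \<in> outs m h' (r' 2)"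
      using st yE by (auto simp: st_def hs r2 oo)
    have "st r' h' (insert ?y Qs) P E (insert e X)"
      unfolding st_def using frh h'(2) lv rel(1) par st
      by (auto simp: st_def hs r2 oo)
    moreover have "(\<forall>p\<in>P. h' 10 p \<le> h' 10 x) \<and> h' 10 x + Wm \<le> card P * Wm \<and> r' 32 = h' 10 x \<and> r' 33 = x"
      using pm b rel(2) yx xP r' by (auto simp: hs frame_r)
    ultimately show ?thesis using xE X e unfolding rinv_def by auto
  qed
  have tr: "tree n (h 9)" using st by (simp add: st_def)
  show ?thesis
    unfolding relax_def
    apply (rule wp_seq, rule wp_asg)
    subgoal by simp
    subgoal using N by simp
    apply (rule wp_seq, rule wp_asg)
    subgoal by simp
    subgoal using N xn tn e by simp
    apply (rule wp_ifl)
    subgoal by simp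
    subgoal by simp
    subgoal premises p1
      apply (rule wp_seq, rule F)
      subgoal using fr by (simp add: frame_upd)
      subgoal using tn e by simp
      subgoal using p1 tI e by simp
      subgoal premises p2 for r' t'
      proof -
        have nd: "?nd < h 10 ?y" using p1 e by simp
        have nI: "?nd < BIG" using nd tI by simp
        have okk: "0 < r' 37 \<longleftrightarrow> ok ?y ?nd" using p2(2) e by simp
        have fr': "frame {35,36,37,43} {} r h r' h" using p2(1) by (auto simp: frame_def)
        have [simp]: "r' 0 = n" "r' 34 = Suc e" "r' 35 = ?y" "r' 36 = ?nd"
          using p2(1) e by (auto simp: frame_r)
        have kl: "?nd * n + ?y < BIG * n" by (rule key_less[OF tn(1) nI])
        show ?thesis
          apply (rule wp_ifl)
          subgoal by simp
          subgoal by simp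
          subgoal
            apply (rule wp_seq, rule wp_sto)
            subgoal by simp
            subgoal by simp
            apply (rule wp_seq, rule wp_sto)
            subgoal by simp
            subgoal by simp
            apply (rule wp_seq, rule wp_asg)
            subgoal by simp
            subgoal by simp
            apply (rule wp_seq, rule wp_asg)
            subgoal by simp
            subgoal using kl N(2) by simp
            apply (rule upd_wp[where L = L and v = ?y and n = n and k = "?nd * n + ?y"])
            subgoal by simp
            subgoal by simp
            subgoal by (rule tn)
            subgoal by simp
            subgoal by (rule L)
            subgoal by (rule N)
            subgoal using tr by simp
            subgoal premises p3 for r2 h2 t2
            proof (rule Q)
              show "rinv x P E r2 h2 (insert e X)"
                apply (rule go[OF nd])
                subgoal using okk p3(1) by simp
                subgoal using p3(2) fr' by (auto simp: frame_def)
                subgoal for a using p3(3)[of a] by simp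
                subgoal by (rule p3)
                subgoal for w using p3(5)[of w] by simp
                done
              show "r2 34 = Suc e" using p3(2)[of 34] by simp
              show "t2 \<le> t + (TF + 100 * L + 300)" using p3(6) p2(3) by simp
            qed
            done
          subgoal premises p3
            apply (rule wp_skip, rule Q)
            subgoal by (rule skip[OF _ fr']) (use okk p3 in simp)
            subgoal by simp
            subgoal using p2(3) by simp
            done
          done
      qed
      done
    subgoal premises p1
      apply (rule wp_skip, rule Q)
      subgoal by (rule skip) (use p1 e in \<open>auto simp: frame_def\<close>)
      subgoal using e by simp
      subgoal by simp
      done
    done
qed

end

context dijkstra begin

lemma rinv_mono:
  assumes "rinv x P E r h X" "\<And>e. e < m \<Longrightarrow> e \<in> X' \<Longrightarrow> e \<in> X" "X' \<subseteq> {e. sr e \<in> E}"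
  shows "rinv x P E r h X'"
proof -
  have "dinv ok u (h0 12) gt (h 10) (h 11) Qs P E X'" if "dinv ok u (h0 12) gt (h 10) (h 11) Qs P E X" for Qs
    using that assms(2) unfolding dinv_def by blast
  then show ?thesis using assms(1,3) unfolding rinv_def st_def by blast
qed

lemma rinv_upd: "rinv x P E r h X \<Longrightarrow> rinv x P E (r(34 := v)) h X"
  unfolding rinv_def st_def by (auto simp: frame_upd)

lemma scan_wp:
  assumes R: "rinv x P E r h {e. sr e \<in> E - {x}}" and x: "x < n"
    and Q: "\<And>r' h' t'. rinv x P E r' h' {e. sr e \<in> E} \<Longrightarrow> t' \<le> t + (deg x * (TF + 100 * L + 400) + 60) \<Longrightarrow> Q r' h' t'"
  shows "wp N (scan hb nb tb F) Q r h t"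
proof -
  define A where "A = TF + 100 * L + 400"
  \<comment> \<open>\<open>c\<close> is the list position in its shifted form: since lists descend,
    exactly the edges of \<open>x\<close> with number at least \<open>c\<close> have been
    relaxed.\<close>
  define X where "X c = {e. sr e \<in> E - {x}} \<union> {e. sr e = x \<and> c \<le> e}" for c
  define cn where "cn c = card {e. e < m \<and> sr e = x \<and> c \<le> e}" for c
  have xE: "x \<in> E" and r33: "r 33 = x" using R by (auto simp: rinv_def)
  have fr: "frame DR DB r0 h0 r h" using R by (auto simp: rinv_def st_def)
  have hx: "h hb x = prv sr x m" using fr banks adj(2)[OF x] by (simp add: frame_h)
  define I where "I r' h' t' \<longleftrightarrow> rinv x P E r' h' (X (r' 34)) \<and> r' 34 \<le> m \<and>
    (0 < r' 34 \<longrightarrow> sr (r' 34 - 1) = x) \<and> t' \<le> t + 30 + cn (r' 34) * A" for r' h' t'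
  have Xsub: "X c \<subseteq> {e. sr e \<in> E}" for c using xE by (auto simp: X_def)
  have I0: "I (r(34 := prv sr x m)) h t'" if "t' \<le> t + 30" for t'
    unfolding I_def
  proof (intro conjI)
    show "rinv x P E (r(34 := prv sr x m)) h (X ((r(34 := prv sr x m)) 34))"
      by (rule rinv_upd, rule rinv_mono[OF R]) (use Xsub prv_none[of sr x m] in \<open>auto simp: X_def\<close>)
    show "0 < (r(34 := prv sr x m)) 34 \<longrightarrow> sr ((r(34 := prv sr x m)) 34 - 1) = x"
      using prv_pos[of sr x m "prv sr x m - 1"] by auto
  qed (use that prv_le[of sr x m] in auto)
  show ?thesis
    unfolding scan_def
    apply (rule wp_seq, rule wp_asg)
    subgoal by simp
    subgoal by simp
    apply (rule wp_whl[where I = I and v = "\<lambda>r h. r 34"])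
    subgoal using I0 r33 hx by simp
    subgoal using N by simp
    subgoal premises p for r' h' t'
    proof -
      obtain e where e: "r' 34 = Suc e" using p(2) by (cases "r' 34") auto
      have e': "e < m" "sr e = x" using p(1) e by (auto simp: I_def)
      have R': "rinv x P E r' h' (X (Suc e))" using p(1) e by (auto simp: I_def)
      show ?thesis
        apply (rule wp_seq, rule relax_wp[OF R' e e'])
        subgoal premises q for r2 h2 t2
        proof -
          have "frame DR DB r0 h0 r2 h2" using q(1) by (auto simp: rinv_def st_def)
          then have nx: "h2 nb e = prv sr x e" using banks adj(1)[OF e'(1)] e' by (simp add: frame_h)
          let ?c = "prv sr x e"
          have "e' = e \<or> Suc e \<le> e'" if "?c \<le> e'" "sr e' = x" for e'
            using prv_none[of sr x e e'] that by linarith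
          then have "rinv x P E (r2(34 := ?c)) h2 (X ?c)"
            using Xsub by (intro rinv_upd rinv_mono[OF q(1)]) (auto simp: X_def)
          moreover have "?c \<le> m" using prv_le[of sr x e] e' by simp
          moreover have "0 < ?c \<longrightarrow> sr (?c - 1) = x" using prv_pos[of sr x e "?c - 1"] by auto
          moreover have "cn (Suc e) + 1 \<le> cn ?c"
          proof -
            have "card (insert e {e'. e' < m \<and> sr e' = x \<and> Suc e \<le> e'}) \<le> cn ?c"
              unfolding cn_def using e' prv_le[of sr x e] by (intro card_mono) auto
            then show ?thesis by (simp add: cn_def)
          qed
          then have "cn (Suc e) * A + A \<le> cn ?c * A"
            by (metis add_mult_distrib mult.left_neutral mult_le_mono1)
          moreover have "t2 + 50 \<le> t + 30 + (cn (Suc e) * A + A)"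
            using q(3) p(1) e by (simp add: I_def A_def)
          ultimately have "I (r2(34 := ?c)) h2 (t2 + 50)" by (simp add: I_def)
          then have I2: "I (r2(34 := ?c)) h2 t3" if "t3 \<le> t2 + 50" for t3
            using that by (auto simp: I_def)
          show ?thesis
            apply (rule wp_asg)
            subgoal by simp
            subgoal using N by simp
            subgoal using I2 nx q(2) e prv_le[of sr x e] by simp
            done
        qed
        done
    qed
    subgoal premises p for r' h' t'
    proof (rule Q)
      have z: "r' 34 = 0" using p by simp
      show "rinv x P E r' h' {e. sr e \<in> E}"
        by (rule rinv_mono) (use p(1) z in \<open>auto simp: I_def X_def\<close>)
      have "cn 0 = deg x" by (simp add: cn_def deg_def)
      then show "t' + (tc (Cn 0) + tc (Vr 34) + 4) \<le> t + (deg x * (TF + 100 * L + 400) + 60)"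
        using p(1) z by (simp add: I_def A_def)
    qed
    done
qed

text \<open>Amortised time: a popped vertex pays for the repair of the tree, an expanded one in
  addition for its edges.\<close>

definition cost :: "nat set \<Rightarrow> nat set \<Rightarrow> nat" where
  "cost P E = card P * (100 * L + 600) + (\<Sum>x\<in>E. deg x) * (TF + 100 * L + 400)"

lemma pop_wp:
  assumes st: "st r h Qs P E {e. sr e \<in> E}" and k: "h 9 1 < BIG * n"
    and Q: "\<And>r' h' t' Qs' P' E'. st r' h' Qs' P' E' {e. sr e \<in> E'} \<Longrightarrow> card P' = Suc (card P) \<Longrightarrow>
      t' + cost P E + 20 \<le> t + cost P' E' \<Longrightarrow> Q r' h' t'"
  shows "wp N (pop hb nb tb F) Q r h t"
proof -
  have fr: "frame DR DB r0 h0 r h" and tr: "tree n (h 9)" and inv: "dinv ok u (h0 12) gt (h 10) (h 11) Qs P E {e. sr e \<in> E}"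
    and leaf: "\<And>v. v < n \<Longrightarrow> h 9 (n + v) = (if v \<in> Qs then h 10 v * n + v else BIG * n)"
    and h12: "h 12 = (\<lambda>v. if v \<in> E then h0 12 v + 1 else h0 12 v)"
    using st by (auto simp: st_def)
  note fin = dinv_fin[OF inv]
  have [simp]: "r 0 = n" "r 9 = BIG * n" "r 10 = gt" using fr regs by (auto simp: frame_r)
  obtain x where x: "x < n" "h 9 1 = h 9 (n + x)" using tree_root_leaf[OF tr n1] by blast
  have xQ: "x \<in> Qs" using leaf[OF x(1)] x(2) k by (auto split: if_splits)
  have key: "h 9 1 = h 10 x * n + x" using leaf[OF x(1)] x(2) xQ by simp
  have dv: "(d * n + v) div n = d" if "v < n" for d v using that by simp
  \<comment> \<open>Keys compare by label first, so dividing by \<open>n\<close> turns the order of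
    keys into the order of labels.\<close>
  have min: "h 10 x \<le> h 10 y" if "y \<in> Qs" for y
  proof -
    have y: "y < n" using that inv by (auto simp: dinv_def)
    have "h 9 1 \<le> h 9 (n + y)" by (rule tree_root_le[OF tr]) (use y n1 in auto)
    then have "h 10 x * n + x \<le> h 10 y * n + y" using key leaf[OF y] that by simp
    then have "(h 10 x * n + x) div n \<le> (h 10 y * n + y) div n" by (rule div_le_mono)
    then show ?thesis using dv x(1) y by simp
  qed
  note exp = dinv_expand[OF inv xQ min, simplified]
  have cP: "card (insert x P) = Suc (card P)" using exp(5) fin by simp
  have kd: "h 9 (Suc 0) div n = h 10 x" "h 9 (Suc 0) - h 10 x * n = x" "h 10 x * n \<le> N" "x \<le> N"
    using key dv[OF x(1)] k N(2) by auto
  have gate: "st r' h' (Qs - {x}) (insert x P) E {e. sr e \<in> E}"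
    if c: "\<not> h 12 x < gt" and r': "frame {31,32,33,40,41,42} {9} r h r' h'" and tr': "tree n (h' 9)"
      and lf: "\<And>w. w < n \<Longrightarrow> h' 9 (n + w) = (if w = x then BIG * n else h 9 (n + w))" for r' h'
  proof -
    have hs: "h' 10 = h 10" "h' 11 = h 11" "h' 12 = h 12" "h' 3 = h 3" "h' 4 = h 4" "h' 0 = h 0" "h' 1 = h 1" "r' 2 = r 2"
      using r' by (auto simp: frame_r frame_h)
    have oo: "outs m h' c = outs m h c" "outok m h' c = outok m h c" for c
      by (simp_all add: outs_def outok_def hs del: One_nat_def)
    have "gt \<le> h0 12 x" using c exp(4) h12 by simp
    note g = dinv_gate[OF inv xQ min this]
    have "frame DR DB r0 h0 r' h'" by (rule frame_trans[OF fr r']) auto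
    then show ?thesis unfolding st_def using g tr' lf leaf st
      by (auto simp: hs oo st_def)
  qed
  have expa: "rinv x (insert x P) (insert x E) r' h' {e. sr e \<in> insert x E - {x}}"
    if g: "h 12 x < gt" and r': "frame {31,32,33,40,41,42,2} {9,12,3,4} r h r' h'" and tr': "tree n (h' 9)"
      and lf: "\<And>w. w < n \<Longrightarrow> h' 9 (n + w) = (if w = x then BIG * n else h 9 (n + w))"
      and h': "h' 12 = (h 12)(x := h 12 x + 1)" "r' 33 = x" "r' 32 = h 10 x"
      and out: "(x = u \<and> r' 2 = r 2 \<and> h' 3 = h 3 \<and> h' 4 = h 4) \<or>
        (x \<noteq> u \<and> r' 2 = Suc (r 2) \<and> h' 3 = (h 3)(r 2 := h 0 (h 11 x - 1)) \<and> h' 4 = (h 4)(r 2 := h 1 (h 11 x - 1)))" for r' h'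
  proof -
    have hs: "h' 10 = h 10" "h' 11 = h 11" "h' 0 = h 0" "h' 1 = h 1" "h' (Suc 0) = h (Suc 0)"
      using r' by (auto simp: frame_h)
    have f: "frame DR DB r0 h0 r' h'" by (rule frame_trans[OF fr r']) auto
    have cE: "card (insert x E) = Suc (card E)" using exp(4) fin by simp
    have pre: "h' 3 i = h 3 i" "h' 4 i = h 4 i" "i < r' 2" if "i < r 2" for i using out that by auto
    have o1: "outs m h (r 2) \<subseteq> outs m h' (r' 2)"
    proof
      fix e assume "e \<in> outs m h (r 2)"
      then obtain i where "e < m" "i < r 2" "h 3 i = h 0 e" "h 4 i = h 1 e" by (auto simp: outs_def)
      then show "e \<in> outs m h' (r' 2)" using pre[of i] by (auto simp: outs_def hs intro!: exI[of _ i])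
    qed
    have ex: "x \<noteq> u \<Longrightarrow> h 11 x - 1 < m"
      using inv xQ unfolding dinv_def by fastforce
    have o2: "outok m h' (r' 2)"
      unfolding outok_def
    proof (intro allI impI)
      fix i assume i: "i < r' 2"
      show "\<exists>e<m. h' 3 i = h' 0 e \<and> h' 4 i = h' 1 e"
      proof (cases "i < r 2")
        case True
        then obtain e where "e < m" "h 3 i = h 0 e \<and> h 4 i = h 1 e" using st unfolding st_def outok_def by blast
        then show ?thesis using pre[OF True] by (intro exI[of _ e]) (simp add: hs)
      next
        case False
        then have "x \<noteq> u" "i = r 2" using out i by auto
        then show ?thesis using out ex by (intro exI[of _ "h 11 x - 1"]) (simp add: hs)
      qed
    qed
    have o3: "x \<noteq> u \<Longrightarrow> h 11 x - 1 \<in> outs m h' (r' 2)"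
      using out ex by (auto simp: outs_def hs intro!: exI[of _ "r 2"])
    have o4: "\<forall>y\<in>insert x E - {u}. h' 11 y - 1 \<in> outs m h' (r' 2)"
      using st o1 o3 unfolding st_def hs by auto
    have r2: "r0 2 \<le> r' 2" "r' 2 \<le> r0 2 + card (insert x E)" using st out unfolding cE by (auto simp: st_def)
    have h12': "h' 12 = (\<lambda>v. if v \<in> insert x E then h0 12 v + 1 else h0 12 v)"
      using h'(1) h12 exp(4) by auto
    have lf': "\<forall>v<n. h' 9 (n + v) = (if v \<in> Qs - {x} then h' 10 v * n + v else BIG * n)"
      using lf leaf by (auto simp: hs)
    have oo: "outs m h0 (r0 2) \<subseteq> outs m h' (r' 2)" using st o1 by (auto simp: st_def)
    have "h0 12 x < gt" using g exp(4) h12 by simp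
    then have "st r' h' (Qs - {x}) (insert x P) (insert x E) {e. sr e \<in> E}"
      unfolding st_def h12' using f tr' lf' exp(1) o2 o4 r2 oo by (simp add: hs)
    moreover have "{e. sr e \<in> insert x E - {x}} = {e. sr e \<in> E}" using exp(4) by auto
    ultimately show ?thesis
      unfolding rinv_def using exp h' by (auto simp: hs)
  qed
  have sE: "(\<Sum>y\<in>insert x E. deg y) = deg x + (\<Sum>y\<in>E. deg y)" using exp(4) fin by simp
  \<comment> \<open>The source is the only queued vertex with parent entry 0, so the test in
    \<open>pop\<close> skips the output exactly for the source.\<close>
  have u0: "h 11 x = 0 \<longleftrightarrow> x = u" using inv xQ by (fastforce simp: dinv_def)
  have cEn: "card E < n"
  proof -
    have "E \<subseteq> {..<n} - {x}" using inv exp(4) by (auto simp: dinv_def)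
    then have "card E \<le> card ({..<n} - {x})" by (intro card_mono) auto
    then show ?thesis using x(1) by simp
  qed
  have r2N: "r 2 + 1 \<le> N" using st N(5) cEn by (auto simp: st_def)
  show ?thesis
    unfolding pop_def
    apply (rule wp_seq, rule wp_asg)
    subgoal by simp
    subgoal using N(1) by simp
    apply (rule wp_seq, rule wp_asg)
    subgoal by simp
    subgoal by simp
    apply (rule wp_seq, rule wp_asg)
    subgoal by simp
    subgoal using kd by simp
    apply (rule wp_seq, rule wp_asg)
    subgoal by simp
    subgoal by simp
    apply (rule wp_seq, rule wp_asg)
    subgoal by simp
    subgoal by simp
    apply (rule wp_seq, rule upd_wp[where L = L and v = x and n = n and k = "BIG * n"])
    subgoal by simp
    subgoal using kd by simp
    subgoal by (rule x(1))
    subgoal by simp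
    subgoal by (rule L)
    subgoal by (rule N)
    subgoal by (rule tr)
    subgoal premises p for r' h' t'
    proof -
      have r33: "r' 33 = x" "r' 32 = h 10 x" "r' 10 = gt" "r' 2 = r 2" using p(1) kd by auto
      have h12': "h' 12 = h 12" "h' 11 = h 11" "h' 0 = h 0" "h' 1 = h 1" "h' 3 = h 3" "h' 4 = h 4" "h' 10 = h 10" using p(2) by auto
      have f9: "frame {31,32,33,40,41,42} {9} r h r' h'"
        using p(1,2) by (auto simp: frame_def)
      have scan: "wp N (scan hb nb tb F) Q r2 h2 t2"
        if "rinv x (insert x P) (insert x E) r2 h2 {e. sr e \<in> insert x E - {x}}" "t2 \<le> t' + 200" for r2 h2 t2
        apply (rule scan_wp[OF that(1) x(1)])
        subgoal premises q for r3 h3 t3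
        proof -
          obtain Qs' where "st r3 h3 Qs' (insert x P) (insert x E) {e. sr e \<in> insert x E}"
            using q(1) by (auto simp: rinv_def)
          then show ?thesis
          proof (rule Q[OF _ cP])
            show "t3 + cost P E + 20 \<le> t + cost (insert x P) (insert x E)"
              unfolding cost_def cP sE using q(2) that(2) p(5) by (simp add: algebra_simps)
          qed
        qed
        done
      show ?thesis
        apply (rule wp_ifl)
        subgoal by simp
        subgoal by simp
        subgoal premises g
          apply (rule wp_seq, rule wp_sto)
          subgoal by simp
          subgoal using g N(4) r33 by simp
          apply (rule wp_seq, rule wp_ifl)
          subgoal by simp
          subgoal by simp
          subgoal premises g2
            apply (rule wp_seq, rule wp_sto)
            subgoal by simp
            subgoal using N(1) by simp
            apply (rule wp_seq, rule wp_sto)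
            subgoal by simp
            subgoal using N(1) by simp
            apply (rule wp_asg)
            subgoal by simp
            subgoal using r2N r33 by simp
            apply (rule scan)
            subgoal
              apply (rule expa)
              subgoal using g h12' r33 by simp
              subgoal using f9 r33 by (auto simp: frame_def)
              subgoal using p(3) by simp
              subgoal for w using p(4)[of w] by simp
              subgoal using h12' r33 by simp
              subgoal using r33 by simp
              subgoal using r33 by simp
              subgoal using g2 u0 r33 h12' by simp
              done
            subgoal by simp
            done
          subgoal premises g2
            apply (rule wp_skip, rule scan)
            subgoal
              apply (rule expa)
              subgoal using g h12' r33 by simp
              subgoal using f9 r33 by (auto simp: frame_def)
              subgoal using p(3) by simp
              subgoal for w using p(4)[of w] by simp
              subgoal using h12' r33 by simp
              subgoal using r33 by simp
              subgoal using r33 by simp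
              subgoal using g2 u0 r33 h12' by simp
              done
            subgoal by simp
            done
          done
        subgoal premises g
          apply (rule wp_skip, rule Q[of _ _ "Qs - {x}" "insert x P" E, OF _ cP])
          subgoal
            apply (rule gate)
            subgoal using g r33 h12' by simp
            subgoal by (rule f9)
            subgoal by (rule p)
            subgoal by (rule p)
            done
          subgoal unfolding cost_def cP using p(5) by simp
          done
        done
    qed
    done
qed

text \<open>Expresses the ghost set \<open>P\<close> through memory alone, because the termination
  measure of a loop may only depend on registers and memory.\<close>

lemma st_popped:
  assumes "st r h Qs P E X"
  shows "{v. v < n \<and> h 10 v < BIG \<and> h 9 (n + v) = BIG * n} = P"
proof -
  have inv: "dinv ok u (h0 12) gt (h 10) (h 11) Qs P E X"
    and leaf: "\<And>v. v < n \<Longrightarrow> h 9 (n + v) = (if v \<in> Qs then h 10 v * n + v else BIG * n)"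
    using assms by (auto simp: st_def)
  have PQ: "P \<inter> Qs = {}" "P \<union> Qs \<subseteq> {..<n}" "\<And>v. v < n \<Longrightarrow> h 10 v < BIG \<longleftrightarrow> v \<in> P \<union> Qs"
    using inv by (auto simp: dinv_def)
  have Q: "h 9 (n + v) \<noteq> BIG * n" if "v \<in> Qs" for v
  proof -
    have "v < n" "h 10 v < BIG" using that PQ(2) PQ(3)[of v] by auto
    then show ?thesis using leaf[of v] key_less[of v "h 10 v"] that by simp
  qed
  show ?thesis
  proof (intro set_eqI iffI)
    fix v assume "v \<in> {v. v < n \<and> h 10 v < BIG \<and> h 9 (n + v) = BIG * n}"
    then show "v \<in> P" using PQ(3)[of v] Q[of v] by auto
  next
    fix v assume "v \<in> P"
    moreover from this have "v < n" "v \<notin> Qs" using PQ(1,2) by auto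
    ultimately show "v \<in> {v. v < n \<and> h 10 v < BIG \<and> h 9 (n + v) = BIG * n}"
      using PQ(3)[of v] leaf[of v] by simp
  qed
qed

lemma dijk_wp:
  assumes Q: "\<And>r h t' P E. st r h {} P E {e. sr e \<in> E} \<Longrightarrow>
      t' \<le> t + (n * (100 * L + 800) + 100 * L + 300 + (\<Sum>x\<in>E. deg x) * (TF + 100 * L + 400)) \<Longrightarrow> Q r h t'"
  shows "wp N (dijk hb nb tb F) Q r0 h0 t"
proof -
  define I where "I i r h t' \<longleftrightarrow> frame {38} {9,10} r0 h0 r h \<and> (\<forall>j<i. h 9 j = BIG * n \<and> h 10 j = BIG) \<and>
     t' \<le> t + 10 + i * 70" for i and r :: "nat \<Rightarrow> nat" and h :: "nat \<Rightarrow> nat \<Rightarrow> nat" and t' :: nat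
  define J where "J r h t' \<longleftrightarrow> (\<exists>Qs P E. st r h Qs P E {e. sr e \<in> E} \<and>
    t' \<le> t + n * 200 + 100 * L + 250 + cost P E)" for r h t'
  show ?thesis
    unfolding dijk_def
    apply (rule wp_seq, rule wp_forl[where I = I and b = "2 * n"])
    subgoal by simp
    subgoal by (simp add: I_def frame_upd)
    subgoal using N regs by (auto simp: I_def frame_r)
    subgoal using N by simp
    subgoal premises p for i r h t'
    proof -
      have [simp]: "r 9 = BIG * n" "r 8 = BIG" using p(1) regs by (auto simp: I_def frame_r)
      have fin: "I (Suc i) (r(38 := Suc i)) (h(9 := (h 9)(i := BIG * n), 10 := (h 10)(i := BIG))) t2"
        if "t2 \<le> t' + 70" for t2
        using p(1) that unfolding I_def by (auto simp: frame_upd less_Suc_eq)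
      show ?thesis
        apply (rule wp_seq, rule wp_sto)
        subgoal by simp
        subgoal by simp
        apply (rule wp_sto)
        subgoal by simp
        subgoal by simp
        subgoal using p(2) fin by simp
        done
    qed
    subgoal premises p for r h t'
    proof -
      have [simp]: "r 0 = n" "r 30 = u" using p(1) regs by (auto simp: I_def frame_r)
      have h9: "h 9 j = BIG * n" "h 10 j = BIG" if "j < 2 * n" for j using p(1) that by (auto simp: I_def)
      have tr: "tree n (h 9)" unfolding tree_def using h9 by auto
      have fr: "frame {38} {9,10} r0 h0 r h" using p(1) by (simp add: I_def)
      show ?thesis
        apply (rule wp_seq, rule wp_sto)
        subgoal by simp
        subgoal by simp
        apply (rule wp_seq, rule wp_sto)
        subgoal by simp
        subgoal by simp
        apply (rule wp_seq, rule wp_asg)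
        subgoal by simp
        subgoal by simp
        apply (rule wp_seq, rule wp_asg)
        subgoal by simp
        subgoal by simp
        apply (rule wp_seq, rule upd_wp[where L = L and v = u and n = n and k = u])
        subgoal by simp
        subgoal by simp
        subgoal by (rule un)
        subgoal by simp
        subgoal by (rule L)
        subgoal by (rule N)
        subgoal using tr by simp
        subgoal premises q for r1 h1 t1
        proof -
          have hs: "h1 10 = (h 10)(u := 0)" "h1 11 = (h 11)(u := 0)" "h1 12 = h0 12" "h1 3 = h0 3" "h1 4 = h0 4" "h1 0 = h0 0" "h1 1 = h0 1" "r1 2 = r0 2"
            using q(1,2) fr by (auto simp: frame_r frame_h)
          have f: "frame DR DB r0 h0 r1 h1" using q(1,2) fr unfolding frame_def by auto
          have oo: "outs m h1 c = outs m h0 c" "outok m h1 c = outok m h0 c" for c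
            by (simp_all add: outs_def outok_def hs del: One_nat_def)
          have d0: "dinv ok u (h0 12) gt (h1 10) (h1 11) {u} {} {} {e. sr e \<in> {}}"
            by (rule dinv_init) (use un h9 in \<open>auto simp: hs\<close>)
          have lf: "\<forall>v<n. h1 9 (n + v) = (if v \<in> {u} then h1 10 v * n + v else BIG * n)"
            using q(4) h9 by (auto simp: hs)
          have st0: "st r1 h1 {u} {} {} {e. sr e \<in> {}}"
            unfolding st_def using f q(3) lf d0 out0 by (auto simp: hs oo)
          have t1: "t1 + 10 \<le> t + n * 200 + 100 * L + 250" using q(5) p(1) by (simp add: I_def)
          show ?thesis
            apply (rule wp_whl[where I = J and v = "\<lambda>r h. n - card {v. v < n \<and> h 10 v < BIG \<and> h 9 (n + v) = BIG * n}"])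
            subgoal unfolding J_def using st0 t1 by (intro exI[of _ "{u}"] exI[of _ "{}"]) (auto simp: cost_def)
            subgoal using N(1) by simp
            subgoal premises w for r2 h2 t2
            proof -
              obtain Qs P E where s2: "st r2 h2 Qs P E {e. sr e \<in> E}" "t2 \<le> t + n * 200 + 100 * L + 250 + cost P E"
                using w(1) by (auto simp: J_def)
              have f2: "frame DR DB r0 h0 r2 h2" using s2(1) by (simp add: st_def)
              have k: "h2 9 1 < BIG * n" using w(2) f2 regs by (simp add: frame_r)
              show ?thesis
              proof (rule pop_wp[OF s2(1) k])
                fix r' h' t' Qs' P' E'
                assume s3: "st r' h' Qs' P' E' {e. sr e \<in> E'}" "card P' = Suc (card P)"
                  "t' + cost P E + 20 \<le> t2 + (tc (Ld 9 (Cn 1)) + tc (Vr 9) + 4) + cost P' E'"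
                have "card P' \<le> n" using s3(1) dinv_card by (auto simp: st_def)
                moreover have "t' \<le> t + n * 200 + 100 * L + 250 + cost P' E'" using s2(2) s3(3) by simp
                then have "J r' h' t'" using s3(1) unfolding J_def by blast
                ultimately show "J r' h' t' \<and> n - card {v. v < n \<and> h' 10 v < BIG \<and> h' 9 (n + v) = BIG * n}
                  < n - card {v. v < n \<and> h2 10 v < BIG \<and> h2 9 (n + v) = BIG * n}"
                  unfolding st_popped[OF s2(1)] st_popped[OF s3(1)] using s3(2) by simp
              qed
            qed
            subgoal premises w for r2 h2 t2
            proof -
              obtain Qs P E where s2: "st r2 h2 Qs P E {e. sr e \<in> E}" "t2 \<le> t + n * 200 + 100 * L + 250 + cost P E"
                using w(1) by (auto simp: J_def)
              have f2: "frame DR DB r0 h0 r2 h2" and tr2: "tree n (h2 9)" and i2: "dinv ok u (h0 12) gt (h2 10) (h2 11) Qs P E {e. sr e \<in> E}"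
                and lf2: "\<And>v. v < n \<Longrightarrow> h2 9 (n + v) = (if v \<in> Qs then h2 10 v * n + v else BIG * n)"
                using s2(1) by (auto simp: st_def)
              have k: "\<not> h2 9 1 < BIG * n" using w(2) f2 regs by (simp add: frame_r)
              have "Qs = {}"
              proof (rule equals0I)
                fix y assume "y \<in> Qs"
                then have y: "y < n" "h2 10 y < BIG" using i2 by (auto simp: dinv_def)
                have "h2 9 1 \<le> h2 9 (n + y)" by (rule tree_root_le[OF tr2]) (use y n1 in auto)
                then show False using lf2[OF y(1)] key_less[OF y] \<open>y \<in> Qs\<close> k by simp
              qed
              moreover have "card P \<le> n" using dinv_card[OF i2] .
              then have "card P * (100 * L + 600) \<le> n * (100 * L + 600)" by (rule mult_right_mono) simp
              then have "t2 + 20 \<le> t + (n * (100 * L + 800) + 100 * L + 300 + (\<Sum>x\<in>E. deg x) * (TF + 100 * L + 400))"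
                using s2(2) by (simp add: cost_def algebra_simps)
              ultimately show ?thesis using s2(1) by (intro Q[of r2 h2 P E]) auto
            qed
            done
        qed
        done
    qed
    done
qed

end

section \<open>Distances\<close>

definition dst :: "nat \<Rightarrow> (nat \<Rightarrow> nat) \<Rightarrow> (nat \<Rightarrow> nat) \<Rightarrow> (nat \<Rightarrow> nat) \<Rightarrow> nat \<Rightarrow> nat \<Rightarrow> nat \<Rightarrow> nat" where
  "dst m sr tg wt b u v = (if \<exists>l. walk {..<m} sr tg wt u v l then LEAST l. walk {..<m} sr tg wt u v l else b)"

lemma dst_walk:
  assumes "walk {..<m} sr tg wt u v l"
  shows "walk {..<m} sr tg wt u v (dst m sr tg wt b u v)" "dst m sr tg wt b u v \<le> l"
proof -
  have "dst m sr tg wt b u v = (LEAST l. walk {..<m} sr tg wt u v l)" using assms by (auto simp: dst_def)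
  then show "walk {..<m} sr tg wt u v (dst m sr tg wt b u v)" "dst m sr tg wt b u v \<le> l"
    using LeastI[of "walk {..<m} sr tg wt u v", OF assms] Least_le[of "walk {..<m} sr tg wt u v", OF assms] by auto
qed

lemma walk_rev_iff: "walk A tg sr wt v u l \<longleftrightarrow> walk A sr tg wt u v l"
  by (rule iffI; erule walk_rev)

lemma dst_rev: "dst m tg sr wt b u v = dst m sr tg wt b v u"
proof -
  have "walk {..<m} tg sr wt u v = walk {..<m} sr tg wt v u" by (intro ext walk_rev_iff)
  then show ?thesis by (simp add: dst_def)
qed

context wgraph begin

abbreviation del :: "nat \<Rightarrow> nat \<Rightarrow> nat" where "del \<equiv> dst m sr tg wt BIG"

lemma walk_in: "walk {..<m} sr tg wt u v l \<Longrightarrow> u < n \<Longrightarrow> v < n"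
  by (induction rule: walk.induct) (auto simp: edge)

lemma del_self [simp]: "del u u = 0"
  using dst_walk(2)[OF walk.nil, where b = BIG] by simp

text \<open>Replaces the removal of cycles from walks: the predecessor of \<open>v\<close> on a
  shortest walk is strictly closer, and one edge adds at most \<open>Wm\<close>. With fewer than
  \<open>n\<close> closer vertices available this bounds all finite distances.\<close>

lemma del_rank:
  "walk {..<m} sr tg wt u v l \<Longrightarrow> u < n \<Longrightarrow> del u v \<le> card {w. w < n \<and> del u w < del u v} * Wm"
proof (induction "del u v" arbitrary: v l rule: less_induct)
  case less
  have w: "walk {..<m} sr tg wt u v (del u v)" using dst_walk(1)[OF less.prems(1)] .
  show ?case
  proof (cases "del u v = 0")
    case False
    with w obtain p l' e where p: "walk {..<m} sr tg wt u p l'" "e < m" "sr e = p" "v = tg e" "del u v = l' + wt e"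
      by (cases rule: walk.cases) auto
    have pn: "p < n" using walk_in[OF p(1) less.prems(2)] .
    have e1: "1 \<le> wt e" "wt e \<le> Wm" using edge p(2) by auto
    have le: "del u p \<le> l'" using dst_walk(2)[OF p(1)] .
    then have lt: "del u p < del u v" using p(5) e1 by simp
    let ?A = "{w. w < n \<and> del u w < del u p}"
    have "walk {..<m} sr tg wt u v (del u p + wt e)"
      unfolding p(4) using walk.snoc[OF dst_walk(1)[OF p(1)]] p(2,3) by simp
    then have "del u v \<le> del u p + Wm"
      using dst_walk(2)[of m sr tg wt u v "del u p + wt e" BIG] e1 by linarith
    also have "del u p \<le> card ?A * Wm" using less.hyps[OF lt p(1) less.prems(2)] .
    finally have "del u v \<le> Suc (card ?A) * Wm" by simp
    also have "Suc (card ?A) = card (insert p ?A)" by simp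
    also have "\<dots> * Wm \<le> card {w. w < n \<and> del u w < del u v} * Wm"
      using lt pn by (intro mult_right_mono card_mono) auto
    finally show ?thesis .
  qed simp
qed

lemma del_bound:
  assumes "walk {..<m} sr tg wt u v l" "u < n"
  shows "del u v \<le> n * Wm" "del u v < BIG"
proof -
  have "card {w. w < n \<and> del u w < del u v} \<le> card {..<n}" by (intro card_mono) auto
  then have "card {w. w < n \<and> del u w < del u v} * Wm \<le> n * Wm" by (intro mult_right_mono) auto
  then show "del u v \<le> n * Wm" using le_trans[OF del_rank[OF assms]] by simp
  then show "del u v < BIG" using BIG by simp
qed

lemma del_none: "\<nexists>l. walk {..<m} sr tg wt u v l \<Longrightarrow> del u v = BIG"
  by (simp only: dst_def if_False)

lemma del_fin:
  assumes "del u v < BIG"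
  shows "walk {..<m} sr tg wt u v (del u v)"
proof -
  have "\<exists>l. walk {..<m} sr tg wt u v l" using del_none[of u v] assms by (metis less_irrefl)
  then show ?thesis using dst_walk(1) by blast
qed

lemma del_le:
  assumes "u < n"
  shows "del u v \<le> BIG"
proof (cases "\<exists>l. walk {..<m} sr tg wt u v l")
  case True
  then show ?thesis using del_bound(2)[OF _ assms] by (blast intro: less_imp_le)
next
  case False
  then show ?thesis using del_none[OF False] by simp
qed

text \<open>The finite stand-in for infinity does no harm: if a summand on the right is
  \<open>BIG\<close>, it already dominates the left side.\<close>

lemma del_tri:
  assumes "u < n" "v < n"
  shows "del u w \<le> del u v + del v w"
proof (cases "del u v < BIG \<and> del v w < BIG")
  case True
  then show ?thesis using dst_walk(2)[OF walk_trans] del_fin by blast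
next
  case False
  then show ?thesis using del_le[OF assms(1), of w] by auto
qed

definition served :: "nat set \<Rightarrow> (nat \<Rightarrow> nat \<Rightarrow> bool) \<Rightarrow> nat \<Rightarrow> bool" where
  "served O1 ok u \<longleftrightarrow> (\<exists>D. D u = 0 \<and>
    (\<forall>e<m. D (sr e) < BIG \<longrightarrow> ok (tg e) (D (sr e) + wt e) \<longrightarrow> D (tg e) \<le> D (sr e) + wt e) \<and>
    (\<forall>v<n. D v < BIG \<longrightarrow> walk O1 sr tg wt u v (D v)))"

lemma served_mono: "served O1 ok u \<Longrightarrow> O1 \<subseteq> O2 \<Longrightarrow> served O2 ok u"
  unfolding served_def by (elim exE, rule exI, elim conjE, intro conjI) (auto elim: walk_mono)

text \<open>The labels need not be distances, but along the given walk each is at most the length of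
  the prefix. Since \<open>ok\<close> admits the prefix lengths and is closed downwards, it also
  admits the smaller tentative labels, so no relaxation along the walk is rejected.\<close>

lemma served_path:
  assumes s: "served O1 ok u" and dc: "\<And>y a b. ok y a \<Longrightarrow> b \<le> a \<Longrightarrow> ok y b"
    and w: "walk {..<m} sr tg wt u v l" "u < n" "l < BIG"
    and pre: "\<And>w l' k. walk {..<m} sr tg wt u w l' \<Longrightarrow> walk {..<m} sr tg wt w v k \<Longrightarrow> l' + k \<le> l \<Longrightarrow> ok w l'"
  shows "\<exists>l'\<le>l. walk O1 sr tg wt u v l'"
proof -
  obtain D where D: "D u = 0" "\<And>v. v < n \<Longrightarrow> D v < BIG \<Longrightarrow> walk O1 sr tg wt u v (D v)"
    "\<And>e. e < m \<Longrightarrow> D (sr e) < BIG \<Longrightarrow> ok (tg e) (D (sr e) + wt e) \<Longrightarrow> D (tg e) \<le> D (sr e) + wt e"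
    using s unfolding served_def by blast
  have "D v \<le> l"
    using w(1,3) pre
  proof (induction rule: walk.induct)
    case nil
    then show ?case using D(1) by simp
  next
    case (snoc v l e)
    have e: "walk {..<m} sr tg wt v (tg e) (wt e)"
      using walk.snoc[OF walk.nil, of e "{..<m}" sr v tg wt] snoc.hyps by simp
    have "D v \<le> l"
    proof (rule snoc.IH)
      show "l < BIG" using snoc.prems by simp
      fix w l' k assume a: "walk {..<m} sr tg wt u w l'" "walk {..<m} sr tg wt w v k" "l' + k \<le> l"
      show "ok w l'"
        using walk_trans[OF e a(2)] a by (intro snoc.prems(2)[of w l' "k + wt e"]) auto
    qed
    moreover have "ok (tg e) (l + wt e)"
      by (rule snoc.prems(2)[OF walk.snoc[OF snoc.hyps(1,2,3)] walk.nil]) simp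
    ultimately have "D (tg e) \<le> D v + wt e"
      using D(3)[of e] snoc.hyps snoc.prems(1) dc[of "tg e" "l + wt e" "D v + wt e"] by auto
    then show ?case using \<open>D v \<le> l\<close> by simp
  qed
  then show ?thesis using D(2)[of v] walk_in[OF w(1,2)] w(3) by (intro exI[of _ "D v"]) auto
qed

definition pass :: "nat \<Rightarrow> nat \<Rightarrow> nat list \<Rightarrow> nat \<Rightarrow> nat \<Rightarrow> bool" where
  "pass d x rs u nd \<longleftrightarrow> nd \<le> d \<and> (\<forall>s\<in>set rs. del s u + nd \<le> d + del s x)"

text \<open>Candidates are defined by true distances, independently of any search. Labels of a
  search are lengths of walks and hence not smaller, so a search from \<open>u\<close> only reaches
  vertices that have \<open>u\<close> as a candidate.\<close>

definition inA :: "(nat \<Rightarrow> nat) \<Rightarrow> nat \<Rightarrow> nat \<Rightarrow> nat list \<Rightarrow> nat \<Rightarrow> bool" where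
  "inA HR d x rs u \<longleftrightarrow> 2 * d < HR u \<and> pass d x rs u (del u x)"

text \<open>A sample is kept only if it has itself survived the samples kept so far. A kept sample
  is therefore uniform in the current candidate set.\<close>

definition pick :: "nat \<Rightarrow> (nat \<Rightarrow> nat) \<Rightarrow> nat \<Rightarrow> nat \<Rightarrow> nat list \<Rightarrow> nat list" where
  "pick cap HR d x ss =
    foldl (\<lambda>rs s. if length rs < cap \<and> inA HR d x rs s then rs @ [s] else rs) [] ss"

fun near :: "(nat \<Rightarrow> nat) \<Rightarrow> nat \<Rightarrow> nat \<Rightarrow> nat" where
  "near S 0 v = BIG"
| "near S (Suc j) v = min (near S j v) (del (S j) v + del v (S j))"

lemma near_le: "near S K v \<le> c \<longleftrightarrow> BIG \<le> c \<or> (\<exists>j<K. del (S j) v + del v (S j) \<le> c)"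
proof (induction K)
  case (Suc K)
  then show ?case unfolding near.simps min_le_iff_disj less_Suc_eq by blast
qed simp

lemma pick_Nil [simp]: "pick cap HR d x [] = []"
  by (simp add: pick_def)

lemma pick_snoc: "pick cap HR d x (ss @ [s]) =
   (let rs = pick cap HR d x ss in if length rs < cap \<and> inA HR d x rs s then rs @ [s] else rs)"
  by (simp add: pick_def Let_def)

lemma pick_set: "set (pick cap HR d x ss) \<subseteq> set ss"
proof (induction ss rule: rev_induct)
  case (snoc s ss)
  then show ?case unfolding pick_snoc Let_def by (simp split: if_split) blast
qed simp

text \<open>One leg of a roundtrip of length at most \<open>d\<close>: either its shortest path is explored by the local
  search, or it meets a vertex with a sample nearby and the trees of that sample cost a detour of \<open>2 * d\<close>.\<close>

lemma leg:
  assumes uv: "u < n" "v < n" "del u v + del v u \<le> d" "2 * d < BIG"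
    and S: "\<And>j. j < K \<Longrightarrow> S j < n"
    and trees: "\<And>j w. j < K \<Longrightarrow> w < n \<Longrightarrow> del (S j) w < BIG \<Longrightarrow> walk O1 sr tg wt (S j) w (del (S j) w)"
      "\<And>j w. j < K \<Longrightarrow> w < n \<Longrightarrow> del w (S j) < BIG \<Longrightarrow> walk O1 sr tg wt w (S j) (del w (S j))"
    and rs: "\<And>x s. s \<in> set (rs x) \<Longrightarrow> s < n"
    and loc: "2 * d < near S K u \<Longrightarrow> served O1 (\<lambda>y nd. 2 * d < near S K y \<and> pass d y (rs y) u nd) u"
  shows "\<exists>l \<le> del u v + 2 * d. walk O1 sr tg wt u v l"
proof (cases "\<exists>w l' k. walk {..<m} sr tg wt u w l' \<and> walk {..<m} sr tg wt w v k \<and> l' + k \<le> del u v \<and> near S K w \<le> 2 * d")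
  case True
  then obtain w l' k where w: "walk {..<m} sr tg wt u w l'" "walk {..<m} sr tg wt w v k" "l' + k \<le> del u v" "near S K w \<le> 2 * d"
    by blast
  then obtain j where j: "j < K" "del (S j) w + del w (S j) \<le> 2 * d" using near_le uv(4) by auto
  have wn: "w < n" using walk_in[OF w(1) uv(1)] .
  have d1: "del u w \<le> l'" "del w v \<le> k" using dst_walk(2) w by auto
  have t1: "del u (S j) \<le> del u w + del w (S j)" using del_tri uv(1) wn .
  have t2: "del (S j) v \<le> del (S j) w + del w v" using del_tri S[OF j(1)] wn .
  have f: "walk {..<m} sr tg wt w (S j) (del w (S j))" "walk {..<m} sr tg wt (S j) w (del (S j) w)"
    using del_fin j uv(4) by auto
  have "del u (S j) < BIG" using del_bound(2)[OF walk_trans[OF f(1) w(1)] uv(1)] .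
  moreover have "del (S j) v < BIG" using del_bound(2)[OF walk_trans[OF w(2) f(2)] S[OF j(1)]] .
  ultimately have "walk O1 sr tg wt u v (del u (S j) + del (S j) v)"
    using trees[OF j(1)] uv by (intro walk_trans) auto
  then show ?thesis using t1 t2 d1 w(3) j(2) by (intro exI[of _ "del u (S j) + del (S j) v"]) auto
next
  case False
  have fin: "walk {..<m} sr tg wt u v (del u v)" "walk {..<m} sr tg wt v u (del v u)" using del_fin uv by auto
  \<comment> \<open>The empty prefix of the leg ends in \<open>u\<close>, so \<open>u\<close> is
    light as well and its local search was carried out.\<close>
  have lu: "2 * d < near S K u" using False walk.nil fin(1) by (metis add_0 le_refl linorder_not_le)
  have "\<exists>l'\<le>del u v. walk O1 sr tg wt u v l'"
  proof (rule served_path[OF loc[OF lu]])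
    show "walk {..<m} sr tg wt u v (del u v)" "u < n" "del u v < BIG" using fin uv by auto
    fix w l' k assume w: "walk {..<m} sr tg wt u w l'" "walk {..<m} sr tg wt w v k" "l' + k \<le> del u v"
    have wn: "w < n" using walk_in[OF w(1) uv(1)] .
    have "del s u + l' \<le> d + del s w" if "s \<in> set (rs w)" for s
    proof -
      have "del s u \<le> del s w + del w u" using del_tri rs[OF that] wn .
      moreover have "del w u \<le> del w v + del v u" using del_tri wn uv(2) .
      moreover have "del w v \<le> k" using dst_walk(2) w by auto
      ultimately show ?thesis using w(3) uv(3) by simp
    qed
    then show "2 * d < near S K w \<and> pass d w (rs w) u l'" using False w uv(3) unfolding pass_def by fastforce
  qed (auto simp: pass_def intro: le_trans)
  then show ?thesis using trans_le_add1 by blast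
qed

end

section \<open>Final state of a search, and exact distances in the absence of a filter\<close>

context dijkstra begin

lemma st_final:
  assumes "st r h {} P E {e. sr e \<in> E}"
  shows "\<And>v. v < n \<Longrightarrow> h 10 v \<le> BIG \<and> (h 10 v < BIG \<longleftrightarrow> v \<in> P)" "h 10 u = 0" "E \<subseteq> {..<n}" "E \<subseteq> P"
    "\<And>v. v \<in> P \<Longrightarrow> walk {..<m} sr tg wt u v (h 10 v)"
    "\<And>v. v \<in> E \<Longrightarrow> walk (outs m h (r 2)) sr tg wt u v (h 10 v)"
    "\<And>v. v \<in> P \<Longrightarrow> v \<noteq> u \<Longrightarrow> ok v (h 10 v)"
    "\<And>e. e < m \<Longrightarrow> sr e \<in> E \<Longrightarrow> ok (tg e) (h 10 (sr e) + wt e) \<Longrightarrow> h 10 (tg e) \<le> h 10 (sr e) + wt e"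
    "\<And>x. x \<in> P - E \<Longrightarrow> gt \<le> h0 12 x" "\<And>x. x \<in> E \<Longrightarrow> h0 12 x < gt" "finite E" "card E \<le> n"
proof -
  have inv: "dinv ok u (h0 12) gt (h 10) (h 11) {} P E {e. sr e \<in> E}"
    and oe: "\<forall>y\<in>E - {u}. h 11 y - 1 \<in> outs m h (r 2)" using assms by (auto simp: st_def)
  show "h 10 v \<le> BIG \<and> (h 10 v < BIG \<longleftrightarrow> v \<in> P)" if "v < n" for v using inv that by (auto simp: dinv_def)
  show "h 10 u = 0" "E \<subseteq> P" using inv by (auto simp: dinv_def)
  show E: "E \<subseteq> {..<n}" using inv by (auto simp: dinv_def)
  show "walk {..<m} sr tg wt u v (h 10 v)" if "v \<in> P" for v
  proof (rule dinv_walk[OF inv])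
    fix z assume "z \<in> E \<union> {v}" "z \<noteq> u"
    moreover from this have "z \<in> P \<union> {}" using inv that by (auto simp: dinv_def)
    ultimately show "h 11 z - 1 \<in> {..<m}" using inv unfolding dinv_def by fastforce
  qed (use that in simp)
  show "walk (outs m h (r 2)) sr tg wt u v (h 10 v)" if "v \<in> E" for v
    by (rule dinv_walk[OF inv]) (use that oe inv in \<open>auto simp: dinv_def\<close>)
  show "ok v (h 10 v)" if "v \<in> P" "v \<noteq> u" for v
    using inv that unfolding dinv_def by blast
  show "h 10 (tg e) \<le> h 10 (sr e) + wt e" if "e < m" "sr e \<in> E" "ok (tg e) (h 10 (sr e) + wt e)" for e
    using inv that by (simp add: dinv_def)
  show "gt \<le> h0 12 x" if "x \<in> P - E" for x using inv that by (auto simp: dinv_def)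
  show "h0 12 x < gt" if "x \<in> E" for x using inv that by (auto simp: dinv_def)
  show "finite E" using dinv_fin[OF inv] by simp
  show "card E \<le> n" using E card_mono[of "{..<n}" E] by simp
qed

text \<open>With all counters below the gate no vertex is refused, so \<open>P = E\<close>. With a
  trivial filter the labels are closed under all relaxations and hence are the distances.\<close>

lemma dijk_full:
  assumes okT: "\<And>y k. ok y k" and c0: "\<And>v. v < n \<Longrightarrow> h0 12 v < gt"
    and Q: "\<And>r h t'. frame DR DB r0 h0 r h \<Longrightarrow> (\<And>v. v < n \<Longrightarrow> h 10 v = del u v) \<Longrightarrow>
      (\<And>v. v < n \<Longrightarrow> del u v < BIG \<Longrightarrow> walk (outs m h (r 2)) sr tg wt u v (del u v)) \<Longrightarrow>
      r0 2 \<le> r 2 \<Longrightarrow> r 2 \<le> r0 2 + n \<Longrightarrow> outok m h (r 2) \<Longrightarrow> outs m h0 (r0 2) \<subseteq> outs m h (r 2) \<Longrightarrow>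
      t' \<le> t + (n * (100 * L + 800) + 100 * L + 300 + m * (TF + 100 * L + 400)) \<Longrightarrow> Q r h t'"
  shows "wp N (dijk hb nb tb F) Q r0 h0 t"
proof (rule dijk_wp)
  fix r h t' P E
  assume st: "st r h {} P E {e. sr e \<in> E}"
    and t': "t' \<le> t + (n * (100 * L + 800) + 100 * L + 300 + (\<Sum>x\<in>E. deg x) * (TF + 100 * L + 400))"
  note f = st_final[OF st]
  have PE: "P = E"
  proof -
    have "P \<subseteq> {..<n}" using st by (auto simp: st_def dinv_def)
    then have "x \<in> E" if "x \<in> P" for x using f(9)[of x] c0[of x] that by force
    then show ?thesis using f(4) by auto
  qed
  have le: "h 10 v \<le> l" if "walk {..<m} sr tg wt u v l" for v l
    using that
  proof (induction rule: walk.induct)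
    case (snoc v l e)
    have e: "sr e < n" "tg e < n" "e < m" using edge snoc.hyps by auto
    show ?case
    proof (cases "sr e \<in> E")
      case True
      then show ?thesis using f(8)[of e] okT snoc e by simp
    next
      case False
      then have "h 10 (sr e) = BIG" using f(1)[OF e(1)] PE by auto
      then show ?thesis using f(1)[OF e(2)] snoc by auto
    qed
  qed (simp add: f(2))
  have D: "h 10 v = del u v" if v: "v < n" for v
  proof (cases "v \<in> P")
    case True
    then show ?thesis using f(5)[OF True] le dst_walk by (metis antisym)
  next
    case False
    then have "h 10 v = BIG" using f(1)[OF v] by auto
    moreover have "\<not> walk {..<m} sr tg wt u v l" for l
      using le[of v "del u v"] del_bound(2)[OF _ un, of v] dst_walk(1) \<open>h 10 v = BIG\<close> by (metis linorder_not_le)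
    ultimately show ?thesis by (simp add: dst_def)
  qed
  have sd: "(\<Sum>x\<in>E. deg x) \<le> m"
    using sum_mono2[of "{..<n}" E deg] f(3) sum_deg by simp
  show "Q r h t'"
  proof (rule Q)
    show "frame DR DB r0 h0 r h" using st by (simp add: st_def)
    show "h 10 v = del u v" if "v < n" for v using D[OF that] .
    show "walk (outs m h (r 2)) sr tg wt u v (del u v)" if "v < n" "del u v < BIG" for v
      using f(1)[OF that(1)] f(6)[of v] PE that D by auto
    show "r0 2 \<le> r 2" "outok m h (r 2)" "outs m h0 (r0 2) \<subseteq> outs m h (r 2)" using st by (auto simp: st_def)
    show "r 2 \<le> r0 2 + n" using st f(12) by (auto simp: st_def)
    have "(\<Sum>x\<in>E. deg x) * (TF + 100 * L + 400) \<le> m * (TF + 100 * L + 400)"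
      using sd by (rule mult_right_mono) simp
    then show "t' \<le> t + (n * (100 * L + 800) + 100 * L + 300 + m * (TF + 100 * L + 400))" using t' by linarith
  qed
qed

end

section \<open>The program\<close>

text \<open>
  Registers: 0 \<open>n\<close>, 1 \<open>m\<close>, 2 number of output edges, 3 \<open>rt\<close> (the rounded square root of \<open>n\<close>),
  4 rounded logarithm of \<open>n\<close>, 5 maximal weight, 6 \<open>K\<close>, 7 \<open>2 * K\<close>, 8 \<open>BIG\<close> (infinite distance), 9 \<open>BIG * n\<close>
  (infinite key), 10 bound on the expansions of a vertex, 11 \<open>cap\<close>, 12 bound on the scales, 22 scale,
  30 source of a search, 35 and 36 vertex and tentative distance that are being filtered,
  37 verdict of the filter; 20 to 26 and 31 to 43 are otherwise loop variables and scratch.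

  Arrays: 0, 1, 2 ends and weights of the edges, 3 and 4 ends of the output edges, 5 and 6 heads and
  links of the lists of outgoing edges, 7 and 8 those of incoming edges (edge numbers shifted by 1,
  so that 0 ends a list), 9 tournament tree, 10 tentative distances, 11 parent edges (shifted by 1),
  12 number of expansions of a vertex, 13 samples, 14 distances from the samples (row-major),
  15 roundtrip distance to the nearest sample \<open>j < K\<close>, 16 and 17 the at most \<open>cap\<close> filtering samples
  \<open>j \<ge> K\<close> of a vertex and their number.
\<close>

definition resetcnt :: com where
  "resetcnt = forl 21 (Vr 0) (sto 12 (Vr 21) (Cn 0))"

definition fd :: "exp \<Rightarrow> exp \<Rightarrow> exp" where "fd j v = Ld 14 (j [*] Vr 0 [+] v)"

definition glob :: com where
  "glob = forl 21 (Vr 0) (sto 15 (Vr 21) (Vr 8));;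
    forl 20 (Vr 7)
     (asg 30 (Ld 13 (Vr 20));;
      resetcnt;; dijk 5 6 1 (asg 37 (Cn 1));;
      forl 21 (Vr 0) (sto 14 (Vr 20 [*] Vr 0 [+] Vr 21) (Ld 10 (Vr 21)));;
      resetcnt;; dijk 7 8 0 (asg 37 (Cn 1));;
      ifl (Vr 20) (Vr 6)
        (forl 21 (Vr 0)
          (ifl (fd (Vr 20) (Vr 21) [+] Ld 10 (Vr 21)) (Ld 15 (Vr 21))
             (sto 15 (Vr 21) (fd (Vr 20) (Vr 21) [+] Ld 10 (Vr 21))) Skip))
        Skip)"

definition rj :: exp where "rj = Ld 16 (Vr 35 [*] Vr 11 [+] Vr 43)"

text \<open>Only strict comparison is available, hence the shift by one and the negated second test.
  The verdict starts as \<open>nd \<le> d\<close>, and each listed sample may revoke it.\<close>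

definition flt :: com where
  "flt = ifl (Vr 36) (Vr 22 [+] Cn 1) (asg 37 (Cn 1)) (asg 37 (Cn 0));;
     forl 43 (Ld 17 (Vr 35))
       (ifl (Vr 22 [+] fd rj (Vr 35)) (fd rj (Vr 30) [+] Vr 36) (asg 37 (Cn 0)) Skip)"

definition select :: com where
  "select = forl 23 (Vr 0) (sto 17 (Vr 23) (Cn 0);;
     forl 26 (Vr 6)
      (asg 21 (Vr 26 [+] Vr 6);;
       ifl (Ld 17 (Vr 23)) (Vr 11)
        (asg 35 (Vr 23);; asg 36 (fd (Vr 21) (Vr 23));; asg 30 (Ld 13 (Vr 21));; flt;;
         ifl (Cn 2 [*] Vr 22) (Ld 15 (Vr 30))
          (ifl (Cn 0) (Vr 37)
            (sto 16 (Vr 23 [*] Vr 11 [+] Ld 17 (Vr 23)) (Vr 21);; sto 17 (Vr 23) (Ld 17 (Vr 23) [+] Cn 1))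
            Skip)
          Skip)
        Skip))"

definition locals :: com where
  "locals = forl 25 (Vr 0)
     (ifl (Cn 2 [*] Vr 22) (Ld 15 (Vr 25))
       (asg 30 (Vr 25);; dijk 5 6 1 (flt;; ifl (Cn 2 [*] Vr 22) (Ld 15 (Vr 35)) Skip (asg 37 (Cn 0))))
       Skip)"

text \<open>The gate \<open>2 * rt + 1\<close> is one above the size allowed for a candidate set, so
  it never closes at a scale where all of these are small enough.\<close>

definition scales :: "nat \<Rightarrow> com" where
  "scales q = asg 10 (Cn 2 [*] Vr 3 [+] Cn 1);; asg 22 (Cn 1);;
     whl (Vr 22) (Vr 12) (select;; resetcnt;; locals;; asg 22 (Vr 22 [+] Cn 1 [+] Vr 22 [div] Cn q))"

text \<open>\<open>M\<close> is not part of the input. The maximal weight is found while the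
  adjacency lists are built, and all limits are derived from it. Registers 13 and 20 prepare the
  sampling loop.\<close>

definition prelude :: "nat \<Rightarrow> com" where
  "prelude \<kappa> = asg 3 (Cn 1);; whl (Vr 3 [*] Vr 3) (Vr 0) (asg 3 (Vr 3 [+] Cn 1));;
     asg 4 (Cn 1);; asg 21 (Cn 2);; whl (Vr 21) (Vr 0) (asg 21 (Vr 21 [*] Cn 2);; asg 4 (Vr 4 [+] Cn 1));;
     forl 20 (Vr 1)
      (sto 6 (Vr 20) (Ld 5 (Ld 0 (Vr 20)));; sto 5 (Ld 0 (Vr 20)) (Vr 20 [+] Cn 1);;
       sto 8 (Vr 20) (Ld 7 (Ld 1 (Vr 20)));; sto 7 (Ld 1 (Vr 20)) (Vr 20 [+] Cn 1);;
       ifl (Vr 5) (Ld 2 (Vr 20)) (asg 5 (Ld 2 (Vr 20))) Skip);;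
     asg 6 (Cn \<kappa> [*] Vr 3 [*] Vr 4);; asg 7 (Cn 2 [*] Vr 6);; asg 12 (Cn 4 [*] Vr 0 [*] Vr 5 [+] Cn 1);;
     asg 8 (Cn 2 [*] Vr 12);; asg 9 (Vr 8 [*] Vr 0);; asg 10 (Cn 1);; asg 11 (Cn (3 * \<kappa>) [*] Vr 4);;
     asg 13 (Cn 1);; asg 20 (Cn 0)"

text \<open>Written in primitive instructions, as \<open>wp\<close> does not cover random commands;
  register 13 holds the constant 1.\<close>

definition sampling :: com where
  "sampling = WhileLess 20 7 (Seq (Rand 14 0) (Seq (Store 13 20 14) (Arith Add 20 20 13)))"

definition copy :: com where
  "copy = forl 20 (Vr 1) (sto 3 (Vr 20) (Ld 0 (Vr 20));; sto 4 (Vr 20) (Ld 1 (Vr 20)));; asg 2 (Vr 1)"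

definition prog :: "nat \<Rightarrow> nat \<Rightarrow> com" where
  "prog \<kappa> q = ifl (Vr 0 [*] Vr 0 [*] Vr 0) (Vr 1 [*] Vr 1)
     (Seq (prelude \<kappa>) (Seq sampling (Seq glob (scales q)))) copy"

section \<open>Trees and distance tables of the samples\<close>

lemma idx_bound: "j < k \<Longrightarrow> v < (n :: nat) \<Longrightarrow> j * n + v < k * n"
proof -
  assume "j < k" "v < n"
  then have "j * n + v < Suc j * n" by simp
  also have "\<dots> \<le> k * n" using \<open>j < k\<close> by (intro mult_right_mono) auto
  finally show ?thesis .
qed

text \<open>\<open>S\<close> lists the \<open>2 * K\<close> samples of one fixed outcome, so
  everything here is deterministic. A roundtrip distance is at most \<open>2 * n * Wm\<close> and
  the scale that covers it at most twice that, hence \<open>dlim\<close>. With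
  \<open>BIG = 2 * dlim\<close> the radius \<open>2 * d\<close> of every scale is still
  finite.\<close>

locale main = wgraph +
  fixes K cap rt dlim N L :: nat and S :: "nat \<Rightarrow> nat"
  assumes n1: "1 \<le> n" and S: "j < 2 * K \<Longrightarrow> S j < n"
    and dlim: "BIG = 2 * dlim" "4 * n * Wm < dlim"
    and L: "2 * n \<le> 2 ^ L"
    and N: "4 * n + 4 \<le> N" "BIG * n \<le> N" "4 * BIG + Wm + 4 \<le> N" "2 * K * n + n \<le> N" "n * cap + cap \<le> N"
      "2 * K < N" "m < N" "2 * rt + 1 < N"
begin

definition base :: "(nat \<Rightarrow> nat) \<Rightarrow> (nat \<Rightarrow> nat \<Rightarrow> nat) \<Rightarrow> bool" where
  "base r h \<longleftrightarrow> r 0 = n \<and> r 1 = m \<and> r 3 = rt \<and> r 6 = K \<and> r 7 = 2 * K \<and> r 8 = BIG \<and> r 9 = BIG * n \<and> r 11 = cap \<and> r 12 = dlim \<and>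
    (\<forall>e<m. h 0 e = sr e \<and> h (Suc 0) e = tg e \<and> h 2 e = wt e \<and> h 6 e = prv sr (sr e) e \<and> h 8 e = prv tg (tg e) e) \<and>
    (\<forall>v<n. h 5 v = prv sr v m \<and> h 7 v = prv tg v m) \<and> (\<forall>j<2 * K. h 13 j = S j)"

definition avoid :: "nat set \<Rightarrow> nat set \<Rightarrow> bool" where
  "avoid R B \<longleftrightarrow> R \<inter> {0,1,3,6,7,8,9,11,12} = {} \<and> B \<inter> {0,1,2,5,6,7,8,13} = {}"

lemma base_frame: "base r h \<Longrightarrow> frame R B r h r' h' \<Longrightarrow> avoid R B \<Longrightarrow> base r' h'"
proof -
  assume b: "base r h" and f: "frame R B r h r' h'" and a: "avoid R B"
  have "r' x = r x" if "x \<in> {0,1,3,6,7,8,9,11,12}" for x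
    using f a that by (intro frame_r[OF f]) (auto simp: avoid_def)
  moreover have "h' a = h a" if "a \<in> {0,1,2,5,6,7,8,13}" for a
    using f a that by (intro frame_h[OF f]) (auto simp: avoid_def)
  ultimately have "r' 0 = r 0" "r' 1 = r 1" "r' 3 = r 3" "r' 6 = r 6" "r' 7 = r 7" "r' 8 = r 8" "r' 9 = r 9"
    "r' 11 = r 11" "r' 12 = r 12" "h' 0 = h 0" "h' (Suc 0) = h (Suc 0)" "h' 2 = h 2" "h' 5 = h 5" "h' 6 = h 6" "h' 7 = h 7"
    "h' 8 = h 8" "h' 13 = h 13" by simp_all
  then show "base r' h'" using b unfolding base_def by simp
qed

lemma resetcnt_wp:
  assumes r: "r 0 = n"
    and Q: "\<And>r' h' t'. frame {21} {12} r h r' h' \<Longrightarrow> (\<And>v. v < n \<Longrightarrow> h' 12 v = 0) \<Longrightarrow> t' \<le> t + (40 * n + 30) \<Longrightarrow> Q r' h' t'"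
  shows "wp N resetcnt Q r h t"
  unfolding resetcnt_def
  apply (rule wp_forl[where I = "\<lambda>i r' h' t'. frame {21} {12} r h r' h' \<and> (\<forall>v<i. h' 12 v = 0) \<and> t' \<le> t + 6 + 40 * i" and b = n])
  subgoal by simp
  subgoal by (simp add: frame_upd)
  subgoal using r by (simp add: frame_def)
  subgoal using N(1) by simp
  subgoal
    apply (rule wp_sto)
    subgoal by simp
    subgoal by simp
    subgoal by (auto simp: frame_upd less_Suc_eq)
    done
  subgoal by (rule Q) auto
  done

definition tree_at :: "nat set \<Rightarrow> nat \<Rightarrow> bool" where
  "tree_at O1 s \<longleftrightarrow> (\<forall>w<n. (del s w < BIG \<longrightarrow> walk O1 sr tg wt s w (del s w)) \<and>
     (del w s < BIG \<longrightarrow> walk O1 sr tg wt w s (del w s)))"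

definition TD :: nat where "TD = n * (100 * L + 800) + 100 * L + 300 + m * (5 + 100 * L + 400)"

lemma filter_true_wp:
  assumes Q: "\<And>r' t'. frame {37,43} {} r h r' h \<Longrightarrow> (0 < r' 37 \<longleftrightarrow> True) \<Longrightarrow> t' \<le> t + 5 \<Longrightarrow> Q r' h t'"
  shows "wp N (asg 37 (Cn 1)) Q r h t"
  apply (rule wp_asg)
  subgoal by simp
  subgoal using N(1) by simp
  subgoal by (rule Q) (auto simp: frame_def)
  done

lemma fwd_wp:
  assumes b: "base r h" "r 10 = 1" "r 30 = s" "s < n" "\<And>v. v < n \<Longrightarrow> h 12 v = 0" "outok m h (r 2)" "r 2 + n < N"
    and Q: "\<And>r' h' t'. frame DR DB r h r' h' \<Longrightarrow> (\<And>v. v < n \<Longrightarrow> h' 10 v = del s v) \<Longrightarrow>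
      (\<And>v. v < n \<Longrightarrow> del s v < BIG \<Longrightarrow> walk (outs m h' (r' 2)) sr tg wt s v (del s v)) \<Longrightarrow>
      r 2 \<le> r' 2 \<Longrightarrow> r' 2 \<le> r 2 + n \<Longrightarrow> outok m h' (r' 2) \<Longrightarrow> outs m h (r 2) \<subseteq> outs m h' (r' 2) \<Longrightarrow>
      t' \<le> t + TD \<Longrightarrow> Q r' h' t'"
  shows "wp N (dijk 5 6 1 (asg 37 (Cn 1))) Q r h t"
proof -
  interpret D: dijkstra n m sr tg wt Wm BIG 5 6 1 "asg 37 (Cn 1)" N L 5 1 s "\<lambda>_ _. True" r h
  proof unfold_locales
    show "wp N (asg 37 (Cn 1)) Q r1 h1 t1"
      if "\<And>r' t'. frame {37, 43} {} r1 h1 r' h1 \<Longrightarrow> (0 < r' 37) = True \<Longrightarrow> t' \<le> t1 + 5 \<Longrightarrow> Q r' h1 t'" for r1 h1 t1 Q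
      by (rule filter_true_wp) (use that in auto)
  qed (use n1 b(2-4,6,7) L N b(1)[unfolded base_def] in \<open>simp_all\<close>)
  show ?thesis by (rule D.dijk_full) (use b Q in \<open>auto simp: TD_def\<close>)
qed

text \<open>A search along reversed edges is a forward search with \<open>sr\<close> and
  \<open>tg\<close> exchanged, on the lists of incoming edges; its walks and distances are turned
  around afterwards.\<close>

lemma bwd_wp:
  assumes b: "base r h" "r 10 = 1" "r 30 = s" "s < n" "\<And>v. v < n \<Longrightarrow> h 12 v = 0" "outok m h (r 2)" "r 2 + n < N"
    and Q: "\<And>r' h' t'. frame DR DB r h r' h' \<Longrightarrow> (\<And>v. v < n \<Longrightarrow> h' 10 v = del v s) \<Longrightarrow>
      (\<And>v. v < n \<Longrightarrow> del v s < BIG \<Longrightarrow> walk (outs m h' (r' 2)) sr tg wt v s (del v s)) \<Longrightarrow>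
      r 2 \<le> r' 2 \<Longrightarrow> r' 2 \<le> r 2 + n \<Longrightarrow> outok m h' (r' 2) \<Longrightarrow> outs m h (r 2) \<subseteq> outs m h' (r' 2) \<Longrightarrow>
      t' \<le> t + TD \<Longrightarrow> Q r' h' t'"
  shows "wp N (dijk 7 8 0 (asg 37 (Cn 1))) Q r h t"
proof -
  interpret D: dijkstra n m tg sr wt Wm BIG 7 8 0 "asg 37 (Cn 1)" N L 5 1 s "\<lambda>_ _. True" r h
  proof unfold_locales
    show "wp N (asg 37 (Cn 1)) Q r1 h1 t1"
      if "\<And>r' t'. frame {37, 43} {} r1 h1 r' h1 \<Longrightarrow> (0 < r' 37) = True \<Longrightarrow> t' \<le> t1 + 5 \<Longrightarrow> Q r' h1 t'" for r1 h1 t1 Q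
      by (rule filter_true_wp) (use that in auto)
  qed (use n1 b(2-4,6,7) L N BIG edge b(1)[unfolded base_def] in \<open>simp_all\<close>)
  show ?thesis
  proof (rule D.dijk_full)
    fix r' h' t'
    assume a: "frame DR DB r h r' h'" "\<And>v. v < n \<Longrightarrow> h' 10 v = dst m tg sr wt BIG s v"
      "\<And>v. v < n \<Longrightarrow> dst m tg sr wt BIG s v < BIG \<Longrightarrow> walk (outs m h' (r' 2)) tg sr wt s v (dst m tg sr wt BIG s v)"
      "r 2 \<le> r' 2" "r' 2 \<le> r 2 + n" "outok m h' (r' 2)" "outs m h (r 2) \<subseteq> outs m h' (r' 2)"
      "t' \<le> t + (n * (100 * L + 800) + 100 * L + 300 + m * (5 + 100 * L + 400))"
    show "Q r' h' t'"
    proof (rule Q[OF a(1)])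
      show "h' 10 v = del v s" if "v < n" for v using a(2)[OF that] by (simp add: dst_rev[of m tg])
      show "walk (outs m h' (r' 2)) sr tg wt v s (del v s)" if "v < n" "del v s < BIG" for v
        using walk_rev[OF a(3)[OF that(1)]] that(2) by (simp add: dst_rev[of m tg])
    qed (use a in \<open>auto simp: TD_def\<close>)
  qed (use b in auto)
qed

definition GR :: "nat set" where "GR = DR \<union> {20,21,30}"
definition GB :: "nat set" where "GB = DB \<union> {14,15}"

definition TG :: nat where "TG = 2 * TD + 400 * n + 500"

lemma glob_wp:
  assumes b: "base r h" "r 10 = 1" "r 2 = 0" "4 * K * n + n < N"
    and Q: "\<And>r' h' t'. frame GR GB r h r' h' \<Longrightarrow> (\<And>j v. j < 2 * K \<Longrightarrow> v < n \<Longrightarrow> h' 14 (j * n + v) = del (S j) v) \<Longrightarrow>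
      (\<And>v. v < n \<Longrightarrow> h' 15 v = near S K v) \<Longrightarrow> (\<And>j. j < 2 * K \<Longrightarrow> tree_at (outs m h' (r' 2)) (S j)) \<Longrightarrow>
      outok m h' (r' 2) \<Longrightarrow> r' 2 \<le> 4 * K * n \<Longrightarrow> t' \<le> t + (2 * K * TG + 50 * n + 60) \<Longrightarrow> Q r' h' t'"
  shows "wp N glob Q r h t"
proof -
  define t0 where "t0 = t + 50 * n + 40"
  \<comment> \<open>The index \<open>min i K\<close> says that only the first \<open>K\<close>
    samples count as centres of detours, while trees and rows of array 14 are produced for all
    samples.\<close>
  define I where "I i r' h' t' \<longleftrightarrow> frame GR GB r h r' h' \<and> (\<forall>j<i. \<forall>v<n. h' 14 (j * n + v) = del (S j) v) \<and>
     (\<forall>v<n. h' 15 v = near S (min i K) v) \<and> (\<forall>j<i. tree_at (outs m h' (r' 2)) (S j)) \<and> outok m h' (r' 2) \<and> r' 2 \<le> i * (2 * n) \<and>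
     t' \<le> t0 + i * TG" for i r' h' t'
  have r[simp]: "r 0 = n" "r 8 = BIG" using b by (auto simp: base_def)
  have av: "avoid GR GB" by (auto simp: avoid_def GR_def GB_def DR_def DB_def)
  show ?thesis
    unfolding glob_def
    apply (rule wp_seq, rule wp_forl[where I = "\<lambda>i r' h' t'. frame {21} {15} r h r' h' \<and> (\<forall>v<i. h' 15 v = BIG) \<and> t' \<le> t + 6 + 40 * i" and b = n])
    subgoal by simp
    subgoal by (simp add: frame_upd)
    subgoal by (simp add: frame_def)
    subgoal using N(1) by simp
    subgoal
      apply (rule wp_sto)
      subgoal by simp
      subgoal by simp
      subgoal by (auto simp: frame_upd less_Suc_eq frame_def)
      done
    subgoal premises p1 for r1 h1 t1
      apply (rule wp_forl[where I = I and b = "2 * K"])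
      subgoal by simp
      subgoal
      proof -
        have "frame GR GB r h (r1(20 := 0)) h1"
          using p1 by (simp add: frame_def GR_def GB_def)
        moreover have "(r1(20 := 0)) 2 = 0" using p1 b by (auto simp: frame_def)
        ultimately show ?thesis using p1 unfolding I_def t0_def by (auto simp: outok_def)
      qed
      subgoal premises p for i r2 h2 t2
        using base_frame[OF b(1) _ av, of r2 h2] p(1) by (simp add: I_def base_def)
      subgoal using N by simp
      subgoal premises p for i r2 h2 t2
      proof -
        have f2: "frame GR GB r h r2 h2" using p(1) by (simp add: I_def)
        have b2: "base r2 h2" "r2 10 = 1" using base_frame[OF b(1) f2 av] f2 b by (auto simp: frame_def GR_def)
        have i2: "i < 2 * K" using p(3) .
        have s: "S i < n" "h2 13 i = S i" using S[OF i2] b2 i2 by (auto simp: base_def)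
        \<comment> \<open>Each sample contributes at most \<open>n\<close> edges per direction; this
          leaves room for both trees of sample \<open>i\<close>.\<close>
        have "i * (2 * n) + 2 * n \<le> 2 * K * (2 * n)"
          using i2 by (metis Suc_leI add.commute mult_Suc mult_le_mono1)
        then have r2N: "r2 2 + n + n < N" using p(1) b(4) by (simp add: I_def algebra_simps)
        show ?thesis
          apply (rule wp_seq, rule wp_asg)
          subgoal by simp
          subgoal by simp
          apply (rule wp_seq, rule resetcnt_wp)
          subgoal using b2 by (simp add: base_def)
          subgoal premises q3 for r3 h3 t3
          proof -
            have f3: "frame {21,30} {12} r2 h2 r3 h3" using q3(1) by (auto simp: frame_def)
            have b3: "base r3 h3" by (rule base_frame[OF b2(1) f3]) (auto simp: avoid_def)
            have hs3: "r3 10 = 1" "r3 30 = S i" "r3 2 = r2 2" "h3 3 = h2 3" "h3 4 = h2 4" "h3 0 = h2 0" "h3 1 = h2 1" "r3 20 = i"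
               using q3(1) f3 b2 s p(2) by (auto simp: frame_def GR_def GB_def)
            have oo3: "outs m h3 c = outs m h2 c" "outok m h3 c = outok m h2 c" for c
              by (simp_all add: outs_def outok_def hs3 del: One_nat_def)
            have ok3: "outok m h3 (r3 2)" using p(1) by (simp add: I_def hs3 oo3)
            show ?thesis
              apply (rule wp_seq, rule fwd_wp[OF b3 hs3(1,2) s(1)])
              subgoal using q3(2) by simp
              subgoal by (rule ok3)
              subgoal using r2N hs3 by simp
              subgoal premises q4 for r4 h4 t4
              proof -
                have b4: "base r4 h4" by (rule base_frame[OF b3 q4(1)]) (auto simp: avoid_def DR_def DB_def)
                have hs4: "r4 20 = i" "r4 0 = n" "r4 10 = 1" "r4 30 = S i" "h4 14 = h2 14" using q4(1) f3 hs3 b4 by (auto simp: frame_def GR_def GB_def base_def)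
                show ?thesis
                  apply (rule wp_seq, rule wp_forl[where b = n and I = "\<lambda>v r' h' t'. frame {21} {14} r4 h4 r' h' \<and>
                     h' 14 = (\<lambda>k. if i * n \<le> k \<and> k < i * n + v then h4 10 (k - i * n) else h4 14 k) \<and> t' \<le> t4 + 10 + 60 * v"])
                  subgoal by simp
                  subgoal by (auto simp: frame_upd)
                  subgoal using hs4 by (simp add: frame_def)
                  subgoal using N(1) by simp
                  subgoal premises q for v r' h' t'
                  proof -
                    have "i * n + v < 2 * K * n" using idx_bound[OF i2 q(3)] .
                    moreover have "r' 20 = i" "r' 0 = n" "h' 10 = h4 10" using q(1) hs4 by (auto simp: frame_def GR_def GB_def)
                    ultimately show ?thesis
                      apply (intro wp_sto)
                      subgoal using N(4) q(2) by simp
                      subgoal by simp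
                      subgoal using q by (auto simp: frame_upd fun_eq_iff)
                      done
                  qed
                  subgoal premises q5 for r5 h5 t5
                  proof -
                    have r50: "r5 0 = n" using q5(1) hs4 by (simp add: frame_def)
                    show ?thesis
                      apply (rule wp_seq, rule resetcnt_wp)
                      subgoal by (rule r50)
                      subgoal premises q6 for r6 h6 t6
                      proof -
                        have f6: "frame {21} {14,12} r4 h4 r6 h6" using q5(1) q6(1) by (auto simp: frame_def)
                        have b6: "base r6 h6" by (rule base_frame[OF b4 f6]) (auto simp: avoid_def)
                        have hs6: "r6 10 = 1" "r6 30 = S i" "r6 2 = r4 2" "h6 3 = h4 3" "h6 4 = h4 4" "h6 0 = h4 0" "h6 1 = h4 1" "r6 20 = i" "h6 14 = h5 14"
                           using q6(1) f6 hs4 by (auto simp: frame_def GR_def GB_def)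
                        have oo6: "outs m h6 c = outs m h4 c" "outok m h6 c = outok m h4 c" for c
                          by (simp_all add: outs_def outok_def hs6 del: One_nat_def)
                        have ok6: "outok m h6 (r6 2)" using q4 by (simp add: hs6 oo6)
                        show ?thesis
                          apply (rule wp_seq, rule bwd_wp[OF b6 hs6(1,2) s(1)])
                          subgoal using q6(2) by simp
                          subgoal by (rule ok6)
                          subgoal using r2N hs6 q4 hs3 by simp
                          subgoal premises q7 for r7 h7 t7
                          proof -
                            have b7: "base r7 h7" by (rule base_frame[OF b6 q7(1)]) (auto simp: avoid_def DR_def DB_def)
                            have hs7: "r7 20 = i" "r7 6 = K" "r7 0 = n" "h7 14 = h5 14" "h7 15 = h2 15" "r7 7 = 2 * K"
                              using q7(1) hs6 b7 q5(1) q6(1) q4(1) f3 by (auto simp: frame_def GR_def GB_def base_def)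
                            \<comment> \<open>Row \<open>i\<close> is the copy of the labels of the
                              forward search, and earlier rows end before it begins.\<close>
                            have FD: "h7 14 (j * n + v) = del (S j) v" if "j < Suc i" "v < n" for j v
                            proof (cases "j = i")
                              case True
                              then show ?thesis using that q5(1) q4(2)[OF that(2)] by (simp add: hs7)
                            next
                              case False
                              then have "j * n + v < i * n" using that by (intro idx_bound) auto
                              then show ?thesis using that False q5(1) p(1) by (simp add: hs7 hs4 I_def)
                            qed
                            have fr7: "frame GR GB r h r7 h7"
                              using f2 f3 q4(1) f6 q7(1) unfolding frame_def GR_def GB_def DR_def DB_def by simp
                            have o24: "outs m h2 (r2 2) \<subseteq> outs m h7 (r7 2)" "outs m h4 (r4 2) \<subseteq> outs m h7 (r7 2)"
                              using q4(7) q7(7) by (auto simp: oo3 oo6 hs3 hs6)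
                            have tr: "tree_at (outs m h7 (r7 2)) (S j)" if "j < Suc i" for j
                            proof (cases "j = i")
                              case True
                              show ?thesis unfolding tree_at_def True
                                using q4(3) q7(3) walk_mono[OF _ o24(2)] by blast
                            next
                              case False
                              then have "tree_at (outs m h2 (r2 2)) (S j)" using that p(1) by (simp add: I_def)
                              then show ?thesis unfolding tree_at_def using walk_mono[OF _ o24(1)] by blast
                            qed
                            have r72: "r7 2 \<le> Suc i * (2 * n)" using q7(5) q4(5) p(1) by (simp add: hs6 hs3 I_def)
                            have t7: "t7 + 120 * n + 200 \<le> t0 + Suc i * TG"
                              using q7(8) q6(3) q5(1) q4(8) q3(3) p(1) by (simp add: I_def TG_def)
                            have fin: "I (Suc i) (r8(20 := Suc i)) h8 t8"
                              if "frame {21} {15} r7 h7 r8 h8" "\<And>v. v < n \<Longrightarrow> h8 15 v = near S (min (Suc i) K) v" "t8 \<le> t7 + 120 * n + 200" for r8 h8 t8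
                            proof -
                              have hs8: "h8 14 = h7 14" "r8 2 = r7 2" "h8 3 = h7 3" "h8 4 = h7 4" "h8 0 = h7 0" "h8 1 = h7 1"
                                using that(1) by (auto simp: frame_def GR_def GB_def)
                              have oo8: "outs m h8 c = outs m h7 c" "outok m h8 c = outok m h7 c" for c
                                by (simp_all add: outs_def outok_def hs8 del: One_nat_def)
                              have "frame GR GB r h (r8(20 := Suc i)) h8"
                                using fr7 that(1) unfolding frame_def GR_def GB_def by auto
                              then show ?thesis unfolding I_def
                                using FD that(2,3) tr q7(6) r72 t7 by (simp add: hs8 oo8)
                            qed
                            show ?thesis
                              apply (rule wp_ifl)
                              subgoal by simp
                              subgoal by simp
                              subgoal premises c
                              proof -
                                have iK: "i < K" using c hs7 by simp
                                show ?thesis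
                                  apply (rule wp_forl[where b = n and I = "\<lambda>w r' h' t'. frame {21} {15} r7 h7 r' h' \<and>
                                    (\<forall>v<n. h' 15 v = (if v < w then near S (Suc i) v else near S i v)) \<and> t' \<le> t7 + 20 + 110 * w"])
                                  subgoal by simp
                                  subgoal using p(1) iK by (auto simp: frame_upd I_def hs7 min_def)
                                  subgoal using hs7 by (simp add: frame_def)
                                  subgoal using N(1) by simp
                                  subgoal premises q for w r' h' t'
                                  proof -
                                    have hh: "r' 20 = i" "r' 0 = n" "h' 10 w = del w (S i)" "h' 14 (i * n + w) = del (S i) w"
                                      using q(1) hs7 FD[of i w] q7(2)[OF q(3)] q(3) by (auto simp: frame_def GR_def GB_def)
                                    have d1: "del w (S i) \<le> BIG" "del (S i) w \<le> BIG" using del_le q(3) s(1) by auto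
                                    have ib: "i * n + w < 2 * K * n" using idx_bound[OF i2 q(3)] .
                                    show ?thesis
                                      unfolding fd_def
                                      apply (rule wp_ifl)
                                      subgoal using hh d1 ib N(3,4) q(2) by simp
                                      subgoal by simp
                                      subgoal premises c2
                                        apply (rule wp_sto)
                                        subgoal by simp
                                        subgoal using hh d1 ib N(3,4) q(2) by simp
                                        subgoal using c2 q hh by (auto simp: frame_upd min_def less_Suc_eq)
                                        done
                                      subgoal premises c2
                                        apply (rule wp_skip)
                                        subgoal using c2 q hh by (auto simp: frame_upd min_def less_Suc_eq)
                                        done
                                      done
                                  qed
                                  subgoal premises q for r8 h8 t8
                                  proof (intro conjI fin)
                                    show "r8 20 = i" using q(1) hs7 by (simp add: frame_def)
                                    show "frame {21} {15} r7 h7 r8 h8" using q(1) by simp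
                                    show "h8 15 v = near S (min (Suc i) K) v" if "v < n" for v
                                      using q(1) that iK by (simp add: min_def)
                                    show "t8 + (tc (Vr 0) + 7) + 12 \<le> t7 + 120 * n + 200" using q(1) by simp
                                  qed
                                  done
                              qed
                              subgoal premises c
                                apply (rule wp_skip)
                                subgoal
                                proof (intro conjI fin)
                                  show "r7 20 = i" by (rule hs7)
                                  have "min (Suc i) K = min i K" using c hs7 by simp
                                  then show "h7 15 v = near S (min (Suc i) K) v" if "v < n" for v
                                    using p(1) that by (simp only: hs7 I_def)
                                qed simp_all
                                done
                              done
                          qed
                          done
                      qed
                      done
                  qed
                  done
              qed
              done
          qed
          done
      qed
      subgoal premises p for r2 h2 t2
        by (rule Q) (use p(1) in \<open>auto simp: I_def t0_def\<close>)
      done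
    done
qed

end

text \<open>The scales in the order of the program. As the division rounds down, the extra 1 is
  needed for growth while the scale is below \<open>q\<close>.\<close>

fun ds :: "nat \<Rightarrow> nat \<Rightarrow> nat" where
  "ds q 0 = 1"
| "ds q (Suc i) = ds q i + 1 + ds q i div q"

lemma ds_mono: "i \<le> j \<Longrightarrow> ds q i \<le> ds q j"
  by (rule lift_Suc_mono_le[of "ds q"]) simp_all

section \<open>Choice of the filtering samples\<close>

context main begin

definition rok :: "(nat \<Rightarrow> nat \<Rightarrow> nat) \<Rightarrow> nat \<Rightarrow> bool" where
  "rok h x \<longleftrightarrow> h 17 x \<le> cap \<and> (\<forall>i<h 17 x. h 16 (x * cap + i) < 2 * K)"

text \<open>Array 16 stores numbers of samples rather than vertices, because the rows of array 14
  are addressed by sample number.\<close>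

definition rsl :: "(nat \<Rightarrow> nat \<Rightarrow> nat) \<Rightarrow> nat \<Rightarrow> nat list" where
  "rsl h x = map (\<lambda>i. S (h 16 (x * cap + i))) [0..<h 17 x]"

definition gb :: "(nat \<Rightarrow> nat) \<Rightarrow> (nat \<Rightarrow> nat \<Rightarrow> nat) \<Rightarrow> bool" where
  "gb r h \<longleftrightarrow> base r h \<and> (\<forall>j<2 * K. \<forall>v<n. h 14 (j * n + v) = del (S j) v) \<and> (\<forall>v<n. h 15 v = near S K v)"

lemma gb_frame:
  assumes "gb r h" and f: "frame R B r h r' h'" and "avoid R B" "14 \<notin> B" "15 \<notin> B"
  shows "gb r' h'"
proof -
  have "h' 14 = h 14" "h' 15 = h 15" using frame_h[OF f] assms(4,5) by auto
  then show ?thesis using assms base_frame[OF _ f] by (simp add: gb_def)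
qed

definition TF1 :: nat where "TF1 = 200 * cap + 100"

lemma flt_wp:
  assumes g: "gb r h" and rk: "rok h x" and r: "r 35 = x" "x < n" "r 36 = nd" "nd \<le> BIG" "r 30 = u" "u < n" "r 22 = d" "d < dlim"
    and Q: "\<And>r' t'. frame {37,43} {} r h r' h \<Longrightarrow> (0 < r' 37 \<longleftrightarrow> pass d x (rsl h x) u nd) \<Longrightarrow> t' \<le> t + TF1 \<Longrightarrow> Q r' h t'"
  shows "wp N flt Q r h t"
proof -
  define cnd where "cnd k \<longleftrightarrow> del (S (h 16 (x * cap + k))) u + nd \<le> d + del (S (h 16 (x * cap + k))) x" for k
  define I where "I i r' h' t' \<longleftrightarrow> h' = h \<and> frame {37,43} {} r h r' h \<and>
    r' 37 = (if nd \<le> d \<and> (\<forall>k<i. cnd k) then 1 else 0) \<and> t' \<le> t + 50 + 200 * i" for i r' h' t'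
  have bs: "r 0 = n" "r 11 = cap" "\<And>j v. j < 2 * K \<Longrightarrow> v < n \<Longrightarrow> h 14 (j * n + v) = del (S j) v"
    using g by (auto simp: gb_def base_def)
  have len: "h 17 x \<le> cap" using rk by (simp add: rok_def)
  have I0: "I 0 (r(37 := if nd \<le> d then 1 else 0, 43 := 0)) h t'" if "t' \<le> t + 50" for t'
    using that by (simp add: I_def frame_def)
  \<comment> \<open>The loop is the same after either outcome of comparing \<open>nd\<close> with
    \<open>d\<close>, so it is verified once from a common description of register 37.\<close>
  have rest: "wp N (forl 43 (Ld 17 (Vr 35))
       (ifl (Vr 22 [+] fd rj (Vr 35)) (fd rj (Vr 30) [+] Vr 36) (asg 37 (Cn 0)) Skip)) Q (r(37 := if nd \<le> d then 1 else 0)) h t1"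
    if "t1 \<le> t + 40" for t1
    apply (rule wp_forl[where I = I and b = "h 17 x"])
    subgoal by simp
    subgoal using I0 that by simp
    subgoal using r by (simp add: I_def frame_def)
    subgoal using len N(1,5) n1 by (metis add_lessD1 le_add2 le_trans less_le_trans mult.left_neutral mult_le_mono1 not_less not_numeral_less_one add_leD1 N(3) less_add_same_cancel1 zero_less_numeral)
    subgoal premises p for i r' h' t'
    proof -
      have hh: "h' = h" "r' 0 = n" "r' 11 = cap" "r' 35 = x" "r' 36 = nd" "r' 30 = u" "r' 22 = d" "r' 43 = i"
        using p r bs by (auto simp: I_def frame_def)
      let ?s = "h 16 (x * cap + i)"
      have s: "?s < 2 * K" using rk p(3) by (simp add: rok_def)
      have ib: "x * cap + i < n * cap" using idx_bound[OF r(2), of i cap] p(3) len by simp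
      have sb: "?s * n + x < 2 * K * n" "?s * n + u < 2 * K * n" using idx_bound[OF s] r by auto
      have dl: "del (S ?s) x \<le> BIG" "del (S ?s) u \<le> BIG" using del_le[OF S[OF s]] by auto
      have dd: "h 14 (?s * n + x) = del (S ?s) x" "h 14 (?s * n + u) = del (S ?s) u" using bs(3)[OF s] r by auto
      show ?thesis
        unfolding fd_def rj_def
        apply (rule wp_ifl)
        subgoal using hh ib sb dl dd N(3,4,5) dlim(1) r(8) by simp
        subgoal using hh ib sb dl dd N(3,4,5) dlim(1) r(4) by simp
        subgoal premises c
          apply (rule wp_asg)
          subgoal by simp
          subgoal by simp
          subgoal
          proof -
            have "\<not> cnd i" using c hh dd by (simp add: cnd_def)
            then show ?thesis using p(1,2) hh by (auto simp: I_def frame_def)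
          qed
          done
        subgoal premises c
          apply (rule wp_skip)
          subgoal
          proof -
            have "cnd i" using c hh dd by (simp add: cnd_def)
            then show ?thesis using p(1,2) hh by (auto simp: I_def frame_def less_Suc_eq)
          qed
          done
        done
    qed
    subgoal premises p for r' h' t'
    proof -
      have *: "(\<forall>k<h 17 x. cnd k) \<longleftrightarrow> (\<forall>s\<in>set (rsl h x). del s u + nd \<le> d + del s x)"
        by (auto simp: rsl_def cnd_def)
      have h': "h' = h" using p by (simp add: I_def)
      have "h 17 x * 200 \<le> cap * 200" using len by simp
      then show ?thesis unfolding h'
        by (intro Q) (use p(1) * in \<open>auto simp: I_def pass_def TF1_def\<close>)
    qed
    done
  show ?thesis
    unfolding flt_def
    apply (rule wp_seq, rule wp_ifl)
    subgoal by simp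
    subgoal using r N(3) dlim(1) by simp
    subgoal premises c
      apply (rule wp_asg)
      subgoal by simp
      subgoal using N(1) by simp
      subgoal using rest c r by (simp add: less_Suc_eq_le)
      done
    subgoal premises c
      apply (rule wp_asg)
      subgoal by simp
      subgoal by simp
      subgoal using rest c r by (simp add: less_Suc_eq_le)
      done
    done
qed

definition ss :: "nat list" where "ss = map S [K..<2 * K]"

definition picks :: "nat \<Rightarrow> nat \<Rightarrow> nat list" where "picks d x = pick cap (near S K) d x ss"

definition TSel :: nat where "TSel = n * (K * (TF1 + 700) + 100) + 100"

lemma select_wp:
  assumes g: "gb r h" and d: "r 22 = d" "d < dlim"
    and Q: "\<And>r' h' t'. frame {21,23,26,30,35,36,37,43} {16,17} r h r' h' \<Longrightarrow>
      (\<And>x. x < n \<Longrightarrow> rok h' x \<and> rsl h' x = picks d x) \<Longrightarrow> t' \<le> t + TSel \<Longrightarrow> Q r' h' t'"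
  shows "wp N select Q r h t"
proof -
  let ?R = "{21,23,26,30,35,36,37,43} :: nat set" and ?B = "{16,17} :: nat set"
  have av: "avoid ?R ?B" by (simp add: avoid_def)
  define I where "I x r' h' t' \<longleftrightarrow> frame ?R ?B r h r' h' \<and> (\<forall>y<x. rok h' y \<and> rsl h' y = picks d y) \<and>
    t' \<le> t + 6 + x * (K * (TF1 + 700) + 100)" for x r' h' t'
  define J where "J x t1 i r' h' t' \<longleftrightarrow> frame ?R ?B r h r' h' \<and> r' 23 = x \<and> (\<forall>y<x. rok h' y \<and> rsl h' y = picks d y) \<and>
    rok h' x \<and> rsl h' x = pick cap (near S K) d x (map S [K..<K + i]) \<and> t' \<le> t1 + 40 + i * (TF1 + 700)" for x t1 i r' h' t'
  have gI: "gb r' h' \<and> r' 22 = d \<and> r' 0 = n \<and> r' 6 = K \<and> r' 11 = cap" if "frame ?R ?B r h r' h'" for r' h'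
    using gb_frame[OF g that av] that d(1) by (simp add: gb_def base_def frame_def)
  show ?thesis
    unfolding select_def
    apply (rule wp_forl[where I = I and b = n])
    subgoal by simp
    subgoal by (simp add: I_def frame_upd)
    subgoal premises p for i r' h' t' using gI[of r' h'] p(1) by (simp add: I_def)
    subgoal using N(1) by simp
    subgoal premises p for x r1 h1 t1
    proof -
      have f1: "frame ?R ?B r h r1 h1" using p(1) by (simp add: I_def)
      show ?thesis
        apply (rule wp_seq, rule wp_sto)
        subgoal by simp
        subgoal by simp
        apply (rule wp_forl[where I = "J x t1" and b = K])
        subgoal by simp
        subgoal
        proof -
          let ?h = "h1(17 := (h1 17)(x := 0))"
          have fr: "frame ?R ?B r h (r1(26 := 0)) ?h" using f1 by (simp add: frame_def)
          have "rok ?h y \<and> rsl ?h y = picks d y" if "y < x" for y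
            using p(1) that by (simp add: I_def rok_def rsl_def)
          moreover have "rok ?h x" "rsl ?h x = []" by (auto simp: rok_def rsl_def)
          ultimately have "J x t1 0 (r1(26 := 0)) ?h t2" if "t2 \<le> t1 + 40" for t2
            using fr p(2) that by (simp add: J_def)
          then show ?thesis using p(2) by simp
        qed
        subgoal premises q for i r' h' t' using gI[of r' h'] q(1) rok_def by (simp add: J_def)
        subgoal using N by simp
        subgoal premises q for i r2 h2 t2
        proof -
          have f2: "frame ?R ?B r h r2 h2" and rk2: "rok h2 x" and r23: "r2 23 = x"
            and ol: "\<And>y. y < x \<Longrightarrow> rok h2 y \<and> rsl h2 y = picks d y"
            and rs2: "rsl h2 x = pick cap (near S K) d x (map S [K..<K + i])" using q(1) by (auto simp: J_def)
          have g2: "gb r2 h2" "r2 22 = d" "r2 0 = n" "r2 6 = K" "r2 11 = cap" using gI[OF f2] by auto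
          let ?j = "K + i"
          have j: "?j < 2 * K" using q(3) by simp
          have sj: "S ?j < n" "h2 13 ?j = S ?j" "h2 14 (?j * n + x) = del (S ?j) x"
            using S[OF j] g2(1) j p(3) unfolding gb_def base_def by auto
          have jb: "?j * n + x < 2 * K * n" using idx_bound[OF j p(3)] .
          have dle: "del (S ?j) x \<le> BIG" using del_le[OF sj(1)] .
          have nxt: "pick cap (near S K) d x (map S [K..<K + Suc i]) =
             (if length (rsl h2 x) < cap \<and> inA (near S K) d x (rsl h2 x) (S ?j) then rsl h2 x @ [S ?j] else rsl h2 x)"
            by (simp add: pick_snoc Let_def rs2)
          have len: "length (rsl h2 x) = h2 17 x" by (simp add: rsl_def)
          have hr: "h2 15 (S ?j) = near S K (S ?j)" using g2(1) sj(1) by (simp add: gb_def)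
          have same: "J x t1 (Suc i) (r3(26 := Suc i)) h2 t3"
            if "frame ?R {} r2 h2 r3 h2" "r3 23 = x" "\<not> (h2 17 x < cap \<and> inA (near S K) d x (rsl h2 x) (S ?j))" "t3 \<le> t2 + TF1 + 700" for r3 t3
          proof -
            have "frame ?R ?B r h (r3(26 := Suc i)) h2" using f2 that(1) by (simp add: frame_def)
            then show ?thesis using that q(1) ol rk2 nxt len by (simp add: J_def)
          qed
          have app: "J x t1 (Suc i) (r3(26 := Suc i)) (h2(16 := (h2 16)(x * cap + h2 17 x := ?j), 17 := (h2 17)(x := Suc (h2 17 x)))) t3"
            if "frame ?R {} r2 h2 r3 h2" "r3 23 = x" "h2 17 x < cap" "inA (near S K) d x (rsl h2 x) (S ?j)" "t3 \<le> t2 + TF1 + 700" for r3 t3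
          proof -
            let ?h = "h2(16 := (h2 16)(x * cap + h2 17 x := ?j), 17 := (h2 17)(x := Suc (h2 17 x)))"
            have fr: "frame ?R ?B r h (r3(26 := Suc i)) ?h" using f2 that(1) by (simp add: frame_def)
            \<comment> \<open>Rows of length \<open>cap\<close> do not overlap, so appending to the
              row of \<open>x\<close> leaves the finished rows intact.\<close>
            have o: "rok ?h y \<and> rsl ?h y = picks d y" if "y < x" for y
            proof -
              have "y * cap + k \<noteq> x * cap + h2 17 x" if "k < h2 17 y" for k
              proof -
                have "k < cap" using that ol[OF \<open>y < x\<close>] by (simp add: rok_def)
                then show ?thesis using idx_bound[OF \<open>y < x\<close>, of k cap] by simp
              qed
              then have "rsl ?h y = rsl h2 y" "rok ?h y = rok h2 y"
                unfolding rsl_def rok_def using that by (auto intro!: map_cong)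
              then show ?thesis using ol[OF that] by simp
            qed
            have k: "rok ?h x" using rk2 that(3) j by (auto simp: rok_def less_Suc_eq)
            have "rsl ?h x = rsl h2 x @ [S ?j]" by (auto simp: rsl_def intro!: map_cong)
            then show ?thesis using fr o k that q(1) nxt len by (simp add: J_def)
          qed
          show ?thesis
            apply (rule wp_seq, rule wp_asg)
            subgoal by simp
            subgoal using g2 q(2) j N(6) by simp
            apply (rule wp_ifl)
            subgoal by simp
            subgoal by simp
            subgoal premises c
              apply (rule wp_seq, rule wp_asg)
              subgoal by simp
              subgoal by simp
              apply (rule wp_seq, rule wp_asg)
              subgoal by simp
              subgoal unfolding fd_def using g2 q(2) r23 jb N(4) by (simp add: add.commute)
              apply (rule wp_seq, rule wp_asg)
              subgoal by simp
              subgoal by simp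
              apply (rule wp_seq, rule flt_wp[where x = x and nd = "del (S ?j) x" and u = "S ?j" and d = d])
              subgoal
                apply (rule gb_frame[OF g2(1), of "{21,30,35,36}" "{}"])
                subgoal by (simp add: frame_def)
                subgoal by (simp add: avoid_def)
                subgoal by simp
                subgoal by simp
                done
              subgoal by (rule rk2)
              subgoal using r23 by simp
              subgoal by (rule p(3))
              subgoal unfolding fd_def using g2 q(2) r23 sj by (simp add: add.commute)
              subgoal by (rule dle)
              subgoal using g2 q(2) sj by (simp add: add.commute)
              subgoal by (rule sj(1))
              subgoal using g2 by simp
              subgoal by (rule d(2))
              subgoal premises w for r3 t3
              proof -
                have fr3: "frame ?R {} r2 h2 r3 h2" using w(1) by (auto simp: frame_def)
                have hh: "r3 22 = d" "r3 30 = S ?j" "r3 23 = x" "r3 11 = cap" "r3 21 = ?j" "r3 26 = i"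
                  using w(1) g2 q(2) sj r23 by (auto simp: frame_def add.commute)
                have cap: "h2 17 x < cap" using c g2 r23 by simp
                have i2: "inA (near S K) d x (rsl h2 x) (S ?j) \<longleftrightarrow> 2 * d < h2 15 (S ?j) \<and> 0 < r3 37"
                  using w(2) hr by (simp add: inA_def)
                show ?thesis
                  apply (rule wp_ifl)
                  subgoal using hh d(2) dlim(1) N(3) by simp
                  subgoal by simp
                  subgoal premises c1
                    apply (rule wp_ifl)
                    subgoal by simp
                    subgoal by simp
                    subgoal premises c2
                      apply (rule wp_seq, rule wp_sto)
                      subgoal using hh cap N(5) p(3) idx_bound[OF p(3) cap] by simp
                      subgoal by simp
                      apply (rule wp_sto)
                      subgoal by simp
                      subgoal using hh cap N(5) by simp
                      subgoal
                      proof -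
                        have i3: "inA (near S K) d x (rsl h2 x) (S ?j)" using c1 c2 hh i2 by simp
                        show ?thesis using app[OF fr3 hh(3) cap i3] hh w(3) by (simp add: fd_def)
                      qed
                      done
                    subgoal premises c2
                      apply (rule wp_skip)
                      subgoal using same[OF fr3 hh(3)] i2 c2 w(3) hh by (simp add: fd_def)
                      done
                    done
                  subgoal premises c1
                    apply (rule wp_skip)
                    subgoal using same[OF fr3 hh(3)] i2 c1 hh w(3) by (simp add: fd_def)
                    done
                  done
              qed
              done
            subgoal premises c
              apply (rule wp_skip)
              subgoal
              proof -
                have "\<not> h2 17 x < cap" using c g2 r23 by simp
                then show ?thesis using same[of "r2(21 := ?j)"] r23 g2 q(2) by (simp add: frame_def add.commute)
              qed
              done
            done
        qed
        subgoal premises q for r2 h2 t2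
        proof -
          have f2: "frame ?R ?B r h r2 h2" using q(1) by (simp add: J_def)
          have "rsl h2 x = picks d x" using q(1) by (simp add: J_def picks_def ss_def mult_2)
          then have "I (Suc x) (r2(23 := Suc x)) h2 t3" if "t3 \<le> t1 + 80 + K * (TF1 + 700)" for t3
            using q(1) that p(1) by (auto simp: I_def J_def frame_def less_Suc_eq)
          then show ?thesis using q(1) by (simp add: J_def)
        qed
        done
    qed
    subgoal premises p for r1 h1 t1
      by (rule Q) (use p(1) in \<open>auto simp: I_def TSel_def\<close>)
    done
qed

end

section \<open>Local searches and the loop over the scales\<close>

context main begin

definition okk :: "nat \<Rightarrow> nat \<Rightarrow> nat \<Rightarrow> nat \<Rightarrow> bool" where
  "okk d u y nd \<longleftrightarrow> 2 * d < near S K y \<and> pass d y (picks d y) u nd"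

definition cand :: "nat \<Rightarrow> nat \<Rightarrow> nat set" where
  "cand d x = {u. u < n \<and> inA (near S K) d x (picks d x) u}"

definition good :: "nat \<Rightarrow> bool" where "good d \<longleftrightarrow> (\<forall>x<n. card (cand d x) \<le> 2 * rt)"

definition lflt :: com where
  "lflt = flt;; ifl (Cn 2 [*] Vr 22) (Ld 15 (Vr 35)) Skip (asg 37 (Cn 0))"

definition TA :: nat where "TA = TF1 + 60 + 100 * L + 400"
definition TL :: nat where "TL = n * (100 * L + 800) + 100 * L + 300"

lemma lflt_wp:
  assumes g: "gb r h" and rk: "rok h x" "rsl h x = picks d x" and r: "r 35 = x" "x < n" "r 36 = nd" "nd < BIG" "r 30 = u" "u < n" "r 22 = d" "d < dlim"
    and Q: "\<And>r' t'. frame {37,43} {} r h r' h \<Longrightarrow> (0 < r' 37 \<longleftrightarrow> okk d u x nd) \<Longrightarrow> t' \<le> t + (TF1 + 60) \<Longrightarrow> Q r' h t'"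
  shows "wp N lflt Q r h t"
  unfolding lflt_def
  apply (rule wp_seq, rule flt_wp[OF g rk(1) r(1-3) _ r(5-8)])
  subgoal using r by simp
  subgoal premises p for r' t'
  proof -
    have hh: "r' 22 = d" "r' 35 = x" using p(1) r by (auto simp: frame_def)
    have hr: "h 15 x = near S K x" using g r(2) by (simp add: gb_def)
    show ?thesis
      apply (rule wp_ifl)
      subgoal using hh r(8) dlim(1) N(3) by simp
      subgoal by simp
      subgoal premises c
        apply (rule wp_skip, rule Q)
        subgoal by (rule p(1))
        subgoal using p(2) c hh hr rk(2) by (simp add: okk_def)
        subgoal using p(3) by simp
        done
      subgoal premises c
        apply (rule wp_asg)
        subgoal by simp
        subgoal by simp
        apply (rule Q)
        subgoal using p(1) by (simp add: frame_def)
        subgoal using c hh hr by (simp add: okk_def)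
        subgoal using p(3) by simp
        done
      done
  qed
  done

text \<open>Two facts to be combined over all sources: whatever is expanded has \<open>u\<close>
  among its candidates, unconditionally; and the search is complete as soon as every vertex with
  candidate \<open>u\<close> still has its counter below the gate.\<close>

lemma ldijk_wp:
  assumes g: "gb r h" and d: "r 22 = d" "d < dlim" and sel: "\<And>x. x < n \<Longrightarrow> rok h x \<and> rsl h x = picks d x"
    and u: "r 30 = u" "u < n" "2 * d < near S K u" and gt: "r 10 = gt" "gt < N"
    and o: "outok m h (r 2)" "r 2 + n < N"
    and Q: "\<And>r' h' t' E. frame DR DB r h r' h' \<Longrightarrow> outok m h' (r' 2) \<Longrightarrow> outs m h (r 2) \<subseteq> outs m h' (r' 2) \<Longrightarrow>
      E \<subseteq> {..<n} \<Longrightarrow> h' 12 = (\<lambda>v. if v \<in> E then h 12 v + 1 else h 12 v) \<Longrightarrow>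
      (\<And>x. x \<in> E \<Longrightarrow> h 12 x < gt \<and> u \<in> cand d x) \<Longrightarrow> r 2 \<le> r' 2 \<Longrightarrow> r' 2 \<le> r 2 + card E \<Longrightarrow>
      ((\<And>x. x < n \<Longrightarrow> u \<in> cand d x \<Longrightarrow> h 12 x < gt) \<Longrightarrow> served (outs m h' (r' 2)) (okk d u) u) \<Longrightarrow>
      t' \<le> t + TL + (\<Sum>x\<in>E. deg x) * TA \<Longrightarrow> Q r' h' t'"
  shows "wp N (dijk 5 6 1 lflt) Q r h t"
proof -
  have avD: "avoid DR DB" by (auto simp: avoid_def DR_def DB_def)
  interpret D: dijkstra n m sr tg wt Wm BIG 5 6 1 lflt N L "TF1 + 60" gt u "okk d u" r h
  proof unfold_locales
    show "wp N lflt Q r1 h1 t1"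
      if f: "frame DR DB r h r1 h1" and r1: "r1 35 < n" "r1 36 < BIG"
        and Q: "\<And>r' t'. frame {37, 43} {} r1 h1 r' h1 \<Longrightarrow> (0 < r' 37) = okk d u (r1 35) (r1 36) \<Longrightarrow> t' \<le> t1 + (TF1 + 60) \<Longrightarrow> Q r' h1 t'" for r1 h1 t1 Q
    proof -
      have g1: "gb r1 h1" by (rule gb_frame[OF g f avD]) simp_all
      have "h1 16 = h 16" "h1 17 = h 17" using f by (simp_all add: frame_def)
      then have s1: "rok h1 (r1 35)" "rsl h1 (r1 35) = picks d (r1 35)"
        using sel[OF r1(1)] by (simp_all add: rok_def rsl_def)
      have "r1 30 = u" "r1 22 = d" using f u d by (simp_all add: frame_def)
      then show ?thesis by (intro lflt_wp[OF g1 s1 refl r1(1) refl r1(2) _ u(2) _ d(2)] Q) auto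
    qed
  qed (use n1 u(1,2) d gt o L N g[unfolded gb_def base_def] in \<open>simp_all\<close>)
  show ?thesis
  proof (rule D.dijk_wp)
    fix r' h' t' P E
    assume st: "D.st r' h' {} P E {e. sr e \<in> E}"
      and t': "t' \<le> t + (n * (100 * L + 800) + 100 * L + 300 + (\<Sum>x\<in>E. deg x) * (TF1 + 60 + 100 * L + 400))"
    note f = D.st_final[OF st]
    have Pn: "P \<subseteq> {..<n}" using st by (auto simp: D.st_def dinv_def)
    \<comment> \<open>Labels are at least distances and \<open>pass\<close> is closed downwards in
      the distance. The source was never filtered, but it passes at distance 0.\<close>
    have cnd: "u \<in> cand d x" if "x \<in> P" for x
    proof -
      have le: "del u x \<le> h' 10 x" using dst_walk(2)[OF f(5)[OF that]] .
      have "pass d x (picks d x) u (del u x)"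
      proof (cases "x = u")
        case False
        then have "pass d x (picks d x) u (h' 10 x)" using f(7)[OF that] by (simp add: okk_def)
        then show ?thesis using le unfolding pass_def by fastforce
      qed (simp add: pass_def)
      then show ?thesis using u by (simp add: cand_def inA_def)
    qed
    show "Q r' h' t'"
    proof (rule Q[where E = E])
      show "served (outs m h' (r' 2)) (okk d u) u" if "\<And>x. x < n \<Longrightarrow> u \<in> cand d x \<Longrightarrow> h 12 x < gt"
      proof -
        have PE: "P = E"
        proof
          show "P \<subseteq> E"
          proof
            fix x assume x: "x \<in> P"
            then have "h 12 x < gt" using that[of x] cnd[OF x] Pn by auto
            then show "x \<in> E" using f(9)[of x] x by force
          qed
        qed (rule f(4))
        have "h' 10 (tg e) \<le> h' 10 (sr e) + wt e" if "e < m" "h' 10 (sr e) < BIG" "okk d u (tg e) (h' 10 (sr e) + wt e)" for e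
          using f(8)[of e] f(1)[of "sr e"] that PE edge[of e] by auto
        moreover have "walk (outs m h' (r' 2)) sr tg wt u v (h' 10 v)" if "v < n" "h' 10 v < BIG" for v
          using f(6)[of v] f(1)[OF that(1)] that PE by auto
        ultimately show ?thesis unfolding served_def using f(2) by (intro exI[of _ "h' 10"]) auto
      qed
      show "h 12 x < gt \<and> u \<in> cand d x" if "x \<in> E" for x using f(4,10) cnd that by auto
      show "t' \<le> t + TL + (\<Sum>x\<in>E. deg x) * TA" using t' by (simp add: TL_def TA_def)
    qed (use st f(3) in \<open>auto simp: D.st_def\<close>)
  qed
qed

definition TLoc :: nat where "TLoc = n * (TL + 100) + m * (2 * rt + 1) * TA + 100"

text \<open>In the invariant, \<open>EE u\<close> is the set expanded by the search from
  \<open>u\<close>; a counter is the number of sources that expanded its vertex, all of them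
  candidates. At a good scale it stays at most \<open>2 * rt\<close>, so no search is cut off; at
  any scale the gate bounds it by \<open>2 * rt + 1\<close>, and thereby output and time.\<close>

lemma locals_wp:
  assumes g: "gb r h" and d: "r 22 = d" "d < dlim" and sel: "\<And>x. x < n \<Longrightarrow> rok h x \<and> rsl h x = picks d x"
    and gt: "r 10 = 2 * rt + 1" and c0: "\<And>v. v < n \<Longrightarrow> h 12 v = 0"
    and o: "outok m h (r 2)" "r 2 + n * (2 * rt + 1) + n < N"
    and Q: "\<And>r' h' t'. frame (DR \<union> {25,30}) DB r h r' h' \<Longrightarrow> outok m h' (r' 2) \<Longrightarrow> outs m h (r 2) \<subseteq> outs m h' (r' 2) \<Longrightarrow>
      r' 2 \<le> r 2 + n * (2 * rt + 1) \<Longrightarrow>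
      (\<And>u. good d \<Longrightarrow> u < n \<Longrightarrow> 2 * d < near S K u \<Longrightarrow> served (outs m h' (r' 2)) (okk d u) u) \<Longrightarrow>
      t' \<le> t + TLoc \<Longrightarrow> Q r' h' t'"
  shows "wp N locals Q r h t"
proof -
  let ?R = "DR \<union> {25,30}"
  have av: "avoid ?R DB" by (auto simp: avoid_def DR_def DB_def)
  define I where "I i r' h' t' \<longleftrightarrow> frame ?R DB r h r' h' \<and> outok m h' (r' 2) \<and> outs m h (r 2) \<subseteq> outs m h' (r' 2) \<and>
     (\<exists>EE. (\<forall>x<n. h' 12 x = card {u. u < i \<and> x \<in> EE u}) \<and> (\<forall>u<i. \<forall>x<n. x \<in> EE u \<longrightarrow> u \<in> cand d x)) \<and>
     (\<forall>x<n. h' 12 x \<le> 2 * rt + 1) \<and> r' 2 \<le> r 2 + (\<Sum>x<n. h' 12 x) \<and>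
     (\<forall>u<i. good d \<longrightarrow> 2 * d < near S K u \<longrightarrow> served (outs m h' (r' 2)) (okk d u) u) \<and>
     t' \<le> t + 6 + i * (TL + 100) + (\<Sum>x<n. h' 12 x * deg x) * TA" for i r' h' t'
  have gI: "gb r' h' \<and> r' 22 = d \<and> r' 0 = n \<and> r' 10 = 2 * rt + 1 \<and> (\<forall>x<n. rok h' x \<and> rsl h' x = picks d x)"
    if "frame ?R DB r h r' h'" for r' h'
  proof -
    have "gb r' h'" by (rule gb_frame[OF g that av]) simp_all
    moreover have "h' 16 = h 16" "h' 17 = h 17" "r' 22 = d" "r' 10 = 2 * rt + 1" using that d gt by (simp_all add: frame_def)
    ultimately show ?thesis using sel by (auto simp: gb_def base_def rok_def rsl_def)
  qed
  \<comment> \<open>The second sum counts the edges scanned at this scale, each vertex being scanned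
    as often as its counter says.\<close>
  have bnd: "(\<Sum>x<n. h' 12 x) \<le> n * (2 * rt + 1)" "(\<Sum>x<n. h' 12 x * deg x) \<le> m * (2 * rt + 1)"
    if "\<forall>x<n. h' 12 x \<le> 2 * rt + 1" for h' :: "nat \<Rightarrow> nat \<Rightarrow> nat"
  proof -
    have "(\<Sum>x<n. h' 12 x) \<le> (\<Sum>x<n. 2 * rt + 1)" using that by (intro sum_mono) auto
    then show "(\<Sum>x<n. h' 12 x) \<le> n * (2 * rt + 1)" by simp
    have "(\<Sum>x<n. h' 12 x * deg x) \<le> (\<Sum>x<n. (2 * rt + 1) * deg x)" using that by (intro sum_mono mult_right_mono) auto
    also have "\<dots> = (2 * rt + 1) * m" by (simp only: sum_distrib_left[symmetric] sum_deg)
    finally show "(\<Sum>x<n. h' 12 x * deg x) \<le> m * (2 * rt + 1)" by (simp add: mult.commute)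
  qed
  show ?thesis
    unfolding locals_def
    apply (fold lflt_def)
    apply (rule wp_forl[where I = I and b = n])
    subgoal by simp
    subgoal
    proof -
      have "(\<Sum>x<n. h 12 x) = 0" "(\<Sum>x<n. h 12 x * deg x) = 0" using c0 by simp_all
      then show ?thesis using o(1) c0 unfolding I_def by (auto simp: frame_def intro!: exI[of _ "\<lambda>_. {}"])
    qed
    subgoal premises p for i r' h' t' using gI[of r' h'] p(1) by (simp add: I_def)
    subgoal using N(1) by simp
    subgoal premises p for i r1 h1 t1
    proof -
      have f1: "frame ?R DB r h r1 h1" and I1: "I i r1 h1 t1" using p(1) by (simp_all add: I_def)
      have g1: "gb r1 h1" "r1 22 = d" "r1 10 = 2 * rt + 1" "\<And>x. x < n \<Longrightarrow> rok h1 x \<and> rsl h1 x = picks d x" using gI[OF f1] by auto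
      obtain EE where EE: "\<And>x. x < n \<Longrightarrow> h1 12 x = card {u. u < i \<and> x \<in> EE u}" "\<And>u x. u < i \<Longrightarrow> x < n \<Longrightarrow> x \<in> EE u \<Longrightarrow> u \<in> cand d x"
        using I1 unfolding I_def by blast
      have cI: "\<forall>x<n. h1 12 x \<le> 2 * rt + 1" using I1 by (simp add: I_def)
      have r2: "r1 2 + n < N" using I1 bnd(1)[of h1, OF cI] o(2) by (simp add: I_def)
      have hr: "h1 15 i = near S K i" using g1(1) p(3) by (simp add: gb_def)
      have cS: "card {u. u < Suc i \<and> x \<in> (EE(i := E)) u} = card {u. u < i \<and> x \<in> EE u} + (if x \<in> E then 1 else 0)" for x E
      proof -
        have "{u. u < Suc i \<and> x \<in> (EE(i := E)) u} = {u. u < i \<and> x \<in> EE u} \<union> (if x \<in> E then {i} else {})"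
          by (auto simp: less_Suc_eq)
        then show ?thesis by simp
      qed
      show ?thesis
        apply (rule wp_ifl)
        subgoal using g1 d dlim(1) N(3) by simp
        subgoal by simp
        subgoal premises c
        proof -
          have lt: "2 * d < near S K i" using c g1 hr p(2) by simp
          show ?thesis
            apply (rule wp_seq, rule wp_asg)
            subgoal by simp
            subgoal by simp
            apply (rule ldijk_wp[where d = d and u = i and gt = "2 * rt + 1"])
            subgoal
              apply (rule gb_frame[OF g1(1), of "{30}" "{}"])
              subgoal by (simp add: frame_def)
              subgoal by (simp add: avoid_def)
              subgoal by simp
              subgoal by simp
              done
            subgoal using g1 by simp
            subgoal by (rule d(2))
            subgoal by (rule g1(4))
            subgoal using p(2) by simp
            subgoal by (rule p(3))
            subgoal by (rule lt)
            subgoal using g1 by simp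
            subgoal by (rule N(8))
            subgoal using I1 by (simp add: I_def)
            subgoal using r2 by simp
            subgoal premises q for r2 h2 t2 E
            proof -
              have f2: "frame ?R DB r h (r2(25 := Suc i)) h2" using f1 q(1) by (simp add: frame_def)
              have r25: "r2 25 = i" using q(1) p(2) by (simp add: frame_def)
              have s1: "(\<Sum>x<n. h2 12 x) = (\<Sum>x<n. h1 12 x) + card E"
              proof -
                have "(\<Sum>x<n. h2 12 x) = (\<Sum>x<n. h1 12 x + (if x \<in> E then 1 else 0))" unfolding q(5) by (intro sum.cong) auto
                also have "\<dots> = (\<Sum>x<n. h1 12 x) + (\<Sum>x<n. if x \<in> E then 1 else 0)" by (rule sum.distrib)
                also have "(\<Sum>x<n. if x \<in> E then 1 else 0) = card ({..<n} \<inter> E)" by (simp add: sum.If_cases)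
                also have "{..<n} \<inter> E = E" using q(4) by auto
                finally show ?thesis .
              qed
              have s2: "(\<Sum>x<n. h2 12 x * deg x) = (\<Sum>x<n. h1 12 x * deg x) + (\<Sum>x\<in>E. deg x)"
              proof -
                have "(\<Sum>x<n. h2 12 x * deg x) = (\<Sum>x<n. h1 12 x * deg x + (if x \<in> E then deg x else 0))" unfolding q(5) by (intro sum.cong) auto
                also have "\<dots> = (\<Sum>x<n. h1 12 x * deg x) + (\<Sum>x<n. if x \<in> E then deg x else 0)" by (rule sum.distrib)
                also have "(\<Sum>x<n. if x \<in> E then deg x else 0) = (\<Sum>x\<in>{..<n} \<inter> E. deg x)" by (simp add: sum.If_cases)
                also have "{..<n} \<inter> E = E" using q(4) by auto
                finally show ?thesis .
              qed
              have sv: "served (outs m h2 (r2 2)) (okk d i) i" if "good d"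
              proof (rule q(9))
                fix x assume x: "x < n" "i \<in> cand d x"
                have "h1 12 x \<le> card (cand d x)"
                  unfolding EE(1)[OF x(1)] using EE(2)[OF _ x(1)] by (intro card_mono) (auto simp: cand_def)
                then show "h1 12 x < 2 * rt + 1" using that x(1) by (auto simp: good_def)
              qed
              have o12: "outs m h1 (r1 2) \<subseteq> outs m h2 (r2 2)" using q(3) by simp
              have sv': "\<forall>u<Suc i. good d \<longrightarrow> 2 * d < near S K u \<longrightarrow> served (outs m h2 (r2 2)) (okk d u) u"
                using sv I1 served_mono[OF _ o12] unfolding I_def less_Suc_eq by auto
              have ee: "\<exists>EE. (\<forall>x<n. h2 12 x = card {u. u < Suc i \<and> x \<in> EE u}) \<and> (\<forall>u<Suc i. \<forall>x<n. x \<in> EE u \<longrightarrow> u \<in> cand d x)"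
              proof (intro exI[of _ "EE(i := E)"] conjI allI impI)
                show "h2 12 x = card {u. u < Suc i \<and> x \<in> (EE(i := E)) u}" if "x < n" for x
                  unfolding cS q(5) using EE(1)[OF that] by simp
                show "u \<in> cand d x" if "u < Suc i" "x < n" "x \<in> (EE(i := E)) u" for u x
                  using EE(2)[of u x] q(6)[of x] that by (cases "u = i") auto
              qed
              have "I (Suc i) (r2(25 := Suc i)) h2 t3" if "t3 \<le> t2 + 40" for t3
                unfolding I_def
              proof (intro conjI)
                show "\<forall>x<n. h2 12 x \<le> 2 * rt + 1" using cI q(6) unfolding q(5) by (auto simp: Suc_le_eq less_Suc_eq_le)
                show "outs m h (r 2) \<subseteq> outs m h2 ((r2(25 := Suc i)) 2)" using q(3) I1 by (auto simp: I_def)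
                show "(r2(25 := Suc i)) 2 \<le> r 2 + (\<Sum>x<n. h2 12 x)" using q(8) I1 by (simp add: s1 I_def)
                show "t3 \<le> t + 6 + Suc i * (TL + 100) + (\<Sum>x<n. h2 12 x * deg x) * TA"
                proof -
                  have "t1 \<le> t + 6 + i * (TL + 100) + (\<Sum>x<n. h1 12 x * deg x) * TA" using I1 by (simp add: I_def)
                  then show ?thesis using that q(10) unfolding s2 add_mult_distrib mult_Suc tc.simps by linarith
                qed
              qed (use f2 q(2) sv' ee in simp_all)
              then show ?thesis using r25 by simp
            qed
            done
        qed
        subgoal premises c
        proof -
          have lt: "\<not> 2 * d < near S K i" using c g1 hr p(2) by simp
          have "I (Suc i) (r1(25 := Suc i)) h1 t3" if "t3 \<le> t1 + 40" for t3
            unfolding I_def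
          proof (intro conjI)
            show "frame ?R DB r h (r1(25 := Suc i)) h1" using f1 by (simp add: frame_def)
            show "\<exists>EE. (\<forall>x<n. h1 12 x = card {u. u < Suc i \<and> x \<in> EE u}) \<and> (\<forall>u<Suc i. \<forall>x<n. x \<in> EE u \<longrightarrow> u \<in> cand d x)"
            proof (intro exI[of _ "EE(i := {})"] conjI allI impI)
              show "h1 12 x = card {u. u < Suc i \<and> x \<in> (EE(i := {})) u}" if "x < n" for x
                unfolding cS using EE(1)[OF that] by simp
              show "u \<in> cand d x" if "u < Suc i" "x < n" "x \<in> (EE(i := {})) u" for u x
                using EE(2)[of u x] that by (cases "u = i") auto
            qed
            show "\<forall>u<Suc i. good d \<longrightarrow> 2 * d < near S K u \<longrightarrow> served (outs m h1 ((r1(25 := Suc i)) 2)) (okk d u) u"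
              using I1 lt by (auto simp: I_def less_Suc_eq)
            show "t3 \<le> t + 6 + Suc i * (TL + 100) + (\<Sum>x<n. h1 12 x * deg x) * TA"
              using that I1 by (simp add: I_def)
          qed (use I1 in \<open>simp_all add: I_def\<close>)
          then show ?thesis using p(2) by (intro wp_skip) simp
        qed
        done
    qed
    subgoal premises p for r1 h1 t1
    proof (rule Q)
      have cI: "\<forall>x<n. h1 12 x \<le> 2 * rt + 1" using p(1) by (simp add: I_def)
      show "r1 2 \<le> r 2 + n * (2 * rt + 1)" using p(1) bnd(1)[of h1, OF cI] by (simp add: I_def)
      have "(\<Sum>x<n. h1 12 x * deg x) * TA \<le> m * (2 * rt + 1) * TA" using bnd(2)[of h1, OF cI] by (rule mult_right_mono) simp
      moreover have "t1 \<le> t + 6 + n * (TL + 100) + (\<Sum>x<n. h1 12 x * deg x) * TA" using p(1) by (simp add: I_def)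
      ultimately show "t1 + (tc (Vr 0) + 7) \<le> t + TLoc" unfolding TLoc_def tc.simps by linarith
    qed (use p(1) in \<open>auto simp: I_def\<close>)
    done
qed

definition RS :: "nat set" where "RS = DR \<union> {10,21,22,23,25,26,30,35,36,37,43}"
definition BS :: "nat set" where "BS = DB \<union> {16,17}"

definition TS :: nat where "TS = TSel + TLoc + 40 * n + 200"

lemma scales_wp:
  assumes g: "gb r h" and o: "outok m h (r 2)" "r 2 + Ns * (n * (2 * rt + 1)) + n < N"
    and q: "q \<le> N" and Ns: "\<And>i. ds q i < dlim \<Longrightarrow> i < Ns"
    and Q: "\<And>r' h' t'. frame RS BS r h r' h' \<Longrightarrow> outok m h' (r' 2) \<Longrightarrow> outs m h (r 2) \<subseteq> outs m h' (r' 2) \<Longrightarrow>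
      r' 2 \<le> r 2 + Ns * (n * (2 * rt + 1)) \<Longrightarrow>
      (\<And>i u. ds q i < dlim \<Longrightarrow> good (ds q i) \<Longrightarrow> u < n \<Longrightarrow> 2 * ds q i < near S K u \<Longrightarrow>
        served (outs m h' (r' 2)) (okk (ds q i) u) u) \<Longrightarrow>
      t' \<le> t + Ns * TS + 100 \<Longrightarrow> Q r' h' t'"
  shows "wp N (scales q) Q r h t"
proof -
  have av: "avoid RS BS" by (auto simp: avoid_def RS_def BS_def DR_def DB_def)
  define J where "J r' h' t' \<longleftrightarrow> (\<exists>i\<le>Ns. r' 22 = ds q i \<and> frame RS BS r h r' h' \<and> r' 10 = 2 * rt + 1 \<and>
     outok m h' (r' 2) \<and> outs m h (r 2) \<subseteq> outs m h' (r' 2) \<and> r' 2 \<le> r 2 + i * (n * (2 * rt + 1)) \<and>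
     (\<forall>k<i. \<forall>u<n. good (ds q k) \<longrightarrow> 2 * ds q k < near S K u \<longrightarrow> served (outs m h' (r' 2)) (okk (ds q k) u) u) \<and>
     t' \<le> t + 40 + i * TS)" for r' h' t'
  have r: "r 3 = rt" using g by (simp add: gb_def base_def)
  have gI: "gb r' h' \<and> r' 12 = dlim \<and> r' 0 = n" if "frame RS BS r h r' h'" for r' h'
  proof -
    have "gb r' h'" by (rule gb_frame[OF g that av]) (simp_all add: BS_def)
    then show ?thesis by (simp add: gb_def base_def)
  qed
  show ?thesis
    unfolding scales_def
    apply (rule wp_seq, rule wp_asg)
    subgoal by simp
    subgoal using N(8) N(1) r by simp
    apply (rule wp_seq, rule wp_asg)
    subgoal by simp
    subgoal using N(1) by simp
    apply (rule wp_whl[where I = J and v = "\<lambda>r h. dlim - r 22"])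
    subgoal unfolding J_def by (rule exI[of _ 0]) (use o r in \<open>simp add: frame_def RS_def\<close>)
    subgoal by simp
    subgoal premises p for r1 h1 t1
    proof -
      obtain i where i: "i \<le> Ns" "r1 22 = ds q i" "frame RS BS r h r1 h1" "r1 10 = 2 * rt + 1"
        "outok m h1 (r1 2)" "outs m h (r 2) \<subseteq> outs m h1 (r1 2)" "r1 2 \<le> r 2 + i * (n * (2 * rt + 1))"
        "\<And>k u. k < i \<Longrightarrow> u < n \<Longrightarrow> good (ds q k) \<Longrightarrow> 2 * ds q k < near S K u \<Longrightarrow> served (outs m h1 (r1 2)) (okk (ds q k) u) u"
        "t1 \<le> t + 40 + i * TS" using p(1) unfolding J_def by blast
      have g1: "gb r1 h1" "r1 12 = dlim" using gI[OF i(3)] by auto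
      have dl: "ds q i < dlim" using p(2) g1 i(2) by simp
      have iN: "i < Ns" using Ns[OF dl] .
      then have "(i + 1) * (n * (2 * rt + 1)) \<le> Ns * (n * (2 * rt + 1))" by (intro mult_right_mono) auto
      then have r1N: "r1 2 + n * (2 * rt + 1) + n < N" using i(7) o(2) by simp
      show ?thesis
        apply (rule wp_seq, rule select_wp[OF g1(1) i(2) dl])
        subgoal premises q2 for r2 h2 t2
        proof -
          have g2: "gb r2 h2" by (rule gb_frame[OF g1(1) q2(1)]) (simp_all add: avoid_def)
          show ?thesis
            apply (rule wp_seq, rule resetcnt_wp)
            subgoal using g2 by (simp add: gb_def base_def)
            subgoal premises q3 for r3 h3 t3
            proof -
              have g3: "gb r3 h3" by (rule gb_frame[OF g2 q3(1)]) (simp_all add: avoid_def)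
              have hs: "r3 2 = r1 2" "r3 22 = ds q i" "r3 10 = 2 * rt + 1" "h3 3 = h1 3" "h3 4 = h1 4" "h3 0 = h1 0" "h3 1 = h1 1" "h3 16 = h2 16" "h3 17 = h2 17"
                using q2(1) q3(1) i(2,4) by (simp_all add: frame_def)
              have oo: "outs m h3 c = outs m h1 c" "outok m h3 c = outok m h1 c" for c
                by (simp_all add: outs_def outok_def hs del: One_nat_def)
              show ?thesis
                apply (rule wp_seq, rule locals_wp[OF g3 hs(2) dl _ hs(3) q3(2)])
                subgoal for x using q2(2)[of x] by (simp add: rok_def rsl_def hs)
                subgoal by assumption
                subgoal using i(5) by (simp add: oo hs)
                subgoal using r1N by (simp add: hs)
                subgoal premises q4 for r4 h4 t4
                proof -
                  have r4: "r4 22 = ds q i" "r4 10 = 2 * rt + 1" using q4(1) hs by (simp_all add: frame_def)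
                  have f4: "frame RS BS r h (r4(22 := v)) h4" for v
                    using i(3) q2(1) q3(1) q4(1) by (simp add: frame_def RS_def BS_def)
                  have o14: "outs m h1 (r1 2) \<subseteq> outs m h4 (r4 2)" using q4(3) by (simp add: oo hs)
                  have sv: "\<forall>k<Suc i. \<forall>u<n. good (ds q k) \<longrightarrow> 2 * ds q k < near S K u \<longrightarrow> served (outs m h4 (r4 2)) (okk (ds q k) u) u"
                    using q4(5) served_mono[OF i(8) o14] by (auto simp: less_Suc_eq)
                  have J: "J (r4(22 := ds q (Suc i))) h4 t5" if "t5 \<le> t4 + 60" for t5
                    unfolding J_def
                  proof (intro exI[of _ "Suc i"] conjI)
                    show "outs m h (r 2) \<subseteq> outs m h4 ((r4(22 := ds q (Suc i))) 2)" using i(6) o14 by auto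
                    show "(r4(22 := ds q (Suc i))) 2 \<le> r 2 + Suc i * (n * (2 * rt + 1))" using q4(4) i(7) by (simp add: hs)
                    show "t5 \<le> t + 40 + Suc i * TS" using that q4(6) q3(3) q2(3) i(9) by (simp add: TS_def)
                  qed (use iN f4 r4 q4(2) sv in simp_all)
                  have "ds q i div q \<le> ds q i" by simp
                  then have dd: "Suc (ds q i + ds q i div q) \<le> N" using dl dlim(1) N(3) by linarith
                  show ?thesis
                    apply (rule wp_asg)
                    subgoal by simp
                    subgoal using r4 dd q by simp
                    subgoal using J r4 dl i(2) by simp
                    done
                qed
                done
            qed
            done
        qed
        done
    qed
    subgoal premises p for r1 h1 t1
    proof -
      obtain i where i: "i \<le> Ns" "r1 22 = ds q i" "frame RS BS r h r1 h1"
        "outok m h1 (r1 2)" "outs m h (r 2) \<subseteq> outs m h1 (r1 2)" "r1 2 \<le> r 2 + i * (n * (2 * rt + 1))"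
        "\<And>k u. k < i \<Longrightarrow> u < n \<Longrightarrow> good (ds q k) \<Longrightarrow> 2 * ds q k < near S K u \<Longrightarrow> served (outs m h1 (r1 2)) (okk (ds q k) u) u"
        "t1 \<le> t + 40 + i * TS" using p(1) unfolding J_def by blast
      have ge: "dlim \<le> ds q i" using p(2) gI[OF i(3)] i(2) by simp
      show ?thesis
      proof (rule Q)
        have "i * (n * (2 * rt + 1)) \<le> Ns * (n * (2 * rt + 1))" using i(1) by (rule mult_right_mono) simp
        then show "r1 2 \<le> r 2 + Ns * (n * (2 * rt + 1))" using i(6) by linarith
        have "i * TS \<le> Ns * TS" using i(1) by (rule mult_right_mono) simp
        then show "t1 + (tc (Vr 22) + tc (Vr 12) + 4) \<le> t + Ns * TS + 100" using i(8) unfolding tc.simps by linarith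
        show "served (outs m h1 (r1 2)) (okk (ds q k) u) u"
          if "ds q k < dlim" "good (ds q k)" "u < n" "2 * ds q k < near S K u" for k u
        proof -
          have "k < i" using that(1) ge ds_mono[of i k q] by (metis le_trans not_le)
          then show ?thesis using i(7) that by blast
        qed
      qed (use i in auto)
    qed
    done
qed

end

section \<open>Prelude and sampling\<close>

definition sqn :: "nat \<Rightarrow> nat" where "sqn n = (LEAST r. n \<le> r * r)"
text \<open>The condition \<open>1 \<le> l\<close> matches the doubling loop of the program, which
  starts with exponent 1; thus the number of samples is positive even for \<open>n = 1\<close> if
  \<kappa> is positive.\<close>

definition lgn :: "nat \<Rightarrow> nat" where "lgn n = (LEAST l. 1 \<le> l \<and> n \<le> 2 ^ l)"

lemma sqn_props:
  assumes "1 \<le> n"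
  shows "n \<le> sqn n * sqn n" "1 \<le> sqn n" "(sqn n - 1) * (sqn n - 1) < n" "r * r < n \<Longrightarrow> r < sqn n" "sqn n * sqn n \<le> 4 * n"
proof -
  show a: "n \<le> sqn n * sqn n" unfolding sqn_def by (rule LeastI[of _ n]) simp
  then show b: "1 \<le> sqn n" using assms by (cases "sqn n") auto
  have "\<not> n \<le> (sqn n - 1) * (sqn n - 1)" using not_less_Least[of "sqn n - 1" "\<lambda>r. n \<le> r * r"] b unfolding sqn_def[symmetric] by simp
  then show c: "(sqn n - 1) * (sqn n - 1) < n" by simp
  show "r < sqn n" if "r * r < n"
  proof (rule ccontr)
    assume "\<not> r < sqn n"
    then have "sqn n * sqn n \<le> r * r" by (intro mult_mono) auto
    then show False using a that by simp
  qed
  show "sqn n * sqn n \<le> 4 * n"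
  proof (cases "sqn n = 1")
    case False
    then have "sqn n \<le> 2 * (sqn n - 1)" using b by (cases "sqn n") auto
    then have "sqn n * sqn n \<le> (2 * (sqn n - 1)) * (2 * (sqn n - 1))" by (intro mult_mono) auto
    then show ?thesis using c by simp
  qed (use assms in simp)
qed

lemma lgn_props:
  assumes "1 \<le> n"
  shows "n \<le> 2 ^ lgn n" "1 \<le> lgn n" "2 ^ (lgn n - 1) \<le> n" "1 \<le> l \<Longrightarrow> 2 ^ l < n \<Longrightarrow> l < lgn n"
proof -
  have "1 \<le> n \<and> n \<le> 2 ^ n" using assms by (simp add: less_imp_le)
  from LeastI[of "\<lambda>l. 1 \<le> l \<and> n \<le> 2 ^ l", OF this] have a: "1 \<le> lgn n \<and> n \<le> 2 ^ lgn n" by (simp add: lgn_def)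
  then show "n \<le> 2 ^ lgn n" "1 \<le> lgn n" by auto
  show "2 ^ (lgn n - 1) \<le> n"
  proof (cases "lgn n = 1")
    case False
    then have "\<not> (1 \<le> lgn n - 1 \<and> n \<le> 2 ^ (lgn n - 1))"
      using not_less_Least[of "lgn n - 1" "\<lambda>l. 1 \<le> l \<and> n \<le> 2 ^ l"] a unfolding lgn_def[symmetric] by simp
    moreover have "1 \<le> lgn n - 1" using False a by linarith
    ultimately show ?thesis by simp
  qed (use assms in simp)
  show "l < lgn n" if "1 \<le> l" "2 ^ l < n"
  proof (rule ccontr)
    assume "\<not> l < lgn n"
    then have "(2 :: nat) ^ lgn n \<le> 2 ^ l" by (intro power_increasing) auto
    then show False using a that(2) by linarith
  qed
qed

fun mx :: "(nat \<Rightarrow> nat) \<Rightarrow> nat \<Rightarrow> nat" where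
  "mx f 0 = 0"
| "mx f (Suc k) = max (mx f k) (f k)"

lemma mx_ge: "e < k \<Longrightarrow> f e \<le> mx f k"
  by (induction k) (auto simp: less_Suc_eq max_def intro: le_trans)

lemma mx_le: "(\<And>e. e < k \<Longrightarrow> f e \<le> M) \<Longrightarrow> mx f k \<le> M"
  by (induction k) auto

definition PR :: "nat set" where "PR = {3,4,5,6,7,8,9,10,11,12,13,20,21}"

lemma prelude_wp:
  fixes sr tg wt :: "nat \<Rightarrow> nat"
  assumes n1: "1 \<le> n" and r: "r 0 = n" "r 1 = m"
    and e: "\<And>e. e < m \<Longrightarrow> h 0 e = sr e \<and> h (Suc 0) e = tg e \<and> h 2 e = wt e \<and> sr e < n \<and> tg e < n"
    and z: "r 5 = 0" "\<And>v. h 5 v = 0" "\<And>v. h 7 v = 0"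
    and N: "4 * n + 4 \<le> N" "m < N" "\<kappa> * sqn n * lgn n * 2 \<le> N" "3 * \<kappa> * lgn n \<le> N" "(2 * (4 * n * mx wt m + 1)) * n \<le> N" "\<kappa> * 3 \<le> N"
    and Q: "\<And>r' h' t'. frame PR {5,6,7,8} r h r' h' \<Longrightarrow> r' 3 = sqn n \<Longrightarrow> r' 6 = \<kappa> * sqn n * lgn n \<Longrightarrow> r' 7 = 2 * (\<kappa> * sqn n * lgn n) \<Longrightarrow>
      r' 12 = 4 * n * mx wt m + 1 \<Longrightarrow> r' 8 = 2 * (4 * n * mx wt m + 1) \<Longrightarrow> r' 9 = 2 * (4 * n * mx wt m + 1) * n \<Longrightarrow>
      r' 10 = 1 \<Longrightarrow> r' 11 = 3 * \<kappa> * lgn n \<Longrightarrow> r' 13 = 1 \<Longrightarrow> r' 20 = 0 \<Longrightarrow>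
      (\<And>e. e < m \<Longrightarrow> h' 6 e = prv sr (sr e) e \<and> h' 8 e = prv tg (tg e) e) \<Longrightarrow>
      (\<And>v. v < n \<Longrightarrow> h' 5 v = prv sr v m \<and> h' 7 v = prv tg v m) \<Longrightarrow>
      t' \<le> t + (60 * sqn n + 80 * lgn n + 200 * m + 500) \<Longrightarrow> Q r' h' t'"
  shows "wp N (prelude \<kappa>) Q r h t"
proof -
  note sq = sqn_props[OF n1] and lg = lgn_props[OF n1]
  define W where "W = mx wt m"
  \<comment> \<open>The clock is bounded together with the charge for the rounds still to come,
    which replaces a count of past rounds.\<close>
  define I1 where "I1 r' h' t' \<longleftrightarrow> h' = h \<and> frame {3} {} r h r' h \<and> r' 3 \<le> sqn n \<and> 1 \<le> r' 3 \<and> t' + 60 * (sqn n - r' 3) \<le> t + 10 + 60 * sqn n" for r' h' t'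
  define I2 where "I2 r' h' t' \<longleftrightarrow> h' = h \<and> frame {3,4,21} {} r h r' h \<and> r' 3 = sqn n \<and> r' 4 \<le> lgn n \<and> 1 \<le> r' 4 \<and> r' 21 = 2 ^ r' 4 \<and>
    t' + 80 * (lgn n - r' 4) \<le> t + 60 + 60 * sqn n + 80 * lgn n" for r' h' t'
  define I3 where "I3 j r' h' t' \<longleftrightarrow> frame {3,4,5,20,21} {5,6,7,8} r h r' h' \<and> r' 3 = sqn n \<and> r' 4 = lgn n \<and> r' 5 = mx wt j \<and>
    (\<forall>e<j. h' 6 e = prv sr (sr e) e \<and> h' 8 e = prv tg (tg e) e) \<and> (\<forall>v<n. h' 5 v = prv sr v j \<and> h' 7 v = prv tg v j) \<and>
    t' \<le> t + 120 + 60 * sqn n + 80 * lgn n + 200 * j" for j r' h' t'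
  show ?thesis
    unfolding prelude_def
    apply (rule wp_seq, rule wp_asg)
    subgoal by simp
    subgoal using N(1) by simp
    apply (rule wp_seq, rule wp_whl[where I = I1 and v = "\<lambda>r h. sqn n - r 3"])
    subgoal using sq by (simp add: I1_def frame_def)
    subgoal premises p for r1 h1 t1
    proof -
      have "r1 3 * r1 3 \<le> sqn n * sqn n" using p by (intro mult_mono) (auto simp: I1_def)
      then show ?thesis using sq(5) N(1) by simp
    qed
    subgoal premises p for r1 h1 t1
    proof -
      have "r1 0 = n" using p(1) r by (simp add: I1_def frame_def)
      then have lt: "r1 3 < sqn n" using p(2) sq(4) by simp
      have "sqn n \<le> sqn n * sqn n" by simp
      then have "sqn n \<le> N" using sq(5) N(1) by linarith
      then show ?thesis
        apply (intro wp_asg)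
        subgoal by simp
        subgoal using lt N(1) by simp
        subgoal using p(1) lt by (auto simp: I1_def frame_def)
        done
    qed
    subgoal premises p for r1 h1 t1
    proof -
      have r10: "r1 0 = n" "h1 = h" using p(1) r by (simp_all add: I1_def frame_def)
      have "sqn n \<le> r1 3" using p(2) r10 unfolding sqn_def by (intro Least_le) simp
      then have r13: "r1 3 = sqn n" using p(1) by (simp add: I1_def)
      show ?thesis
        apply (rule wp_seq, rule wp_asg)
        subgoal by simp
        subgoal using N(1) by simp
        apply (rule wp_seq, rule wp_asg)
        subgoal by simp
        subgoal using N(1) by simp
        apply (rule wp_seq, rule wp_whl[where I = I2 and v = "\<lambda>r h. lgn n - r 4"])
        subgoal
        proof -
          obtain k where "lgn n = Suc k" using lg(2) by (cases "lgn n") auto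
          then show ?thesis using p(1) r13 by (simp add: I1_def I2_def frame_def)
        qed
        subgoal by simp
        subgoal premises q for r2 h2 t2
        proof -
          have "r2 0 = n" using q(1) r by (simp add: I2_def frame_def)
          then have b: "r2 21 < n" using q(2) by simp
          then have lt: "r2 4 < lgn n" using q(1) lg(4)[of "r2 4"] by (simp add: I2_def)
          have "r2 21 = 2 ^ r2 4" using q(1) by (simp add: I2_def)
          then have b4: "r2 4 < n" using b less_exp[of "r2 4"] by linarith
          show ?thesis
            apply (rule wp_seq, rule wp_asg)
            subgoal by simp
            subgoal using b N(1) by simp
            apply (rule wp_asg)
            subgoal by simp
            subgoal using b4 N(1) by simp
            subgoal using q(1) lt by (auto simp: I2_def frame_def)
            done
        qed
        subgoal premises q for r2 h2 t2
        proof -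
          have r20: "r2 0 = n" "h2 = h" using q(1) r by (simp_all add: I2_def frame_def)
          have "lgn n \<le> r2 4" using q r20 unfolding lgn_def by (intro Least_le) (simp add: I2_def)
          then have r24: "r2 4 = lgn n" using q(1) by (simp add: I2_def)
          show ?thesis
            apply (rule wp_seq, rule wp_forl[where I = I3 and b = m])
            subgoal by simp
            subgoal using q(1) r24 z r20 by (simp add: I2_def I3_def frame_def)
            subgoal using r by (simp add: I3_def frame_def)
            subgoal by (rule N(2))
            subgoal premises w for j r3 h3 t3
            proof -
              have hj: "h3 0 j = sr j" "h3 (Suc 0) j = tg j" "h3 2 j = wt j" "sr j < n" "tg j < n"
                using e[OF w(3)] w(1) by (simp_all add: I3_def frame_def)
              have hv: "h3 5 (sr j) = prv sr (sr j) j" "h3 7 (tg j) = prv tg (tg j) j" using w(1) hj by (simp_all add: I3_def)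
              let ?h = "h3(6 := (h3 6)(j := prv sr (sr j) j), 5 := (h3 5)(sr j := Suc j), 8 := (h3 8)(j := prv tg (tg j) j), 7 := (h3 7)(tg j := Suc j))"
              have fin: "I3 (Suc j) (r4(20 := Suc j)) ?h t4" if "frame {5} {} r3 h3 r4 h3" "r4 5 = max (r3 5) (wt j)" "t4 \<le> t3 + 200" for r4 t4
                unfolding I3_def
              proof (intro conjI)
                show "frame {3,4,5,20,21} {5,6,7,8} r h (r4(20 := Suc j)) ?h" using that(1) w(1) by (simp add: I3_def frame_def)
                show "\<forall>e<Suc j. ?h 6 e = prv sr (sr e) e \<and> ?h 8 e = prv tg (tg e) e" using w(1) by (auto simp: I3_def less_Suc_eq)
                show "\<forall>v<n. ?h 5 v = prv sr v (Suc j) \<and> ?h 7 v = prv tg v (Suc j)" using w(1) by (auto simp: I3_def)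
              qed (use that w(1) in \<open>simp_all add: I3_def frame_def\<close>)
              show ?thesis
                apply (rule wp_seq, rule wp_sto)
                subgoal by simp
                subgoal by simp
                apply (rule wp_seq, rule wp_sto)
                subgoal by simp
                subgoal using w N(2) by simp
                apply (rule wp_seq, rule wp_sto)
                subgoal by simp
                subgoal by simp
                apply (rule wp_seq, rule wp_sto)
                subgoal by simp
                subgoal using w N(2) by simp
                apply (rule wp_ifl)
                subgoal by simp
                subgoal by simp
                subgoal premises c
                  apply (rule wp_asg)
                  subgoal by simp
                  subgoal by simp
                  subgoal using fin[of "r3(5 := wt j)"] c w(2) hj hv by (simp add: frame_def max_def)
                  done
                subgoal premises c
                  apply (rule wp_skip)
                  subgoal using fin[of r3] c w(2) hj hv by (simp add: frame_def max_def)
                  done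
                done
            qed
            subgoal premises w for r3 h3 t3
            proof -
              have hh: "r3 0 = n" "r3 3 = sqn n" "r3 4 = lgn n" "r3 5 = W" using w(1) r by (simp_all add: I3_def frame_def W_def)
              have NN: "1 \<le> N" "2 \<le> N" "4 \<le> N" "\<kappa> \<le> N" "\<kappa> * 3 \<le> N" "\<kappa> * sqn n \<le> N" "4 * n \<le> N" "\<kappa> * sqn n * lgn n \<le> N" "2 * (\<kappa> * sqn n * lgn n) \<le> N" "3 * \<kappa> * lgn n \<le> N"
                "4 * n * W + 1 \<le> N" "4 * n * W \<le> N" "2 * (4 * n * W + 1) \<le> N" "2 * (4 * n * W + 1) * n \<le> N"
              proof -
                have dbl: "x \<le> N" if "2 * x \<le> N" for x using that by simp
                have a: "2 * (4 * n * W + 1) \<le> 2 * (4 * n * W + 1) * n"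
                  using mult_le_mono2[OF n1, of "2 * (4 * n * W + 1)"] by (simp only: mult_1_right)
                then show "2 * (4 * n * W + 1) \<le> N" using N(5) unfolding W_def by (rule le_trans)
                then show e: "4 * n * W + 1 \<le> N" by (rule dbl)
                show "4 * n * W \<le> N" using e by simp
                show "2 * (4 * n * W + 1) * n \<le> N" using N(5) unfolding W_def .
                have b: "\<kappa> * sqn n \<le> \<kappa> * sqn n * lgn n" using lg(2) by simp
                show "2 * (\<kappa> * sqn n * lgn n) \<le> N" using N(3) by (simp add: mult.commute)
                then show d: "\<kappa> * sqn n * lgn n \<le> N" by (rule dbl)
                show "\<kappa> * sqn n \<le> N" using b d by (rule le_trans)
              qed (use N in auto)
              show ?thesis
                apply (rule wp_seq, rule wp_asg)
                subgoal by simp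
                subgoal using hh NN by simp
                apply (rule wp_seq, rule wp_asg)
                subgoal by simp
                subgoal using hh NN by simp
                apply (rule wp_seq, rule wp_asg)
                subgoal by simp
                subgoal using hh NN by simp
                apply (rule wp_seq, rule wp_asg)
                subgoal by simp
                subgoal using hh NN by simp
                apply (rule wp_seq, rule wp_asg)
                subgoal by simp
                subgoal using hh NN by simp
                apply (rule wp_seq, rule wp_asg)
                subgoal by simp
                subgoal using hh NN by simp
                apply (rule wp_seq, rule wp_asg)
                subgoal by simp
                subgoal using hh NN by (simp add: mult.commute)
                apply (rule wp_seq, rule wp_asg)
                subgoal by simp
                subgoal using hh NN by simp
                apply (rule wp_asg)
                subgoal by simp
                subgoal using hh NN by simp
                subgoal
                proof (rule Q, goal_cases)
                  case 1
                  then show ?case using w(1) by (simp add: I3_def frame_def PR_def)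
                qed (use hh w(1) in \<open>simp_all add: I3_def W_def\<close>)
                done
            qed
            done
        qed
        done
    qed
    done
qed

section \<open>Law of the samples left in memory\<close>

fun samp :: "nat \<Rightarrow> nat \<Rightarrow> nat list pmf" where
  "samp n 0 = return_pmf []"
| "samp n (Suc k) = bind_pmf (pmf_of_set {..<n}) (\<lambda>y. map_pmf ((#) y) (samp n k))"

lemma set_pmf_lessThan: "1 \<le> n \<Longrightarrow> set_pmf (pmf_of_set {..<n :: nat}) = {..<n}"
  by (intro set_pmf_of_set) (auto simp: lessThan_empty_iff)

definition put :: "nat \<Rightarrow> ram_state \<Rightarrow> ram_state" where
  "put y s = set_reg 20 (Suc (reg s 20)) (set_mem 13 (reg s 20) y (set_reg 14 y s))"

lemma put_simps [simp]:
  "reg (put y s) = (reg s)(14 := y, 20 := Suc (reg s 20))" "mem (put y s) = (mem s)(13 := (mem s 13)(reg s 20 := y))"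
  by (simp_all add: put_def)

lemma put_body:
  assumes s: "fit N s" "reg s 0 = n" "1 \<le> n" "reg s 13 = 1" "reg s 20 < N"
  shows "ex N (Seq (Rand 14 0) (Seq (Store 13 20 14) (Arith Add 20 20 13))) s 5 (map_pmf (\<lambda>y. put y s) (pmf_of_set {..<n}))"
proof -
  let ?D = "map_pmf (\<lambda>y. set_reg 14 y s) (pmf_of_set {..<n})"
  have nN: "n \<le> N" using s by (auto simp: fit_def)
  have set: "set_pmf (pmf_of_set {..<n}) = {..<n}" using set_pmf_lessThan[OF s(3)] .
  have mn: "max (Suc 0) n = n" using s by simp
  have st: "step (Rand 14 0) s = map_pmf (\<lambda>k. (Skip, set_reg 14 k s)) (pmf_of_set {..<n})"
    using s(2) mn by simp
  have "ex N (Rand 14 0) s (Suc 0) (bind_pmf (step (Rand 14 0) s) (\<lambda>(p', s'). return_pmf s'))"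
  proof (rule ex_step[OF s(1)])
    fix p' s' assume "(p', s') \<in> set_pmf (step (Rand 14 0) s)"
    then obtain y where "y < n" "p' = Skip" "s' = set_reg 14 y s" unfolding st set_map_pmf set by auto
    then show "ex N p' s' 0 (return_pmf s')" using s(1) nN by (simp add: ex_Skip fit_set)
  qed
  also have "bind_pmf (step (Rand 14 0) s) (\<lambda>(p', s'). return_pmf s') = ?D"
    unfolding st bind_map_pmf by (simp add: map_pmf_def)
  finally have 1: "ex N (Rand 14 0) s (Suc 0) ?D" .
  have 2: "ex N (Seq (Store 13 20 14) (Arith Add 20 20 13)) (set_reg 14 y s) (1 + Suc 1) (return_pmf (put y s))" if "y < n" for y
  proof (rule ex_Seq_det)
    have f: "fit N (set_reg 14 y s)" using s nN that by auto
    have f2: "fit N (set_mem 13 (reg s 20) y (set_reg 14 y s))" using f nN that by auto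
    show "ex N (Store 13 20 14) (set_reg 14 y s) 1 (return_pmf (set_mem 13 (reg s 20) y (set_reg 14 y s)))"
      using f f2 by (intro ex_prim) auto
    show "ex N (Arith Add 20 20 13) (set_mem 13 (reg s 20) y (set_reg 14 y s)) 1 (return_pmf (put y s))"
      using f2 s unfolding put_def by (intro ex_prim) auto
  qed
  have "ex N (Seq (Rand 14 0) (Seq (Store 13 20 14) (Arith Add 20 20 13))) s (Suc 0 + Suc (1 + Suc 1))
    (bind_pmf ?D (\<lambda>s'. return_pmf (put (reg s' 14) s)))"
  proof (rule ex_Seq[OF 1])
    fix s' assume "s' \<in> set_pmf ?D"
    then obtain y where "y < n" "s' = set_reg 14 y s" using set by auto
    then show "ex N (Seq (Store 13 20 14) (Arith Add 20 20 13)) s' (1 + Suc 1) (return_pmf (put (reg s' 14) s))"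
      using 2[of y] by simp
  qed
  then show ?thesis unfolding bind_map_pmf by (simp add: map_pmf_def numeral_eq_Suc)
qed

text \<open>The final state is a function of the drawn list, so its law is an image of
  \<open>samp\<close>; all probabilistic arguments can then be made about lists.\<close>

lemma sampling_ex:
  assumes "fit N s" "reg s 0 = n" "1 \<le> n" "reg s 13 = 1" "reg s 7 = reg s 20 + k"
  shows "ex N sampling s (7 * k + 1) (map_pmf (\<lambda>ys. fold put ys s) (samp n k))"
  using assms
proof (induction k arbitrary: s)
  case 0
  then show ?case using ex_prim[of N s sampling s] by (simp add: sampling_def)
next
  case (Suc k)
  let ?B = "Seq (Rand 14 0) (Seq (Store 13 20 14) (Arith Add 20 20 13))"
  have lt: "reg s 20 < reg s 7" "reg s 20 < N"
  proof -
    show "reg s 20 < reg s 7" using Suc.prems by simp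
    then show "reg s 20 < N" using Suc.prems(1) by (auto simp: fit_def intro: less_le_trans)
  qed
  have set: "set_pmf (pmf_of_set {..<n}) = {..<n}" using set_pmf_lessThan[OF Suc.prems(3)] .
  have B: "ex N ?B s 5 (map_pmf (\<lambda>y. put y s) (pmf_of_set {..<n}))" using Suc.prems lt by (intro put_body) auto
  let ?E = "\<lambda>s'. map_pmf (\<lambda>ys. fold put ys s') (samp n k)"
  have "ex N (Seq ?B sampling) s (5 + Suc (7 * k + 1)) (bind_pmf (map_pmf (\<lambda>y. put y s) (pmf_of_set {..<n})) ?E)"
  proof (rule ex_Seq[OF B])
    fix s' assume s': "s' \<in> set_pmf (map_pmf (\<lambda>y. put y s) (pmf_of_set {..<n}))"
    then have "fit N s'" by (rule ex_fit[OF B])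
    then show "ex N sampling s' (7 * k + 1) (?E s')" using s' Suc.prems by (intro Suc.IH) auto
  qed
  then have "ex N sampling s (Suc (5 + Suc (7 * k + 1))) (bind_pmf (map_pmf (\<lambda>y. put y s) (pmf_of_set {..<n})) ?E)"
    using Suc.prems lt unfolding sampling_def by (intro ex_det[where p' = "Seq ?B (WhileLess 20 7 ?B)"]) auto
  then show ?case by (simp add: bind_map_pmf map_bind_pmf pmf.map_comp o_def)
qed

lemma fold_put:
  "reg s 20 = i \<Longrightarrow> x \<noteq> 14 \<Longrightarrow> x \<noteq> 20 \<Longrightarrow> reg (fold put ys s) x = reg s x"
  "a \<noteq> 13 \<Longrightarrow> mem (fold put ys s) a = mem s a"
  "j < length ys \<Longrightarrow> mem (fold put ys s) 13 (reg s 20 + j) = ys ! j"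
proof -
  show "x \<noteq> 14 \<Longrightarrow> x \<noteq> 20 \<Longrightarrow> reg (fold put ys s) x = reg s x" by (induction ys arbitrary: s) auto
  show "a \<noteq> 13 \<Longrightarrow> mem (fold put ys s) a = mem s a" by (induction ys arbitrary: s) auto
  have old: "j < reg s 20 \<Longrightarrow> mem (fold put ys s) 13 j = mem s 13 j" for j s ys
    by (induction ys arbitrary: s) auto
  show "j < length ys \<Longrightarrow> mem (fold put ys s) 13 (reg s 20 + j) = ys ! j"
  proof (induction ys arbitrary: s j)
    case (Cons y ys)
    show ?case
    proof (cases j)
      case 0
      then show ?thesis using old[of "reg s 20" "put y s" ys] by simp
    next
      case (Suc j')
      then show ?thesis using Cons.IH[of j' "put y s"] Cons.prems by simp
    qed
  qed simp
qed

lemma samp_set: "1 \<le> n \<Longrightarrow> ys \<in> set_pmf (samp n k) \<Longrightarrow> length ys = k \<and> set ys \<subseteq> {..<n}"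
proof (induction k arbitrary: ys)
  case (Suc k)
  have "set_pmf (pmf_of_set {..<n}) = {..<n}" using set_pmf_lessThan[OF Suc.prems(1)] .
  then show ?case using Suc by fastforce
qed simp

section \<open>Stretch\<close>

context main begin

lemma ds_ge: "i < ds q i" by (induction i) auto

text \<open>Let \<open>D\<close> be the roundtrip distance and \<open>d\<close> the least scale with
  \<open>D \<le> d\<close>. The two legs together cost at most \<open>D + 4 * d\<close>, and
  \<open>d \<le> D + D div q\<close> since the preceding scale is below \<open>D\<close>.
  Multiplication by \<open>q\<close> avoids fractions.\<close>

lemma stretch:
  assumes trees: "\<And>j. j < 2 * K \<Longrightarrow> tree_at O1 (S j)"
    and sv: "\<And>i u. ds q i < dlim \<Longrightarrow> u < n \<Longrightarrow> 2 * ds q i < near S K u \<Longrightarrow> served O1 (okk (ds q i) u) u"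
    and uv: "u < n" "v < n" "u \<noteq> v" "walk {..<m} sr tg wt u v l" "walk {..<m} sr tg wt v u l'"
  shows "\<exists>l1 l2. walk O1 sr tg wt u v l1 \<and> walk O1 sr tg wt v u l2 \<and>
    q * (l1 + l2) \<le> (5 * q + 4) * (del u v + del v u)"
proof -
  let ?D = "del u v + del v u"
  \<comment> \<open>Positivity of the roundtrip distance is needed when the least scale is the first
    one, \<open>ds q 0 = 1\<close>.\<close>
  have "del u v \<noteq> 0"
  proof
    assume "del u v = 0"
    then have "walk {..<m} sr tg wt u v 0" using dst_walk(1)[OF uv(4), where b = BIG] by simp
    then show False
    proof (cases rule: walk.cases)
      case (snoc v' l e)
      then show False using edge[of e] by auto
    qed (use uv(3) in simp)
  qed
  then have D1: "1 \<le> ?D" by simp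
  define i where "i = (LEAST i. ?D \<le> ds q i)"
  have i: "?D \<le> ds q i" unfolding i_def by (rule LeastI[of _ ?D]) (simp add: ds_ge less_imp_le)
  have d: "ds q i \<le> ?D + ?D div q"
  proof (cases i)
    case (Suc k)
    then have "\<not> ?D \<le> ds q k" using not_less_Least[of k "\<lambda>i. ?D \<le> ds q i"] unfolding i_def[symmetric] by simp
    then have "ds q k < ?D" by simp
    moreover from this have "ds q k div q \<le> ?D div q" by (intro div_le_mono) simp
    ultimately show ?thesis using Suc by simp
  qed (use D1 in simp)
  have "?D div q \<le> ?D" by simp
  moreover have "?D \<le> 2 * (n * Wm)" using del_bound(1)[OF uv(4,1)] del_bound(1)[OF uv(5,2)] by simp
  ultimately have dl: "ds q i < dlim" using d dlim(2) by linarith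
  have rs: "\<And>x s. s \<in> set (picks (ds q i) x) \<Longrightarrow> s < n"
    using pick_set[of cap "near S K"] S unfolding picks_def ss_def by fastforce
  have leg': "\<exists>l\<le>del a b + 2 * ds q i. walk O1 sr tg wt a b l" if "a < n" "b < n" "del a b + del b a \<le> ds q i" for a b
  proof (rule leg[where S = S and K = K and rs = "picks (ds q i)"])
    show "2 * ds q i < BIG" using dl dlim(1) by simp
    show "2 * ds q i < near S K a \<Longrightarrow> served O1 (\<lambda>y nd. 2 * ds q i < near S K y \<and> pass (ds q i) y (picks (ds q i) y) a nd) a"
      using sv[OF dl that(1)] by (simp add: okk_def[abs_def])
    show "S j < n" if "j < K" for j using S[of j] that by simp
    show "walk O1 sr tg wt (S j) w (del (S j) w)" if "j < K" "w < n" "del (S j) w < BIG" for j w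
      using trees[of j] that by (simp add: tree_at_def)
    show "walk O1 sr tg wt w (S j) (del w (S j))" if "j < K" "w < n" "del w (S j) < BIG" for j w
      using trees[of j] that by (simp add: tree_at_def)
  qed (use that rs in auto)
  obtain l1 where l1: "l1 \<le> del u v + 2 * ds q i" "walk O1 sr tg wt u v l1" using leg'[OF uv(1,2) i] by blast
  have "del v u + del u v \<le> ds q i" using i by simp
  then obtain l2 where l2: "l2 \<le> del v u + 2 * ds q i" "walk O1 sr tg wt v u l2" using leg'[OF uv(2,1)] by blast
  have "l1 + l2 \<le> 5 * ?D + 4 * (?D div q)" using l1 l2 d by simp
  then have "q * (l1 + l2) \<le> q * (5 * ?D + 4 * (?D div q))" by (rule mult_left_mono) simp
  also have "\<dots> = 5 * q * ?D + 4 * (q * (?D div q))" by (simp add: algebra_simps)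
  also have "\<dots> \<le> 5 * q * ?D + 4 * ?D" by (intro add_left_mono mult_left_mono) (auto simp: times_div_less_eq_dividend)
  also have "\<dots> = (5 * q + 4) * ?D" by (simp add: algebra_simps)
  finally show ?thesis using l1 l2 by blast
qed

end

section \<open>Probability\<close>

lemma samp_fin: "1 \<le> n \<Longrightarrow> finite (set_pmf (samp n k))"
  by (induction k) (simp_all add: set_pmf_lessThan)

lemma samp_Suc_prob:
  assumes "1 \<le> n"
  shows "measure_pmf.prob (samp n (Suc k)) X = (\<Sum>y<n. measure_pmf.prob (samp n k) {ys. y # ys \<in> X}) / n"
proof -
  have "measure_pmf.prob (samp n (Suc k)) X = measure_pmf.expectation (samp n (Suc k)) (indicator X)" by simp
  also have "\<dots> = (\<Sum>y<n. measure_pmf.expectation (map_pmf ((#) y) (samp n k)) (indicator X :: _ \<Rightarrow> real) /\<^sub>R real (card {..<n}))"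
    unfolding samp.simps using assms samp_fin[OF assms]
    by (intro pmf_expectation_bind_pmf_of_set) (auto simp: lessThan_empty_iff)
  also have "\<dots> = (\<Sum>y<n. measure_pmf.prob (samp n k) {ys. y # ys \<in> X} / n)"
    by (intro sum.cong) (simp_all add: vimage_def divide_inverse mult.commute)
  finally show ?thesis by (simp add: sum_divide_distrib)
qed

text \<open>Conditioning on the first \<open>j\<close> draws: either they fall into
  \<open>B\<close>, or the remaining independent draws fail with probability at most
  \<open>b\<close>.\<close>

lemma samp_append_prob:
  assumes n: "1 \<le> n" and b: "0 \<le> b"
    and "\<And>as. length as = j \<Longrightarrow> set as \<subseteq> {..<n} \<Longrightarrow> as \<notin> B \<Longrightarrow> measure_pmf.prob (samp n k) {bs. as @ bs \<in> X} \<le> b"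
  shows "measure_pmf.prob (samp n (j + k)) X \<le> measure_pmf.prob (samp n j) B + b"
  using assms(3)
proof (induction j arbitrary: X B)
  case 0
  show ?case
  proof (cases "[] \<in> B")
    case True
    then have "1 \<le> measure_pmf.prob (samp n 0) B" by (simp add: indicator_def)
    then show ?thesis using b measure_pmf.prob_le_1[of "samp n (0 + k)" X] by linarith
  next
    case False
    then have "measure_pmf.prob (samp n k) {bs. [] @ bs \<in> X} \<le> b" by (intro "0.prems") auto
    then show ?thesis by (simp add: add_increasing)
  qed
next
  case (Suc j)
  have "measure_pmf.prob (samp n (Suc j + k)) X = (\<Sum>y<n. measure_pmf.prob (samp n (j + k)) {ys. y # ys \<in> X}) / n"
    using samp_Suc_prob[OF n, of "j + k"] by simp
  also have "\<dots> \<le> (\<Sum>y<n. measure_pmf.prob (samp n j) {as. y # as \<in> B} + b) / n"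
  proof (intro divide_right_mono sum_mono)
    fix y assume y: "y \<in> {..<n}"
    show "measure_pmf.prob (samp n (j + k)) {ys. y # ys \<in> X} \<le> measure_pmf.prob (samp n j) {as. y # as \<in> B} + b"
    proof (rule Suc.IH)
      fix as assume "length as = j" "set as \<subseteq> {..<n}" "as \<notin> {as. y # as \<in> B}"
      then show "measure_pmf.prob (samp n k) {bs. as @ bs \<in> {ys. y # ys \<in> X}} \<le> b"
        using Suc.prems[of "y # as"] y by simp
    qed
  qed simp
  also have "\<dots> = measure_pmf.prob (samp n (Suc j)) B + b"
    unfolding samp_Suc_prob[OF n, of j] using n by (simp add: sum.distrib add_divide_distrib)
  finally show ?case .
qed

lemma samp_avoid:
  assumes n: "1 \<le> n" and B: "B \<subseteq> {..<n}"
  shows "measure_pmf.prob (samp n k) {ys. set ys \<inter> B = {}} \<le> (1 - real (card B) / n) ^ k"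
proof (induction k)
  case (Suc k)
  let ?p = "(1 - real (card B) / n) ^ k"
  have cB: "card B \<le> n" using card_mono[OF _ B] by simp
  have "measure_pmf.prob (samp n (Suc k)) {ys. set ys \<inter> B = {}} \<le> (\<Sum>y<n. if y \<in> B then 0 else ?p) / n"
    unfolding samp_Suc_prob[OF n]
  proof (intro divide_right_mono sum_mono)
    fix y
    show "measure_pmf.prob (samp n k) {ys. y # ys \<in> {ys. set ys \<inter> B = {}}} \<le> (if y \<in> B then 0 else ?p)"
      using Suc.IH by auto
  qed simp
  also have "(\<Sum>y<n. if y \<in> B then 0 else ?p) = real (card ({..<n} - B)) * ?p"
    by (simp add: sum.If_cases Diff_eq)
  also have "card ({..<n} - B) = n - card B" using B by (simp add: card_Diff_subset finite_subset)
  finally show ?case using n cB by (simp add: of_nat_diff field_simps)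
qed simp

text \<open>Members of a chain of finite sets are determined by their cardinality. This keeps union
  bounds over all scales independent of the weights.\<close>

lemma card_chain:
  fixes f :: "nat \<Rightarrow> 'a set"
  assumes "mono f" "\<And>i. f i \<subseteq> X" "finite X"
  shows "finite (range f)" "card (range f) \<le> card X + 1"
proof -
  have "inj_on card (range f)"
  proof (rule inj_onI)
    fix A B assume "A \<in> range f" "B \<in> range f" and c: "card A = card B"
    then obtain i j where ij: "A = f i" "B = f j" by auto
    have fin: "finite (f i)" "finite (f j)" using assms(2,3) finite_subset by blast+
    show "A = B"
    proof (cases "i \<le> j")
      case True
      then have "f i \<subseteq> f j" using assms(1) by (simp add: monoD)
      then show ?thesis using c ij fin card_subset_eq by blast
    next
      case False
      then have "f j \<subseteq> f i" using assms(1) by (simp add: monoD)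
      then show ?thesis using c ij fin card_subset_eq by metis
    qed
  qed
  moreover have "card ` range f \<subseteq> {..card X}" using assms(2,3) by (auto intro: card_mono)
  ultimately show "finite (range f)" "card (range f) \<le> card X + 1"
    using card_mono[of "{..card X}" "card ` range f"] by (auto simp: card_image intro: inj_on_finite)
qed

text \<open>The elimination process on the candidate set \<open>A\<close> with the samples \<open>bs\<close>; \<open>k\<close> is the number of
  earlier samples that were candidates.\<close>

fun proc :: "nat \<Rightarrow> (nat \<times> nat) set \<Rightarrow> nat list \<Rightarrow> nat set \<Rightarrow> nat \<Rightarrow> nat set" where
  "proc cap R [] A k = A"
| "proc cap R (s # bs) A k =
    (if k < cap \<and> s \<in> A then proc cap R bs (A \<inter> {u. (s, u) \<in> R}) (Suc k) else proc cap R bs A k)"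

lemma proc_sub: "proc cap R bs A k \<subseteq> A"
proof (induction bs arbitrary: A k)
  case (Cons s bs)
  then show ?case using Cons.IH[of "A \<inter> {u. (s, u) \<in> R}" "Suc k"] Cons.IH[of A k] by auto
qed simp

text \<open>A candidate set of size \<open>a > 2 * r\<close> is hit with probability \<open>a / n\<close>, and then a quarter of it
  is expected to be eliminated. The two terms of the bound account for too few hits and too many hits.\<close>

lemma proc_prob:
  assumes n: "1 \<le> n" and A: "A \<subseteq> {..<n}" and r: "r \<le> n" and k: "k \<le> cap"
    and hyp: "\<And>A'. A' \<subseteq> A \<Longrightarrow> 2 * r < card A' \<Longrightarrow> 4 * (\<Sum>s\<in>A'. card (A' \<inter> {u. (s, u) \<in> R})) \<le> 3 * (card A')\<^sup>2"
  shows "measure_pmf.prob (samp n K) {bs. 2 * r < card (proc cap R bs A k)} \<le>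
    real (card A) * ((1 - real r / (2 * n)) ^ K + (3 / 4) ^ (cap - k))"
  using A k hyp
proof (induction K arbitrary: A k)
  case (0 A k)
  show ?case
  proof (cases "2 * r < card A")
    case True
    \<comment> \<open>No draw is left: the right side is at least 1, since \<open>A\<close> is
      nonempty and the zeroth power is 1.\<close>
    then have "1 * 1 \<le> real (card A) * ((1 - real r / (2 * n)) ^ 0 + (3 / 4) ^ (cap - k))" by (intro mult_mono) auto
    then show ?thesis using measure_pmf.prob_le_1[of "samp n 0" "{bs. 2 * r < card (proc cap R bs A k)}"] by linarith
  qed simp
next
  case (Suc K A k)
  let ?\<rho> = "1 - real r / (2 * n)"
  have \<rho>: "0 \<le> ?\<rho>" using r n by (simp add: field_simps)
  have fA: "finite A" using Suc.prems(1) finite_subset by blast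
  let ?a = "real (card A)"
  consider "card A \<le> 2 * r" | "2 * r < card A" "k = cap" | "2 * r < card A" "k < cap" using Suc.prems(2) by linarith
  then show ?case
  proof cases
    case 1
    have "\<not> 2 * r < card (proc cap R bs A k)" for bs
      using card_mono[OF fA proc_sub[of cap R bs A k]] 1 by simp
    then show ?thesis using \<rho> by simp
  next
    case 2
    then have "1 * 1 \<le> ?a * (?\<rho> ^ Suc K + (3 / 4) ^ (cap - k))" using \<rho> by (intro mult_mono) auto
    then show ?thesis using measure_pmf.prob_le_1[of "samp n (Suc K)" "{bs. 2 * r < card (proc cap R bs A k)}"] by linarith
  next
    case 3
    define P where "P = (3 / 4 :: real) ^ (cap - Suc k)"
    have P: "(3 / 4) ^ (cap - k) = 3 / 4 * P" unfolding P_def using 3(2) by (simp add: Suc_diff_Suc[symmetric])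
    have P0: "0 \<le> P" by (simp add: P_def)
    let ?c = "\<lambda>y. real (card (A \<inter> {u. (y, u) \<in> R}))"
    \<comment> \<open>Average over the first draw: a draw \<open>y\<close> in \<open>A\<close>
      shrinks the set to the partners of \<open>y\<close> and uses up one unit of
      \<open>cap\<close>; any other draw changes nothing.\<close>
    have "measure_pmf.prob (samp n (Suc K)) {bs. 2 * r < card (proc cap R bs A k)} \<le>
      (\<Sum>y<n. if y \<in> A then ?c y * (?\<rho> ^ K + P) else ?a * (?\<rho> ^ K + 3 / 4 * P)) / n"
      unfolding samp_Suc_prob[OF n]
    proof (intro divide_right_mono sum_mono)
      fix y assume "y \<in> {..<n}"
      show "measure_pmf.prob (samp n K) {ys. y # ys \<in> {bs. 2 * r < card (proc cap R bs A k)}} \<le>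
        (if y \<in> A then ?c y * (?\<rho> ^ K + P) else ?a * (?\<rho> ^ K + 3 / 4 * P))"
      proof (cases "y \<in> A")
        case True
        have "measure_pmf.prob (samp n K) {bs. 2 * r < card (proc cap R bs (A \<inter> {u. (y, u) \<in> R}) (Suc k))} \<le> ?c y * (?\<rho> ^ K + P)"
          unfolding P_def by (rule Suc.IH) (use Suc.prems 3 in auto)
        then show ?thesis using True 3 by simp
      next
        case False
        have "measure_pmf.prob (samp n K) {bs. 2 * r < card (proc cap R bs A k)} \<le> ?a * (?\<rho> ^ K + (3 / 4) ^ (cap - k))"
          by (rule Suc.IH) (use Suc.prems in auto)
        then show ?thesis using False by (simp add: P)
      qed
    qed simp
    also have "(\<Sum>y<n. if y \<in> A then ?c y * (?\<rho> ^ K + P) else ?a * (?\<rho> ^ K + 3 / 4 * P)) =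
      (\<Sum>y\<in>A. ?c y) * (?\<rho> ^ K + P) + (n - ?a) * (?a * (?\<rho> ^ K + 3 / 4 * P))"
    proof -
      have 1: "{..<n} \<inter> A = A" using Suc.prems(1) by auto
      have "card ({..<n} \<inter> - A) = n - card A" using Suc.prems(1) fA by (simp add: Diff_eq[symmetric] card_Diff_subset)
      moreover have "card A \<le> n" using card_mono[OF _ Suc.prems(1)] by simp
      ultimately show ?thesis by (simp add: sum.If_cases 1 sum_distrib_right of_nat_diff)
    qed
    also have "\<dots> / n \<le> (3 / 4 * ?a\<^sup>2 * (?\<rho> ^ K + P) + (n - ?a) * (?a * (?\<rho> ^ K + 3 / 4 * P))) / n"
    proof -
      have "4 * (\<Sum>s\<in>A. card (A \<inter> {u. (s, u) \<in> R})) \<le> 3 * (card A)\<^sup>2" using Suc.prems(3)[of A] 3 by simp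
      then have "real (4 * (\<Sum>s\<in>A. card (A \<inter> {u. (s, u) \<in> R}))) \<le> real (3 * (card A)\<^sup>2)" by (rule of_nat_mono)
      then have "(\<Sum>y\<in>A. ?c y) \<le> 3 / 4 * ?a\<^sup>2" by simp
      then show ?thesis using \<rho> P0 by (intro divide_right_mono add_right_mono mult_right_mono) auto
    qed
    \<comment> \<open>The bound is linear in the size of the set. A draw hits with probability
      \<open>?a / n\<close> and then keeps at most three quarters on average. In the first term this
      saves \<open>?a / (4 * n)\<close>; in the second the factor 3/4 gained exactly offsets the
      unit of \<open>cap\<close> spent.\<close>
    also have "\<dots> = ?a * (?\<rho> ^ K * (1 - ?a / (4 * n)) + 3 / 4 * P)"
      using n by (simp add: field_simps power2_eq_square)
    also have "\<dots> \<le> ?a * (?\<rho> ^ K * ?\<rho> + 3 / 4 * P)"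
    proof -
      have "2 * real r \<le> ?a" using 3(1) by simp
      then have "1 - ?a / (4 * n) \<le> ?\<rho>" using n by (simp add: field_simps)
      then show ?thesis using \<rho> by (intro mult_left_mono add_right_mono) auto
    qed
    finally show ?thesis by (simp add: P mult.commute)
  qed
qed

lemma prob_UN_le:
  assumes "finite I" "card I \<le> c" "0 \<le> b" "X \<subseteq> (\<Union>i\<in>I. Y i)" "\<And>i. i \<in> I \<Longrightarrow> measure_pmf.prob p (Y i) \<le> b"
  shows "measure_pmf.prob p X \<le> real c * b"
proof -
  have "measure_pmf.prob p X \<le> measure_pmf.prob p (\<Union>i\<in>I. Y i)" using assms(4) by (intro measure_pmf.finite_measure_mono) auto
  also have "\<dots> \<le> (\<Sum>i\<in>I. measure_pmf.prob p (Y i))" using assms(1) by (intro measure_pmf.finite_measure_subadditive_finite) auto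
  also have "\<dots> \<le> (\<Sum>i\<in>I. b)" using assms(5) by (rule sum_mono)
  also have "\<dots> \<le> real c * b" using assms(2,3) by (simp add: mult_right_mono)
  finally show ?thesis .
qed

section \<open>Candidate sets are small at all scales with high probability\<close>

context wgraph begin

text \<open>The property \<open>good\<close> for a variable list of samples, as needed to speak of
  an event of \<open>samp\<close>.\<close>

definition gl :: "nat \<Rightarrow> nat \<Rightarrow> nat \<Rightarrow> nat list \<Rightarrow> nat \<Rightarrow> bool" where
  "gl K cap rt ys d \<longleftrightarrow> (\<forall>x<n. card {u. u < n \<and>
     inA (near (nth ys) K) d x (pick cap (near (nth ys) K) d x (drop K ys)) u} \<le> 2 * rt)"

lemma near_append: "j \<le> length as \<Longrightarrow> near (nth (as @ bs)) j v = near (nth as) j v"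
  by (induction j) (simp_all add: nth_append)

definition surv :: "nat \<Rightarrow> nat \<Rightarrow> (nat \<times> nat) set" where
  "surv d x = {(s, u). s < n \<and> u < n \<and> del s u + del u x \<le> d + del s x}"

lemma inA_snoc: "inA HR d x (rs @ [s]) u \<longleftrightarrow> inA HR d x rs u \<and> del s u + del u x \<le> d + del s x"
  by (auto simp: inA_def pass_def)

text \<open>Keeping one more sample intersects the candidates with its partners under
  \<open>surv\<close>, so filtering a vertex is an instance of the abstract elimination
  process.\<close>

lemma cand_proc:
  assumes "set bs \<subseteq> {..<n}"
  shows "{u. u < n \<and> inA HR d x (pick cap HR d x bs) u} = proc cap (surv d x) bs {u. u < n \<and> inA HR d x [] u} 0"
proof -
  let ?st = "\<lambda>rs s. if length rs < cap \<and> inA HR d x rs s then rs @ [s] else rs"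
  have "{u. u < n \<and> inA HR d x (foldl ?st rs bs) u} = proc cap (surv d x) bs {u. u < n \<and> inA HR d x rs u} (length rs)" for rs
    using assms
  proof (induction bs arbitrary: rs)
    case (Cons s bs)
    have "{u. u < n \<and> inA HR d x (rs @ [s]) u} = {u. u < n \<and> inA HR d x rs u} \<inter> {u. (s, u) \<in> surv d x}"
      using Cons.prems by (auto simp: surv_def inA_snoc)
    then show ?case using Cons.IH[of "rs @ [s]"] Cons.IH[of rs] Cons.prems by simp
  qed simp
  from this[of "[]"] show ?thesis by (simp add: pick_def)
qed

definition ball :: "nat \<Rightarrow> nat \<Rightarrow> nat set" where
  "ball u d = {v. v < n \<and> del u v + del v u \<le> 2 * d}"

definition g1 :: "nat \<Rightarrow> nat \<Rightarrow> nat list \<Rightarrow> bool" where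
  "g1 K rt as \<longleftrightarrow> (\<forall>u<n. \<forall>d. 2 * d < BIG \<longrightarrow> 2 * d < near (nth as) K u \<longrightarrow> card (ball u d) \<le> rt)"

text \<open>The relation holds in both directions only between candidates within roundtrip distance \<open>2 * d\<close>,
  and \<open>g1\<close> allows at most \<open>rt\<close> of these around each candidate.\<close>

lemma surv_count:
  assumes g: "g1 K rt as" and d: "2 * d < BIG" and A': "A' \<subseteq> {u. u < n \<and> inA (near (nth as) K) d x [] u}" "2 * rt < card A'"
  shows "4 * (\<Sum>s\<in>A'. card (A' \<inter> {u. (s, u) \<in> surv d x})) \<le> 3 * (card A')\<^sup>2"
proof -
  have fin: "finite A'" using A'(1) by (rule finite_subset) simp
  let ?t = "\<lambda>s u. if (s, u) \<in> surv d x then 1 else (0 :: nat)" and ?b = "\<lambda>s u. if u \<in> ball s d then 1 else (0 :: nat)"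
  have c: "card (A' \<inter> {u. P u}) = (\<Sum>u\<in>A'. if P u then 1 else 0)" for P
    using fin by (simp add: sum.If_cases)
  \<comment> \<open>If both relations hold, adding the two inequalities cancels the distances to
    \<open>x\<close> and leaves a roundtrip of length at most \<open>2 * d\<close>.\<close>
  have le: "?t s u + ?t u s \<le> 1 + ?b s u" if "s \<in> A'" "u \<in> A'" for s u
    using that A'(1) by (auto simp: surv_def ball_def inA_def pass_def)
  have sw: "(\<Sum>s\<in>A'. \<Sum>u\<in>A'. ?t s u) = (\<Sum>u\<in>A'. \<Sum>s\<in>A'. ?t s u)" by (rule sum.swap)
  have "2 * (\<Sum>s\<in>A'. \<Sum>u\<in>A'. ?t s u) = (\<Sum>s\<in>A'. \<Sum>u\<in>A'. ?t s u) + (\<Sum>u\<in>A'. \<Sum>s\<in>A'. ?t s u)"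
    using sw by linarith
  also have "\<dots> = (\<Sum>s\<in>A'. \<Sum>u\<in>A'. ?t s u + ?t u s)" by (simp only: sum.distrib)
  also have "\<dots> \<le> (\<Sum>s\<in>A'. \<Sum>u\<in>A'. 1 + ?b s u)" using le by (intro sum_mono) auto
  also have "\<dots> = (card A')\<^sup>2 + (\<Sum>s\<in>A'. card (A' \<inter> {u. u \<in> ball s d}))"
    unfolding c sum.distrib by (simp add: power2_eq_square)
  also have "(\<Sum>s\<in>A'. card (A' \<inter> {u. u \<in> ball s d})) \<le> (\<Sum>s\<in>A'. rt)"
  proof (rule sum_mono)
    fix s assume s: "s \<in> A'"
    have "card (A' \<inter> {u. u \<in> ball s d}) \<le> card (ball s d)" by (intro card_mono) (auto simp: ball_def)
    also have "\<dots> \<le> rt" using g d s A'(1) by (auto simp: g1_def inA_def)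
    finally show "card (A' \<inter> {u. u \<in> ball s d}) \<le> rt" .
  qed
  also have "(\<Sum>s\<in>A'. rt) = card A' * rt" by simp
  finally have "2 * (\<Sum>s\<in>A'. card (A' \<inter> {u. (s, u) \<in> surv d x})) \<le> (card A')\<^sup>2 + card A' * rt"
    unfolding c by simp
  \<comment> \<open>With a for \<open>card A'\<close>, the number of related pairs is at most (a^2 +
    a rt) / 2; as 2 rt < a, this is at most 3 a^2 / 4.\<close>
  moreover have "card A' * (2 * rt) \<le> card A' * card A'" using A'(2) by (intro mult_left_mono) auto
  ultimately show ?thesis unfolding power2_eq_square by linarith
qed

text \<open>A light \<open>u\<close> has no sample in its ball, so a large ball around it was missed
  by all \<open>K\<close> samples. For fixed \<open>u\<close> the balls grow with \<open>d\<close>,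
  so at most \<open>n + 1\<close> different sets occur and there are at most
  \<open>n * (n + 1)\<close> events to unite.\<close>

lemma g1_prob:
  assumes n: "1 \<le> n" and rt: "rt \<le> n"
  shows "measure_pmf.prob (samp n K) {as. length as = K \<and> \<not> g1 K rt as} \<le> real (n * (n + 1)) * (1 - real rt / n) ^ K"
proof (rule prob_UN_le[where I = "(\<lambda>B. B) ` {B \<in> (\<Union>u<n. range (ball u)). rt < card B}" and Y = "\<lambda>B. {ys. set ys \<inter> B = {}}"])
  have ch: "finite (range (ball u))" "card (range (ball u)) \<le> n + 1" for u
  proof -
    have "mono (ball u)" "\<And>d. ball u d \<subseteq> {..<n}" by (auto simp: ball_def intro!: monoI)
    from card_chain[OF this] show "finite (range (ball u))" "card (range (ball u)) \<le> n + 1" by auto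
  qed
  have f: "finite (\<Union>u<n. range (ball u))" using ch by auto
  then show "finite ((\<lambda>B. B) ` {B \<in> (\<Union>u<n. range (ball u)). rt < card B})" by simp
  have "card ((\<lambda>B. B) ` {B \<in> (\<Union>u<n. range (ball u)). rt < card B}) \<le> card (\<Union>u<n. range (ball u))"
    using f by (intro card_mono) auto
  also have "\<dots> \<le> (\<Sum>u<n. card (range (ball u)))" by (rule card_UN_le) simp
  also have "\<dots> \<le> (\<Sum>u<n. n + 1)" using ch by (intro sum_mono) auto
  finally show "card ((\<lambda>B. B) ` {B \<in> (\<Union>u<n. range (ball u)). rt < card B}) \<le> n * (n + 1)" by simp
  have q: "0 \<le> 1 - real rt / n" using rt n by (simp add: field_simps)
  then show "0 \<le> (1 - real rt / n) ^ K" by simp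
  show "measure_pmf.prob (samp n K) {ys. set ys \<inter> B = {}} \<le> (1 - real rt / n) ^ K"
    if "B \<in> (\<lambda>B. B) ` {B \<in> (\<Union>u<n. range (ball u)). rt < card B}" for B
  proof -
    have B: "B \<subseteq> {..<n}" "rt < card B" using that by (auto simp: ball_def)
    have "card B \<le> n" using card_mono[OF _ B(1)] by simp
    then have "(1 - real (card B) / n) ^ K \<le> (1 - real rt / n) ^ K"
      using n B(2) by (intro power_mono) (auto simp: field_simps)
    then show ?thesis using samp_avoid[OF n B(1), of K] by linarith
  qed
  show "{as. length as = K \<and> \<not> g1 K rt as} \<subseteq> (\<Union>B\<in>(\<lambda>B. B) ` {B \<in> (\<Union>u<n. range (ball u)). rt < card B}. {ys. set ys \<inter> B = {}})"
  proof
    fix as assume "as \<in> {as. length as = K \<and> \<not> g1 K rt as}"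
    then obtain u d where u: "length as = K" "u < n" "2 * d < near (nth as) K u" "rt < card (ball u d)"
      by (auto simp: g1_def not_le)
    have "\<not> near (nth as) K u \<le> 2 * d" using u(3) by simp
    then have nj: "\<And>j. j < K \<Longrightarrow> \<not> del (as ! j) u + del u (as ! j) \<le> 2 * d" unfolding near_le by blast
    have "set as \<inter> ball u d = {}"
    proof (rule equals0I)
      fix v assume "v \<in> set as \<inter> ball u d"
      then obtain j where "j < K" "as ! j = v" "del u v + del v u \<le> 2 * d" using u(1) by (auto simp: ball_def in_set_conv_nth)
      then show False using nj[of j] by simp
    qed
    then show "as \<in> (\<Union>B\<in>(\<lambda>B. B) ` {B \<in> (\<Union>u<n. range (ball u)). rt < card B}. {ys. set ys \<inter> B = {}})"
      using u by auto
  qed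
qed

text \<open>The scales \<open>d\<close> are unbounded in terms of \<open>n\<close>, but the configurations \<open>(X1 d, X2 d, surv d x)\<close>
  are monotone in \<open>d\<close>, hence only polynomially many.\<close>

lemma g2_prob:
  assumes n: "1 \<le> n" and rt: "rt \<le> n" and as: "length as = K" "g1 K rt as"
  shows "measure_pmf.prob (samp n k) {bs. length bs = k \<and> set bs \<subseteq> {..<n} \<and> (\<exists>d. 2 * d < BIG \<and> \<not> gl K cap rt (as @ bs) d)}
    \<le> real (n * ((n + 1) * ((n + 1) * (n * n + 1)))) * (real n * ((1 - real rt / (2 * n)) ^ k + (3 / 4) ^ cap))"
proof -
  define b where "b = real n * ((1 - real rt / (2 * n)) ^ k + (3 / 4) ^ cap)"
  have q: "0 \<le> 1 - real rt / (2 * n)" using rt n by (simp add: field_simps)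
  have b0: "0 \<le> b" unfolding b_def using q by simp
  define X1 where "X1 d = {u. u < n \<and> near (nth as) K u \<le> 2 * d}" for d
  define X2 where "X2 x d = {u. u < n \<and> del u x \<le> d}" for x d
  have s1: "finite (range X1)" "card (range X1) \<le> n + 1"
  proof -
    have "mono X1" "\<And>d. X1 d \<subseteq> {..<n}" by (auto simp: X1_def intro!: monoI)
    from card_chain[OF this] show "finite (range X1)" "card (range X1) \<le> n + 1" by auto
  qed
  have s2: "finite (range (X2 x))" "card (range (X2 x)) \<le> n + 1" for x
  proof -
    have "mono (X2 x)" "\<And>d. X2 x d \<subseteq> {..<n}" by (auto simp: X2_def intro!: monoI)
    from card_chain[OF this] show "finite (range (X2 x))" "card (range (X2 x)) \<le> n + 1" by auto
  qed
  have s3: "finite (range (\<lambda>d. surv d x))" "card (range (\<lambda>d. surv d x)) \<le> n * n + 1" for x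
  proof -
    have "mono (\<lambda>d. surv d x)" "\<And>d. surv d x \<subseteq> {..<n} \<times> {..<n}" by (auto simp: surv_def intro!: monoI)
    from card_chain[OF this] show "finite (range (\<lambda>d. surv d x))" "card (range (\<lambda>d. surv d x)) \<le> n * n + 1"
      by (auto simp: card_cartesian_product)
  qed
  have A0: "{u. u < n \<and> inA (near (nth as) K) d x [] u} = X2 x d - X1 d" for d x
    by (auto simp: X1_def X2_def inA_def pass_def)
  \<comment> \<open>Events are indexed by the triple instead of \<open>d\<close>: scales with the
    same configuration yield the same event.\<close>
  define I where "I x = (\<lambda>d. (X1 d, X2 x d, surv d x)) ` {d. 2 * d < BIG}" for x
  define J where "J = Sigma {..<n} I"
  have cI: "finite (I x) \<and> card (I x) \<le> (n + 1) * ((n + 1) * (n * n + 1))" for x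
  proof -
    let ?P = "range X1 \<times> range (X2 x) \<times> range (\<lambda>d. surv d x)"
    have f: "finite ?P" using s1 s2 s3 by blast
    have "card (I x) \<le> card ?P" using f by (intro card_mono) (auto simp: I_def)
    also have "\<dots> \<le> (n + 1) * ((n + 1) * (n * n + 1))"
      unfolding card_cartesian_product using s1 s2 s3 by (intro mult_mono) auto
    finally have "card (I x) \<le> (n + 1) * ((n + 1) * (n * n + 1))" .
    moreover have "finite (I x)" by (rule finite_subset[OF _ f]) (auto simp: I_def)
    ultimately show ?thesis by blast
  qed
  have "measure_pmf.prob (samp n k) {bs. length bs = k \<and> set bs \<subseteq> {..<n} \<and> (\<exists>d. 2 * d < BIG \<and> \<not> gl K cap rt (as @ bs) d)}
    \<le> real (n * ((n + 1) * ((n + 1) * (n * n + 1)))) * b"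
  proof (rule prob_UN_le[where I = J and Y = "\<lambda>(x, Y1, Y2, R). {bs. 2 * rt < card (proc cap R bs (Y2 - Y1) 0)}"])
    show "finite J" unfolding J_def using cI by (intro finite_SigmaI) auto
    have "card J = (\<Sum>x<n. card (I x))" unfolding J_def using cI by (intro card_SigmaI) auto
    also have "\<dots> \<le> (\<Sum>x<n. (n + 1) * ((n + 1) * (n * n + 1)))" using cI by (intro sum_mono) auto
    finally show "card J \<le> n * ((n + 1) * ((n + 1) * (n * n + 1)))" by simp
    show "0 \<le> b" by (rule b0)
    show "measure_pmf.prob (samp n k) (case i of (x, Y1, Y2, R) \<Rightarrow> {bs. 2 * rt < card (proc cap R bs (Y2 - Y1) 0)}) \<le> b"
      if iJ: "i \<in> J" for i
    proof -
      obtain x d where x: "2 * d < BIG" "i = (x, X1 d, X2 x d, surv d x)" using iJ by (auto simp: J_def I_def)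
      let ?A = "X2 x d - X1 d"
      have An: "?A \<subseteq> {..<n}" by (auto simp: X2_def)
      have "measure_pmf.prob (samp n k) {bs. 2 * rt < card (proc cap (surv d x) bs ?A 0)} \<le>
        real (card ?A) * ((1 - real rt / (2 * n)) ^ k + (3 / 4) ^ (cap - 0))"
        by (rule proc_prob[OF n An rt]) (use surv_count[OF as(2) x(1)] A0 in auto)
      also have "\<dots> \<le> b"
      proof -
        have "card ?A \<le> n" using card_mono[OF _ An] by simp
        then show ?thesis unfolding b_def using q by (intro mult_mono) auto
      qed
      finally show ?thesis using x by simp
    qed
    show "{bs. length bs = k \<and> set bs \<subseteq> {..<n} \<and> (\<exists>d. 2 * d < BIG \<and> \<not> gl K cap rt (as @ bs) d)} \<subseteq>
      (\<Union>i\<in>J. case i of (x, Y1, Y2, R) \<Rightarrow> {bs. 2 * rt < card (proc cap R bs (Y2 - Y1) 0)})"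
    proof
      fix bs assume "bs \<in> {bs. length bs = k \<and> set bs \<subseteq> {..<n} \<and> (\<exists>d. 2 * d < BIG \<and> \<not> gl K cap rt (as @ bs) d)}"
      then obtain d x where d: "set bs \<subseteq> {..<n}" "2 * d < BIG" "x < n"
        "2 * rt < card {u. u < n \<and> inA (near (nth (as @ bs)) K) d x (pick cap (near (nth (as @ bs)) K) d x (drop K (as @ bs))) u}"
        by (auto simp: gl_def not_le)
      \<comment> \<open>Lightness depends on the first half only, so \<open>as\<close> fixes the
        initial candidates before \<open>bs\<close> is drawn.\<close>
      have nr: "near (nth (as @ bs)) K = near (nth as) K" using near_append as(1) by (intro ext) simp
      have "2 * rt < card (proc cap (surv d x) bs (X2 x d - X1 d) 0)"
        using d(4) unfolding nr using as(1) cand_proc[OF d(1)] by (simp add: A0)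
      moreover have "(x, X1 d, X2 x d, surv d x) \<in> J" using d unfolding J_def I_def by auto
      ultimately show "bs \<in> (\<Union>i\<in>J. case i of (x, Y1, Y2, R) \<Rightarrow> {bs. 2 * rt < card (proc cap R bs (Y2 - Y1) 0)})" by force
    qed
  qed
  then show ?thesis by (simp add: b_def)
qed

lemma bad_prob:
  assumes n: "1 \<le> n" and rt: "rt \<le> n"
  shows "measure_pmf.prob (samp n (K + K)) {ys. \<exists>d. 2 * d < BIG \<and> \<not> gl K cap rt ys d} \<le>
    real (n * (n + 1)) * (1 - real rt / n) ^ K +
    real (n * ((n + 1) * ((n + 1) * (n * n + 1)))) * (real n * ((1 - real rt / (2 * n)) ^ K + (3 / 4) ^ cap))"
proof -
  have q: "0 \<le> 1 - real rt / (2 * n)" using rt n by (simp add: field_simps)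
  let ?X = "{ys. \<exists>d. 2 * d < BIG \<and> \<not> gl K cap rt ys d}"
  have "measure_pmf.prob (samp n (K + K)) ?X \<le> measure_pmf.prob (samp n K) {as. length as = K \<and> \<not> g1 K rt as} +
     real (n * ((n + 1) * ((n + 1) * (n * n + 1)))) * (real n * ((1 - real rt / (2 * n)) ^ K + (3 / 4) ^ cap))"
  proof (rule samp_append_prob[OF n])
    show "0 \<le> real (n * ((n + 1) * ((n + 1) * (n * n + 1)))) * (real n * ((1 - real rt / (2 * n)) ^ K + (3 / 4) ^ cap))"
      using q by simp
    fix as assume as: "length as = K" "set as \<subseteq> {..<n}" "as \<notin> {as. length as = K \<and> \<not> g1 K rt as}"
    \<comment> \<open>Draws have the right length and range almost surely, so these conditions may
      be added to the event.\<close>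
    have "measure_pmf.prob (samp n K) {bs. as @ bs \<in> ?X} =
      measure_pmf.prob (samp n K) {bs. length bs = K \<and> set bs \<subseteq> {..<n} \<and> (\<exists>d. 2 * d < BIG \<and> \<not> gl K cap rt (as @ bs) d)}"
      using samp_set[OF n] by (intro measure_pmf.finite_measure_eq_AE) (auto simp: AE_measure_pmf_iff)
    also have "\<dots> \<le> real (n * ((n + 1) * ((n + 1) * (n * n + 1)))) * (real n * ((1 - real rt / (2 * n)) ^ K + (3 / 4) ^ cap))"
      using as by (intro g2_prob[OF n rt]) auto
    finally show "measure_pmf.prob (samp n K) {bs. as @ bs \<in> ?X} \<le> \<dots>" .
  qed
  also have "measure_pmf.prob (samp n K) {as. length as = K \<and> \<not> g1 K rt as} \<le> real (n * (n + 1)) * (1 - real rt / n) ^ K"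
    by (rule g1_prob[OF n rt])
  finally show ?thesis by simp
qed

end

section \<open>Spanners and walks\<close>

lemma pcas_append: "pcas u (p @ p') v \<longleftrightarrow> (\<exists>x. pcas u p x \<and> pcas x p' v)"
  by (induction p arbitrary: u) auto

abbreviation esr :: "(nat \<times> nat) list \<Rightarrow> nat \<Rightarrow> nat" where "esr es \<equiv> \<lambda>e. fst (es ! e)"
abbreviation etg :: "(nat \<times> nat) list \<Rightarrow> nat \<Rightarrow> nat" where "etg es \<equiv> \<lambda>e. snd (es ! e)"
abbreviation ewt :: "(nat \<times> nat) list \<Rightarrow> (nat \<times> nat \<Rightarrow> nat) \<Rightarrow> nat \<Rightarrow> nat" where "ewt es w \<equiv> \<lambda>e. w (es ! e)"

lemma walk_imp_awalk:
  "walk A (esr es) (etg es) (ewt es w) u v l \<Longrightarrow>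
   \<exists>p. set p \<subseteq> (!) es ` A \<and> pcas u p v \<and> sum_list (map (\<lambda>e. real (w e)) p) = real l"
proof (induction rule: walk.induct)
  case nil
  show ?case by (intro exI[of _ "[]"]) simp
next
  case (snoc v l e)
  then obtain p where "set p \<subseteq> (!) es ` A" "pcas u p v" "sum_list (map (\<lambda>e. real (w e)) p) = real l" by blast
  then show ?case using snoc.hyps by (intro exI[of _ "p @ [es ! e]"]) (auto simp: pcas_append)
qed

lemma awalk_imp_walk:
  "set p \<subseteq> set es \<Longrightarrow> pcas u p v \<Longrightarrow>
   \<exists>l. walk {..<length es} (esr es) (etg es) (ewt es w) u v l \<and> sum_list (map (\<lambda>e. real (w e)) p) = real l"
proof (induction p arbitrary: u)
  case Nil
  then show ?case using walk.nil by (intro exI[of _ 0]) auto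
next
  case (Cons a p)
  then obtain l where l: "walk {..<length es} (esr es) (etg es) (ewt es w) (snd a) v l" "sum_list (map (\<lambda>e. real (w e)) p) = real l"
    by auto
  obtain e where e: "e < length es" "es ! e = a" using Cons.prems(1) by (auto simp: in_set_conv_nth)
  have "walk {..<length es} (esr es) (etg es) (ewt es w) u (snd (es ! e)) (0 + w (es ! e))"
    using walk.snoc[OF walk.nil, of e "{..<length es}" "esr es" u "etg es" "ewt es w"] e Cons.prems(2) by simp
  then have "walk {..<length es} (esr es) (etg es) (ewt es w) u v (w a + l)"
    using walk_trans[OF l(1)] e by simp
  then show ?case using l(2) by (intro exI[of _ "w a + l"]) simp
qed

lemma dist_in_le:
  assumes "pair_wf_digraph H" "u \<in> pverts H" "set p \<subseteq> parcs H" "pcas u p v"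
  shows "dist_in H w u v \<le> ereal (sum_list (map w p))"
proof -
  interpret pair_wf_digraph H by fact
  have "awalk u p v" using assms(2-4) by (simp add: awalk_def)
  then show ?thesis using min_cost_le_walk_cost[of u p v w] unfolding dist_in_def awalk_cost_def by simp
qed

lemma le_dist_in:
  assumes "pair_wf_digraph H" "\<And>p. set p \<subseteq> parcs H \<Longrightarrow> pcas u p v \<Longrightarrow> c \<le> ereal (sum_list (map w p))"
  shows "c \<le> dist_in H w u v"
proof -
  interpret pair_wf_digraph H by fact
  show ?thesis unfolding dist_in_def \<mu>_def awalk_cost_def using assms(2) by (intro INF_greatest) (auto simp: awalk_def)
qed

text \<open>If one direction admits no walk, the right side is infinite; a vertex paired with itself
  has roundtrip 0 in the subgraph. This leaves distinct vertices that reach each other, for which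
  \<open>main\<close> compares walks with the least lengths of walks.\<close>

lemma spanner_of_walks:
  fixes es :: "(nat \<times> nat) list" and w :: "nat \<times> nat \<Rightarrow> nat"
  assumes G: "pair_fin_digraph G" "pverts G = {..<n}" "set es = parcs G"
    and H: "H = \<lparr>pverts = {..<n}, parcs = (!) es ` A\<rparr>" "A \<subseteq> {..<length es}" and c: "0 < c"
    and main: "\<And>u v l l'. u < n \<Longrightarrow> v < n \<Longrightarrow> u \<noteq> v \<Longrightarrow>
      walk {..<length es} (esr es) (etg es) (ewt es w) u v l \<Longrightarrow> walk {..<length es} (esr es) (etg es) (ewt es w) v u l' \<Longrightarrow>
      \<exists>l1 l2. walk A (esr es) (etg es) (ewt es w) u v l1 \<and> walk A (esr es) (etg es) (ewt es w) v u l2 \<and>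
        real (l1 + l2) \<le> c * real (dst (length es) (esr es) (etg es) (ewt es w) b u v + dst (length es) (esr es) (etg es) (ewt es w) b v u)"
  shows "approx_roundtrip_spanner c G (\<lambda>e. real (w e)) H"
proof -
  interpret G: pair_fin_digraph G by fact
  have sub: "parcs H \<subseteq> parcs G" using H G(3) by (auto simp: subset_iff)
  have wfG: "pair_wf_digraph G" by unfold_locales
  have wfH: "pair_wf_digraph H"
  proof
    show "fst e \<in> pverts H" "snd e \<in> pverts H" if "e \<in> parcs H" for e
      using G.arc_fst_in_verts[OF subsetD[OF sub that]] G.arc_snd_in_verts[OF subsetD[OF sub that]] G(2) H(1) by simp_all
  qed
  interpret H: pair_wf_digraph H by fact
  let ?w = "\<lambda>e. real (w e)" and ?d = "dst (length es) (esr es) (etg es) (ewt es w) b"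
  have span: "spanning (with_proj H) (with_proj G)"
    unfolding spanning_def subgraph_def compatible_def
    using sub G(2) H(1) G.wf_digraph_axioms H.wf_digraph_axioms by auto
  have low: "ereal (real (?d u v)) \<le> dist_in G ?w u v" if "walk {..<length es} (esr es) (etg es) (ewt es w) u v l" for u v l
  proof (rule le_dist_in[OF wfG])
    fix p assume p: "set p \<subseteq> parcs G" "pcas u p v"
    then obtain l' where "walk {..<length es} (esr es) (etg es) (ewt es w) u v l'" "sum_list (map ?w p) = real l'"
      using awalk_imp_walk[of p es u v w] G(3) by auto
    then show "ereal (real (?d u v)) \<le> ereal (sum_list (map ?w p))" using dst_walk(2) by fastforce
  qed
  have none: "dist_in G ?w u v = \<infinity>" if "\<nexists>l. walk {..<length es} (esr es) (etg es) (ewt es w) u v l" for u v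
  proof -
    have "\<infinity> \<le> dist_in G ?w u v"
      by (rule le_dist_in[OF wfG]) (use that awalk_imp_walk[of _ es u v w] G(3) in blast)
    then show ?thesis by simp
  qed
  have nonneg: "0 \<le> dist_in G ?w u v" for u v
    by (rule le_dist_in[OF wfG]) (simp, rule sum_list_nonneg, auto)
  have up: "dist_in H ?w u v \<le> ereal (real l)" if a: "walk A (esr es) (etg es) (ewt es w) u v l" "u < n" for u v l
  proof -
    obtain p where "set p \<subseteq> (!) es ` A" "pcas u p v" "sum_list (map ?w p) = real l" using walk_imp_awalk[OF a(1)] by blast
    then show ?thesis using dist_in_le[OF wfH, of u p v ?w] a(2) H(1) by simp
  qed
  have "dist_in H ?w u v + dist_in H ?w v u \<le> ereal c * (dist_in G ?w u v + dist_in G ?w v u)" if uv: "u < n" "v < n" for u v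
  proof (cases "(\<exists>l. walk {..<length es} (esr es) (etg es) (ewt es w) u v l) \<and> (\<exists>l. walk {..<length es} (esr es) (etg es) (ewt es w) v u l)")
    case False
    \<comment> \<open>Nonnegativity excludes minus infinity as the other summand.\<close>
    then have inf: "dist_in G ?w u v + dist_in G ?w v u = \<infinity>" using none nonneg by (metis plus_ereal.simps(2,3) ereal_plus_eq_PInfty)
    show ?thesis unfolding inf using c by simp
  next
    case True
    show ?thesis
    proof (cases "u = v")
      case True
      have "dist_in H ?w u u \<le> 0" using up[OF walk.nil uv(1)] by (simp add: zero_ereal_def)
      then have "dist_in H ?w u v + dist_in H ?w v u \<le> 0 + 0" unfolding True[symmetric] by (intro add_mono)
      also have "0 + 0 \<le> ereal c * (dist_in G ?w u v + dist_in G ?w v u)" using c nonneg by simp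
      finally show ?thesis .
    next
      case False
      obtain l l' where l: "walk {..<length es} (esr es) (etg es) (ewt es w) u v l" "walk {..<length es} (esr es) (etg es) (ewt es w) v u l'"
        using True by blast
      obtain l1 l2 where l12: "walk A (esr es) (etg es) (ewt es w) u v l1" "walk A (esr es) (etg es) (ewt es w) v u l2"
        "real (l1 + l2) \<le> c * real (?d u v + ?d v u)" using main[OF uv False l] by blast
      have "dist_in H ?w u v + dist_in H ?w v u \<le> ereal (real l1) + ereal (real l2)" using up l12 uv by (intro add_mono) auto
      also have "\<dots> \<le> ereal c * (ereal (real (?d u v)) + ereal (real (?d v u)))" using l12(3) by simp
      also have "\<dots> \<le> ereal c * (dist_in G ?w u v + dist_in G ?w v u)"
        using c low[OF l(1)] low[OF l(2)] by (intro ereal_mult_left_mono add_mono) auto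
      finally show ?thesis .
    qed
  qed
  then show ?thesis unfolding approx_roundtrip_spanner_def using span G(2) by auto
qed

section \<open>The whole program\<close>

context main begin

lemma good_gl:
  assumes "\<And>j. j < 2 * K \<Longrightarrow> S j = ys ! j" "length ys = 2 * K"
  shows "good d \<longleftrightarrow> gl K cap rt ys d"
proof -
  have "near S j v = near (nth ys) j v" if "j \<le> 2 * K" for j v using that assms(1) by (induction j) auto
  then have nr: "near S K = near (nth ys) K" by auto
  have "drop K ys = map (nth ys) [K..<2 * K]" using assms(2) by (metis drop_map drop_upt add_0 map_nth)
  also have "\<dots> = ss" using assms(1) by (simp add: ss_def)
  finally show ?thesis by (simp add: good_def gl_def cand_def picks_def nr)
qed

text \<open>Only the stretch is conditional on good scales; output size and clock are bounded for
  every choice of samples.\<close>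

lemma rest_wp:
  assumes b: "base r h" "r 10 = 1" "r 2 = 0" and q: "q \<le> N"
    and NN: "4 * K * n + Ns * (n * (2 * rt + 1)) + n < N" and Ns: "\<And>i. ds q i < dlim \<Longrightarrow> i < Ns"
    and Q: "\<And>r' h' t'. h' 0 = h 0 \<Longrightarrow> h' (Suc 0) = h (Suc 0) \<Longrightarrow> outok m h' (r' 2) \<Longrightarrow>
      r' 2 \<le> 4 * K * n + Ns * (n * (2 * rt + 1)) \<Longrightarrow>
      (\<And>u v l l'. (\<And>i. ds q i < dlim \<Longrightarrow> good (ds q i)) \<Longrightarrow> u < n \<Longrightarrow> v < n \<Longrightarrow> u \<noteq> v \<Longrightarrow>
        walk {..<m} sr tg wt u v l \<Longrightarrow> walk {..<m} sr tg wt v u l' \<Longrightarrow>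
        \<exists>l1 l2. walk (outs m h' (r' 2)) sr tg wt u v l1 \<and> walk (outs m h' (r' 2)) sr tg wt v u l2 \<and>
          q * (l1 + l2) \<le> (5 * q + 4) * (del u v + del v u)) \<Longrightarrow>
      t' \<le> t + (2 * K * TG + 50 * n + Ns * TS + 200) \<Longrightarrow> Q r' h' t'"
  shows "wp N (Seq glob (scales q)) Q r h t"
proof (rule wp_seq, rule glob_wp[OF b])
  show "4 * K * n + n < N" using NN by simp
  fix r1 h1 t1
  assume g: "frame GR GB r h r1 h1" "\<And>j v. j < 2 * K \<Longrightarrow> v < n \<Longrightarrow> h1 14 (j * n + v) = del (S j) v"
    "\<And>v. v < n \<Longrightarrow> h1 15 v = near S K v" "\<And>j. j < 2 * K \<Longrightarrow> tree_at (outs m h1 (r1 2)) (S j)"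
    "outok m h1 (r1 2)" "r1 2 \<le> 4 * K * n" "t1 \<le> t + (2 * K * TG + 50 * n + 60)"
  have av: "avoid GR GB" by (auto simp: avoid_def GR_def GB_def DR_def DB_def)
  have gb1: "gb r1 h1" using base_frame[OF b(1) g(1) av] g(2,3) by (simp add: gb_def)
  show "wp N (scales q) Q r1 h1 (t1 + 1)"
  proof (rule scales_wp[OF gb1 g(5) _ q Ns])
    show "r1 2 + Ns * (n * (2 * rt + 1)) + n < N" using g(6) NN by linarith
    fix r2 h2 t2
    assume s: "frame RS BS r1 h1 r2 h2" "outok m h2 (r2 2)" "outs m h1 (r1 2) \<subseteq> outs m h2 (r2 2)"
      "r2 2 \<le> r1 2 + Ns * (n * (2 * rt + 1))"
      "\<And>i u. ds q i < dlim \<Longrightarrow> good (ds q i) \<Longrightarrow> u < n \<Longrightarrow> 2 * ds q i < near S K u \<Longrightarrow> served (outs m h2 (r2 2)) (okk (ds q i) u) u"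
      "t2 \<le> t1 + 1 + Ns * TS + 100"
    show "Q r2 h2 t2"
    proof (rule Q)
      show "h2 0 = h 0" "h2 (Suc 0) = h (Suc 0)" using g(1) s(1) by (simp_all add: frame_def GB_def BS_def)
      show "\<exists>l1 l2. walk (outs m h2 (r2 2)) sr tg wt u v l1 \<and> walk (outs m h2 (r2 2)) sr tg wt v u l2 \<and>
          q * (l1 + l2) \<le> (5 * q + 4) * (del u v + del v u)"
        if "\<And>i. ds q i < dlim \<Longrightarrow> good (ds q i)" "u < n" "v < n" "u \<noteq> v" "walk {..<m} sr tg wt u v l" "walk {..<m} sr tg wt v u l'" for u v l l'
      proof (rule stretch[OF _ _ that(2-6)])
        show "tree_at (outs m h2 (r2 2)) (S j)" if "j < 2 * K" for j
          using g(4)[OF that] walk_mono[OF _ s(3)] unfolding tree_at_def by blast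
        show "served (outs m h2 (r2 2)) (okk (ds q i) u) u" if "ds q i < dlim" "u < n" "2 * ds q i < near S K u" for i u
          using s(5) that \<open>\<And>i. ds q i < dlim \<Longrightarrow> good (ds q i)\<close> by blast
      qed
    qed (use s g in auto)
  qed
qed

end

lemma ab_input: "ab (input_state n es w) = (\<lambda>_. 0)(0 := n, 1 := length es)"
  by (auto simp: ab_def input_state_def)

lemma mem_input: "mem (input_state n es w) = (\<lambda>_ _. 0)
        (0 := (\<lambda>i. if i < length es then fst (es ! i) else 0),
         1 := (\<lambda>i. if i < length es then snd (es ! i) else 0),
         2 := (\<lambda>i. if i < length es then w (es ! i) else 0))"
  by (simp add: input_state_def)

lemma output_graph_eq:
  assumes "outok (length es) h c" "\<And>e. e < length es \<Longrightarrow> h 0 e = fst (es ! e) \<and> h (Suc 0) e = snd (es ! e)"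
    "h = mem s" "c = reg s 2"
  shows "output_graph n s = \<lparr>pverts = {..<n}, parcs = (!) es ` outs (length es) h c\<rparr>"
proof -
  have "(\<lambda>i. (h 3 i, h 4 i)) ` {..<c} = (!) es ` outs (length es) h c"
  proof (intro equalityI subsetI)
    fix a assume "a \<in> (\<lambda>i. (h 3 i, h 4 i)) ` {..<c}"
    then obtain i where i: "i < c" "a = (h 3 i, h 4 i)" by auto
    then obtain e where e: "e < length es" "h 3 i = h 0 e \<and> h 4 i = h 1 e" using assms(1) unfolding outok_def by blast
    then have "a = es ! e" using i assms(2)[OF e(1)] by simp
    moreover have "e \<in> outs (length es) h c" using i e by (auto simp: outs_def)
    ultimately show "a \<in> (!) es ` outs (length es) h c" by blast
  next
    fix a assume "a \<in> (!) es ` outs (length es) h c"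
    then obtain e i where "e < length es" "a = es ! e" "i < c" "h 3 i = h 0 e" "h 4 i = h 1 e" by (auto simp: outs_def)
    then show "a \<in> (\<lambda>i. (h 3 i, h 4 i)) ` {..<c}" using assms(2)[of e] by (intro image_eqI[of _ _ i]) auto
  qed
  then show ?thesis using assms(3,4) by (simp add: output_graph_def)
qed

lemma card_output: "card (parcs (output_graph n s)) \<le> reg s 2"
  unfolding output_graph_def using card_image_le[of "{..<reg s 2}"] by simp

text \<open>The first branch contains the sampling loop, so the outermost conditional is handled
  with \<open>ex\<close> instead of \<open>wp_ifl\<close>.\<close>

lemma prog_branch:
  assumes "fit N s" "ab s 0 = n" "ab s 1 = m" "n * n * n \<le> N" "m * m \<le> N"
    and br: "\<And>s'. fit N s' \<Longrightarrow> ab s' = ab s \<Longrightarrow> mem s' = mem s \<Longrightarrow>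
      \<exists>D. ex N (if n * n * n < m * m then Seq (prelude \<kappa>) (Seq sampling (Seq glob (scales q))) else copy) s' T D \<and> X D"
  shows "\<exists>D. ex N (prog \<kappa> q) s (T + 30) D \<and> X D"
proof -
  let ?e1 = "Vr 0 [*] Vr 0 [*] Vr 0" and ?e2 = "Vr 1 [*] Vr 1"
  have nn: "n * n \<le> N"
  proof (cases n)
    case (Suc k)
    have "n * n * 1 \<le> n * n * n" using Suc by (intro mult_left_mono) auto
    then show ?thesis using assms(4) by linarith
  qed simp
  obtain s1 where s1: "ex N (Seq (cexp ?e1 60) (cexp ?e2 61)) s (tc ?e1 + Suc (tc ?e2)) (return_pmf s1)" "mem s1 = mem s"
     "ab s1 = ab s" "reg s1 60 = vl ?e1 (ab s) (mem s)" "reg s1 61 = vl ?e2 (ab s) (mem s)"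
    using comp2[of N s ?e1 ?e2] assms(1-5) nn by auto
  have f1: "fit N s1" using ex_fit[OF s1(1)] by simp
  obtain D where D: "ex N (if n * n * n < m * m then Seq (prelude \<kappa>) (Seq sampling (Seq glob (scales q))) else copy) s1 T D" "X D"
    using br[OF f1 s1(3,2)] by blast
  have "ex N (IfLess 60 61 (Seq (prelude \<kappa>) (Seq sampling (Seq glob (scales q)))) copy) s1 (Suc T) D"
    using D f1 s1 assms by (intro ex_det[OF f1 _ D(1)]) simp
  then have "ex N (prog \<kappa> q) s (tc ?e1 + Suc (tc ?e2) + Suc (Suc T)) (bind_pmf (return_pmf s1) (\<lambda>_. D))"
    unfolding prog_def ifl_def by (intro ex_Seq[OF s1(1)]) simp
  then have "ex N (prog \<kappa> q) s (T + 30) D" unfolding bind_return_pmf by (rule ex_mono) simp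
  then show ?thesis using D(2) by blast
qed

lemma small_run:
  fixes es :: "(nat \<times> nat) list" and w :: "nat \<times> nat \<Rightarrow> nat"
  assumes G: "pair_fin_digraph G" "pverts G = {..<n}" "set es = parcs G"
    and N: "n * n * n \<le> N" "length es * length es \<le> N" "length es < N"
    and fit: "fit N (input_state n es w)" and small: "\<not> n * n * n < length es * length es" and c: "1 \<le> c"
  shows "\<exists>D. ex N (prog \<kappa> q) (input_state n es w) (100 * length es + 100) D \<and>
    (\<forall>s\<in>set_pmf D. approx_roundtrip_spanner c G (\<lambda>e. real (w e)) (output_graph n s) \<and> reg s 2 \<le> length es)"
proof -
  let ?m = "length es" and ?s = "input_state n es w"
  have "\<exists>D. ex N (prog \<kappa> q) ?s (100 * ?m + 70 + 30) D \<and>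
    (\<forall>s\<in>set_pmf D. approx_roundtrip_spanner c G (\<lambda>e. real (w e)) (output_graph n s) \<and> reg s 2 \<le> length es)"
  proof (rule prog_branch[OF fit _ _ N(1,2)])
    show "ab ?s 0 = n" "ab ?s 1 = ?m" by (simp_all add: ab_input)
    fix s' assume s': "fit N s'" "ab s' = ab ?s" "mem s' = mem ?s"
    define h where "h = mem ?s"
    define I where "I i r h' t' \<longleftrightarrow> r 1 = ?m \<and> frame {} {3,4} r h r h' \<and> (\<forall>j<i. h' 3 j = fst (es ! j) \<and> h' 4 j = snd (es ! j)) \<and> t' \<le> 10 + 60 * i"
      for i and r :: "nat \<Rightarrow> nat" and h' and t' :: nat
    have "wp N copy (\<lambda>r h' t'. I ?m r h' 0 \<and> r 2 = ?m \<and> t' \<le> 60 * ?m + 60) (ab s') (mem s') 0"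
      unfolding copy_def
      apply (rule wp_seq, rule wp_forl[where I = I and b = ?m])
      subgoal by simp
      subgoal using s' by (simp add: I_def ab_input h_def frame_def)
      subgoal by (simp add: I_def)
      subgoal by (rule N(3))
      subgoal premises p for i r h' t'
      proof -
        have hh: "h' 0 i = fst (es ! i)" "h' (Suc 0) i = snd (es ! i)" using p(1,3) by (simp_all add: I_def frame_def h_def mem_input)
        show ?thesis
          apply (rule wp_seq, rule wp_sto)
          subgoal by simp
          subgoal by simp
          apply (rule wp_sto)
          subgoal by simp
          subgoal by simp
          subgoal using p hh by (auto simp: I_def frame_def less_Suc_eq)
          done
      qed
      subgoal premises p for r h' t'
        apply (rule wp_asg)
        subgoal by simp
        subgoal by simp
        subgoal using p(1) by (simp add: I_def frame_def)
        done
      done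
    then obtain s'' T where s'': "ex N copy s' T (return_pmf s'')" "I ?m (ab s'') (mem s'') 0" "ab s'' 2 = ?m" "T \<le> 60 * ?m + 60"
      unfolding wp_def using s'(1) by force
    have h01: "mem s'' 0 e = fst (es ! e) \<and> mem s'' (Suc 0) e = snd (es ! e)" if "e < ?m" for e
      using s''(2) that by (simp add: I_def frame_def h_def mem_input)
    have h34: "mem s'' 3 e = fst (es ! e) \<and> mem s'' 4 e = snd (es ! e)" if "e < ?m" for e
      using s''(2) that by (simp add: I_def)
    have r2: "reg s'' 2 = ?m" using s''(3) by (simp add: ab_def)
    have ok: "outok ?m (mem s'') (reg s'' 2)" unfolding outok_def r2 using h01 h34 by auto
    have out: "outs ?m (mem s'') (reg s'' 2) = {..<?m}" unfolding outs_def r2 using h01 h34 by auto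
    have "approx_roundtrip_spanner c G (\<lambda>e. real (w e)) (output_graph n s'')"
    proof (rule spanner_of_walks[OF G output_graph_eq[OF ok h01 refl refl, unfolded out] order_refl, where b = 0])
      show "0 < c" using c by simp
      fix u v l l'
      assume a: "walk {..<?m} (esr es) (etg es) (ewt es w) u v l" "walk {..<?m} (esr es) (etg es) (ewt es w) v u l'"
      let ?d = "dst ?m (esr es) (etg es) (ewt es w) 0"
      have "1 * real (?d u v + ?d v u) \<le> c * real (?d u v + ?d v u)" using c by (intro mult_right_mono) auto
      then show "\<exists>l1 l2. walk {..<?m} (esr es) (etg es) (ewt es w) u v l1 \<and> walk {..<?m} (esr es) (etg es) (ewt es w) v u l2 \<and>
        real (l1 + l2) \<le> c * real (?d u v + ?d v u)"
        using dst_walk(1)[OF a(1)] dst_walk(1)[OF a(2)] by (intro exI[of _ "?d u v"] exI[of _ "?d v u"]) auto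
    qed
    moreover have "ex N copy s' (100 * ?m + 70) (return_pmf s'')" using s''(4) by (intro ex_mono[OF s''(1)]) simp
    ultimately show "\<exists>D. ex N (if n * n * n < ?m * ?m then Seq (prelude \<kappa>) (Seq sampling (Seq glob (scales q))) else copy) s' (100 * ?m + 70) D \<and>
      (\<forall>s\<in>set_pmf D. approx_roundtrip_spanner c G (\<lambda>e. real (w e)) (output_graph n s) \<and> reg s 2 \<le> ?m)"
      using small r2 by (intro exI[of _ "return_pmf s''"]) simp
  qed
  then show ?thesis by (simp add: add.assoc)
qed

section \<open>Running time on dense graphs\<close>

context main begin

text \<open>The critical part is the initialisation of \<open>n\<close> searches per scale, of order
  n^2 l; the hypothesis \<open>n * n \<le> m * rt\<close> absorbs it. Choosing the filters costs
  about \<open>n * K * cap\<close> per scale and the relaxations about \<open>m * rt * cap\<close>,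
  which accounts for both factors \<open>l\<close> and both factors \<kappa>.\<close>

lemma time_bound:
  assumes "n \<le> m" "n * n \<le> m * rt" "1 \<le> l" "1 \<le> \<kappa>" "1 \<le> rt" "L = l + 1" "K = \<kappa> * rt * l" "cap = 3 * \<kappa> * l"
  shows "2 * K * TG + 50 * n + Ns * TS + 200 \<le> 20000 * (Ns + 1) * (\<kappa> * \<kappa> * l * l * m * rt)"
proof -
  have m1: "1 \<le> m" using n1 assms(1) by simp
  define a where "a = l * m"
  define X where "X = \<kappa> * \<kappa> * l * l * m * rt"
  have al: "n * l \<le> a" "n \<le> a" "l \<le> a" "1 \<le> a" "m \<le> a" "m * l = a"
    unfolding a_def using assms(1,3) m1 by (auto simp: mult.commute intro: mult_le_mono le_trans[OF assms(1)] )
  have TD: "TD \<le> 2105 * a"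
  proof -
    have "TD = 100 * (n * l) + 900 * n + 100 * l + 400 + 100 * (m * l) + 505 * m"
      unfolding TD_def by (simp add: assms(6) algebra_simps)
    then show ?thesis using al by linarith
  qed
  then have TG: "TG \<le> 5110 * a" unfolding TG_def using al by linarith
  have aX: "\<kappa> * rt * l * a \<le> X"
  proof -
    have "\<kappa> * rt * l * a * 1 \<le> \<kappa> * rt * l * a * \<kappa>" using assms(4) by (rule mult_left_mono) simp
    then show ?thesis by (simp add: X_def a_def mult_ac)
  qed
  have g1: "2 * K * TG \<le> 10220 * X"
  proof -
    have "2 * K * TG \<le> 2 * K * (5110 * a)" using TG by (rule mult_left_mono) simp
    also have "\<dots> = 10220 * (\<kappa> * rt * l * a)" by (simp add: assms(7))
    finally show ?thesis using aX by linarith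
  qed
  have kl: "1 \<le> \<kappa> * l" "l \<le> \<kappa> * l" using assms(3,4) by auto
  have TF: "TF1 + 700 \<le> 1400 * (\<kappa> * l)" "TA \<le> 1360 * (\<kappa> * l)"
  proof -
    have c: "200 * cap = 600 * (\<kappa> * l)" by (simp add: assms(8))
    show "TF1 + 700 \<le> 1400 * (\<kappa> * l)" using kl c unfolding TF1_def by linarith
    show "TA \<le> 1360 * (\<kappa> * l)" using kl c assms(6) unfolding TA_def TF1_def by linarith
  qed
  have mX: "m * rt \<le> X" "m * rt * (\<kappa> * l) \<le> X" "m * rt * l \<le> X"
  proof -
    have "m * rt * (\<kappa> * l) * 1 \<le> m * rt * (\<kappa> * l) * (\<kappa> * l)" using kl(1) by (rule mult_left_mono) simp
    then show b: "m * rt * (\<kappa> * l) \<le> X" by (simp add: X_def mult_ac)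
    have "m * rt * 1 \<le> m * rt * (\<kappa> * l)" using kl(1) by (rule mult_left_mono) simp
    then show "m * rt \<le> X" using b by linarith
    have "m * rt * l \<le> m * rt * (\<kappa> * l)" using kl(2) by (rule mult_left_mono) simp
    then show "m * rt * l \<le> X" using b by linarith
  qed
  have nX: "n \<le> X" "m \<le> X" "1 \<le> X"
  proof -
    have "m * 1 \<le> m * rt" using assms(5) by (rule mult_left_mono) simp
    then show "m \<le> X" using mX(1) by linarith
    then show "n \<le> X" "1 \<le> X" using assms(1) m1 by auto
  qed
  have TSel: "TSel \<le> 1600 * X"
  proof -
    have "n * (K * (TF1 + 700)) \<le> m * (K * (1400 * (\<kappa> * l)))" using assms(1) TF by (intro mult_mono) auto
    also have "\<dots> = 1400 * X" by (simp add: assms(7) X_def mult_ac)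
    finally have "n * (K * (TF1 + 700)) \<le> 1400 * X" .
    then show ?thesis using nX unfolding TSel_def add_mult_distrib2 by linarith
  qed
  have TLoc: "TLoc \<le> 5880 * X"
  proof -
    have "n * 1 \<le> n * l" "1 * l \<le> n * l" using assms(3) n1 by (auto intro: mult_le_mono)
    moreover have "TL = 100 * (n * l) + 900 * n + 100 * l + 400" unfolding TL_def by (simp add: assms(6) algebra_simps)
    ultimately have "TL + 100 \<le> 1600 * (n * l)" using n1 assms(3) by linarith
    then have "n * (TL + 100) \<le> n * (1600 * (n * l))" by (rule mult_left_mono) simp
    also have "\<dots> = 1600 * (n * n * l)" by simp
    also have "n * n * l \<le> m * rt * l" using assms(2) by (rule mult_right_mono) simp
    finally have 1: "n * (TL + 100) \<le> 1600 * X" using mX(3) by linarith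
    have "m * (2 * rt + 1) * TA \<le> m * (3 * rt) * (1360 * (\<kappa> * l))" using assms(5) TF by (intro mult_mono) auto
    also have "\<dots> = 4080 * (m * rt * (\<kappa> * l))" by simp
    finally have "m * (2 * rt + 1) * TA \<le> 4080 * X" using mX(2) by linarith
    then show ?thesis using 1 nX unfolding TLoc_def by linarith
  qed
  have TS: "TS \<le> 7720 * X" unfolding TS_def using TSel TLoc nX by linarith
  then have "Ns * TS \<le> Ns * (7720 * X)" by (rule mult_left_mono) simp
  moreover have "Ns * (7720 * X) = 7720 * (Ns * X)" "20000 * (Ns + 1) * X = 20000 * (Ns * X) + 20000 * X"
    by (simp_all add: algebra_simps)
  ultimately show ?thesis using g1 nX unfolding X_def[symmetric] by linarith
qed

end

lemma lgn_le: "1 \<le> n \<Longrightarrow> lgn n \<le> n"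
  using lgn_props(3)[of n] less_exp[of "lgn n - 1"] by linarith

lemma sqn_le: "sqn n \<le> n"
  unfolding sqn_def by (rule Least_le) simp

text \<open>A single product that dominates, up to constants, whatever the program stores; a factor
  100 in the choice of the word bound later makes room for these constants.\<close>

lemma width:
  fixes n W \<kappa> q Ns :: nat
  assumes n: "1 \<le> n" and P: "P = (\<kappa> + 1) * (q + 1) * (Ns + 1) * (W + 1) * (n + 1) ^ 4"
  shows "\<kappa> * n * n * n \<le> P" "\<kappa> * n * n \<le> P" "\<kappa> * n \<le> P" "\<kappa> \<le> P" "q \<le> P" "Ns * n * n \<le> P" "W * n * n \<le> P" "W * n \<le> P" "W \<le> P"
    "n * n * n * n \<le> P" "n * n * n \<le> P" "n * n \<le> P" "n \<le> P" "1 \<le> P"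
proof -
  have e: "n * n * n * n \<le> (n + 1) ^ 4" "n * n * n \<le> (n + 1) ^ 4" "n * n \<le> (n + 1) ^ 4" "n \<le> (n + 1) ^ 4" "1 \<le> (n + 1) ^ 4"
    by (simp_all add: eval_nat_numeral algebra_simps)
  have m: "a * b * c * d * x \<le> P" if "a \<le> \<kappa> + 1" "b \<le> q + 1" "c \<le> Ns + 1" "d \<le> W + 1" "x \<le> (n + 1) ^ 4" for a b c d x
    unfolding P using that by (intro mult_mono) auto
  show "\<kappa> * n * n * n \<le> P" using m[of \<kappa> 1 1 1 "n * n * n"] e by (simp add: mult.assoc)
  show "\<kappa> * n * n \<le> P" using m[of \<kappa> 1 1 1 "n * n"] e by (simp add: mult.assoc)
  show "\<kappa> * n \<le> P" using m[of \<kappa> 1 1 1 "n"] e by simp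
  show "\<kappa> \<le> P" using m[of \<kappa> 1 1 1 1] e by simp
  show "q \<le> P" using m[of 1 q 1 1 1] e by simp
  show "Ns * n * n \<le> P" using m[of 1 1 Ns 1 "n * n"] e by (simp add: mult.assoc)
  show "W * n * n \<le> P" using m[of 1 1 1 W "n * n"] e by (simp add: mult.assoc)
  show "W * n \<le> P" using m[of 1 1 1 W "n"] e by simp
  show "W \<le> P" using m[of 1 1 1 W 1] e by simp
  show "n * n * n * n \<le> P" using m[of 1 1 1 1 "n * n * n * n"] e by simp
  show "n * n * n \<le> P" using m[of 1 1 1 1 "n * n * n"] e by simp
  show "n * n \<le> P" using m[of 1 1 1 1 "n * n"] e by simp
  show "n \<le> P" using m[of 1 1 1 1 n] e by simp
  show "1 \<le> P" using m[of 1 1 1 1 1] e by simp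
qed

text \<open>The bound of \<open>bad_prob\<close> at the parameters of the program; it depends on
  \<open>n\<close> and \<kappa> only, not on the weights.\<close>

definition pbad :: "nat \<Rightarrow> nat \<Rightarrow> real" where
  "pbad \<kappa> n = (let K = \<kappa> * sqn n * lgn n in real (n * (n + 1)) * (1 - real (sqn n) / n) ^ K +
    real (n * ((n + 1) * ((n + 1) * (n * n + 1)))) *
      (real n * ((1 - real (sqn n) / (2 * n)) ^ K + (3 / 4) ^ (3 * \<kappa> * lgn n))))"

lemma ex_Seq_return:
  assumes "ex N p s T1 (return_pmf s')" "ex N q s' T2 D"
  shows "ex N (Seq p q) s (T1 + Suc T2) D"
  using ex_Seq[OF assms(1), of q T2 "\<lambda>_. D"] assms(2) by (simp only: bind_return_pmf set_return_pmf singleton_iff simp_thms)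

lemma big_run:
  fixes es :: "(nat \<times> nat) list" and w :: "nat \<times> nat \<Rightarrow> nat"
  defines "m \<equiv> length es" and "W \<equiv> mx (ewt es w) (length es)"
  assumes G: "pair_fin_digraph G" "pverts G = {..<n}" "set es = parcs G"
    and n: "1 \<le> n" and big: "n * n * n < m * m" and mn: "m \<le> n * n"
    and w1: "\<And>e. e < m \<Longrightarrow> 1 \<le> w (es ! e)"
    and \<kappa>: "1 \<le> \<kappa>" and q: "1 \<le> q" and c: "real (5 * q + 4) \<le> c * real q"
    and Ns: "\<And>i. ds q i < 4 * n * W + 1 \<Longrightarrow> i < Ns"
    and N: "100 * ((\<kappa> + 1) * (q + 1) * (Ns + 1) * (W + 1) * (n + 1) ^ 4) \<le> N"
    and fit: "fit N (input_state n es w)"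
  shows "\<exists>D. ex N (prog \<kappa> q) (input_state n es w) (30000 * (Ns + 1) * (\<kappa> * \<kappa> * lgn n * lgn n * m * sqn n)) D \<and>
    (\<forall>s\<in>set_pmf D. reg s 2 \<le> 4 * (\<kappa> * sqn n * lgn n) * n + Ns * (n * (2 * sqn n + 1))) \<and>
    measure_pmf.prob D {s. approx_roundtrip_spanner c G (\<lambda>e. real (w e)) (output_graph n s)} \<ge> 1 - pbad \<kappa> n"
proof -
  define rt l where "rt = sqn n" and "l = lgn n"
  define K where "K = \<kappa> * rt * l"
  define cap where "cap = 3 * \<kappa> * l"
  define dl where "dl = 4 * n * W + 1"
  define P where "P = (\<kappa> + 1) * (q + 1) * (Ns + 1) * (W + 1) * (n + 1) ^ 4"
  note wd = width[OF n P_def]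
  have NP: "100 * P \<le> N" using N unfolding P_def .
  note sq = sqn_props[OF n, folded rt_def] and lg = lgn_props[OF n, folded l_def]
  have rn: "rt \<le> n" and ln: "l \<le> n" using sqn_le lgn_le[OF n] by (simp_all add: rt_def l_def)
  have nm: "n \<le> m"
  proof (rule ccontr)
    assume "\<not> n \<le> m"
    then have "m * m * 1 \<le> n * n * n" using n by (intro mult_mono) auto
    then show False using big by simp
  qed
  \<comment> \<open>After squaring: n^4 is n^3 times n, where n^3 < m^2 and n is at most
    rt^2.\<close>
  have nnm: "n * n \<le> m * rt"
  proof (rule power2_le_imp_le)
    have "(n * n)\<^sup>2 = (n * n * n) * n" by (simp add: power2_eq_square)
    also have "\<dots> \<le> (m * m) * (rt * rt)" using big sq(1) by (intro mult_mono[of "n * n * n"]) auto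
    finally show "(n * n)\<^sup>2 \<le> (m * rt)\<^sup>2" by (simp add: power2_eq_square mult_ac)
  qed simp
  have Kb: "K \<le> \<kappa> * n * n" unfolding K_def using rn ln by (intro mult_mono) auto
  have Knb: "K * n \<le> \<kappa> * n * n * n" using Kb by (rule mult_right_mono) simp
  have capb: "cap \<le> 3 * (\<kappa> * n)" "n * cap \<le> 3 * (\<kappa> * n * n)"
  proof -
    have "3 * \<kappa> * l \<le> 3 * \<kappa> * n" using ln by (rule mult_left_mono) simp
    then show c: "cap \<le> 3 * (\<kappa> * n)" by (simp add: cap_def mult.assoc)
    have "n * cap \<le> n * (3 * (\<kappa> * n))" using c by (rule mult_left_mono) simp
    then show "n * cap \<le> 3 * (\<kappa> * n * n)" by (simp add: mult_ac)
  qed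
  have BIGn: "2 * dl = 8 * (W * n) + 2" "2 * dl * n = 8 * (W * n * n) + 2 * n" by (simp_all add: dl_def algebra_simps)
  have mm: "m * m \<le> n * n * n * n"
  proof -
    have "m * m \<le> (n * n) * (n * n)" using mn by (intro mult_mono) auto
    then show ?thesis by (simp add: mult.assoc)
  qed
  have Nsn: "Ns * (n * (2 * rt + 1)) \<le> 3 * (Ns * n * n)"
  proof -
    have "2 * rt + 1 \<le> 3 * n" using rn n by simp
    then have "Ns * (n * (2 * rt + 1)) \<le> Ns * (n * (3 * n))" by (intro mult_left_mono) auto
    then show ?thesis by (simp add: mult_ac)
  qed
  have ed: "esr es e < n" "etg es e < n" "1 \<le> ewt es w e" "ewt es w e \<le> W" if "e < m" for e
  proof -
    interpret G: pair_fin_digraph G by fact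
    have "es ! e \<in> parcs G" using that G(3) unfolding m_def by (metis nth_mem)
    then show "esr es e < n" "etg es e < n" using G.arc_fst_in_verts G.arc_snd_in_verts G(2) by auto
    show "1 \<le> ewt es w e" using w1[OF that] .
    show "ewt es w e \<le> W" unfolding W_def using mx_ge[of e m "ewt es w"] that by (simp add: m_def)
  qed
  let ?sr = "esr es" and ?tg = "etg es" and ?wt = "ewt es w"
  interpret Wg: wgraph n m ?sr ?tg ?wt W "2 * dl"
  proof
    have "W * 1 \<le> W * n" using n by (intro mult_left_mono) auto
    moreover have "n * W = W * n" by simp
    ultimately show "n * W < 2 * dl" "W < 2 * dl" using BIGn(1) by linarith+
  qed (use ed in auto)
  have N1: "4 * n + 4 \<le> N" "m < N" "\<kappa> * rt * l * 2 \<le> N" "3 * \<kappa> * l \<le> N" "(2 * (4 * n * W + 1)) * n \<le> N" "\<kappa> * 3 \<le> N"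
  proof -
    show "4 * n + 4 \<le> N" "\<kappa> * 3 \<le> N" using NP wd by linarith+
    show "m < N" using NP wd mn by linarith
    show "\<kappa> * rt * l * 2 \<le> N" using Kb NP wd unfolding K_def by linarith
    show "3 * \<kappa> * l \<le> N" using capb NP wd unfolding cap_def by linarith
    show "(2 * (4 * n * W + 1)) * n \<le> N" using BIGn(2) NP wd unfolding dl_def by linarith
  qed
  have N2: "2 * dl * n \<le> N" "4 * (2 * dl) + W + 4 \<le> N" "2 * K * n + n \<le> N" "n * cap + cap \<le> N" "2 * K < N" "2 * rt + 1 < N"
    "4 * K * n + Ns * (n * (2 * rt + 1)) + n < N" "q \<le> N" "n * n * n \<le> N" "m * m \<le> N"
  proof -
    show "2 * dl * n \<le> N" using BIGn(2) NP wd by linarith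
    show "4 * (2 * dl) + W + 4 \<le> N" using BIGn(1) NP wd by linarith
    show "2 * K * n + n \<le> N" using Knb NP wd by linarith
    show "n * cap + cap \<le> N" using capb NP wd by linarith
    show "2 * K < N" using Kb NP wd by linarith
    show "2 * rt + 1 < N" using rn NP wd by linarith
    show "4 * K * n + Ns * (n * (2 * rt + 1)) + n < N" using Knb Nsn NP wd by linarith
    show "q \<le> N" "n * n * n \<le> N" using NP wd by linarith+
    show "m * m \<le> N" using mm NP wd by linarith
  qed
  \<comment> \<open>All \<open>d\<close> below \<open>dl\<close> are covered, not only the scales of
    the program; the union over configurations makes this free of charge.\<close>
  define Bad where "Bad = {ys. \<exists>d. 2 * d < 2 * dl \<and> \<not> Wg.gl K cap rt ys d}"
  have pb: "measure_pmf.prob (samp n (K + K)) Bad \<le> pbad \<kappa> n"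
    unfolding Bad_def pbad_def Let_def using Wg.bad_prob[OF n rn, of K cap]
    by (simp only: K_def cap_def rt_def l_def)
  define X where "X = \<kappa> * \<kappa> * l * l * m * rt"
  define TR where "TR = 20000 * (Ns + 1) * X"
  define TP where "TP = 60 * rt + 80 * l + 200 * m + 500"
  define RB where "RB = 4 * K * n + Ns * (n * (2 * rt + 1))"
  let ?ok = "\<lambda>s. approx_roundtrip_spanner c G (\<lambda>e. real (w e)) (output_graph n s)"
  let ?s0 = "input_state n es w"
  let ?X = "\<lambda>D. (\<forall>s\<in>set_pmf D. reg s 2 \<le> RB) \<and> measure_pmf.prob D {s. ?ok s} \<ge> 1 - pbad \<kappa> n"
  have "\<exists>D. ex N (prog \<kappa> q) ?s0 ((TP + Suc (7 * (2 * K) + 1 + Suc (TR + 10))) + 30) D \<and> ?X D"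
  proof (rule prog_branch[OF fit])
    show "ab ?s0 0 = n" "ab ?s0 1 = m" by (simp_all add: ab_input m_def)
    show "n * n * n \<le> N" "m * m \<le> N" by (rule N2)+
    fix s' assume s': "fit N s'" "ab s' = ab ?s0" "mem s' = mem ?s0"
    have h0: "mem s' 0 e = ?sr e \<and> mem s' (Suc 0) e = ?tg e \<and> mem s' 2 e = ?wt e" if "e < m" for e
      using that by (simp add: s' mem_input m_def)
    let ?Q = "\<lambda>r' h' t'. frame PR {5,6,7,8} (ab s') (mem s') r' h' \<and> r' 3 = rt \<and> r' 6 = K \<and> r' 7 = 2 * K \<and> r' 12 = dl \<and> r' 8 = 2 * dl \<and>
       r' 9 = 2 * dl * n \<and> r' 10 = 1 \<and> r' 11 = cap \<and> r' 13 = 1 \<and> r' 20 = 0 \<and>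
       (\<forall>e<m. h' 6 e = prv ?sr (?sr e) e \<and> h' 8 e = prv ?tg (?tg e) e) \<and> (\<forall>v<n. h' 5 v = prv ?sr v m \<and> h' 7 v = prv ?tg v m) \<and> t' \<le> TP"
    have "wp N (prelude \<kappa>) ?Q (ab s') (mem s') 0"
    proof (rule prelude_wp[where n = n and m = m and sr = ?sr and tg = ?tg and wt = ?wt])
      show "ab s' 0 = n" "ab s' 1 = m" "ab s' 5 = 0" by (simp_all add: s' ab_input m_def)
      show "mem s' 5 v = 0" "mem s' 7 v = 0" for v by (simp_all add: s' mem_input)
      show "2 * (4 * n * mx ?wt m + 1) * n \<le> N" using N1(5) by (simp add: W_def m_def)
      show "\<kappa> * sqn n * lgn n * 2 \<le> N" "3 * \<kappa> * lgn n \<le> N" using N1 by (simp_all add: rt_def l_def)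
    qed (use n h0 ed N1 in \<open>auto simp: rt_def l_def K_def dl_def cap_def TP_def W_def m_def\<close>)
    then obtain s1 T1 where s1: "ex N (prelude \<kappa>) s' T1 (return_pmf s1)" "?Q (ab s1) (mem s1) (0 + T1)"
      unfolding wp_def using s'(1) by blast
    have f1: "fit N s1" using ex_fit[OF s1(1)] by simp
    have r0: "ab s1 0 = n" "ab s1 (Suc 0) = m" "ab s1 2 = 0"
      using s1(2) by (simp_all add: frame_def PR_def s' ab_input m_def)
    have e1: "ex N (prelude \<kappa>) s' TP (return_pmf s1)" using s1 by (auto intro: ex_mono)
    have regs1: "reg s1 0 = n" "reg s1 13 = 1" "reg s1 20 = 0" "reg s1 7 = 2 * K"
      using s1(2) r0(1) by (simp_all add: ab_def)
    let ?D1 = "map_pmf (\<lambda>ys. fold put ys s1) (samp n (2 * K))"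
    have e2: "ex N sampling s1 (7 * (2 * K) + 1) ?D1"
      using f1 n regs1 by (intro sampling_ex) simp_all
    let ?FP = "\<lambda>ys s3. reg s3 2 \<le> RB \<and> (ys \<notin> Bad \<longrightarrow> ?ok s3)"
    \<comment> \<open>Once the drawn list \<open>ys\<close> is fixed, the rest of the program is
      deterministic and the locale \<open>main\<close> applies.\<close>
    have rest: "\<exists>s3. ex N (Seq glob (scales q)) (fold put ys s1) (TR + 10) (return_pmf s3) \<and> ?FP ys s3" if ys: "ys \<in> set_pmf (samp n (2 * K))" for ys
    proof -
      have yl: "length ys = 2 * K" "set ys \<subseteq> {..<n}" using samp_set[OF n ys] by auto
      interpret M: main n m ?sr ?tg ?wt W "2 * dl" K cap rt dl N "l + 1" "nth ys"
      proof
        show "ys ! j < n" if "j < 2 * K" for j using yl that by (metis lessThan_iff nth_mem subsetD)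
        show "2 * n \<le> 2 ^ (l + 1)" using lg(1) by simp
      qed (use n N1 N2 in \<open>auto simp: dl_def\<close>)
      let ?s2 = "fold put ys s1"
      have f2: "fit N ?s2" using ex_fit[OF e2] ys by auto
      have rg: "ab ?s2 x = ab s1 x" if "x \<noteq> 14" "x \<noteq> 20" for x
        using fold_put(1)[OF refl that, of ys s1] by (simp add: ab_def)
      have mg: "mem ?s2 a = mem s1 a" if "a \<noteq> 13" for a using fold_put(2)[OF that] .
      have m13: "mem ?s2 13 j = ys ! j" if "j < 2 * K" for j
        using fold_put(3)[of j ys s1] that yl(1) regs1(3) by simp
      have h1: "mem s1 0 = mem s' 0" "mem s1 (Suc 0) = mem s' (Suc 0)" "mem s1 2 = mem s' 2" using s1(2) by (simp_all add: frame_def)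
      have b2: "M.base (ab ?s2) (mem ?s2)"
        unfolding M.base_def using s1(2) r0 h0 m13 by (simp add: rg mg h1)
      define Qr where "Qr r' h' t' \<longleftrightarrow> h' 0 = mem ?s2 0 \<and> h' (Suc 0) = mem ?s2 (Suc 0) \<and> outok m h' (r' 2) \<and> r' 2 \<le> RB \<and>
         ((\<forall>i. ds q i < dl \<longrightarrow> M.good (ds q i)) \<longrightarrow> (\<forall>u v l l'. u < n \<longrightarrow> v < n \<longrightarrow> u \<noteq> v \<longrightarrow>
           walk {..<m} ?sr ?tg ?wt u v l \<longrightarrow> walk {..<m} ?sr ?tg ?wt v u l' \<longrightarrow>
          (\<exists>l1 l2. walk (outs m h' (r' 2)) ?sr ?tg ?wt u v l1 \<and> walk (outs m h' (r' 2)) ?sr ?tg ?wt v u l2 \<and>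
            q * (l1 + l2) \<le> (5 * q + 4) * (Wg.del u v + Wg.del v u)))) \<and> t' \<le> TR" for r' :: "nat \<Rightarrow> nat" and h' :: "nat \<Rightarrow> nat \<Rightarrow> nat" and t' :: nat
      have "wp N (Seq glob (scales q)) Qr (ab ?s2) (mem ?s2) 0"
      proof (rule M.rest_wp[OF b2 _ _ N2(8,7)])
        show "ab ?s2 10 = 1" "ab ?s2 2 = 0" using s1(2) r0 by (simp_all add: rg)
        show "i < Ns" if "ds q i < dl" for i using Ns that by (simp add: dl_def)
      next
        fix r' :: "nat \<Rightarrow> nat" and h' :: "nat \<Rightarrow> nat \<Rightarrow> nat" and t' :: nat
        assume a: "h' 0 = mem ?s2 0" "h' (Suc 0) = mem ?s2 (Suc 0)" "outok m h' (r' 2)"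
          "r' 2 \<le> 4 * K * n + Ns * (n * (2 * rt + 1))"
          "\<And>u v l l'. (\<And>i. ds q i < dl \<Longrightarrow> M.good (ds q i)) \<Longrightarrow> u < n \<Longrightarrow> v < n \<Longrightarrow> u \<noteq> v \<Longrightarrow>
             walk {..<m} ?sr ?tg ?wt u v l \<Longrightarrow> walk {..<m} ?sr ?tg ?wt v u l' \<Longrightarrow>
             \<exists>l1 l2. walk (outs m h' (r' 2)) ?sr ?tg ?wt u v l1 \<and> walk (outs m h' (r' 2)) ?sr ?tg ?wt v u l2 \<and>
               q * (l1 + l2) \<le> (5 * q + 4) * (Wg.del u v + Wg.del v u)"
          "t' \<le> 0 + (2 * K * M.TG + 50 * n + Ns * M.TS + 200)"
        have "2 * K * M.TG + 50 * n + Ns * M.TS + 200 \<le> TR"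
          unfolding TR_def X_def using nm nnm lg(2) \<kappa> sq(2) by (intro M.time_bound) (simp_all add: K_def cap_def)
        then have "t' \<le> TR" using a(6) by simp
        moreover have "r' 2 \<le> RB" using a(4) by (simp add: RB_def)
        ultimately show "Qr r' h' t'"
          unfolding Qr_def using a(1-3,5) by blast
      qed
      from this[unfolded wp_def, rule_format, OF f2 refl refl]
      obtain s3 T3 where e: "ex N (Seq glob (scales q)) ?s2 T3 (return_pmf s3)" and Qr: "Qr (ab s3) (mem s3) (0 + T3)" by blast
      have s3: "ex N (Seq glob (scales q)) ?s2 T3 (return_pmf s3)" "T3 \<le> TR"
        "mem s3 0 = mem ?s2 0" "mem s3 (Suc 0) = mem ?s2 (Suc 0)" "outok m (mem s3) (ab s3 2)" "ab s3 2 \<le> RB"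
        using e Qr unfolding Qr_def by simp_all
      have s37: "\<exists>l1 l2. walk (outs m (mem s3) (ab s3 2)) ?sr ?tg ?wt u v l1 \<and> walk (outs m (mem s3) (ab s3 2)) ?sr ?tg ?wt v u l2 \<and>
               q * (l1 + l2) \<le> (5 * q + 4) * (Wg.del u v + Wg.del v u)"
        if "\<forall>i. ds q i < dl \<longrightarrow> M.good (ds q i)" "u < n" "v < n" "u \<noteq> v"
          "walk {..<m} ?sr ?tg ?wt u v l" "walk {..<m} ?sr ?tg ?wt v u l'" for u v l l'
        using Qr that unfolding Qr_def by blast
      have r2: "ab s3 2 = reg s3 2" by (simp add: ab_def)
      have h3: "mem s3 0 e = ?sr e \<and> mem s3 (Suc 0) e = ?tg e" if "e < length es" for e
        using h0[of e] that by (simp add: s3(3,4) mg h1 m_def)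
      have "?ok s3" if nb: "ys \<notin> Bad"
      proof (rule spanner_of_walks[OF G output_graph_eq[OF _ h3 refl refl], where b = "2 * dl"])
        show "outok (length es) (mem s3) (reg s3 2)" using s3(5) by (simp add: r2 m_def)
        show "outs (length es) (mem s3) (reg s3 2) \<subseteq> {..<length es}" by (auto simp: outs_def)
        show "0 < c"
        proof (rule ccontr)
          assume "\<not> 0 < c"
          then have "c * real q \<le> 0" by (intro mult_nonpos_nonneg) auto
          then show False using c by simp
        qed
        fix u v l l'
        assume uv: "u < n" "v < n" "u \<noteq> v" "walk {..<length es} ?sr ?tg ?wt u v l" "walk {..<length es} ?sr ?tg ?wt v u l'"
        have gd: "M.good (ds q i)" if "ds q i < dl" for i
          using nb that M.good_gl[OF refl yl(1)] unfolding Bad_def by auto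
        have "\<forall>i. ds q i < dl \<longrightarrow> M.good (ds q i)" using gd by blast
        from s37[OF this uv(1-3) uv(4,5)[folded m_def]]
        obtain l1 l2 where l: "walk (outs m (mem s3) (ab s3 2)) ?sr ?tg ?wt u v l1" "walk (outs m (mem s3) (ab s3 2)) ?sr ?tg ?wt v u l2"
          "q * (l1 + l2) \<le> (5 * q + 4) * (Wg.del u v + Wg.del v u)" by blast
        have "real q * real (l1 + l2) \<le> real (5 * q + 4) * real (Wg.del u v + Wg.del v u)"
          using l(3) by (metis of_nat_le_iff of_nat_mult)
        also have "\<dots> \<le> (c * real q) * real (Wg.del u v + Wg.del v u)" using c by (rule mult_right_mono) simp
        also have "\<dots> = real q * (c * real (Wg.del u v + Wg.del v u))" by simp
        finally have "real (l1 + l2) \<le> c * real (Wg.del u v + Wg.del v u)" using q by simp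
        then show "\<exists>l1 l2. walk (outs (length es) (mem s3) (reg s3 2)) ?sr ?tg ?wt u v l1 \<and>
          walk (outs (length es) (mem s3) (reg s3 2)) ?sr ?tg ?wt v u l2 \<and>
          real (l1 + l2) \<le> c * real (dst (length es) ?sr ?tg ?wt (2 * dl) u v + dst (length es) ?sr ?tg ?wt (2 * dl) v u)"
          using l(1,2) unfolding m_def r2 by blast
      qed
      moreover have "ex N (Seq glob (scales q)) ?s2 (TR + 10) (return_pmf s3)" using s3(2) by (intro ex_mono[OF s3(1)]) simp
      ultimately show ?thesis using s3(6) r2 by auto
    qed
    \<comment> \<open>\<open>ex_Seq\<close> wants the outcome as a function of the intermediate
      state. \<open>yo\<close> reads the sample list back from array 13, so that the choice of
      \<open>g\<close> can refer to it.\<close>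
    define yo where "yo s = map (mem s 13) [0..<2 * K]" for s :: ram_state
    have yo: "yo (fold put ys s1) = ys" if "ys \<in> set_pmf (samp n (2 * K))" for ys
      using samp_set[OF n that] fold_put(3)[of _ ys s1] regs1(3) by (intro nth_equalityI) (auto simp: yo_def)
    have "\<forall>s. \<exists>s3. s \<in> set_pmf ?D1 \<longrightarrow> ex N (Seq glob (scales q)) s (TR + 10) (return_pmf s3) \<and> ?FP (yo s) s3"
      using rest yo by (auto simp: image_iff)
    then obtain g where g: "\<And>s. s \<in> set_pmf ?D1 \<Longrightarrow> ex N (Seq glob (scales q)) s (TR + 10) (return_pmf (g s)) \<and> ?FP (yo s) (g s)"
      by metis
    let ?D = "bind_pmf ?D1 (\<lambda>s. return_pmf (g s))"
    have "ex N (Seq sampling (Seq glob (scales q))) s1 (7 * (2 * K) + 1 + Suc (TR + 10)) ?D"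
      by (rule ex_Seq[OF e2]) (use g in blast)
    with e1 have e3: "ex N (Seq (prelude \<kappa>) (Seq sampling (Seq glob (scales q)))) s' (TP + Suc (7 * (2 * K) + 1 + Suc (TR + 10))) ?D"
      by (rule ex_Seq_return)
    have "\<forall>s\<in>set_pmf ?D. reg s 2 \<le> RB" using g by auto
    moreover have "1 - pbad \<kappa> n \<le> measure_pmf.prob ?D {s. ?ok s}"
    proof -
      have "1 - pbad \<kappa> n \<le> 1 - measure_pmf.prob (samp n (2 * K)) Bad" using pb by (simp add: mult_2)
      also have "\<dots> = measure_pmf.prob (samp n (2 * K)) (UNIV - Bad)"
        using measure_pmf.prob_compl[of Bad "samp n (2 * K)"] by simp
      also have "\<dots> \<le> measure_pmf.prob (samp n (2 * K)) {ys. ?ok (g (fold put ys s1))}"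
        using g yo by (intro measure_pmf.finite_measure_mono_AE) (auto simp: AE_measure_pmf_iff)
      also have "\<dots> = measure_pmf.prob ?D {s. ?ok s}"
        by (simp add: map_pmf_def[symmetric] pmf.map_comp vimage_def)
      finally show ?thesis .
    qed
    ultimately have "?X ?D" by blast
    with e3 show "\<exists>D. ex N (if n * n * n < m * m then Seq (prelude \<kappa>) (Seq sampling (Seq glob (scales q))) else copy) s'
       (TP + Suc (7 * (2 * K) + 1 + Suc (TR + 10))) D \<and> ?X D"
      unfolding if_P[OF big] by blast
  qed
  then obtain D where D: "ex N (prog \<kappa> q) ?s0 ((TP + Suc (7 * (2 * K) + 1 + Suc (TR + 10))) + 30) D" "?X D" by blast
  have "(TP + Suc (7 * (2 * K) + 1 + Suc (TR + 10))) + 30 \<le> 30000 * (Ns + 1) * X"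
  proof -
    have a: "1 \<le> \<kappa> * l" "1 \<le> m" "1 \<le> rt" using \<kappa> lg(2) nm n sq(2) by auto
    have X: "X = (\<kappa> * l) * (\<kappa> * l) * (m * rt)" by (simp add: X_def mult_ac)
    have mr: "1 * 1 * (m * rt) \<le> X" unfolding X using a by (intro mult_mono) auto
    have m: "m * 1 \<le> m * rt" "1 * rt \<le> m * rt" using a by (auto intro: mult_le_mono)
    have "1 * (\<kappa> * l) * (1 * rt) \<le> X" unfolding X using a by (intro mult_mono) auto
    moreover have "K = 1 * (\<kappa> * l) * (1 * rt)" by (simp add: K_def)
    ultimately have K: "K \<le> X" by (simp only:)
    have "1 * l * 1 \<le> (\<kappa> * l) * rt" using \<kappa> a(3) by (intro mult_mono) auto
    then have "l \<le> K" by (simp add: K_def mult_ac)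
    then have b: "m \<le> X" "rt \<le> X" "K \<le> X" "l \<le> X" "1 \<le> X" using a(2) K mr m by linarith+
    have "(TP + Suc (7 * (2 * K) + 1 + Suc (TR + 10))) + 30 \<le> TR + 10000 * X" unfolding TP_def using b by linarith
    also have "\<dots> \<le> 30000 * (Ns + 1) * X" by (simp add: TR_def algebra_simps)
    finally show ?thesis .
  qed
  then have "ex N (prog \<kappa> q) ?s0 (30000 * (Ns + 1) * X) D" by (rule ex_mono[OF D(1)])
  then show ?thesis using D(2) unfolding X_def RB_def K_def rt_def l_def by blast
qed

section \<open>Parameters\<close>

lemma inverse_power_bound:
  assumes "1 \<le> n" "0 \<le> x" "x \<le> 1 / 2 ^ l" "n \<le> 2 ^ l"
  shows "x ^ j \<le> 1 / real n ^ j"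
proof -
  have "real n \<le> 2 ^ l" using assms(4) by (metis of_nat_le_iff of_nat_numeral of_nat_power)
  then have "(1 :: real) / 2 ^ l \<le> 1 / n" using assms(1) by (intro divide_left_mono) auto
  then have "x \<le> 1 / n" using assms(3) by linarith
  then have "x ^ j \<le> (1 / n) ^ j" using assms(2) by (rule power_mono)
  then show ?thesis by (simp add: power_one_over)
qed

lemma exp_neg_le_half: "exp (- real k) \<le> 1 / 2 ^ k"
proof -
  have "(2 :: real) \<le> exp 1" using exp_ge_add_one_self[of 1] by simp
  then have "(2 :: real) ^ k \<le> exp 1 ^ k" by (rule power_mono) simp
  also have "exp 1 ^ k = exp (real k)" by (simp add: exp_of_nat_mult[symmetric])
  finally show ?thesis by (simp add: exp_minus field_simps)
qed

text \<open>Let i = 11 + j. The number 2 i rt l of draws and rt^2 >= n bring each power of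
  \<open>1 - rt / (2 * n)\<close> or less down to e^(-i l), at most n^(-i); six factors 3/4 per unit
  of i l do the same for the last power. The prefactors sum to at most n^3 + n^10, hence to at most
  n^11, and n^(-j) is left.\<close>

lemma pbad_le:
  assumes n: "2 \<le> n"
  shows "pbad (2 * (11 + j)) n \<le> 1 / real n ^ j"
proof -
  have n1: "1 \<le> n" using n by simp
  define rt l where "rt = sqn n" and "l = lgn n"
  define i where "i = 11 + j"
  define K where "K = 2 * i * rt * l"
  note sq = sqn_props[OF n1, folded rt_def] and lg = lgn_props[OF n1, folded l_def]
  have rn: "rt \<le> n" using sqn_le by (simp add: rt_def)
  have rr: "real n \<le> real rt * real rt" using sq(1) by (metis of_nat_le_iff of_nat_mult)
  define y where "y = 1 / real n ^ i"
  have ex: "exp (- real l) ^ i \<le> y"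
    unfolding y_def by (rule inverse_power_bound[OF n1 _ exp_neg_le_half lg(1)]) simp
  have a2: "(1 - real rt / (2 * n)) ^ K \<le> y"
  proof -
    have "(1 - real rt / (2 * n)) ^ K \<le> exp (- (real rt / (2 * n))) ^ K"
      using rn n exp_ge_add_one_self[of "- (real rt / (2 * n))"] by (intro power_mono) (auto simp: field_simps)
    also have "\<dots> = exp (- (real i * real l * (real rt * real rt / n)))"
      by (simp add: exp_of_nat_mult[symmetric] K_def)
    also have "\<dots> \<le> exp (- (real i * real l * 1))"
    proof -
      have "1 \<le> real rt * real rt / n" using rr n by simp
      then have "real i * real l * 1 \<le> real i * real l * (real rt * real rt / n)" by (intro mult_left_mono) auto
      then show ?thesis by simp
    qed
    also have "\<dots> = exp (- real l) ^ i" by (simp add: exp_of_nat_mult[symmetric])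
    finally show ?thesis using ex by simp
  qed
  have a1: "(1 - real rt / n) ^ K \<le> y"
  proof -
    have "(1 - real rt / n) ^ K \<le> (1 - real rt / (2 * n)) ^ K"
      using rn n by (intro power_mono) (auto simp: field_simps)
    then show ?thesis using a2 by simp
  qed
  have a3: "(3 / 4 :: real) ^ (3 * (2 * i) * l) \<le> y"
  proof -
    have "(3 / 4 :: real) ^ (3 * (2 * i) * l) = (((3 / 4) ^ 6) ^ l) ^ i" by (simp add: power_mult[symmetric] mult_ac)
    also have "\<dots> \<le> y"
      unfolding y_def
    proof (rule inverse_power_bound[OF n1 _ _ lg(1)])
      have "((3 / 4 :: real) ^ 6) ^ l \<le> (1 / 2) ^ l" by (intro power_mono) (simp_all add: eval_nat_numeral)
      then show "((3 / 4 :: real) ^ 6) ^ l \<le> 1 / 2 ^ l" by (simp add: power_one_over)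
    qed simp
    finally show ?thesis .
  qed
  have y0: "0 \<le> y" by (simp add: y_def)
  have pn: "n * (n + 1) \<le> n ^ 3" "n * ((n + 1) * ((n + 1) * (n * n + 1))) * n * 2 \<le> n ^ 10"
  proof -
    have b: "n + 1 \<le> n * n" "n * n + 1 \<le> n * n * n"
    proof -
      have "2 * n \<le> n * n" using n by simp
      then show "n + 1 \<le> n * n" using n by linarith
      have "2 * (n * n) \<le> n * (n * n)" using n by simp
      moreover have "1 \<le> n * n" using n1 by (simp add: Suc_le_eq)
      ultimately show "n * n + 1 \<le> n * n * n" by (simp only: mult.assoc)
    qed
    have "n * (n + 1) \<le> n * (n * n)" using b(1) by (rule mult_left_mono) simp
    then show "n * (n + 1) \<le> n ^ 3" by (simp add: eval_nat_numeral)
    have "n * ((n + 1) * ((n + 1) * (n * n + 1))) * n * 2 \<le> n * ((n * n) * ((n * n) * (n * n * n))) * n * n"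
      using b n by (intro mult_mono) auto
    then show "n * ((n + 1) * ((n + 1) * (n * n + 1))) * n * 2 \<le> n ^ 10" by (simp add: eval_nat_numeral mult_ac)
  qed
  have "pbad (2 * i) n = real (n * (n + 1)) * (1 - real rt / n) ^ K +
    real (n * ((n + 1) * ((n + 1) * (n * n + 1)))) * (real n * ((1 - real rt / (2 * n)) ^ K + (3 / 4) ^ (3 * (2 * i) * l)))"
    by (simp only: pbad_def Let_def rt_def l_def K_def)
  also have "\<dots> \<le> real (n * (n + 1)) * y + real (n * ((n + 1) * ((n + 1) * (n * n + 1)))) * (real n * (y + y))"
    using a1 a2 a3 by (intro add_mono mult_left_mono) auto
  also have "\<dots> = real (n * (n + 1)) * y + real (n * ((n + 1) * ((n + 1) * (n * n + 1))) * n * 2) * y"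
    by (simp only: of_nat_mult of_nat_numeral) (simp add: algebra_simps)
  also have "\<dots> \<le> real (n ^ 3) * y + real (n ^ 10) * y"
    using pn y0 by (intro add_mono mult_right_mono of_nat_mono) auto
  also have "\<dots> \<le> real (n ^ 10) * y + real (n ^ 10) * y"
    using y0 n by (intro add_mono mult_right_mono of_nat_mono power_increasing) auto
  also have "\<dots> = 2 * (real n ^ 10 * y)" by simp
  also have "\<dots> \<le> real n * (real n ^ 10 * y)" using n y0 by (intro mult_right_mono) auto
  also have "\<dots> = 1 / real n ^ j"
    using n by (simp add: y_def i_def power_add eval_nat_numeral)
  finally show ?thesis by (simp add: i_def)
qed

text \<open>Each of the next \<open>q\<close> increments is at least
  \<open>1 + ds q i div q\<close>, and \<open>q\<close> of these add up to at least
  \<open>ds q i\<close>. Hence about \<open>q\<close> times a logarithm many scales suffice.\<close>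

lemma ds_double:
  assumes "1 \<le> q"
  shows "2 * ds q i \<le> ds q (i + q)"
proof -
  have "ds q i + j * (1 + ds q i div q) \<le> ds q (i + j)" for j
  proof (induction j)
    case (Suc j)
    have "ds q i div q \<le> ds q (i + j) div q" by (intro div_le_mono ds_mono) simp
    then show ?case using Suc by simp
  qed simp
  from this[of q] have "ds q i + (q + q * (ds q i div q)) \<le> ds q (i + q)" by (simp add: algebra_simps)
  moreover have "ds q i \<le> q + q * (ds q i div q)"
    using mod_less_divisor[of q "ds q i"] assms mult_div_mod_eq[of q "ds q i"] by linarith
  ultimately show ?thesis by linarith
qed

lemma ds_pow: "1 \<le> q \<Longrightarrow> 2 ^ k \<le> ds q (q * k)"
proof (induction k)
  case (Suc k)
  then have "2 ^ Suc k \<le> 2 * ds q (q * k)" by simp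
  also have "\<dots> \<le> ds q (q * k + q)" using ds_double Suc by simp
  finally show ?case by (simp add: add.commute)
qed simp

lemma ds_count:
  assumes "1 \<le> q" "ds q i < x" "x \<le> 2 ^ k"
  shows "i < q * k"
proof (rule ccontr)
  assume "\<not> i < q * k"
  then have "ds q (q * k) \<le> ds q i" by (intro ds_mono) simp
  then show False using ds_pow[OF assms(1), of k] assms(2,3) by linarith
qed

lemma lg_ge: "1 \<le> lg x" "log 2 (real x) \<le> lg x"
  by (simp_all add: lg_def)

lemma lgn_lg:
  assumes "1 \<le> n"
  shows "real (lgn n) \<le> 1 + log 2 (real n)"
proof -
  have "real (2 ^ (lgn n - 1)) \<le> real n" using lgn_props(3)[OF assms] by (rule of_nat_mono)
  then have "2 powr real (lgn n - 1) \<le> real n" by (simp add: powr_realpow)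
  then have "real (lgn n - 1) \<le> log 2 (real n)" using assms by (subst le_log_iff) auto
  then show ?thesis using lgn_props(2)[OF assms] by (simp add: of_nat_diff)
qed

lemma sqn_sqrt:
  assumes "1 \<le> n"
  shows "real (sqn n) \<le> 2 * sqrt (real n)"
proof -
  have "real ((sqn n - 1) * (sqn n - 1)) \<le> real n" using sqn_props(3)[OF assms] by (intro of_nat_mono) simp
  then have "(real (sqn n - 1))\<^sup>2 \<le> real n" by (simp add: power2_eq_square)
  then have "real (sqn n - 1) \<le> sqrt (real n)" by (rule real_le_rsqrt)
  moreover have "1 \<le> sqrt (real n)" using assms by simp
  moreover have "real (sqn n - 1) = real (sqn n) - 1" using sqn_props(2)[OF assms] by (simp add: of_nat_diff)
  ultimately show ?thesis by linarith
qed

text \<open>In the last claim \<open>B\<close> holds on every run, so adding it to the event does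
  not change the probability.\<close>

lemma ex_conclusion:
  assumes e: "ex N P s T D" and N: "real N \<le> W"
  shows "fits_words W P s" "halts_within T P s"
    "(\<And>s'. s' \<in> set_pmf D \<Longrightarrow> B s') \<Longrightarrow> measure_pmf.prob (run T P s) {(p, s). A s \<and> B s} = measure_pmf.prob D {s. A s}"
proof -
  show "fits_words W P s"
    unfolding fits_words_def
  proof (intro allI ballI)
    fix t a assume "a \<in> set_pmf (run t P s)"
    then have "fit N (snd a)" using e unfolding ex_def by fastforce
    moreover have "real x \<le> W" if "x \<le> N" for x using that N by linarith
    ultimately show "case a of (p', s') \<Rightarrow> (\<forall>x. real (reg s' x) \<le> W) \<and> (\<forall>a i. real (mem s' a i) \<le> W)"
      by (simp add: fit_def case_prod_beta)
  qed
  have r: "run T P s = map_pmf (Pair Skip) D" using e by (simp add: ex_def)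
  show "halts_within T P s" unfolding halts_within_def r by auto
  show "measure_pmf.prob (run T P s) {(p, s). A s \<and> B s} = measure_pmf.prob D {s. A s}"
    if "\<And>s'. s' \<in> set_pmf D \<Longrightarrow> B s'"
  proof -
    have "measure_pmf.prob (run T P s) {(p, s). A s \<and> B s} = measure_pmf.prob D {s. A s \<and> B s}"
      unfolding r by (simp add: vimage_def)
    also have "\<dots> = measure_pmf.prob D {s. A s}"
      using that by (intro measure_pmf.finite_measure_eq_AE) (auto simp: AE_measure_pmf_iff)
    finally show ?thesis .
  qed
qed

lemma input_fit:
  assumes "n \<le> N" "length es \<le> N" "\<And>e. e \<in> set es \<Longrightarrow> fst e \<le> N \<and> snd e \<le> N \<and> w e \<le> N"
  shows "fit N (input_state n es w)"
  unfolding fit_def input_state_def using assms by auto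

text \<open>The argument is at most 8 n M, so the left side is at most 4 + lg n + lg M. As both
  logarithms are at least 1, each summand is bounded by their product.\<close>

lemma scales_bound:
  assumes n: "1 \<le> n" and M: "1 \<le> M" and W: "W \<le> M"
  shows "real (lgn (4 * n * W + 1)) \<le> 6 * (lg n * lg M)"
proof -
  let ?x = "4 * n * W + 1"
  have nM: "1 \<le> n * M" using n M by (simp add: Suc_le_eq)
  have "?x \<le> 8 * (n * M)"
  proof -
    have "4 * n * W \<le> 4 * n * M" using W by (rule mult_left_mono) simp
    then show ?thesis using nM by linarith
  qed
  then have "log 2 (real ?x) \<le> log 2 (real (8 * (n * M)))" by (intro log_mono of_nat_mono) (simp_all add: add_pos_nonneg)
  also have "\<dots> = 3 + log 2 n + log 2 M"
  proof -
    have "log 2 (8 :: real) = 3" using log_pow_cancel[of "2 :: real" 3] by simp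
    then show ?thesis using n M by (simp add: log_mult)
  qed
  finally have "real (lgn ?x) \<le> 4 + lg n + lg M" using lgn_lg[of ?x] lg_ge(2)[of n] lg_ge(2)[of M] by simp
  moreover have "1 * 1 \<le> lg n * lg M" "lg n * 1 \<le> lg n * lg M" "1 * lg M \<le> lg n * lg M"
    using lg_ge(1)[of n] lg_ge(1)[of M] by (intro mult_mono; simp)+
  ultimately show ?thesis by linarith
qed

text \<open>The factor 31 bounds \<open>Ns + 1\<close> in units of lg n lg M / e; the factor 8
  collects a 2 from each rounded logarithm and one from the rounded square root. The number of
  scales contributes lg M / e only once, which is then enlarged to its square.\<close>

lemma big_sizes:
  fixes e :: real
  assumes n: "1 \<le> n" and M: "1 \<le> M" and e: "0 < e" "e \<le> 1" and q: "real q \<le> 5 / e" and Ns: "real Ns \<le> real q * (6 * (lg n * lg M))"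
    and C: "C = 30000 * 31 * 8 * (real \<kappa>)\<^sup>2 + 16 * real \<kappa> + 400"
  shows "real (30000 * (Ns + 1) * (\<kappa> * \<kappa> * lgn n * lgn n * m * sqn n)) \<le> C * lg n ^ 3 * (real m * sqrt (real n) * (lg M)\<^sup>2 / e\<^sup>2)"
    "real (4 * (\<kappa> * sqn n * lgn n) * n + Ns * (n * (2 * sqn n + 1))) \<le> C * lg n ^ 3 * (real n powr (3/2) * (lg M)\<^sup>2 / e\<^sup>2)"
proof -
  let ?a = "lg n" and ?b = "lg M" and ?r = "sqrt (real n)" and ?k = "real \<kappa>"
  have ab: "1 \<le> ?a" "1 \<le> ?b" using lg_ge by auto
  have r1: "1 \<le> ?r" using n by simp
  have l: "real (lgn n) \<le> 2 * ?a" using lgn_lg[OF n] lg_ge(2)[of n] ab by linarith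
  have s: "real (sqn n) \<le> 2 * ?r" by (rule sqn_sqrt[OF n])
  have s5: "2 * real (sqn n) + 1 \<le> 5 * ?r" using s r1 by linarith
  have ie: "1 \<le> 1 / e" using e by simp
  have ab1: "1 \<le> ?a * ?b" using mult_mono[OF ab] ab by simp
  have Ns1: "real Ns \<le> 30 * (?a * ?b / e)"
  proof -
    have "real q * (6 * (?a * ?b)) \<le> 5 / e * (6 * (?a * ?b))" using q ab by (intro mult_right_mono) auto
    then show ?thesis using Ns by simp
  qed
  have abe: "1 \<le> ?a * ?b / e"
    using mult_mono[OF ab1 ie] ab by simp
  have bb: "?b / e \<le> ?b\<^sup>2 / e\<^sup>2"
  proof -
    have "?b / e * 1 \<le> ?b / e * (?b / e)" using ab e mult_mono[OF ab(2) ie] by (intro mult_left_mono) auto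
    then show ?thesis by (simp add: power2_eq_square)
  qed
  have one: "1 \<le> ?b\<^sup>2 / e\<^sup>2" using bb mult_mono[OF ab(2) ie] ab by simp
  have a13: "?a \<le> ?a ^ 3" using power_increasing[of 1 3 ?a] ab by simp
  have C0: "0 \<le> C" "30000 * 31 * 8 * ?k\<^sup>2 \<le> C" "16 * ?k + 150 \<le> C" using C by auto
  have "real (30000 * (Ns + 1) * (\<kappa> * \<kappa> * lgn n * lgn n * m * sqn n)) =
     30000 * (real Ns + 1) * (?k\<^sup>2 * (real (lgn n) * real (lgn n)) * (real m * real (sqn n)))"
    by (simp add: power2_eq_square)
  also have "\<dots> \<le> 30000 * (31 * (?a * ?b / e)) * (?k\<^sup>2 * ((2 * ?a) * (2 * ?a)) * (real m * (2 * ?r)))"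
    using Ns1 abe l s ab by (intro mult_mono) auto
  also have "\<dots> = (30000 * 31 * 8 * ?k\<^sup>2) * ?a ^ 3 * (real m * ?r * (?b / e))"
    by (simp add: power2_eq_square power3_eq_cube)
  also have "\<dots> \<le> C * ?a ^ 3 * (real m * ?r * (?b\<^sup>2 / e\<^sup>2))"
    using C0 bb ab e by (intro mult_mono) auto
  finally show "real (30000 * (Ns + 1) * (\<kappa> * \<kappa> * lgn n * lgn n * m * sqn n)) \<le> C * ?a ^ 3 * (real m * ?r * ?b\<^sup>2 / e\<^sup>2)"
    by simp
  have pw: "real n powr (3/2) = real n * ?r"
  proof -
    have "real n powr (3/2) = real n powr 1 * real n powr (1/2)" unfolding powr_add[symmetric] by simp
    then show ?thesis using n by (simp add: powr_half_sqrt)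
  qed
  have "real (4 * (\<kappa> * sqn n * lgn n) * n + Ns * (n * (2 * sqn n + 1))) =
    4 * (?k * real (sqn n) * real (lgn n)) * real n + real Ns * (real n * (2 * real (sqn n) + 1))"
    by (simp add: distrib_left)
  also have "\<dots> \<le> 4 * (?k * (2 * ?r) * (2 * ?a)) * real n + (30 * (?a * ?b / e)) * (real n * (5 * ?r))"
    using s l Ns1 s5 ab e by (intro add_mono mult_mono mult_left_mono) auto
  also have "\<dots> = (16 * ?k) * ?a * (real n * ?r) * 1 + 150 * ?a * (real n * ?r) * (?b / e)" by simp
  also have "\<dots> \<le> (16 * ?k) * ?a ^ 3 * (real n * ?r) * (?b\<^sup>2 / e\<^sup>2) + 150 * ?a ^ 3 * (real n * ?r) * (?b\<^sup>2 / e\<^sup>2)"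
    using a13 bb one ab e by (intro add_mono mult_mono) auto
  also have "\<dots> = (16 * ?k + 150) * ?a ^ 3 * (real n * ?r * (?b\<^sup>2 / e\<^sup>2))" by (simp add: algebra_simps)
  also have "\<dots> \<le> C * ?a ^ 3 * (real n * ?r * (?b\<^sup>2 / e\<^sup>2))"
    using C0 ab by (intro mult_right_mono) auto
  finally show "real (4 * (\<kappa> * sqn n * lgn n) * n + Ns * (n * (2 * sqn n + 1))) \<le> C * ?a ^ 3 * (real n powr (3/2) * ?b\<^sup>2 / e\<^sup>2)"
    by (simp add: pw)
qed

lemma small_sizes:
  fixes e :: real
  assumes n: "1 \<le> n" and e: "0 < e" "e \<le> 1" and C: "400 \<le> C" and m: "m * m \<le> n * n * n"
  shows "real (100 * m + 100) \<le> C * lg n ^ 3 * (real (max 1 m) * sqrt (real n) * (lg M)\<^sup>2 / e\<^sup>2)"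
    "real m \<le> C * lg n ^ 3 * (real n powr (3/2) * (lg M)\<^sup>2 / e\<^sup>2)"
proof -
  have 1: "1 \<le> lg n ^ 3" "1 \<le> (lg M)\<^sup>2" "1 \<le> 1 / e\<^sup>2" "1 \<le> sqrt (real n)"
    using lg_ge(1)[of n] lg_ge(1)[of M] e n by (auto intro: one_le_power power_le_one)
  have C1: "0 \<le> C * lg n ^ 3" using C 1(1) by (intro mult_nonneg_nonneg) linarith+
  have 2: "1 \<le> (lg M)\<^sup>2 / e\<^sup>2" using mult_mono[OF 1(2,3)] 1 by simp
  have "real (100 * m + 100) \<le> 400 * 1 * (real (max 1 m) * 1 * 1)" by simp
  also have "\<dots> \<le> C * lg n ^ 3 * (real (max 1 m) * sqrt (real n) * ((lg M)\<^sup>2 / e\<^sup>2))"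
    using 1 2 C C1 by (intro mult_mono) auto
  finally show "real (100 * m + 100) \<le> C * lg n ^ 3 * (real (max 1 m) * sqrt (real n) * (lg M)\<^sup>2 / e\<^sup>2)" by simp
  have "real m \<le> real n powr (3/2)"
  proof (rule power2_le_imp_le)
    have "(real m)\<^sup>2 \<le> real n ^ 3" using m by (simp add: power2_eq_square power3_eq_cube) (metis of_nat_le_iff of_nat_mult)
    also have "\<dots> = (real n powr (3/2))\<^sup>2" using n by (simp add: powr_power powr_numeral)
    finally show "(real m)\<^sup>2 \<le> (real n powr (3/2))\<^sup>2" .
  qed simp
  also have "\<dots> = 1 * 1 * (real n powr (3/2) * 1)" by simp
  also have "\<dots> \<le> C * lg n ^ 3 * (real n powr (3/2) * ((lg M)\<^sup>2 / e\<^sup>2))"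
    using 1 2 C C1 by (intro mult_mono) auto
  finally show "real m \<le> C * lg n ^ 3 * (real n powr (3/2) * (lg M)\<^sup>2 / e\<^sup>2)" by simp
qed

text \<open>With Z = 2 n M / e the left side is at most 3900 (\<kappa> + 1) Z^7: one factor Z each
  for \<open>q\<close>, \<open>Ns\<close> and \<open>W\<close>, four for \<open>n\<close>, and 3900
  = 100 * 3 * 13. Since Z is at least 2, the constant is at most Z raised to the same number and
  moves into the exponent.\<close>

lemma word_size:
  fixes e :: real
  assumes n: "1 \<le> n" and M: "1 \<le> M" and e: "0 < e" "e \<le> 1" and q: "real q \<le> 5 / e" and W: "W \<le> M"
    and Ns: "Ns = q * lgn (4 * n * W + 1)"
  shows "real (100 * ((\<kappa> + 1) * (q + 1) * (Ns + 1) * (W + 1) * (n + 1) ^ 4)) \<le> (2 * real n * real M / e) ^ (3900 * (\<kappa> + 1) + 7)"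
proof -
  let ?Z = "2 * real n * real M / e"
  have nM: "1 \<le> real n * real M" using mult_mono[of 1 "real n" 1 "real M"] n M by simp
  have ie: "1 \<le> 1 / e" using e by simp
  have Z: "2 * (real n * real M) \<le> ?Z" "2 * (1 / e) \<le> ?Z" "2 * (real n * real M * (1 / e)) = ?Z"
  proof -
    have "real n * real M * 1 \<le> real n * real M * (1 / e)" using ie nM e by (intro mult_left_mono) auto
    then show "2 * (real n * real M) \<le> ?Z" by simp
    have "1 * (1 / e) \<le> real n * real M * (1 / e)" using ie nM e by (intro mult_right_mono) auto
    then show "2 * (1 / e) \<le> ?Z" by simp
  qed simp
  have Z2: "2 \<le> ?Z" using Z(1) nM by linarith
  have q1: "real (q + 1) \<le> 3 * ?Z" using q Z(2) ie by simp
  have nn: "real (n + 1) \<le> ?Z"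
  proof -
    have "real n * 1 \<le> real n * real M" using M by (intro mult_left_mono) auto
    then show ?thesis using Z(1) n by linarith
  qed
  have WW: "real (W + 1) \<le> ?Z"
  proof -
    have "1 * real M \<le> real n * real M" using n by (intro mult_right_mono) auto
    then show ?thesis using Z(1) W M by linarith
  qed
  have NN: "real (Ns + 1) \<le> 13 * ?Z"
  proof -
    have "real n * real W \<le> real n * real M" using W by (intro mult_left_mono) auto
    moreover have "real (lgn (4 * n * W + 1)) \<le> real (4 * n * W + 1)" by (intro of_nat_mono lgn_le) simp
    ultimately have "real (lgn (4 * n * W + 1)) \<le> 5 * (real n * real M)" using nM by simp
    then have "real q * real (lgn (4 * n * W + 1)) \<le> 5 / e * (5 * (real n * real M))" using q e by (intro mult_mono) auto
    also have "\<dots> = 25 * (real n * real M * (1 / e))" by simp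
    finally have "real Ns \<le> 25 * (real n * real M * (1 / e))" by (simp add: Ns)
    then show ?thesis using Z(3) Z2 by linarith
  qed
  have poly: "100 * (k * (3 * z) * (13 * z) * z * z ^ 4) = 3900 * k * z ^ 7" for k z :: real
    by (simp add: eval_nat_numeral)
  have "real (100 * ((\<kappa> + 1) * (q + 1) * (Ns + 1) * (W + 1) * (n + 1) ^ 4)) =
     100 * (real (\<kappa> + 1) * real (q + 1) * real (Ns + 1) * real (W + 1) * real (n + 1) ^ 4)"
    by (simp only: of_nat_mult of_nat_power of_nat_numeral)
  also have "\<dots> \<le> 100 * (real (\<kappa> + 1) * (3 * ?Z) * (13 * ?Z) * ?Z * ?Z ^ 4)"
    using q1 nn WW NN Z2 e by (intro mult_left_mono mult_mono power_mono) auto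
  also have "\<dots> = real (3900 * (\<kappa> + 1)) * ?Z ^ 7" by (simp only: poly of_nat_mult of_nat_numeral)
  also have "\<dots> \<le> ?Z ^ (3900 * (\<kappa> + 1)) * ?Z ^ 7"
  proof (rule mult_right_mono)
    have "real (3900 * (\<kappa> + 1)) \<le> real (2 ^ (3900 * (\<kappa> + 1)))" by (intro of_nat_mono less_imp_le less_exp)
    also have "\<dots> = 2 ^ (3900 * (\<kappa> + 1))" by simp
    also have "\<dots> \<le> ?Z ^ (3900 * (\<kappa> + 1))" using Z2 by (intro power_mono) auto
    finally show "real (3900 * (\<kappa> + 1)) \<le> ?Z ^ (3900 * (\<kappa> + 1))" .
  qed (use Z2 in simp)
  finally show ?thesis by (simp only: power_add)
qed

theorem theorem1p5:
  shows "\<forall>c::real. c > 0 \<longrightarrow>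
    (\<exists>(C::real) (k::nat) (b::nat). C > 0 \<and>
      (\<forall>\<epsilon>::real. \<epsilon> > 0 \<longrightarrow>
        (\<exists>P::com. \<forall>(n::nat) (m::nat) (M::nat) (G::nat pair_pre_digraph)
            (w::nat \<times> nat \<Rightarrow> nat) (es::(nat \<times> nat) list).
          n \<ge> 1 \<longrightarrow> M \<ge> 1 \<longrightarrow>
          pair_fin_digraph G \<longrightarrow> pverts G = {..<n} \<longrightarrow> card (parcs G) = m \<longrightarrow>
          (\<forall>e \<in> parcs G. w e \<in> {1..M}) \<longrightarrow>
          distinct es \<longrightarrow> set es = parcs G \<longrightarrow>
          fits_words ((2 * real n * real M / min 1 \<epsilon>) ^ b) P (input_state n es w) \<and>
          (\<exists>T::nat.
            real T \<le> C * lg n ^ k * (real (max 1 m) * sqrt (real n) * (lg M)\<^sup>2 / (min 1 \<epsilon>)\<^sup>2) \<and>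
            halts_within T P (input_state n es w) \<and>
            measure_pmf.prob (run T P (input_state n es w))
              {(p, s).
                approx_roundtrip_spanner (5 + \<epsilon>) G (\<lambda>e. real (w e)) (output_graph n s) \<and>
                real (card (parcs (output_graph n s)))
                  \<le> C * lg n ^ k * (real n powr (3/2) * (lg M)\<^sup>2 / (min 1 \<epsilon>)\<^sup>2)}
            \<ge> 1 - 1 / real n powr c))))"
proof (intro allI impI)
  fix c :: real assume c: "0 < c"
  \<comment> \<open>\<kappa> depends on \<open>c\<close> only and \<open>q\<close> on \<epsilon>
    only. Hence \<open>C\<close> and the exponents serve all \<epsilon>, and only the program varies
    with it.\<close>
  define j where "j = nat \<lceil>c\<rceil>"
  define \<kappa> where "\<kappa> = 2 * (11 + j)"
  define C where "C = 30000 * 31 * 8 * (real \<kappa>)\<^sup>2 + 16 * real \<kappa> + 400"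
  define b where "b = 3900 * (\<kappa> + 1) + 7"
  have C400: "400 \<le> C" by (simp add: C_def)
  show "\<exists>(C::real) (k::nat) (b::nat). C > 0 \<and>
      (\<forall>\<epsilon>::real. \<epsilon> > 0 \<longrightarrow>
        (\<exists>P::com. \<forall>(n::nat) (m::nat) (M::nat) (G::nat pair_pre_digraph)
            (w::nat \<times> nat \<Rightarrow> nat) (es::(nat \<times> nat) list).
          n \<ge> 1 \<longrightarrow> M \<ge> 1 \<longrightarrow>
          pair_fin_digraph G \<longrightarrow> pverts G = {..<n} \<longrightarrow> card (parcs G) = m \<longrightarrow>
          (\<forall>e \<in> parcs G. w e \<in> {1..M}) \<longrightarrow>
          distinct es \<longrightarrow> set es = parcs G \<longrightarrow>
          fits_words ((2 * real n * real M / min 1 \<epsilon>) ^ b) P (input_state n es w) \<and>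
          (\<exists>T::nat.
            real T \<le> C * lg n ^ k * (real (max 1 m) * sqrt (real n) * (lg M)\<^sup>2 / (min 1 \<epsilon>)\<^sup>2) \<and>
            halts_within T P (input_state n es w) \<and>
            measure_pmf.prob (run T P (input_state n es w))
              {(p, s).
                approx_roundtrip_spanner (5 + \<epsilon>) G (\<lambda>e. real (w e)) (output_graph n s) \<and>
                real (card (parcs (output_graph n s)))
                  \<le> C * lg n ^ k * (real n powr (3/2) * (lg M)\<^sup>2 / (min 1 \<epsilon>)\<^sup>2)}
            \<ge> 1 - 1 / real n powr c)))"
  proof (rule exI[of _ C], rule exI[of _ "3 :: nat"], rule exI[of _ b], intro conjI allI impI)
    show "0 < C" using C400 by simp
    fix \<epsilon> :: real assume \<epsilon>: "0 < \<epsilon>"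
    define e where "e = min 1 \<epsilon>"
    have e: "0 < e" "e \<le> 1" "e \<le> \<epsilon>" using \<epsilon> by (auto simp: e_def)
    \<comment> \<open>The stretch is 5 + 4 / q, so \<open>q\<close> is 4 / e rounded up; as e is at
      most 1, rounding keeps it below 5 / e.\<close>
    define q where "q = nat \<lceil>4 / e\<rceil>"
    have q: "4 / e \<le> real q" "real q \<le> 5 / e" "1 \<le> q"
    proof -
      show a: "4 / e \<le> real q" unfolding q_def by (rule real_nat_ceiling_ge)
      have "real q \<le> 4 / e + 1" unfolding q_def using e by (simp add: of_nat_nat)
      moreover have "1 \<le> 1 / e" using e by simp
      ultimately show "real q \<le> 5 / e" by (simp add: add_divide_distrib[symmetric])
      have "1 \<le> 4 / e" using e by simp
      then show "1 \<le> q" using a by linarith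
    qed
    have qc: "real (5 * q + 4) \<le> (5 + \<epsilon>) * real q"
    proof -
      have "4 \<le> e * real q" using q(1) e by (simp add: field_simps)
      also have "\<dots> \<le> \<epsilon> * real q" using e by (intro mult_right_mono) auto
      finally show ?thesis by (simp add: algebra_simps)
    qed
    show "\<exists>P::com. \<forall>(n::nat) (m::nat) (M::nat) (G::nat pair_pre_digraph)
            (w::nat \<times> nat \<Rightarrow> nat) (es::(nat \<times> nat) list).
          n \<ge> 1 \<longrightarrow> M \<ge> 1 \<longrightarrow>
          pair_fin_digraph G \<longrightarrow> pverts G = {..<n} \<longrightarrow> card (parcs G) = m \<longrightarrow>
          (\<forall>e \<in> parcs G. w e \<in> {1..M}) \<longrightarrow>
          distinct es \<longrightarrow> set es = parcs G \<longrightarrow>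
          fits_words ((2 * real n * real M / min 1 \<epsilon>) ^ b) P (input_state n es w) \<and>
          (\<exists>T::nat.
            real T \<le> C * lg n ^ 3 * (real (max 1 m) * sqrt (real n) * (lg M)\<^sup>2 / (min 1 \<epsilon>)\<^sup>2) \<and>
            halts_within T P (input_state n es w) \<and>
            measure_pmf.prob (run T P (input_state n es w))
              {(p, s).
                approx_roundtrip_spanner (5 + \<epsilon>) G (\<lambda>e. real (w e)) (output_graph n s) \<and>
                real (card (parcs (output_graph n s)))
                  \<le> C * lg n ^ 3 * (real n powr (3/2) * (lg M)\<^sup>2 / (min 1 \<epsilon>)\<^sup>2)}
            \<ge> 1 - 1 / real n powr c)"
    proof (intro exI[of _ "prog \<kappa> q"] allI impI)
      fix n m M :: nat and G :: "nat pair_pre_digraph" and w :: "nat \<times> nat \<Rightarrow> nat" and es :: "(nat \<times> nat) list"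
      assume n: "1 \<le> n" and M: "1 \<le> M" and G: "pair_fin_digraph G" "pverts G = {..<n}" and cm: "card (parcs G) = m"
        and w: "\<forall>e\<in>parcs G. w e \<in> {1..M}" and es: "distinct es" "set es = parcs G"
      interpret G: pair_fin_digraph G by fact
      have ml: "m = length es" using cm es distinct_card by metis
      have ed: "fst a < n" "snd a < n" "1 \<le> w a" "w a \<le> M" if "a \<in> set es" for a
        using that es(2) w G.arc_fst_in_verts G.arc_snd_in_verts G(2) by auto
      have mn: "m \<le> n * n"
      proof -
        have "parcs G \<subseteq> {..<n} \<times> {..<n}" using ed es(2) by auto
        then have "card (parcs G) \<le> card ({..<n} \<times> {..<n})" by (intro card_mono) auto
        then show ?thesis using cm by (simp add: card_cartesian_product)
      qed
      \<comment> \<open>The largest weight present is what the program computes; \<open>M\<close>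
        enters only through \<open>W \<le> M\<close>.\<close>
      define W where "W = mx (ewt es w) (length es)"
      have WM: "W \<le> M" unfolding W_def using ed by (intro mx_le) auto
      define Ns where "Ns = q * lgn (4 * n * W + 1)"
      define N where "N = 100 * ((\<kappa> + 1) * (q + 1) * (Ns + 1) * (W + 1) * (n + 1) ^ 4)"
      note wd = width[OF n refl, where \<kappa> = \<kappa> and q = q and Ns = Ns and W = W]
      have NW: "real N \<le> (2 * real n * real M / min 1 \<epsilon>) ^ b"
        unfolding N_def b_def e_def[symmetric] by (rule word_size[OF n M e(1,2) q(2) WM Ns_def])
      have wW: "w a \<le> W" if "a \<in> set es" for a
        using that mx_ge[of _ "length es" "ewt es w"] unfolding W_def by (auto simp: in_set_conv_nth)
      have fit: "fit N (input_state n es w)"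
      proof (rule input_fit)
        show "n \<le> N" using wd unfolding N_def by linarith
        show "length es \<le> N" using wd mn ml unfolding N_def by linarith
        show "fst a \<le> N \<and> snd a \<le> N \<and> w a \<le> N" if "a \<in> set es" for a
          using wd ed[OF that] wW[OF that] unfolding N_def by (intro conjI) linarith+
      qed
      \<comment> \<open>For \<open>n = 1\<close> the required success probability is 0.\<close>
      have bound_n: "1 - 1 / real n powr c \<le> 1 - (if n = 1 then 1 else 1 / real n ^ j)"
      proof (cases "n = 1")
        case False
        have "real n powr c \<le> real n powr real j"
          using n unfolding j_def by (intro powr_mono real_nat_ceiling_ge) auto
        also have "\<dots> = real n ^ j" using n by (simp add: powr_realpow)
        finally have "1 / real n ^ j \<le> 1 / real n powr c" using n by (intro divide_left_mono) auto
        then show ?thesis using False by simp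
      qed simp
      let ?ok = "\<lambda>s. approx_roundtrip_spanner (5 + \<epsilon>) G (\<lambda>e. real (w e)) (output_graph n s)"
      let ?B = "\<lambda>s. real (card (parcs (output_graph n s))) \<le> C * lg n ^ 3 * (real n powr (3/2) * (lg M)\<^sup>2 / (min 1 \<epsilon>)\<^sup>2)"
      have "\<exists>T D. ex N (prog \<kappa> q) (input_state n es w) T D \<and>
        real T \<le> C * lg n ^ 3 * (real (max 1 m) * sqrt (real n) * (lg M)\<^sup>2 / (min 1 \<epsilon>)\<^sup>2) \<and>
        (\<forall>s\<in>set_pmf D. ?B s) \<and> 1 - 1 / real n powr c \<le> measure_pmf.prob D {s. ?ok s}"
      proof (cases "n * n * n < m * m")
        case False
        have s: "n * n * n \<le> N" "length es * length es \<le> N" "length es < N"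
        proof -
          show "n * n * n \<le> N" using wd unfolding N_def by linarith
          then show "length es * length es \<le> N" using False ml by simp
          show "length es < N" using wd mn ml unfolding N_def by linarith
        qed
        obtain D where D: "ex N (prog \<kappa> q) (input_state n es w) (100 * length es + 100) D"
          "\<And>s. s \<in> set_pmf D \<Longrightarrow> ?ok s \<and> reg s 2 \<le> length es"
          using small_run[OF G es(2) s fit, of "5 + \<epsilon>" \<kappa> q] False ml \<epsilon> by auto
        have mm: "m * m \<le> n * n * n" using False by simp
        note sz = small_sizes[OF n e(1,2) C400 mm, of M, unfolded e_def]
        have "?B s" if "s \<in> set_pmf D" for s
        proof -
          have "real (card (parcs (output_graph n s))) \<le> real m"
            using card_output[of n s] D(2)[OF that] ml by (intro of_nat_mono) simp
          then show ?thesis using sz(2) by linarith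
        qed
        moreover have "measure_pmf.prob D {s. ?ok s} = 1"
          using D(2) by (subst measure_pmf.prob_eq_1) (auto simp: AE_measure_pmf_iff)
        then have "1 - 1 / real n powr c \<le> measure_pmf.prob D {s. ?ok s}" by simp
        ultimately show ?thesis using D(1) sz(1) ml by blast
      next
        case True
        have n2: "2 \<le> n"
        proof (rule ccontr)
          assume "\<not> 2 \<le> n"
          then have "n = 1" using n by simp
          then have "m * m \<le> 1 * 1" using mn by (intro mult_mono) auto
          then show False using True \<open>n = 1\<close> by simp
        qed
        have Nsi: "i < Ns" if "ds q i < 4 * n * W + 1" for i
          unfolding Ns_def by (rule ds_count[OF q(3) that lgn_props(1)]) simp
        have k1: "1 \<le> \<kappa>" by (simp add: \<kappa>_def)
        obtain D where D: "ex N (prog \<kappa> q) (input_state n es w) (30000 * (Ns + 1) * (\<kappa> * \<kappa> * lgn n * lgn n * length es * sqn n)) D"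
          "\<And>s. s \<in> set_pmf D \<Longrightarrow> reg s 2 \<le> 4 * (\<kappa> * sqn n * lgn n) * n + Ns * (n * (2 * sqn n + 1))"
          "1 - pbad \<kappa> n \<le> measure_pmf.prob D {s. ?ok s}"
          using big_run[OF G es(2) n True[unfolded ml] mn[unfolded ml] _ k1 q(3) qc Nsi[unfolded W_def] _ fit] ed(3)
          unfolding N_def W_def by (metis (no_types, lifting) nth_mem order_refl)
        have "real Ns \<le> real q * (6 * (lg n * lg M))"
          unfolding Ns_def of_nat_mult by (intro mult_left_mono scales_bound[OF n M WM]) simp
        note sz = big_sizes[OF n M e(1,2) q(2) this C_def, unfolded e_def]
        have "1 \<le> m" using True by (cases m) auto
        then have "real (30000 * (Ns + 1) * (\<kappa> * \<kappa> * lgn n * lgn n * length es * sqn n)) \<le>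
          C * lg n ^ 3 * (real (max 1 m) * sqrt (real n) * (lg M)\<^sup>2 / (min 1 \<epsilon>)\<^sup>2)"
          using sz(1)[of m] ml by (simp only: max_absorb2)
        moreover have "?B s" if "s \<in> set_pmf D" for s
        proof -
          have "real (card (parcs (output_graph n s))) \<le> real (4 * (\<kappa> * sqn n * lgn n) * n + Ns * (n * (2 * sqn n + 1)))"
            using card_output[of n s] D(2)[OF that] by (intro of_nat_mono) simp
          then show ?thesis using sz(2) by linarith
        qed
        moreover have "1 - 1 / real n powr c \<le> measure_pmf.prob D {s. ?ok s}"
          using bound_n n2 pbad_le[OF n2, of j] D(3) unfolding \<kappa>_def by simp
        ultimately show ?thesis using D(1) by blast
      qed
      then obtain T D where TD: "ex N (prog \<kappa> q) (input_state n es w) T D"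
        "real T \<le> C * lg n ^ 3 * (real (max 1 m) * sqrt (real n) * (lg M)\<^sup>2 / (min 1 \<epsilon>)\<^sup>2)"
        "\<And>s. s \<in> set_pmf D \<Longrightarrow> ?B s" "1 - 1 / real n powr c \<le> measure_pmf.prob D {s. ?ok s}" by blast
      note con = ex_conclusion[OF TD(1) NW]
      show "fits_words ((2 * real n * real M / min 1 \<epsilon>) ^ b) (prog \<kappa> q) (input_state n es w) \<and>
          (\<exists>T::nat.
            real T \<le> C * lg n ^ 3 * (real (max 1 m) * sqrt (real n) * (lg M)\<^sup>2 / (min 1 \<epsilon>)\<^sup>2) \<and>
            halts_within T (prog \<kappa> q) (input_state n es w) \<and>
            measure_pmf.prob (run T (prog \<kappa> q) (input_state n es w)) {(p, s). ?ok s \<and> ?B s} \<ge> 1 - 1 / real n powr c)"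
      proof (intro conjI exI[of _ T])
        show "1 - 1 / real n powr c \<le> measure_pmf.prob (run T (prog \<kappa> q) (input_state n es w)) {(p, s). ?ok s \<and> ?B s}"
          using con(3)[of ?B ?ok] TD(3,4) by simp
      qed (use con TD(2) in auto)
    qed
  qed
qed

end
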